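(* Let $S$ and $\widetilde S$ be locally compact Hausdorff spaces with countable base, and let $\mathbf{P}:\widetilde S\to\mathcal{P}(\mathbb{D}_{\mathrm{loc}}(S))$, $a\mapsto\mathbf{P}_a$, be a weakly continuous mapping for the local Skorokhod topology. Then for any open subset $U$ of $S$ there exists $g\in\mathrm{C}(S,\mathbb{R}_+)$ such that $\{g\neq0\}=U$, for all $a\in\widetilde S$ $$g\cdot\mathbf{P}_a\big(0<\xi<\infty\Rightarrow X_{\xi-}\text{ exists in }U\big)=1,$$ and the mapping $$g\cdot\mathbf{P}:\widetilde S\to\mathcal{P}\big(\{0<\xi<\infty\Rightarrow X_{\xi-}\text{ exists in }U\}\big),\qquad a\mapsto g\cdot\mathbf{P}_a$$ is weakly continuous for the global Skorokhod topology from $\mathbb{D}(S^\Delta)$.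
   Context: $\Delta\notin S$ is a point and $S^\Delta=S\cup\{\Delta\}$ is the one-point compactification of $S$ if $S$ is not compact, and the topological sum $S\sqcup\{\Delta\}$ ($\Delta$ isolated) if $S$ is compact. $C\Subset A$ means that $C\subset A$ is contained in a compact subset of $A$. $\mathcal{P}(E)$ denotes the set of probability measures on $E$. $\mathbb{D}_{\mathrm{exp}}(S)$ is the set of maps $x:[0,T_{\max})\to S$, $0\le T_{\max}\le\infty$, that are right-continuous on $[0,T_{\max})$ and have left limits $x_{t-}\in S$ at each $t\in(0,T_{\max})$; write $\xi(x):=T_{\max}$ and set $x_t:=\Delta$ for $t\ge\xi(x)$, so paths are elements of $(S^\Delta)^{\mathbb{R}_+}$. $\mathbb{D}_{\mathrm{loc}}(S)$ is the set of $x\in\mathbb{D}_{\mathrm{exp}}(S)$ such that if $\xi(x)\in(0,\infty)$ and $\{x_s\}_{s<\xi(x)}\Subset S$ then $x_{\xi(x)-}$ exists (in $S$). $X$ is the canonical process and $\xi=\xi(X)$. Local Skorokhod topology ($d$ any metric for the topology of $S$; the topology does not depend on $d$): the unique Polish topology on $\mathbb{D}_{\mathrm{loc}}(S)$ for which $x^k\to x$ if and only if there are $\lambda^k\in\Lambda$ such that: if $\xi(x)<\infty$ and $\{x_s\}_{s<\xi(x)}\Subset S$, then $\lambda^k_{\xi(x)}\le\xi(x^k)$ for $k$ large, $\sup_{s<\xi(x)}d(x_s,x^k_{\lambda^k_s})\to0$, $x^k_{\lambda^k_{\xi(x)}}\to\Delta$ and $\|\log\dot\lambda^k\|_{\xi(x)}\to0$;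 otherwise, for all $t<\xi(x)$, $\lambda^k_t<\xi(x^k)$ for $k$ large, $\sup_{s\le t}d(x_s,x^k_{\lambda^k_s})\to0$ and $\|\log\dot\lambda^k\|_t\to0$. Here $\Lambda$ is the set of increasing bijections $\lambda$ of $\mathbb{R}_+$ with $\lambda,\lambda^{-1}$ locally Lipschitz and $\|\log\dot\lambda\|_t:=\operatorname{ess\,sup}_{0\le s\le t}|\log\dot\lambda_s|$. $\mathbb{D}(S^\Delta)$ is the set of cadlag paths $\mathbb{R}_+\to S^\Delta$ (right-continuous on $\mathbb{R}_+$, with left limits in $S^\Delta$ at every $t>0$) with the global Skorokhod topology: $x^k\to x$ iff there are increasing homeomorphisms $\lambda^k$ of $\mathbb{R}_+$ with $\sup_{s\le t}\widetilde d(x_s,x^k_{\lambda^k_s})\to0$ and $\sup_{s\le t}|\lambda^k_s-s|\to0$ for all $t\ge0$, where $\widetilde d$ is any metric for $S^\Delta$. The set $\{0<\xi<\infty\Rightarrow X_{\xi-}\text{ exists in }U\}$ is the set of $x\in\mathbb{D}_{\mathrm{loc}}(S)$ such that if $0<\xi(x)<\infty$ then $x_{\xi(x)-}$ exists and belongs to $U$; it is a subset of $\mathbb{D}_{\mathrm{loc}}(S)\cap\mathbb{D}(S^\Delta)$. Time change. $\mathrm{C}^{\neq0}(S,\mathbb{R}_+)$ is the set of $g:S\to\mathbb{R}_+$ such that $\{g=0\}$ is closed and $g$ is continuous on $\{g\neq0\}$ (it contains $\mathrm{C}(S,\mathbb{R}_+)$). For $V\subset S$ open, $\tau^V(x):=\inf\{t\ge0:x_{t-}\notin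 V\text{ or }x_t\notin V\}\le\xi(x)$ (at $t=0$ only $x_0\notin V$ is considered; $\inf\emptyset=\infty$). For $g\in\mathrm{C}^{\neq0}(S,\mathbb{R}_+)$, $x\in\mathbb{D}_{\mathrm{exp}}(S)$, $t\in[0,\infty]$: $$A^g_t(x):=\int_0^t\frac{\mathrm{d}u}{g(x_u)}\text{ if }t\in[0,\tau^{\{g\neq0\}}(x)],\quad A^g_t(x):=\infty\text{ otherwise},\qquad \tau^g_t(x):=\inf\{s\ge0:A^g_s(x)\ge t\}.$$ The path $g\cdot x\in\mathbb{D}_{\mathrm{exp}}(S)$ is defined for $t\in\mathbb{R}_+$ by $(g\cdot x)_t:=x_{\tau^g_\infty-}$ if $t\ge A^g_{\tau^g_\infty}$ and $x_{\tau^g_\infty-}$ exists and belongs to $\{g=0\}$, and $(g\cdot x)_t:=x_{\tau^g_t}$ otherwise (all at $x$). Conventions: $x_{\infty}:=\Delta$, $x_{\infty-}:=\lim_{t\to\infty}x_t$ if it exists, $x_{0-}$ does not exist. $g\cdot\mathbf{P}$ is the pushforward of $\mathbf{P}$ under $x\mapsto g\cdot x$. *)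

theory Defs
  imports "HOL-Analysis.Analysis" "HOL-Probability.Probability_Measure"
    "HOL-Probability.Essential_Supremum"
begin

section \<open>Topologies given by convergent sequences\<close>

text \<open>
  The path spaces below carry topologies that are specified through their convergent sequences.
  The open sets are those that are sequentially open for the given convergence. Whenever a
  metrizable (in particular, a Polish) topology with exactly these convergent sequences exists,
  it is this one: see \<open>metrizable_eq_seq_topology\<close>.
\<close>

definition seq_topology :: "'p set \<Rightarrow> ((nat \<Rightarrow> 'p) \<Rightarrow> 'p \<Rightarrow> bool) \<Rightarrow> 'p topology" where
  "seq_topology D conv = topology (\<lambda>U. U \<subseteq> D \<and>
     (\<forall>xk. \<forall>x\<in>U. range xk \<subseteq> D \<and> conv xk x \<longrightarrow> (\<forall>\<^sub>F k in sequentially. xk k \<in> U)))"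

lemma openin_seq_topology:
  "openin (seq_topology D conv) U \<longleftrightarrow> U \<subseteq> D \<and>
     (\<forall>xk. \<forall>x\<in>U. range xk \<subseteq> D \<and> conv xk x \<longrightarrow> (\<forall>\<^sub>F k in sequentially. xk k \<in> U))"
proof -
  let ?P = "\<lambda>U. U \<subseteq> D \<and>
     (\<forall>xk. \<forall>x\<in>U. range xk \<subseteq> D \<and> conv xk x \<longrightarrow> (\<forall>\<^sub>F k in sequentially. xk k \<in> U))"
  have "istopology ?P"
    unfolding istopology_def
  proof (intro conjI allI impI)
    fix A B assume A: "?P A" and B: "?P B"
    show "A \<inter> B \<subseteq> D" using A by blast
    fix xk
    show "\<forall>x\<in>A \<inter> B. range xk \<subseteq> D \<and> conv xk x \<longrightarrow> (\<forall>\<^sub>F k in sequentially. xk k \<in> A \<inter> B)"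
    proof (intro ballI impI)
      fix x assume x: "x \<in> A \<inter> B" and c: "range xk \<subseteq> D \<and> conv xk x"
      have "\<forall>\<^sub>F k in sequentially. xk k \<in> A" using A x c by blast
      moreover have "\<forall>\<^sub>F k in sequentially. xk k \<in> B" using B x c by blast
      ultimately show "\<forall>\<^sub>F k in sequentially. xk k \<in> A \<inter> B"
        by eventually_elim blast
    qed
  next
    fix K assume K: "\<forall>A\<in>K. ?P A"
    show "\<Union>K \<subseteq> D" using K by blast
    fix xk
    show "\<forall>x\<in>\<Union>K. range xk \<subseteq> D \<and> conv xk x \<longrightarrow> (\<forall>\<^sub>F k in sequentially. xk k \<in> \<Union>K)"
    proof (intro ballI impI)
      fix x assume x: "x \<in> \<Union>K" and c: "range xk \<subseteq> D \<and> conv xk x"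
      then obtain A where "A \<in> K" "x \<in> A" by blast
      then have "\<forall>\<^sub>F k in sequentially. xk k \<in> A" using K c by blast
      then show "\<forall>\<^sub>F k in sequentially. xk k \<in> \<Union>K"
        by (rule eventually_mono) (use \<open>A \<in> K\<close> in blast)
    qed
  qed
  then show ?thesis
    by (simp add: seq_topology_def topology_inverse')
qed

lemma topspace_seq_topology [simp]: "topspace (seq_topology D conv) = D"
proof -
  have "openin (seq_topology D conv) D"
    unfolding openin_seq_topology by (intro conjI allI ballI impI always_eventually) blast+
  moreover have "U \<subseteq> D" if "openin (seq_topology D conv) U" for U
    using that by (simp add: openin_seq_topology)
  ultimately show ?thesis
    by (intro subset_antisym openin_subset) auto
qed

lemma metrizable_eq_seq_topology:
  assumes met: "metrizable_space T" and top: "topspace T = D"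
    and lim: "\<And>xk x. range xk \<subseteq> D \<Longrightarrow> x \<in> D \<Longrightarrow> limitin T xk x sequentially \<longleftrightarrow> conv xk x"
  shows "T = seq_topology D conv"
proof -
  obtain M d where M: "Metric_space M d" and T: "T = Metric_space.mtopology M d"
    using met unfolding metrizable_space_def by blast
  interpret Metric_space M d by (rule M)
  have MD: "M = D" using top unfolding T by simp
  have "openin T U = openin (seq_topology D conv) U" for U
  proof
    assume U: "openin T U"
    then have UD: "U \<subseteq> D" using openin_subset[OF U] top by simp
    show "openin (seq_topology D conv) U"
      unfolding openin_seq_topology
    proof (intro conjI allI ballI impI)
      fix xk x assume x: "x \<in> U" and c: "range xk \<subseteq> D \<and> conv xk x"
      then have "limitin T xk x sequentially"
        using lim[of xk x] subsetD[OF UD x] by simp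
      then show "\<forall>\<^sub>F k in sequentially. xk k \<in> U"
        using U x unfolding limitin_def by simp
    qed (rule UD)
  next
    assume U: "openin (seq_topology D conv) U"
    then have UD: "U \<subseteq> D" unfolding openin_seq_topology by blast
    have "closedin T (D - U)"
      unfolding T metric_closedin_iff_sequentially_closed
    proof (intro conjI allI impI)
      show "D - U \<subseteq> M" using MD by blast
      fix \<sigma> l assume \<sigma>: "range \<sigma> \<subseteq> D - U \<and> limitin mtopology \<sigma> l sequentially"
      then have lT: "limitin T \<sigma> l sequentially" unfolding T by blast
      then have l: "l \<in> D" using limitin_topspace[OF lT] top by simp
      have rD: "range \<sigma> \<subseteq> D" using \<sigma> by blast
      have "conv \<sigma> l" using lim[OF rD l] lT by simp
      show "l \<in> D - U"
      proof (rule ccontr)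
        assume "l \<notin> D - U"
        then have "l \<in> U" using l by simp
        then have "\<forall>\<^sub>F k in sequentially. \<sigma> k \<in> U"
          using U rD \<open>conv \<sigma> l\<close> unfolding openin_seq_topology by metis
        then obtain k where "\<sigma> k \<in> U"
          using eventually_happens' [OF sequentially_bot] by blast
        then show False using \<sigma> by blast
      qed
    qed
    then show "openin T U"
      unfolding openin_closedin_eq[of T U] using UD top by simp
  qed
  then show ?thesis unfolding topology_eq by simp
qed

text \<open>The topologies defined below do not depend on the choice of the metric.\<close>

definition compatible_metric :: "'a topology \<Rightarrow> 'a \<Rightarrow> 'a \<Rightarrow> real" where
  "compatible_metric X =
     (SOME d. Metric_space (topspace X) d \<and> Metric_space.mtopology (topspace X) d = X)"


section \<open>Path spaces\<close>

text \<open>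
  The space \<open>S\<close> is the topology \<open>X\<close>, and the space obtained by adding the point \<open>\<Delta>\<close> is
  \<open>Alexandroff_compactification X\<close>, with \<open>\<Delta> = None\<close>; this point is isolated if \<open>X\<close> is compact.
  A path is a function on \<open>{0..}\<close>, extended to the negative reals by \<open>undefined\<close>.
\<close>

type_synonym 'a path = "real \<Rightarrow> 'a option"

definition lifetime :: "'a path \<Rightarrow> ennreal" where
  "lifetime x = Inf {ennreal t |t. 0 \<le> t \<and> x t = None}"

definition path_at :: "'a path \<Rightarrow> ennreal \<Rightarrow> 'a option" where
  "path_at x t = (if t = \<infinity> then None else x (enn2real t))"

definition has_left_limit :: "'a topology \<Rightarrow> 'a path \<Rightarrow> ennreal \<Rightarrow> 'a option \<Rightarrow> bool" where
  "has_left_limit X x t l \<longleftrightarrow> 0 < t \<and>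
     limitin (Alexandroff_compactification X) x l (if t = \<infinity> then at_top else at_left (enn2real t))"

definition left_limit :: "'a topology \<Rightarrow> 'a path \<Rightarrow> ennreal \<Rightarrow> 'a option" where
  "left_limit X x t = (THE l. has_left_limit X x t l)"

definition D_exp :: "'a topology \<Rightarrow> 'a path set" where
  "D_exp X = {x \<in> {0..} \<rightarrow>\<^sub>E topspace (Alexandroff_compactification X).
     (\<forall>t\<ge>0. x t = None \<longleftrightarrow> lifetime x \<le> ennreal t) \<and>
     (\<forall>t\<ge>0. ennreal t < lifetime x \<longrightarrow>
        limitin (Alexandroff_compactification X) x (x t) (at_right t)) \<and>
     (\<forall>t>0. ennreal t < lifetime x \<longrightarrow>
        (\<exists>l\<in>topspace X. has_left_limit X x (ennreal t) (Some l)))}"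

definition relatively_compact_path :: "'a topology \<Rightarrow> 'a path \<Rightarrow> bool" where
  "relatively_compact_path X x \<longleftrightarrow>
     (\<exists>K. compactin X K \<and> (\<forall>s\<ge>0. ennreal s < lifetime x \<longrightarrow> x s \<in> Some ` K))"

definition D_loc :: "'a topology \<Rightarrow> 'a path set" where
  "D_loc X = {x \<in> D_exp X.
     0 < lifetime x \<and> lifetime x < \<infinity> \<and> relatively_compact_path X x \<longrightarrow>
       (\<exists>l\<in>topspace X. has_left_limit X x (lifetime x) (Some l))}"

definition D_global :: "'a topology \<Rightarrow> 'a path set" where
  "D_global X = {x \<in> {0..} \<rightarrow>\<^sub>E topspace (Alexandroff_compactification X).
     (\<forall>t\<ge>0. limitin (Alexandroff_compactification X) x (x t) (at_right t)) \<and>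
     (\<forall>t>0. \<exists>l. has_left_limit X x (ennreal t) l)}"

text \<open>The set \<open>{0 < \<xi> < \<infinity> \<Rightarrow> X\<^bsub>\<xi>-\<^esub> exists in U}\<close>.\<close>

definition left_limit_in :: "'a topology \<Rightarrow> 'a set \<Rightarrow> 'a path set" where
  "left_limit_in X U = {x \<in> D_loc X.
     0 < lifetime x \<and> lifetime x < \<infinity> \<longrightarrow> (\<exists>l\<in>U. has_left_limit X x (lifetime x) (Some l))}"


section \<open>Skorokhod topologies\<close>

definition locally_lipschitz_on :: "real set \<Rightarrow> (real \<Rightarrow> real) \<Rightarrow> bool" where
  "locally_lipschitz_on A f \<longleftrightarrow> (\<forall>t\<in>A. \<exists>e>0. \<exists>L. L-lipschitz_on (ball t e \<inter> A) f)"

definition bilipschitz_time_changes :: "(real \<Rightarrow> real) set" where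
  "bilipschitz_time_changes = {l. bij_betw l {0..} {0..} \<and> strict_mono_on {0..} l \<and>
     locally_lipschitz_on {0..} l \<and> locally_lipschitz_on {0..} (inv_into {0..} l)}"

definition log_deriv_norm :: "(real \<Rightarrow> real) \<Rightarrow> real \<Rightarrow> ennreal" where
  "log_deriv_norm l t = esssup (lebesgue_on {0..t}) (\<lambda>s. ennreal \<bar>ln (deriv l s)\<bar>)"

text \<open>
  The distances below are only meaningful while both paths are alive, which the accompanying
  conditions on \<open>l k\<close> ensure for all large \<open>k\<close>.
\<close>

definition local_skorokhod_conv ::
    "'a topology \<Rightarrow> (nat \<Rightarrow> 'a path) \<Rightarrow> 'a path \<Rightarrow> bool" where
  "local_skorokhod_conv X xk x \<longleftrightarrow>
     (\<exists>l :: nat \<Rightarrow> real \<Rightarrow> real. (\<forall>k. l k \<in> bilipschitz_time_changes) \<and>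
       (let d = (\<lambda>p q. compatible_metric X (the p) (the q)) in
        if lifetime x < \<infinity> \<and> relatively_compact_path X x
        then (let T = enn2real (lifetime x) in
          (\<forall>\<^sub>F k in sequentially. ennreal (l k T) \<le> lifetime (xk k)) \<and>
          (\<lambda>k. SUP s\<in>{0..<T}. ennreal (d (x s) (xk k (l k s)))) \<longlonglongrightarrow> 0 \<and>
          limitin (Alexandroff_compactification X) (\<lambda>k. xk k (l k T)) None sequentially \<and>
          (\<lambda>k. log_deriv_norm (l k) T) \<longlonglongrightarrow> 0)
        else (\<forall>t\<ge>0. ennreal t < lifetime x \<longrightarrow>
          (\<forall>\<^sub>F k in sequentially. ennreal (l k t) < lifetime (xk k)) \<and>
          (\<lambda>k. SUP s\<in>{0..t}. ennreal (d (x s) (xk k (l k s)))) \<longlonglongrightarrow> 0 \<and>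
          (\<lambda>k. log_deriv_norm (l k) t) \<longlonglongrightarrow> 0)))"

definition local_skorokhod :: "'a topology \<Rightarrow> 'a path topology" where
  "local_skorokhod X = seq_topology (D_loc X) (local_skorokhod_conv X)"

lemma Polish_eq_local_skorokhod:
  assumes "completely_metrizable_space T" "second_countable T" "topspace T = D_loc X"
    and "\<And>xk x. range xk \<subseteq> D_loc X \<Longrightarrow> x \<in> D_loc X \<Longrightarrow>
      limitin T xk x sequentially \<longleftrightarrow> local_skorokhod_conv X xk x"
  shows "T = local_skorokhod X"
  unfolding local_skorokhod_def
  by (rule metrizable_eq_seq_topology
      [OF completely_metrizable_imp_metrizable_space [OF assms(1)] assms(3,4)])

definition global_skorokhod_conv ::
    "'a topology \<Rightarrow> (nat \<Rightarrow> 'a path) \<Rightarrow> 'a path \<Rightarrow> bool" where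
  "global_skorokhod_conv X xk x \<longleftrightarrow>
     (\<exists>l :: nat \<Rightarrow> real \<Rightarrow> real.
       (\<forall>k. strict_mono_on {0..} (l k) \<and> (\<exists>m. homeomorphism {0..} {0..} (l k) m)) \<and>
       (\<forall>t\<ge>0.
         (\<lambda>k. SUP s\<in>{0..t}. ennreal
            (compatible_metric (Alexandroff_compactification X) (x s) (xk k (l k s)))) \<longlonglongrightarrow> 0 \<and>
         (\<lambda>k. SUP s\<in>{0..t}. ennreal \<bar>l k s - s\<bar>) \<longlonglongrightarrow> 0))"

definition global_skorokhod :: "'a topology \<Rightarrow> 'a path topology" where
  "global_skorokhod X = seq_topology (D_global X) (global_skorokhod_conv X)"


section \<open>Weak topology on probability measures\<close>

definition borel_of :: "'p topology \<Rightarrow> 'p measure" where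
  "borel_of T = sigma (topspace T) {V. openin T V}"

definition prob_measures :: "'p topology \<Rightarrow> 'p measure set" where
  "prob_measures T = {M. prob_space M \<and> sets M = sets (borel_of T)}"

definition weak_topology :: "'p topology \<Rightarrow> 'p measure topology" where
  "weak_topology T = topology_generated_by
     {{M \<in> prob_measures T. (\<integral>x. f x \<partial>M) \<in> V} |f V.
        continuous_map T euclideanreal f \<and> bounded (f ` topspace T) \<and> open V}"

lemma topspace_weak_topology: "topspace (weak_topology T) = prob_measures T"
proof
  show "topspace (weak_topology T) \<subseteq> prob_measures T"
    unfolding weak_topology_def topology_generated_by_topspace by blast
  have "continuous_map T euclideanreal (\<lambda>_. 0)" "bounded ((\<lambda>_. 0::real) ` topspace T)"
    by (auto simp: bounded_iff)
  then have "prob_measures T \<in>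
     {{M \<in> prob_measures T. (\<integral>x. f x \<partial>M) \<in> V} |f V.
        continuous_map T euclideanreal f \<and> bounded (f ` topspace T) \<and> open V}"
    by (intro CollectI exI[of _ "\<lambda>_. 0::real"] exI[of _ "UNIV :: real set"]) simp
  then show "prob_measures T \<subseteq> topspace (weak_topology T)"
    unfolding weak_topology_def topology_generated_by_topspace by (rule Union_upper)
qed


section \<open>Time change\<close>

text \<open>
  For a path in \<open>D_exp X\<close> the left limit in \<open>exit_time\<close> exists unless \<open>t\<close> is at or after the
  lifetime, and then \<open>x t = None\<close>; so a missing left limit may be counted as an exit.
\<close>

definition exit_time :: "'a topology \<Rightarrow> 'a set \<Rightarrow> 'a path \<Rightarrow> ennreal" where
  "exit_time X V x = Inf {ennreal t |t. 0 \<le> t \<and>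
     ((0 < t \<and> \<not> (\<exists>l\<in>V. has_left_limit X x (ennreal t) (Some l))) \<or> x t \<notin> Some ` V)}"

text \<open>
  Leaving out the endpoint \<open>t\<close> does not change the integral, and keeps \<open>x u\<close> inside \<open>{g \<noteq> 0}\<close>.
\<close>

definition clock :: "'a topology \<Rightarrow> ('a \<Rightarrow> real) \<Rightarrow> 'a path \<Rightarrow> ennreal \<Rightarrow> ennreal" where
  "clock X g x t =
     (if t \<le> exit_time X {y \<in> topspace X. g y \<noteq> 0} x
      then (\<integral>\<^sup>+u\<in>{u. 0 \<le> u \<and> ennreal u < t}. 1 / ennreal (g (the (x u))) \<partial>lborel)
      else \<infinity>)"

definition inverse_clock :: "'a topology \<Rightarrow> ('a \<Rightarrow> real) \<Rightarrow> 'a path \<Rightarrow> ennreal \<Rightarrow> ennreal" where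
  "inverse_clock X g x t = Inf {s. t \<le> clock X g x s}"

definition time_change :: "'a topology \<Rightarrow> ('a \<Rightarrow> real) \<Rightarrow> 'a path \<Rightarrow> 'a path" where
  "time_change X g x = (\<lambda>t\<in>{0..}.
     let T = inverse_clock X g x \<infinity> in
     if clock X g x T \<le> ennreal t \<and> (\<exists>l\<in>topspace X. g l = 0 \<and> has_left_limit X x T (Some l))
     then left_limit X x T
     else path_at x (inverse_clock X g x (ennreal t)))"

definition time_change_measure ::
    "'a topology \<Rightarrow> ('a \<Rightarrow> real) \<Rightarrow> 'a path measure \<Rightarrow> 'a path measure" where
  "time_change_measure X g P = distr P (borel_of (local_skorokhod X)) (time_change X g)"

end

theory Submission
  imports Defs
begin

text \<open>
  Let \<open>\<rho>\<close> be the distance to the complement of \<open>U\<close> in the compactification, and \<open>g = \<gamma> \<circ> \<rho>\<close>. A time-changed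
  path can fail to have a left limit in \<open>U\<close> at its lifetime only if the original path approaches the complement
  of \<open>U\<close> while the new clock stays bounded, and time change is discontinuous only at such
  paths or when approximating paths do not stay near the point to which the limit jumps out of \<open>U\<close>. A path in
  \<open>D_loc X\<close> on its way to the complement of \<open>U\<close> spends a positive time near each level of
  \<open>\<rho>\<close>; by weak continuity, for \<open>a\<close> in a compact set this time exceeds some \<open>\<epsilon> n\<close> at level
  \<open>2\<^sup>-\<^sup>n\<close> up to probability \<open>2\<^sup>-\<^sup>n\<close>. Choosing \<open>\<gamma> \<le> \<epsilon> n / (n + 1)\<close> at this level, the clock explodes by
  Borel--Cantelli. On the sets of paths that are not too fast at all levels \<open>n \<ge> m\<close>, time change is
  continuous into the global topology, and these sets have probability close to one locally uniformly in \<open>a\<close>.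

  The local topology is handled through the functions \<open>misfit y\<close>, \<open>y\<close> in a countable set of templates. They
  measure how badly the path fits a step path, and generate the topology. Comparing \<open>log_deriv_norm\<close> with
  increments needs Lebesgue's differentiation theorem for bi-Lipschitz functions, since \<open>deriv\<close> is
  arbitrary where the derivative does not exist.
\<close>

section \<open>Almost everywhere differentiability of bi-Lipschitz time changes\<close>

text \<open>One \<open>g\<close> has to serve every \<open>a\<close>, whereas
  \<open>\<epsilon> n\<close> comes from a compact set of parameters. Level \<open>n\<close>
  therefore uses the \<open>n\<close>-th member of an increasing sequence of compact subsets of
  \<open>Y\<close>, and each point has a neighbourhood contained in all members from some index on;
  a summable bound for the late levels is all that Borel--Cantelli asks for.

  The rushing paths are described by uncountable quantifiers and need not be closed under limits.
  Their closure in the coordinates of the misfits is used instead: it is measurable and its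
  indicator is upper semicontinuous. As the rush gets infinitely fast these closures shrink to the
  empty set, because a cadlag path has small oscillation on either side of each time.

  On \<open>left_limit_in X U\<close> the global topology asks for more than the local one only
  after the killing time, which local convergence does not see. The laws live on the local Borel
  sets, so the global ones have to be recovered from them by adding countably many events about
  returns from a neighbourhood of \<open>None\<close>.\<close>

lemma Vitali_measure_compare:
  fixes M N :: "real measure" and q :: ennreal
  assumes sM: "sets M = sets borel" and sN: "sets N = sets borel" and A: "A \<in> sets borel"
    and ac: "\<And>S. S \<in> sets borel \<Longrightarrow> emeasure lborel S = 0 \<Longrightarrow> emeasure M S = 0"
    and reg: "\<And>e. (0::real) < e \<Longrightarrow> \<exists>G. open G \<and> A \<subseteq> G \<and> emeasure N G \<le> emeasure N A + ennreal e"
    and cov: "\<And>s d. s \<in> A \<Longrightarrow> 0 < d \<Longrightarrow>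
      \<exists>u v. u < v \<and> v - u < d \<and> s \<in> {u..v} \<and> q * emeasure M {u..v} \<le> emeasure N {u..v}"
  shows "q * emeasure M A \<le> emeasure N A"
proof (rule ennreal_le_epsilon)
  fix e :: real assume "0 < e"
  then obtain G where G: "open G" "A \<subseteq> G" "emeasure N G \<le> emeasure N A + e"
    using reg[of e] by auto
  \<comment> \<open>These intervals form a fine cover of \<open>A\<close>: a countable disjoint
    subfamily exhausts \<open>A\<close> up to a Lebesgue null set, which is null for
    \<open>M\<close> by absolute continuity, and on each interval the two measures already compare.
    Lying inside \<open>G\<close>, they cost at most \<open>e\<close> more than \<open>N\<close>
    charges \<open>A\<close>.\<close>
  define K where "K = {(u, v). u < v \<and> {u..v} \<subseteq> G \<and> q * emeasure M {u..v} \<le> emeasure N {u..v}}"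
  define c r where "c i = (fst i + snd i) / 2" and "r i = (snd i - fst i) / 2" for i :: "real \<times> real"
  have cb: "cball (c i) (r i) = {fst i..snd i}" for i
  proof -
    have "c i - r i = fst i" "c i + r i = snd i" unfolding c_def r_def by argo+
    thus ?thesis by (simp add: cball_eq_atLeastAtMost)
  qed
  have small: "\<exists>i. i \<in> K \<and> s \<in> cball (c i) (r i) \<and> r i < d" if sA: "s \<in> A" and d: "0 < d" for s d
  proof -
    obtain e where e: "0 < e" "ball s e \<subseteq> G"
      using openE[OF G(1) subsetD[OF G(2) sA]] by metis
    obtain u v where uv: "u < v" "v - u < min e d" "s \<in> {u..v}"
      "q * emeasure M {u..v} \<le> emeasure N {u..v}"
      using cov[OF sA, of "min e d"] e(1) d by fastforce
    have "{u..v} \<subseteq> ball s e" using uv by (auto simp: dist_real_def)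
    hence "(u, v) \<in> K" using uv e by (auto simp: K_def)
    thus ?thesis
      using uv by (intro exI[of _ "(u, v)"], subst cb) (auto simp: r_def)
  qed
  have pos: "0 < r i" if "i \<in> K" for i using that by (auto simp: K_def r_def)
  obtain C where C: "countable C" "C \<subseteq> K"
    "pairwise (\<lambda>i j. disjnt (cball (c i) (r i)) (cball (c j) (r j))) C"
    "negligible (A - (\<Union>i\<in>C. cball (c i) (r i)))"
    by (rule Vitali_covering_theorem_cballs[of K r A c, OF pos small])
  note C = C[unfolded cb]
  let ?I = "\<lambda>i::real \<times> real. {fst i..snd i}"
  have disj: "disjoint_family_on ?I C"
    using C(3) unfolding disjoint_family_on_def pairwise_def disjnt_def by blast
  have bor: "(\<Union>i\<in>C. ?I i) \<in> sets borel" using C(1) by auto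
  have "emeasure M A \<le> emeasure M ((A - (\<Union>i\<in>C. ?I i)) \<union> (\<Union>i\<in>C. ?I i))"
    by (rule emeasure_mono) (use A bor sM in auto)
  also have "\<dots> \<le> emeasure M (A - (\<Union>i\<in>C. ?I i)) + emeasure M (\<Union>i\<in>C. ?I i)"
    by (rule emeasure_subadditive) (use A bor sM in auto)
  also have "emeasure M (A - (\<Union>i\<in>C. ?I i)) = 0"
    using C(4) A bor by (intro ac) (auto simp: negligible_iff_emeasure0 emeasure_completion)
  finally have "q * emeasure M A \<le> q * emeasure M (\<Union>i\<in>C. ?I i)" by (simp add: mult_left_mono)
  also have "emeasure M (\<Union>i\<in>C. ?I i) = (\<integral>\<^sup>+i. emeasure M (?I i) \<partial>count_space C)"
    by (rule emeasure_UN_countable) (use sM C disj in auto)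
  also have "q * \<dots> = (\<integral>\<^sup>+i. q * emeasure M (?I i) \<partial>count_space C)"
    by (rule nn_integral_cmult[symmetric]) simp
  also have "\<dots> \<le> (\<integral>\<^sup>+i. emeasure N (?I i) \<partial>count_space C)"
    by (rule nn_integral_mono) (use C in \<open>auto simp: K_def\<close>)
  also have "\<dots> = emeasure N (\<Union>i\<in>C. ?I i)"
    by (rule emeasure_UN_countable[symmetric]) (use sN C disj in auto)
  also have "\<dots> \<le> emeasure N G"
    by (rule emeasure_mono) (use C(2) G(1) sN in \<open>fastforce simp: K_def\<close>)+
  finally show "q * emeasure M A \<le> emeasure N A + e" using G by simp
qed

section \<open>Increasing homeomorphisms of the half-line and their extension to the line\<close>

definition time_homeo :: "(real \<Rightarrow> real) \<Rightarrow> bool" where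
  "time_homeo l \<longleftrightarrow> strict_mono_on {0..} l \<and> l ` {0..} = {0..}"

lemma time_homeoD:
  assumes "time_homeo l"
  shows "0 \<le> s \<Longrightarrow> 0 \<le> l s" "l 0 = 0"
    "0 \<le> s \<Longrightarrow> 0 \<le> t \<Longrightarrow> l s < l t \<longleftrightarrow> s < t" "0 \<le> s \<Longrightarrow> 0 \<le> t \<Longrightarrow> l s \<le> l t \<longleftrightarrow> s \<le> t"
    "0 \<le> y \<Longrightarrow> \<exists>s\<ge>0. l s = y"
proof -
  have sm: "strict_mono_on {0..} l" and im: "l ` {0..} = {0..}" using assms by (auto simp: time_homeo_def)
  have nn: "0 \<le> l s" if "0 \<le> s" for s using im that by auto
  show "0 \<le> s \<Longrightarrow> 0 \<le> l s" by (rule nn)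
  show sur: "0 \<le> y \<Longrightarrow> \<exists>s\<ge>0. l s = y" for y
  proof -
    assume "0 \<le> y"
    hence "y \<in> l ` {0..}" unfolding im by simp
    thus ?thesis by auto
  qed
  show lt: "0 \<le> s \<Longrightarrow> 0 \<le> t \<Longrightarrow> l s < l t \<longleftrightarrow> s < t" for s t
    using strict_mono_onD[OF sm, of s t] strict_mono_onD[OF sm, of t s] by (cases s t rule: linorder_cases) auto
  show "0 \<le> s \<Longrightarrow> 0 \<le> t \<Longrightarrow> l s \<le> l t \<longleftrightarrow> s \<le> t" using lt[of t s] by auto
  obtain s where s: "s \<ge> 0" "l s = 0" using sur[of 0] by auto
  show "l 0 = 0" using lt[of s 0] lt[of 0 s] s nn[of 0] by (cases "s = 0") auto
qed

lemma bilipschitz_imp_time_homeo: "l \<in> bilipschitz_time_changes \<Longrightarrow> time_homeo l"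
  by (simp add: bilipschitz_time_changes_def bij_betw_def time_homeo_def)

text \<open>Continuation by the identity below zero gives a homeomorphism of the whole line, so that
  Vitali's theorem and two-sided difference quotients need no boundary case at
  \<open>0\<close>.\<close>

definition two_sided :: "(real \<Rightarrow> real) \<Rightarrow> real \<Rightarrow> real" where
  "two_sided l s = (if 0 \<le> s then l s else s)"

lemma bilipschitz_time_changesD:
  assumes "l \<in> bilipschitz_time_changes"
  shows "strict_mono_on {0..} l" "l ` {0..} = {0..}" "l 0 = 0"
    "\<And>s. 0 \<le> s \<Longrightarrow> \<exists>d>0. \<exists>L>0. \<forall>u\<ge>0. \<bar>u - s\<bar> < d \<longrightarrow> \<bar>l u - l s\<bar> \<le> L * \<bar>u - s\<bar>"
    "\<And>s. 0 \<le> s \<Longrightarrow> \<exists>d>0. \<exists>L>0. \<forall>u\<ge>0. \<bar>u - s\<bar> < d \<longrightarrow> \<bar>u - s\<bar> \<le> L * \<bar>l u - l s\<bar>"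
proof -
  have b: "bij_betw l {0..} {0..}" and sm: "strict_mono_on {0..} l"
    and lip: "locally_lipschitz_on {0..} l" and lipi: "locally_lipschitz_on {0..} (inv_into {0..} l)"
    using assms by (auto simp: bilipschitz_time_changes_def)
  show "strict_mono_on {0..} l" by (rule sm)
  show im: "l ` {0..} = {0..}" using b by (simp add: bij_betw_def)
  show "l 0 = 0" by (rule time_homeoD(2)[OF bilipschitz_imp_time_homeo[OF assms]])
  have loc: "\<exists>d>0. \<exists>L>0. \<forall>u\<ge>0. \<bar>u - s\<bar> < d \<longrightarrow> \<bar>f u - f s\<bar> \<le> L * \<bar>u - s\<bar>"
    if f: "locally_lipschitz_on {0..} f" and s: "0 \<le> s" for f :: "real \<Rightarrow> real" and s
  proof -
    obtain d L where d: "d > 0" "L-lipschitz_on (ball s d \<inter> {0..}) f"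
      using f s unfolding locally_lipschitz_on_def by (meson atLeast_iff)
    have "\<bar>f u - f s\<bar> \<le> (L + 1) * \<bar>u - s\<bar>" if "u \<ge> 0" "\<bar>u - s\<bar> < d" for u
    proof -
      have "dist (f u) (f s) \<le> L * dist u s"
        using d s that by (intro lipschitz_onD[OF d(2)]) (auto simp: dist_real_def)
      also have "\<dots> \<le> (L + 1) * dist u s" by (simp add: mult_right_mono)
      finally show ?thesis by (simp add: dist_real_def)
    qed
    thus ?thesis using d lipschitz_on_nonneg[OF d(2)]
      by (intro exI[of _ d] conjI exI[of _ "L + 1"]) auto
  qed
  show L: "\<exists>d>0. \<exists>L>0. \<forall>u\<ge>0. \<bar>u - s\<bar> < d \<longrightarrow> \<bar>l u - l s\<bar> \<le> L * \<bar>u - s\<bar>" if "0 \<le> s" for s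
    by (rule loc[OF lip that])
  show "\<exists>d>0. \<exists>L>0. \<forall>u\<ge>0. \<bar>u - s\<bar> < d \<longrightarrow> \<bar>u - s\<bar> \<le> L * \<bar>l u - l s\<bar>" if s: "0 \<le> s" for s
  proof -
    have ls: "l s \<ge> 0" using im s by auto
    obtain d L where d: "d > 0" "L > 0" "\<And>y. y \<ge> 0 \<Longrightarrow> \<bar>y - l s\<bar> < d \<Longrightarrow>
        \<bar>inv_into {0..} l y - inv_into {0..} l (l s)\<bar> \<le> L * \<bar>y - l s\<bar>"
      using loc[OF lipi ls] by auto
    obtain d' L' where d': "d' > 0" "L' > 0" "\<And>u. u \<ge> 0 \<Longrightarrow> \<bar>u - s\<bar> < d' \<Longrightarrow> \<bar>l u - l s\<bar> \<le> L' * \<bar>u - s\<bar>"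
      using L[OF s] by auto
    have "\<bar>u - s\<bar> \<le> L * \<bar>l u - l s\<bar>" if u: "u \<ge> 0" "\<bar>u - s\<bar> < min d' (d / L')" for u
    proof -
      have "L' * \<bar>u - s\<bar> < d" using u d' by (simp add: field_simps)
      hence "\<bar>l u - l s\<bar> < d" using d'(3)[of u] u by auto
      moreover have "l u \<ge> 0" using im u by auto
      moreover have "inv_into {0..} l (l u) = u" "inv_into {0..} l (l s) = s"
        using b u s by (auto simp: bij_betw_def)
      ultimately show ?thesis using d(3)[of "l u"] by auto
    qed
    thus ?thesis using d d' by (intro exI[of _ "min d' (d / L')"] conjI exI[of _ L]) auto
  qed
qed

text \<open>Bounded quotients have finite lower and upper limits at \<open>s\<close>, and equality
  of the two would be a derivative; rationals in the gap separate them. For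
  \<open>h \<noteq> 0\<close> the quotient is continuous in \<open>h\<close>, so rational increments
  suffice, which makes the exceptional set a countable combination of Borel sets.\<close>

lemma nondifferentiable_quotients:
  fixes f :: "real \<Rightarrow> real"
  assumes cont: "continuous_on UNIV f" and nd: "\<nexists>D. (f has_real_derivative D) (at s)"
    and d: "0 < d" and L: "\<And>u. \<bar>u - s\<bar> < d \<Longrightarrow> \<bar>f u - f s\<bar> \<le> L * \<bar>u - s\<bar>"
  shows "\<exists>p\<in>(\<rat>::real set). \<exists>q\<in>(\<rat>::real set). p < q \<and>
    (\<forall>e>(0::real). \<exists>h\<in>(\<rat>::real set). h \<noteq> 0 \<and> \<bar>h\<bar> < e \<and> (f (s + h) - f s) / h < p) \<and>
    (\<forall>e>(0::real). \<exists>h\<in>(\<rat>::real set). h \<noteq> 0 \<and> \<bar>h\<bar> < e \<and> q < (f (s + h) - f s) / h)"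
proof -
  define Q where "Q h = (f (s + h) - f s) / h" for h
  have Qb: "\<bar>Q h\<bar> \<le> L" if "h \<noteq> 0" "\<bar>h\<bar> < d" for h
    using L[of "s + h"] that by (simp add: Q_def abs_divide pos_divide_le_eq)
  define m M where "m = Liminf (at 0) (\<lambda>h. ereal (Q h))" and "M = Limsup (at 0) (\<lambda>h. ereal (Q h))"
  have ev: "eventually (\<lambda>h. \<bar>Q h\<bar> \<le> L) (at 0)"
    unfolding eventually_at using d Qb by (intro exI[of _ d]) (auto simp: dist_real_def)
  have "ereal (- L) \<le> m" unfolding m_def
    by (rule Liminf_bounded, rule eventually_mono[OF ev]) auto
  moreover have "M \<le> ereal L" unfolding M_def
    by (rule Limsup_bounded, rule eventually_mono[OF ev]) auto
  moreover have mM: "m \<le> M" unfolding m_def M_def by (rule Liminf_le_Limsup) simp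
  ultimately have "ereal (- L) \<le> m" "m \<le> ereal L" "ereal (- L) \<le> M" "M \<le> ereal L"
    using order_trans by blast+
  hence fin: "\<bar>m\<bar> \<noteq> \<infinity>" "\<bar>M\<bar> \<noteq> \<infinity>" by auto
  have "m \<noteq> M"
  proof
    assume e: "m = M"
    then obtain D where D: "m = ereal D" using fin by (cases m) auto
    have "((\<lambda>h. ereal (Q h)) \<longlongrightarrow> ereal D) (at 0)"
      using e D unfolding m_def M_def by (intro Liminf_eq_Limsup) auto
    hence "(f has_real_derivative D) (at s)"
      unfolding DERIV_def Q_def by simp
    thus False using nd by blast
  qed
  with mM have "m < M" by simp
  then obtain p' where p': "m < ereal p'" "ereal p' < M" using ereal_dense2 by blast
  then obtain q' where q': "ereal p' < ereal q'" "ereal q' < M" using ereal_dense2 by blast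
  hence "p' < q'" by simp
  then obtain p where p: "p \<in> \<rat>" "p' < p" "p < q'" using Rats_dense_in_real by blast
  then obtain q where q: "q \<in> \<rat>" "p < q" "q < q'" using Rats_dense_in_real by blast
  note pq = p q
  have mp: "m < ereal p" using p' pq by (meson less_ereal.simps(1) order.strict_trans)
  have qM: "ereal q < M" using q' pq by (meson less_ereal.simps(1) order.strict_trans)
  have contQ: "isCont Q h" if "h \<noteq> 0" for h
  proof -
    have "isCont (\<lambda>h. f (s + h)) h"
    proof (rule isCont_o2[where f="\<lambda>h. s + h" and g=f])
      show "isCont (\<lambda>h. s + h) h" by (intro continuous_intros)
      show "isCont f (s + h)" using cont by (simp add: continuous_on_eq_continuous_at)
    qed
    thus ?thesis unfolding Q_def using that by (intro continuous_intros)
  qed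
  have rat: "\<exists>h\<in>\<rat>. h \<noteq> 0 \<and> \<bar>h\<bar> < e \<and> Q h \<in> A"
    if "open A" "h \<noteq> 0" "\<bar>h\<bar> < e" "Q h \<in> A" for A h e
  proof -
    have "eventually (\<lambda>u. Q u \<in> A) (nhds h)"
      using contQ[OF that(2)] that(1,4)
      by (simp add: isCont_def tendsto_at_iff_tendsto_nhds topological_tendstoD)
    then obtain r where r: "r > 0" "\<And>u. \<bar>u - h\<bar> < r \<Longrightarrow> Q u \<in> A"
      unfolding eventually_nhds_metric dist_real_def by auto
    define r' where "r' = Min {r, \<bar>h\<bar>, e - \<bar>h\<bar>}"
    have r': "r' > 0" "r' \<le> r" "r' \<le> \<bar>h\<bar>" "r' \<le> e - \<bar>h\<bar>" using r that by (auto simp: r'_def)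
    obtain u where u: "u \<in> \<rat>" "h < u" "u < h + r'"
      using Rats_dense_in_real[of h "h + r'"] r' by auto
    thus ?thesis using r r' by (intro bexI[of _ u]) auto
  qed
  have 1: "\<exists>h. h \<noteq> 0 \<and> \<bar>h\<bar> < e \<and> Q h < p" if "e > 0" for e
  proof (rule ccontr)
    assume "\<not> ?thesis"
    hence "eventually (\<lambda>h. ereal p \<le> ereal (Q h)) (at 0)"
      unfolding eventually_at using that by (intro exI[of _ e]) (force simp: dist_real_def)
    hence "ereal p \<le> m" unfolding m_def by (rule Liminf_bounded)
    thus False using mp by simp
  qed
  have 2: "\<exists>h. h \<noteq> 0 \<and> \<bar>h\<bar> < e \<and> q < Q h" if "e > 0" for e
  proof (rule ccontr)
    assume "\<not> ?thesis"
    hence "eventually (\<lambda>h. ereal (Q h) \<le> ereal q) (at 0)"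
      unfolding eventually_at using that by (intro exI[of _ e]) (force simp: dist_real_def)
    hence "M \<le> ereal q" unfolding M_def by (rule Limsup_bounded)
    thus False using qM by simp
  qed
  have "\<exists>h\<in>\<rat>. h \<noteq> 0 \<and> \<bar>h\<bar> < e \<and> Q h < p" if "e > 0" for e
  proof -
    obtain h where "h \<noteq> 0" "\<bar>h\<bar> < e" "Q h < p" using 1[OF \<open>e > 0\<close>] by blast
    thus ?thesis using rat[of "{..<p}" h e] by auto
  qed
  moreover have "\<exists>h\<in>\<rat>. h \<noteq> 0 \<and> \<bar>h\<bar> < e \<and> q < Q h" if "e > 0" for e
  proof -
    obtain h where "h \<noteq> 0" "\<bar>h\<bar> < e" "q < Q h" using 2[OF \<open>e > 0\<close>] by blast
    thus ?thesis using rat[of "{q<..}" h e] by auto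
  qed
  ultimately show ?thesis using p(1) q(1,2) unfolding Q_def by (intro bexI[of _ p] bexI[of _ q]) simp_all
qed

lemma two_sided_homeo:
  assumes l: "time_homeo l"
  shows "strict_mono (two_sided l)" "surj (two_sided l)" "continuous_on UNIV (two_sided l)"
proof -
  note H = time_homeoD[OF l]
  show sm: "strict_mono (two_sided l)"
  proof (rule strict_monoI)
    fix x y :: real assume "x < y"
    thus "two_sided l x < two_sided l y" using H(1)[of y] H(3)[of x y] by (auto simp: two_sided_def)
  qed
  have "\<exists>x. two_sided l x = y" for y
  proof (cases "0 \<le> y")
    case True
    then obtain s where "0 \<le> s" "l s = y" using H(5) by blast
    thus ?thesis by (intro exI[of _ s]) (simp add: two_sided_def)
  qed (intro exI[of _ y], simp add: two_sided_def)
  thus "surj (two_sided l)" unfolding surj_def by metis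
  thus "continuous_on UNIV (two_sided l)"
    using strict_mono_less_eq[OF sm] by (intro continuous_onI_mono) auto
qed

lemma two_sided_properties:
  assumes l: "l \<in> bilipschitz_time_changes"
  shows "strict_mono (two_sided l)" "surj (two_sided l)" "continuous_on UNIV (two_sided l)"
    "\<exists>d>0. \<exists>L>0. \<forall>u. \<bar>u - s\<bar> < d \<longrightarrow> \<bar>two_sided l u - two_sided l s\<bar> \<le> L * \<bar>u - s\<bar>"
proof -
  note D = bilipschitz_time_changesD[OF l]
  show "strict_mono (two_sided l)" "surj (two_sided l)" "continuous_on UNIV (two_sided l)"
    by (rule two_sided_homeo[OF bilipschitz_imp_time_homeo[OF l]])+
  show lip: "\<exists>d>0. \<exists>L>0. \<forall>u. \<bar>u - s\<bar> < d \<longrightarrow> \<bar>two_sided l u - two_sided l s\<bar> \<le> L * \<bar>u - s\<bar>" for s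
  proof -
    consider "s < 0" | "s = 0" | "s > 0" by linarith
    thus ?thesis
    proof cases
      case 1
      thus ?thesis by (intro exI[of _ "-s"] conjI exI[of _ 1]) (auto simp: two_sided_def)
    next
      case 2
      obtain d L where dL: "d > 0" "L > 0" "\<And>u. u \<ge> 0 \<Longrightarrow> \<bar>u - 0\<bar> < d \<Longrightarrow> \<bar>l u - l 0\<bar> \<le> L * \<bar>u - 0\<bar>"
        using D(4)[of 0] by auto
      have "\<bar>two_sided l u - two_sided l s\<bar> \<le> (L + 1) * \<bar>u - s\<bar>" if "\<bar>u - s\<bar> < d" for u
      proof (cases "u \<ge> 0")
        case True
        thus ?thesis using dL(3)[of u] that 2 D(3) by (auto simp: two_sided_def algebra_simps)
      next
        case False
        hence "L * u \<le> 0" using dL by (simp add: mult_nonneg_nonpos)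
        thus ?thesis using False 2 D(3) dL by (auto simp: two_sided_def algebra_simps)
      qed
      thus ?thesis using dL by (intro exI[of _ d] conjI exI[of _ "L + 1"]) auto
    next
      case 3
      obtain d L where dL: "d > 0" "L > 0" "\<And>u. u \<ge> 0 \<Longrightarrow> \<bar>u - s\<bar> < d \<Longrightarrow> \<bar>l u - l s\<bar> \<le> L * \<bar>u - s\<bar>"
        using D(4)[of s] 3 by auto
      thus ?thesis using 3
        by (intro exI[of _ "min d s"] conjI exI[of _ L]) (auto simp: two_sided_def)
    qed
  qed
qed

text \<open>For a strictly increasing surjection this is its Lebesgue--Stieltjes measure, charging a
  set with the Lebesgue measure of its image. Written as a push-forward along the inverse, it is a
  measure on the Borel sets without further proof.\<close>

definition image_lborel :: "(real \<Rightarrow> real) \<Rightarrow> real measure" where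
  "image_lborel f = distr lborel borel (inv f)"

context
  fixes f :: "real \<Rightarrow> real"
  assumes mono: "strict_mono f" and surj: "surj f" and cont: "continuous_on UNIV f"
    and lip: "\<And>s. \<exists>d>0. \<exists>L>0. \<forall>u. \<bar>u - s\<bar> < d \<longrightarrow> \<bar>f u - f s\<bar> \<le> L * \<bar>u - s\<bar>"
begin

lemma inv_f_eq: "inv f (f x) = x" "f (inv f y) = y"
  using mono surj by (auto simp: strict_mono_imp_inj_on surj_f_inv_f)

lemma inv_f_measurable [measurable]: "inv f \<in> borel_measurable borel"
proof (rule borel_measurable_mono)
  show "mono (inv f)"
    by (rule monoI) (metis inv_f_eq(2) mono strict_mono_less_eq)
qed

lemma vimage_inv_f: "inv f -` A = f ` A"
  using inv_f_eq by (auto simp: image_iff) metis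

lemma sets_image_lborel: "sets (image_lborel f) = sets borel"
  by (simp add: image_lborel_def)

lemma image_lborel_sets: "A \<in> sets borel \<Longrightarrow> emeasure (image_lborel f) A = emeasure lborel (f ` A)"
  by (simp add: image_lborel_def emeasure_distr vimage_inv_f)

lemma image_lborel_Icc: "u \<le> v \<Longrightarrow> emeasure (image_lborel f) {u..v} = ennreal (f v - f u)"
proof -
  assume "u \<le> v"
  have "f ` {u..v} = {f u..f v}"
  proof (intro set_eqI iffI)
    fix y assume "y \<in> {f u..f v}"
    hence "inv f y \<in> {u..v}" using strict_mono_less_eq[OF mono] inv_f_eq(2)[of y]
      by (metis atLeastAtMost_iff)
    thus "y \<in> f ` {u..v}" by (intro image_eqI[of _ _ "inv f y"]) (simp_all add: inv_f_eq)
  qed (use strict_mono_less_eq[OF mono] in auto)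
  thus ?thesis using \<open>u \<le> v\<close> strict_mono_less_eq[OF mono] by (simp add: image_lborel_sets)
qed

text \<open>A locally Lipschitz map sends null sets to null sets. This excludes a singular part, so
  the null set left over by Vitali's theorem may be discarded for this measure as well.\<close>

lemma image_lborel_null:
  assumes S: "S \<in> sets borel" "emeasure lborel S = 0"
  shows "emeasure (image_lborel f) S = 0"
proof -
  have "negligible S" using S by (simp add: negligible_iff_emeasure0 emeasure_completion)
  hence "negligible (f ` S)"
  proof (rule negligible_locally_Lipschitz_image[OF order_refl])
    fix x
    obtain d L where dL: "d > 0" "\<forall>u. \<bar>u - x\<bar> < d \<longrightarrow> \<bar>f u - f x\<bar> \<le> L * \<bar>u - x\<bar>" using lip by blast
    thus "\<exists>T B. open T \<and> x \<in> T \<and> (\<forall>y\<in>S \<inter> T. norm (f y - f x) \<le> B * norm (y - x))"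
      by (intro exI[of _ "ball x d"] exI[of _ L]) (auto simp: dist_real_def)
  qed
  moreover have "f ` S \<in> sets borel"
    using measurable_sets[OF inv_f_measurable S(1)] by (simp add: vimage_inv_f)
  ultimately show ?thesis using S
    by (simp add: image_lborel_sets negligible_iff_emeasure0 emeasure_completion)
qed

lemma lborel_outer:
  assumes "A \<in> sets borel" "(0::real) < e"
  shows "\<exists>G. open G \<and> A \<subseteq> G \<and> emeasure lborel G \<le> emeasure lborel (A :: real set) + ennreal e"
proof -
  obtain G where G: "open G" "A \<subseteq> G" "emeasure lborel (G - A) < e"
    using outer_regular_lborel[OF assms] by blast
  have "emeasure lborel (A \<union> (G - A)) \<le> emeasure lborel A + emeasure lborel (G - A)"
    by (rule emeasure_subadditive) (use assms G in auto)
  also have "A \<union> (G - A) = G" using G by auto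
  finally have "emeasure lborel G \<le> emeasure lborel A + ennreal e"
    using G(3) by (meson add_left_mono less_imp_le order_trans)
  thus ?thesis using G by (intro exI[of _ G]) auto
qed

lemma image_lborel_outer:
  assumes "A \<in> sets borel" "(0::real) < e"
  shows "\<exists>G. open G \<and> A \<subseteq> G \<and> emeasure (image_lborel f) G \<le> emeasure (image_lborel f) A + ennreal e"
proof -
  have fA: "f ` A \<in> sets borel"
    using measurable_sets[OF inv_f_measurable assms(1)] by (simp add: vimage_inv_f)
  obtain G where G: "open G" "f ` A \<subseteq> G" "emeasure lborel G \<le> emeasure lborel (f ` A) + ennreal e"
    using lborel_outer[OF fA assms(2)] by blast
  have "open (f -` G)" using cont G(1) by (simp add: open_vimage)
  moreover have "f ` (f -` G) = G" using surj by (simp add: surj_image_vimage_eq)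
  ultimately show ?thesis using G assms by (intro exI[of _ "f -` G"]) (auto simp: image_lborel_sets)
qed

lemma image_lborel_lower:
  assumes A: "A \<in> sets borel" and q: "0 \<le> q"
    and cov: "\<And>s d. s \<in> A \<Longrightarrow> 0 < d \<Longrightarrow> \<exists>h. h \<noteq> 0 \<and> \<bar>h\<bar> < d \<and> q < (f (s + h) - f s) / h"
  shows "ennreal q * emeasure lborel A \<le> emeasure (image_lborel f) A"
proof (rule Vitali_measure_compare[OF _ _ A])
  fix s d :: real assume "s \<in> A" "0 < d"
  then obtain h where h: "h \<noteq> 0" "\<bar>h\<bar> < d" "q < (f (s + h) - f s) / h" using cov by blast
  show "\<exists>u v. u < v \<and> v - u < d \<and> s \<in> {u..v} \<and> ennreal q * emeasure lborel {u..v} \<le> emeasure (image_lborel f) {u..v}"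
  proof (cases "h > 0")
    case True
    thus ?thesis using h q
      by (intro exI[of _ s] exI[of _ "s + h"])
        (auto simp: image_lborel_Icc ennreal_mult'[symmetric] intro!: ennreal_leI simp: field_simps)
  next
    case False
    hence "h < 0" using h by simp
    thus ?thesis using h q
      by (intro exI[of _ "s + h"] exI[of _ s])
        (auto simp: image_lborel_Icc ennreal_mult'[symmetric] intro!: ennreal_leI simp: field_simps)
  qed
qed (simp_all add: sets_image_lborel image_lborel_outer[OF A])

lemma image_lborel_upper:
  assumes A: "A \<in> sets borel" and p: "0 < p"
    and cov: "\<And>s d. s \<in> A \<Longrightarrow> 0 < d \<Longrightarrow> \<exists>h. h \<noteq> 0 \<and> \<bar>h\<bar> < d \<and> (f (s + h) - f s) / h < p"
  shows "emeasure (image_lborel f) A \<le> ennreal p * emeasure lborel A"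
proof -
  \<comment> \<open>The roles of the two measures are exchanged: an interval on which the slope is
    below \<open>p\<close> has image measure at most \<open>p\<close> times its length, and
    \<open>1 / p\<close> takes the place of \<open>q\<close>.\<close>
  have "ennreal (1 / p) * emeasure (image_lborel f) A \<le> emeasure lborel A"
  proof (rule Vitali_measure_compare[OF _ _ A])
    fix s d :: real assume "s \<in> A" "0 < d"
    then obtain h where h: "h \<noteq> 0" "\<bar>h\<bar> < d" "(f (s + h) - f s) / h < p" using cov by blast
    have mon: "f x \<le> f y" if "x \<le> y" for x y using that by (simp add: strict_mono_less_eq[OF mono])
    show "\<exists>u v. u < v \<and> v - u < d \<and> s \<in> {u..v} \<and> ennreal (1 / p) * emeasure (image_lborel f) {u..v} \<le> emeasure lborel {u..v}"
    proof (cases "h > 0")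
      case True
      hence "1 / p * (f (s + h) - f s) \<le> h" using h p by (simp add: field_simps)
      thus ?thesis using h p True mon[of s "s + h"]
        by (intro exI[of _ s] exI[of _ "s + h"])
          (auto simp: image_lborel_Icc ennreal_mult'[symmetric] intro!: ennreal_leI)
    next
      case False
      hence "1 / p * (f s - f (s + h)) \<le> - h" using h p by (simp add: field_simps)
      thus ?thesis using h p False mon[of "s + h" s]
        by (intro exI[of _ "s + h"] exI[of _ s])
          (auto simp: image_lborel_Icc ennreal_mult'[symmetric] intro!: ennreal_leI)
    qed
  qed (simp_all add: sets_image_lborel image_lborel_null lborel_outer[OF A])
  hence "ennreal p * (ennreal (1 / p) * emeasure (image_lborel f) A) \<le> ennreal p * emeasure lborel A"
    by (rule mult_left_mono) simp
  moreover have "ennreal p * (ennreal (1 / p) * x) = x" for x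
    using p by (simp add: mult.assoc[symmetric] ennreal_mult'[symmetric])
  ultimately show ?thesis by simp
qed

text \<open>Where the quotients fall below \<open>p\<close> and also exceed some
  \<open>q > p\<close> at arbitrarily small scales, the two comparisons bound the image measure by
  \<open>p\<close> times the Lebesgue measure from above and by \<open>q\<close> times it from
  below; a set of finite measure that allows both is null.\<close>

lemma differentiable_AE: "\<exists>N\<in>sets borel. emeasure lborel N = 0 \<and> {s. \<nexists>D. (f has_real_derivative D) (at s)} \<subseteq> N"
proof -
  define Q where "Q s h = (f (s + h) - f s) / h" for s h
  define H where "H n = {h\<in>(\<rat>::real set). h \<noteq> 0 \<and> \<bar>h\<bar> < 1 / Suc n}" for n :: nat
  define F where "F p q = (\<Inter>n. \<Union>h\<in>H n. {s. Q s h < p}) \<inter> (\<Inter>n. \<Union>h\<in>H n. {s. q < Q s h})" for p q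
  have cQ: "continuous_on UNIV (\<lambda>s. Q s h)" if "h \<noteq> 0" for h
    unfolding Q_def using that by (intro continuous_intros continuous_on_compose2[OF cont]) auto
  have "open {s. Q s h < p}" "open {s. p < Q s h}" if "h \<noteq> 0" for h p
    using cQ[OF that] by (auto intro!: open_Collect_less continuous_intros)
  hence bor: "{s. Q s h < p} \<in> sets borel" "{s. p < Q s h} \<in> sets borel" if "h \<in> H n" for h p n
    using that by (auto simp: H_def)
  have cH: "countable (H n)" for n
    by (rule countable_subset[OF _ countable_rat]) (auto simp: H_def)
  have F: "F p q \<in> sets borel" for p q unfolding F_def
    using cH bor by (intro sets.Int sets.countable_INT'' sets.countable_UN') auto
  have HD: "\<exists>h\<in>H n. P h \<Longrightarrow> 1 / Suc n < d \<Longrightarrow> \<exists>h. h \<noteq> 0 \<and> \<bar>h\<bar> < d \<and> P h" for n d P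
    by (force simp: H_def)
  have null: "emeasure lborel (F p q) = 0" if "p < q" for p q
  proof (cases "p > 0")
    case False
    have nonneg: "Q s h \<ge> 0" if "h \<noteq> 0" for s h
      using strict_mono_less_eq[OF mono, of "s + h" s] strict_mono_less_eq[OF mono, of s "s + h"] that
      by (auto simp: Q_def zero_le_divide_iff)
    have "s \<notin> F p q" for s
    proof
      assume "s \<in> F p q"
      then obtain h where "h \<in> H 0" "Q s h < p" by (auto simp: F_def)
      thus False using nonneg[of h s] False by (auto simp: H_def)
    qed
    hence "F p q = {}" by blast
    thus ?thesis by simp
  next
    case True
    \<comment> \<open>Cut to bounded pieces, whose measure is finite and can be cancelled.\<close>
    have fin: "emeasure lborel (F p q \<inter> {-real n..real n}) = 0" for n
    proof -
      let ?A = "F p q \<inter> {-real n..real n}"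
      have A: "?A \<in> sets borel" using F by auto
      have "emeasure lborel ?A \<le> emeasure lborel {-real n..real n}" by (rule emeasure_mono) auto
      hence "emeasure lborel ?A \<le> ennreal (2 * real n)" by simp
      then obtain a where a: "emeasure lborel ?A = ennreal a" "0 \<le> a"
        by (metis ennreal_cases ennreal_less_top leD)
      have "ennreal q * emeasure lborel ?A \<le> emeasure (image_lborel f) ?A"
      proof (rule image_lborel_lower[OF A])
        fix s d :: real assume s: "s \<in> ?A" and d: "0 < d"
        obtain k where k: "1 / Suc k < d" using d nat_approx_posE by metis
        show "\<exists>h. h \<noteq> 0 \<and> \<bar>h\<bar> < d \<and> q < (f (s + h) - f s) / h"
          using HD[OF _ k, of "\<lambda>h. q < Q s h"] s by (auto simp: F_def Q_def)
      qed (use True that in auto)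
      also have "\<dots> \<le> ennreal p * emeasure lborel ?A"
      proof (rule image_lborel_upper[OF A True])
        fix s d :: real assume s: "s \<in> ?A" and d: "0 < d"
        obtain k where k: "1 / Suc k < d" using d nat_approx_posE by metis
        show "\<exists>h. h \<noteq> 0 \<and> \<bar>h\<bar> < d \<and> (f (s + h) - f s) / h < p"
          using HD[OF _ k, of "\<lambda>h. Q s h < p"] s by (auto simp: F_def Q_def)
      qed
      finally have "q * a \<le> p * a" using a True that by (simp add: ennreal_mult'[symmetric])
      hence "(q - p) * a \<le> 0" by (simp add: algebra_simps)
      hence "a \<le> 0" using that by (simp add: mult_le_0_iff)
      thus ?thesis using a by simp
    qed
    have "F p q = (\<Union>n. F p q \<inter> {-real n..real n})"
    proof -
      have "\<exists>n. - real n \<le> x \<and> x \<le> real n" for x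
        using real_arch_simple[of "\<bar>x\<bar>"] by (auto simp: abs_le_iff minus_le_iff)
      thus ?thesis by auto
    qed
    moreover have "(\<Union>n. F p q \<inter> {-real n..real n}) \<in> null_sets lborel"
      using fin F by (intro null_sets_UN) auto
    ultimately show ?thesis by (metis null_setsD1)
  qed
  have c: "countable {(p, q). p \<in> (\<rat>::real set) \<and> q \<in> (\<rat>::real set) \<and> p < q}"
    by (rule countable_subset[of _ "\<rat> \<times> \<rat>"]) (auto simp: countable_rat)
  define N where "N = (\<Union>(p, q)\<in>{(p, q). p \<in> (\<rat>::real set) \<and> q \<in> (\<rat>::real set) \<and> p < q}. F p q)"
  have "N \<in> null_sets lborel" unfolding N_def
    by (rule null_sets_UN'[OF c]) (use null F in auto)
  moreover have "{s. \<nexists>D. (f has_real_derivative D) (at s)} \<subseteq> N"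
  proof
    fix s assume "s \<in> {s. \<nexists>D. (f has_real_derivative D) (at s)}"
    hence nd: "\<nexists>D. (f has_real_derivative D) (at s)" by simp
    obtain d L where dL: "d > 0" "\<And>u. \<bar>u - s\<bar> < d \<Longrightarrow> \<bar>f u - f s\<bar> \<le> L * \<bar>u - s\<bar>" using lip by blast
    have "\<exists>p\<in>\<rat>. \<exists>q\<in>\<rat>. p < q \<and>
      (\<forall>e>0. \<exists>h\<in>\<rat>. h \<noteq> 0 \<and> \<bar>h\<bar> < e \<and> Q s h < p) \<and>
      (\<forall>e>0. \<exists>h\<in>\<rat>. h \<noteq> 0 \<and> \<bar>h\<bar> < e \<and> q < Q s h)"
      unfolding Q_def by (rule nondifferentiable_quotients[OF cont nd dL(1)]) (rule dL(2))
    then obtain p q where pq: "p \<in> \<rat>" "q \<in> \<rat>" "p < q"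
      "\<forall>e>0. \<exists>h\<in>\<rat>. h \<noteq> 0 \<and> \<bar>h\<bar> < e \<and> Q s h < p"
      "\<forall>e>0. \<exists>h\<in>\<rat>. h \<noteq> 0 \<and> \<bar>h\<bar> < e \<and> q < Q s h"
      by (elim bexE conjE)
    have "\<exists>h\<in>H n. Q s h < p" "\<exists>h\<in>H n. q < Q s h" for n
      using pq(4)[rule_format, of "1 / Suc n"] pq(5)[rule_format, of "1 / Suc n"] unfolding H_def by auto
    hence "s \<in> F p q" unfolding F_def by simp
    thus "s \<in> N" using pq by (auto simp: N_def)
  qed
  ultimately show ?thesis by (metis null_setsD1 null_setsD2 sets_lborel)
qed

end

text \<open>The essential bound says something about \<open>l\<close> only where \<open>l\<close> is
  differentiable, which is almost everywhere; there it confines the derivative to the interval from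
  \<open>exp (- \<eta>)\<close> to \<open>exp \<eta>\<close>, and Vitali's comparisons turn this
  into a bound on the increment over \<open>[0, t]\<close>.\<close>

lemma log_deriv_norm_le_imp_bounds:
  assumes l: "l \<in> bilipschitz_time_changes" and ln: "log_deriv_norm l T \<le> ennreal \<eta>" and \<eta>: "0 \<le> \<eta>"
    and t: "0 \<le> t" "t \<le> T"
  shows "exp (- \<eta>) * t \<le> l t" "l t \<le> exp \<eta> * t"
proof -
  note D = bilipschitz_time_changesD[OF l] and P = two_sided_properties[OF l]
  define f where "f = two_sided l"
  note P = P[folded f_def]
  obtain N where N: "N \<in> sets borel" "emeasure lborel N = 0"
    "{s. \<nexists>D. (f has_real_derivative D) (at s)} \<subseteq> N"
    by (rule bexE[OF differentiable_AE[OF P]]) (elim conjE)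
  have "AE s in lebesgue_on {0..T}. ennreal \<bar>ln (deriv l s)\<bar> \<le> ennreal \<eta>"
    using esssup_AE[of "\<lambda>s. ennreal \<bar>ln (deriv l s)\<bar>" "lebesgue_on {0..T}"] ln
    unfolding log_deriv_norm_def by (auto elim!: eventually_mono)
  hence "AE s in lebesgue. s \<in> {0..T} \<longrightarrow> ennreal \<bar>ln (deriv l s)\<bar> \<le> ennreal \<eta>"
    by (simp add: AE_restrict_space_iff)
  hence "AE s in lborel. s \<in> {0..T} \<longrightarrow> ennreal \<bar>ln (deriv l s)\<bar> \<le> ennreal \<eta>"
    by (simp add: AE_completion_iff)
  then obtain N' where N': "N' \<in> sets borel" "emeasure lborel N' = 0"
    "{s. \<not> (s \<in> {0..T} \<longrightarrow> ennreal \<bar>ln (deriv l s)\<bar> \<le> ennreal \<eta>)} \<subseteq> N'"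
    by (auto elim!: AE_E)
  define A where "A = {0<..<t} - (N \<union> N')"
  have A: "A \<in> sets borel" using N N' by (auto simp: A_def)
  have NN: "emeasure lborel (N \<union> N') = 0"
    using N N' by (metis emeasure_Un_null_set null_setsI sets_lborel sup_commute)
  have split: "emeasure M A = emeasure M {0..t}"
    if sM: "sets M = sets borel" and ac: "\<And>S. S \<in> sets borel \<Longrightarrow> emeasure lborel S = 0 \<Longrightarrow> emeasure M S = 0" for M
  proof -
    have nl: "N \<union> N' \<union> {0, t} \<in> null_sets M"
    proof (rule null_setsI)
      have "{0, t} \<in> null_sets lborel" by (intro finite_imp_null_set_lborel) auto
      hence "emeasure lborel (N \<union> N' \<union> {0, t}) = 0"
        using N N' NN by (subst emeasure_Un_null_set) auto
      thus "emeasure M (N \<union> N' \<union> {0, t}) = 0" using N N' by (intro ac) auto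
    qed (use N N' sM in auto)
    have "emeasure M ({0..t} - (N \<union> N' \<union> {0, t})) = emeasure M {0..t}"
      by (rule emeasure_Diff_null_set[OF nl]) (simp add: sM)
    also have "{0..t} - (N \<union> N' \<union> {0, t}) = A" using t by (auto simp: A_def)
    finally show ?thesis .
  qed
  have f0: "f 0 = 0" and ft: "f t = l t" using D(3) t by (auto simp: f_def two_sided_def)
  have imA: "emeasure (image_lborel f) A = ennreal (l t)"
    using split[of "image_lborel f"] image_lborel_null[OF P] image_lborel_Icc[OF P t(1)] f0 ft
    by (simp add: image_lborel_def)
  have lbA: "emeasure lborel A = ennreal t" using split[of lborel] t by simp
  have lt: "l t \<ge> 0" using D(2) t by auto
  have der: "\<exists>d. (f has_real_derivative d) (at s) \<and> exp (- \<eta>) \<le> d \<and> d \<le> exp \<eta>" if s: "s \<in> A" for s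
  proof -
    have s0: "0 < s" "s \<le> T" using s t by (auto simp: A_def)
    obtain d where d: "(f has_real_derivative d) (at s)" using s N by (auto simp: A_def)
    have "(l has_real_derivative d) (at s)"
      by (rule DERIV_cong_ev[THEN iffD1, OF refl _ refl d])
        (use s0 in \<open>auto simp: eventually_nhds_metric f_def two_sided_def dist_real_def intro!: exI[of _ s]\<close>)
    hence "deriv l s = d" by (rule DERIV_imp_deriv)
    moreover have "ennreal \<bar>ln (deriv l s)\<bar> \<le> ennreal \<eta>" using s s0 subsetD[OF N'(3), of s] by (auto simp: A_def)
    ultimately have lnd: "\<bar>ln d\<bar> \<le> \<eta>" using \<eta> by simp
    obtain e L where L: "e > 0" "L > 0" "\<And>u. u \<ge> 0 \<Longrightarrow> \<bar>u - s\<bar> < e \<Longrightarrow> \<bar>u - s\<bar> \<le> L * \<bar>l u - l s\<bar>"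
      using D(5)[of s] s0 by auto
    \<comment> \<open>Positivity of the derivative comes from the Lipschitz inverse; only for
      \<open>d > 0\<close> does the bound on \<open>ln d\<close> bound \<open>d\<close>
      itself.\<close>
    have "1 / L \<le> d"
    proof (rule tendsto_lowerbound[OF DERIV_D[OF d]])
      show "\<forall>\<^sub>F h in at 0. 1 / L \<le> (f (s + h) - f s) / h"
        unfolding eventually_at
      proof (intro exI[of _ "min e s"] conjI ballI impI)
        show "min e s > 0" using L s0 by simp
        fix h :: real assume h: "h \<noteq> 0 \<and> dist h 0 < min e s"
        hence "\<bar>h\<bar> \<le> L * \<bar>l (s + h) - l s\<bar>" using L(3)[of "s + h"] by (auto simp: dist_real_def)
        moreover have "f (s + h) = l (s + h)" "f s = l s" using h s0 by (auto simp: f_def two_sided_def dist_real_def)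
        moreover have "h > 0 \<Longrightarrow> f (s + h) \<ge> f s" "h < 0 \<Longrightarrow> f (s + h) \<le> f s"
          using strict_mono_less_eq[OF P(1)] by auto
        ultimately show "1 / L \<le> (f (s + h) - f s) / h"
          using h L(2) by (cases "h > 0") (auto simp: field_simps abs_if split: if_splits)
      qed
    qed simp
    hence "d > 0" using L(2) by (meson divide_pos_pos less_le_trans zero_less_one)
    hence "exp (ln d) = d" by simp
    moreover have "exp (- \<eta>) \<le> exp (ln d)" "exp (ln d) \<le> exp \<eta>" using lnd by (simp_all add: abs_le_iff)
    ultimately show ?thesis using d by auto
  qed
  have quot: "\<exists>h. h \<noteq> 0 \<and> \<bar>h\<bar> < d \<and> (f (s + h) - f s) / h \<in> B"
    if "(f has_real_derivative c) (at s)" "c \<in> B" "open B" "0 < d" for c s d B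
  proof -
    have "\<forall>\<^sub>F h in at 0. (f (s + h) - f s) / h \<in> B"
      using DERIV_D[OF that(1)] that(2,3) by (auto simp: tendsto_def)
    then obtain e where e: "e > 0" "\<And>h. h \<noteq> 0 \<Longrightarrow> \<bar>h\<bar> < e \<Longrightarrow> (f (s + h) - f s) / h \<in> B"
      unfolding eventually_at by (auto simp: dist_real_def)
    show ?thesis using e(1) that(4) by (intro exI[of _ "min d e / 2"] conjI e(2)) auto
  qed
  have "l t \<le> p * t" if "p > exp \<eta>" for p
  proof -
    have p: "p > 0" using that by (meson exp_gt_zero less_trans)
    have "emeasure (image_lborel f) A \<le> ennreal p * emeasure lborel A"
    proof (rule image_lborel_upper[OF P A p])
      fix s d :: real assume s: "s \<in> A" and d: "0 < d"
      obtain c where c: "(f has_real_derivative c) (at s)" "c \<le> exp \<eta>" using der[OF s] by blast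
      show "\<exists>h. h \<noteq> 0 \<and> \<bar>h\<bar> < d \<and> (f (s + h) - f s) / h < p"
        using quot[OF c(1), of "{..<p}" d] c that d by auto
    qed
    thus ?thesis using p t lt by (simp add: imA lbA ennreal_mult'[symmetric])
  qed
  hence "\<And>e. 0 < e \<Longrightarrow> l t \<le> (exp \<eta> + e / (t + 1)) * t" using t by auto
  moreover have "(exp \<eta> + e / (t + 1)) * t \<le> exp \<eta> * t + e" if "e > 0" for e
  proof -
    have "e * t \<le> e * (t + 1)" using that t by (intro mult_left_mono) auto
    hence "e / (t + 1) * t \<le> e" using t by (simp add: divide_le_eq)
    thus ?thesis by (simp add: distrib_right)
  qed
  ultimately show "l t \<le> exp \<eta> * t" by (meson field_le_epsilon order_trans)
  have "q * t \<le> l t" if "q < exp (- \<eta>)" "q \<ge> 0" for q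
  proof -
    have "ennreal q * emeasure lborel A \<le> emeasure (image_lborel f) A"
    proof (rule image_lborel_lower[OF P A that(2)])
      fix s d :: real assume s: "s \<in> A" and d: "0 < d"
      obtain c where c: "(f has_real_derivative c) (at s)" "exp (- \<eta>) \<le> c" using der[OF s] by blast
      show "\<exists>h. h \<noteq> 0 \<and> \<bar>h\<bar> < d \<and> q < (f (s + h) - f s) / h"
        using quot[OF c(1), of "{q<..}" d] c that d by auto
    qed
    thus ?thesis using that t lt by (simp add: imA lbA ennreal_mult'[symmetric])
  qed note low = this
  show "exp (- \<eta>) * t \<le> l t"
  proof (rule field_le_mult_one_interval)
    fix z :: real assume z: "0 < z" "z < 1"
    have "z * exp (- \<eta>) < exp (- \<eta>)" using z by simp
    thus "z * (exp (- \<eta>) * t) \<le> l t" using low[of "z * exp (- \<eta>)"] z by (simp add: mult.assoc)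
  qed
qed

section \<open>Metrizability of the Alexandroff compactification\<close>

lemma dist_fun_coordinate:
  fixes x :: "nat \<Rightarrow> real" and n :: nat
  assumes "0 < e"
  shows "\<exists>d>0. \<forall>y. dist x y < d \<longrightarrow> \<bar>x n - y n\<bar> < e"
proof -
  have "open {y :: nat \<Rightarrow> real. \<bar>x n - y n\<bar> < e}"
    by (intro open_Collect_less continuous_intros continuous_on_product_coordinates)
  moreover have "x \<in> {y :: nat \<Rightarrow> real. \<bar>x n - y n\<bar> < e}" using assms by simp
  ultimately obtain d where "d > 0" "ball x d \<subseteq> {y. \<bar>x n - y n\<bar> < e}" by (rule openE)
  thus ?thesis by (intro exI[of _ d]) auto
qed

text \<open>The metric is pulled back from the space of real sequences. Continuity of the
  coordinates makes its balls open; separating a point from a closed set by one coordinate gives the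
  converse, and with T1 also that distinct points have positive distance.\<close>

lemma metrizable_via_embedding:
  fixes F :: "'a \<Rightarrow> nat \<Rightarrow> real"
  assumes cont: "\<And>n. continuous_map T euclideanreal (\<lambda>x. F x n)" and t1: "t1_space T"
    and sep: "\<And>G x. openin T G \<Longrightarrow> x \<in> G \<Longrightarrow> \<exists>n. F x n = 0 \<and> (\<forall>y\<in>topspace T - G. F y n = (1::real))"
  shows "metrizable_space T"
proof -
  define d where "d x y = dist (F x) (F y)" for x y
  have sep': "\<exists>r>0. \<forall>y\<in>topspace T. d x y < r \<longrightarrow> y \<in> G" if G: "openin T G" "x \<in> G" for G x
  proof -
    obtain n where n: "F x n = 0" "\<forall>y\<in>topspace T - G. F y n = 1" using sep[OF G] by blast
    obtain r where r: "r > 0" "\<forall>y. dist (F x) y < r \<longrightarrow> \<bar>F x n - y n\<bar> < 1"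
      using dist_fun_coordinate[of 1 "F x" n] by auto
    have "y \<in> G" if y: "y \<in> topspace T" "d x y < r" for y
    proof (rule ccontr)
      assume "y \<notin> G"
      hence "F y n = 1" using n y by auto
      moreover have "\<bar>F x n - F y n\<bar> < 1" using r y by (auto simp: d_def)
      ultimately show False using n by simp
    qed
    thus ?thesis using r by blast
  qed
  have "x = y" if xy: "x \<in> topspace T" "y \<in> topspace T" "d x y = 0" for x y
  proof (rule ccontr)
    assume "x \<noteq> y"
    then obtain G where G: "openin T G" "x \<in> G" "y \<notin> G" using t1 xy by (auto simp: t1_space_def)
    then obtain r where "r > 0" "\<forall>y\<in>topspace T. d x y < r \<longrightarrow> y \<in> G" using sep' by blast
    thus False using xy G by auto
  qed
  then interpret M: Metric_space "topspace T" d
    by unfold_locales (auto simp: d_def dist_commute dist_triangle)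
  have contF: "continuous_map T euclidean F"
    using cont by (simp add: euclidean_product_topology[symmetric] continuous_map_componentwise)
  have "openin T (M.mball x r)" for x r
  proof (cases "x \<in> topspace T")
    case True
    have "openin T {y \<in> topspace T. F y \<in> ball (F x) r}"
      using contF by (rule openin_continuous_map_preimage) simp
    moreover have "{y \<in> topspace T. F y \<in> ball (F x) r} = M.mball x r" using True by (auto simp: d_def M.mball_def)
    ultimately show ?thesis by simp
  next
    case False
    hence "M.mball x r = {}" by (auto simp: M.mball_def)
    thus ?thesis by simp
  qed
  hence 1: "openin T V" if "openin M.mtopology V" for V
    using that unfolding M.openin_mtopology by (meson M.centre_in_mball_iff openin_subopen subsetD)
  have 2: "openin M.mtopology V" if V: "openin T V" for V
    unfolding M.openin_mtopology
  proof (intro conjI allI impI)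
    show "V \<subseteq> topspace T" using V openin_subset by blast
    fix x assume "x \<in> V"
    then obtain r where r: "r > 0" "\<forall>y\<in>topspace T. d x y < r \<longrightarrow> y \<in> V" using sep'[OF V] by blast
    thus "\<exists>r>0. M.mball x r \<subseteq> V" by (intro exI[of _ r]) (auto simp: M.mball_def)
  qed
  have "M.mtopology = T" unfolding topology_eq using 1 2 by blast
  thus ?thesis using M.metrizable_space_mtopology by simp
qed

theorem Urysohn_metrization:
  assumes reg: "regular_space T" and haus: "Hausdorff_space T" and sc: "second_countable T"
  shows "metrizable_space T"
proof -
  have norm: "normal_space T"
    by (rule regular_Lindelof_imp_normal_space[OF reg second_countable_imp_Lindelof_space[OF sc]])
  obtain B where B: "countable B" "\<And>V. V \<in> B \<Longrightarrow> openin T V"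
    "\<And>V x. openin T V \<Longrightarrow> x \<in> V \<Longrightarrow> \<exists>W\<in>B. x \<in> W \<and> W \<subseteq> V"
    using sc unfolding second_countable_def by metis
  define I where "I = {(V, W). V \<in> B \<and> W \<in> B \<and> T closure_of V \<subseteq> W}"
  have cI: "countable I" by (rule countable_subset[of _ "B \<times> B"]) (use B(1) in \<open>auto simp: I_def\<close>)
  have "\<exists>f. continuous_map T euclideanreal f \<and> (p \<in> I \<longrightarrow> f ` (T closure_of fst p) \<subseteq> {0} \<and> f ` (topspace T - snd p) \<subseteq> {1})" for p
  proof (cases "p \<in> I")
    case True
    hence o: "openin T (snd p)" and sub: "T closure_of fst p \<subseteq> snd p" using B(2) by (auto simp: I_def)
    have "closedin T (T closure_of fst p)" "closedin T (topspace T - snd p)"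
      "disjnt (T closure_of fst p) (topspace T - snd p)"
      using o sub by (auto simp: disjnt_def)
    then obtain f :: "'a \<Rightarrow> real" where "continuous_map T euclideanreal f" "f ` (T closure_of fst p) \<subseteq> {0}" "f ` (topspace T - snd p) \<subseteq> {1}"
      using Urysohn_lemma_alt[OF norm, of "T closure_of fst p" "topspace T - snd p" 0 1] by metis
    thus ?thesis by blast
  qed (auto intro!: exI[of _ "\<lambda>_. 0"])
  then obtain f where f: "\<And>p. continuous_map T euclideanreal (f p)"
    "\<And>p. p \<in> I \<Longrightarrow> f p ` (T closure_of fst p) \<subseteq> {0} \<and> f p ` (topspace T - snd p) \<subseteq> {1}"
    by metis
  show ?thesis
  proof (rule metrizable_via_embedding[where F="\<lambda>x n. f (from_nat_into I n) x"])
    fix G x assume G: "openin T G" "x \<in> G"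
    obtain W where W: "W \<in> B" "x \<in> W" "W \<subseteq> G" using B(3)[OF G] by blast
    obtain G' C where OC: "openin T G'" "closedin T C" "x \<in> G'" "G' \<subseteq> C" "C \<subseteq> W"
      using reg B(2)[OF W(1)] W(2) unfolding neighbourhood_base_of_closedin[symmetric] neighbourhood_base_of by metis
    obtain V where V: "V \<in> B" "x \<in> V" "V \<subseteq> G'" using B(3)[OF OC(1,3)] by blast
    have "T closure_of V \<subseteq> W" using OC V by (meson closure_of_minimal order_trans)
    hence p: "(V, W) \<in> I" using V W by (auto simp: I_def)
    have "x \<in> T closure_of V" using V B(2) closure_of_subset[of V T] openin_subset by blast
    hence "f (V, W) x = 0" using f(2)[OF p] by auto
    moreover have "\<forall>y\<in>topspace T - G. f (V, W) y = 1" using f(2)[OF p] W(3) by (auto simp: image_subset_iff)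
    moreover obtain n where "from_nat_into I n = (V, W)" using from_nat_into_surj[OF cI p] by blast
    ultimately show "\<exists>n. f (from_nat_into I n) x = 0 \<and> (\<forall>y\<in>topspace T - G. f (from_nat_into I n) y = 1)"
      by (intro exI[of _ n]) simp
  qed (simp_all add: f(1) haus Hausdorff_imp_t1_space)
qed

text \<open>A base at the added point consists of the complements of closures of finite unions of
  relatively compact basic sets: each compact set is covered by such a union. If \<open>X\<close> is
  compact, one of these complements is the point alone.\<close>

lemma second_countable_Alexandroff_compactification:
  assumes lc: "locally_compact_space X" and haus: "Hausdorff_space X" and sc: "second_countable X"
  shows "second_countable (Alexandroff_compactification X)"
proof -
  obtain B where B: "countable B" "\<And>V. V \<in> B \<Longrightarrow> openin X V"
    "\<And>V x. openin X V \<Longrightarrow> x \<in> V \<Longrightarrow> \<exists>W\<in>B. x \<in> W \<and> W \<subseteq> V"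
    using sc unfolding second_countable_def by metis
  define B' where "B' = {V \<in> B. \<exists>K. compactin X K \<and> V \<subseteq> K}"
  define N where "N F = insert None (Some ` (topspace X - X closure_of (\<Union>F)))" for F
  define \<B> where "\<B> = (`) Some ` B \<union> N ` {F. finite F \<and> F \<subseteq> B'}"
  have cB': "countable B'" using B(1) by (auto simp: B'_def intro: countable_subset)
  have cnt: "countable \<B>" unfolding \<B>_def using B(1) cB' countable_Collect_finite_subset by auto
  have opn: "openin (Alexandroff_compactification X) V" if "V \<in> \<B>" for V
  proof -
    have "openin (Alexandroff_compactification X) (N F)" if F: "finite F" "F \<subseteq> B'" for F
    proof -
      obtain K where K: "\<And>V. V \<in> F \<Longrightarrow> compactin X (K V) \<and> V \<subseteq> K V" using F by (auto simp: B'_def subset_iff) metis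
      have cK: "compactin X (\<Union>(K ` F))" using F K by (intro compactin_Union) auto
      hence "closedin X (\<Union>(K ` F))" using haus compactin_imp_closedin by blast
      hence "X closure_of (\<Union>F) \<subseteq> \<Union>(K ` F)" using K by (intro closure_of_minimal) auto
      hence "compactin X (X closure_of (\<Union>F))" using cK closed_compactin closedin_closure_of by metis
      thus ?thesis unfolding N_def openin_Alexandroff_compactification by auto
    qed
    thus ?thesis using that B(2) by (auto simp: \<B>_def)
  qed
  have bas: "\<exists>W\<in>\<B>. x \<in> W \<and> W \<subseteq> V" if V: "openin (Alexandroff_compactification X) V" "x \<in> V" for V x
  proof (cases x)
    case (Some y)
    have o: "openin X {y \<in> topspace X. Some y \<in> V}"
      by (rule openin_continuous_map_preimage[OF continuous_map_Some V(1)])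
    have m: "y \<in> {y \<in> topspace X. Some y \<in> V}" using V Some openin_subset by fastforce
    obtain W where "W \<in> B" "y \<in> W" "W \<subseteq> {y \<in> topspace X. Some y \<in> V}" using B(3)[OF o m] by blast
    thus ?thesis using Some by (intro bexI[of _ "Some ` W"]) (auto simp: \<B>_def)
  next
    case None
    then obtain C where C: "compactin X C" "V = insert None (Some ` (topspace X - C))"
      using V by (auto simp: openin_Alexandroff_compactification)
    have cov: "C \<subseteq> \<Union>B'"
    proof
      fix y assume "y \<in> C"
      hence y: "y \<in> topspace X" using C compactin_subset_topspace by blast
      then obtain U K where UK: "openin X U" "compactin X K" "y \<in> U" "U \<subseteq> K"
        using lc unfolding locally_compact_space_def by blast
      obtain W where "W \<in> B" "y \<in> W" "W \<subseteq> U" using B(3)[OF UK(1,3)] by blast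
      thus "y \<in> \<Union>B'" using UK by (auto simp: B'_def)
    qed
    have "\<exists>F. finite F \<and> F \<subseteq> B' \<and> C \<subseteq> \<Union>F"
      by (rule compactinD[OF C(1) _ cov]) (use B(2) in \<open>auto simp: B'_def\<close>)
    then obtain F where F: "finite F" "F \<subseteq> B'" "C \<subseteq> \<Union>F" by blast
    have "V \<subseteq> topspace X" if "V \<in> F" for V
      using that F(2) by (intro openin_subset B(2)) (auto simp: B'_def)
    hence "\<Union>F \<subseteq> topspace X" by blast
    hence cF: "\<Union>F \<subseteq> X closure_of (\<Union>F)" by (rule closure_of_subset)
    hence "C \<subseteq> X closure_of (\<Union>F)" using F(3) by (rule order_trans[rotated])
    hence "N F \<subseteq> V" using C(2) by (auto simp: N_def)
    thus ?thesis using F None by (intro bexI[of _ "N F"]) (auto simp: \<B>_def N_def)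
  qed
  show ?thesis unfolding second_countable_def
  proof (intro exI[of _ \<B>] conjI ballI allI impI)
    fix V x assume "openin (Alexandroff_compactification X) V \<and> x \<in> V"
    thus "\<exists>W\<in>\<B>. x \<in> W \<and> W \<subseteq> V" by (elim conjE) (rule bas)
  qed (use cnt opn in simp_all)
qed

section \<open>Metrics on the space and on its compactification\<close>

lemma compatible_metric:
  assumes "metrizable_space T"
  shows "Metric_space (topspace T) (compatible_metric T)"
    "Metric_space.mtopology (topspace T) (compatible_metric T) = T"
proof -
  obtain M d where M: "Metric_space M d" "T = Metric_space.mtopology M d"
    using assms unfolding metrizable_space_def by blast
  hence eq: "M = topspace T" by (simp add: Metric_space.topspace_mtopology)
  have "Metric_space (topspace T) d \<and> Metric_space.mtopology (topspace T) d = T"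
    by (rule conjI[OF M(1)[unfolded eq] M(2)[symmetric, unfolded eq]])
  hence "\<exists>d. Metric_space (topspace T) d \<and> Metric_space.mtopology (topspace T) d = T" by (intro exI[of _ d])
  from someI_ex[OF this] show "Metric_space (topspace T) (compatible_metric T)"
    "Metric_space.mtopology (topspace T) (compatible_metric T) = T"
    unfolding compatible_metric_def by auto
qed

text \<open>The local topology is defined with a metric of \<open>X\<close>, while the arguments
  below use one of the compactification. Two metrics of a topology need not be uniformly equivalent,
  but near a compact set they are, by a Lebesgue number argument, and up to the times that matter a
  path stays in a compact set.\<close>

lemma metrics_uniform_on_compact:
  assumes M1: "Metric_space M d1" and M2: "Metric_space M d2"
    and eq: "Metric_space.mtopology M d1 = Metric_space.mtopology M d2"
    and K: "compactin (Metric_space.mtopology M d1) K" and e: "0 < e"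
  shows "\<exists>r>0. \<forall>p\<in>K. \<forall>q\<in>M. d1 p q < r \<longrightarrow> d2 p q < e"
proof -
  interpret A: Metric_space M d1 by (rule M1)
  interpret B: Metric_space M d2 by (rule M2)
  have KM: "K \<subseteq> M" using K A.topspace_mtopology compactin_subset_topspace by metis
  have "\<exists>r>0. \<forall>q\<in>M. d1 p q < 2 * r \<longrightarrow> d2 p q < e / 2" if "p \<in> K" for p
  proof -
    have "openin A.mtopology (B.mball p (e / 2))" using eq by simp
    moreover have "p \<in> B.mball p (e / 2)" using that KM e by auto
    ultimately obtain r where "r > 0" "A.mball p r \<subseteq> B.mball p (e / 2)"
      unfolding A.openin_mtopology by blast
    thus ?thesis using that KM by (intro exI[of _ "r / 2"]) (auto simp: subset_iff)
  qed
  then obtain r where r: "\<And>p. p \<in> K \<Longrightarrow> r p > 0 \<and> (\<forall>q\<in>M. d1 p q < 2 * r p \<longrightarrow> d2 p q < e / 2)" by metis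
  have "K \<subseteq> \<Union>((\<lambda>p. A.mball p (r p)) ` K)" using r KM by auto
  then obtain \<F> where \<F>: "finite \<F>" "\<F> \<subseteq> (\<lambda>p. A.mball p (r p)) ` K" "K \<subseteq> \<Union>\<F>"
    using compactinD[OF K, of "(\<lambda>p. A.mball p (r p)) ` K"] by auto
  then obtain F where F: "finite F" "F \<subseteq> K" "\<F> = (\<lambda>p. A.mball p (r p)) ` F"
    using finite_subset_image by metis
  note F = F(1,2) \<F>(3)[unfolded F(3)]
  show ?thesis
  proof (intro exI[of _ "Min (insert 1 (r ` F))"] conjI ballI impI)
    show "0 < Min (insert 1 (r ` F))" using F r by auto
    fix p q assume p: "p \<in> K" and q: "q \<in> M" and d: "d1 p q < Min (insert 1 (r ` F))"
    obtain c where c: "c \<in> F" "p \<in> A.mball c (r c)" using F p by blast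
    have cM: "c \<in> M" "c \<in> K" "p \<in> M" using c F KM p by auto
    have "d1 p q < r c" using d c F by auto
    hence "d1 c q < 2 * r c" "d1 c p < 2 * r c"
      using A.triangle[of c p q] c cM q r[of c] by auto
    hence "d2 c q < e / 2" "d2 c p < e / 2" using r[OF cM(2)] q cM by auto
    thus "d2 p q < e" using B.triangle[of p c q] cM q B.commute[of p c] by auto
  qed
qed

lemma limitin_Metric_iff:
  assumes "Metric_space M d" "Metric_space.mtopology M d = T"
  shows "limitin T f l F \<longleftrightarrow> l \<in> M \<and> (\<forall>e>0. \<forall>\<^sub>F x in F. f x \<in> M \<and> d (f x) l < e)"
  using Metric_space.limitin_metric[OF assms(1)] assms(2) by metis

locale lc_space =
  fixes X :: "'a topology"
  assumes hausdorff: "Hausdorff_space X" and lcompact: "locally_compact_space X"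
    and countable_base: "second_countable X"
begin

abbreviation E :: "'a option topology" where "E \<equiv> Alexandroff_compactification X"
definition \<Omega> :: "'a option set" where "\<Omega> = insert None (Some ` topspace X)"
definition dE :: "'a option \<Rightarrow> 'a option \<Rightarrow> real" where "dE = compatible_metric E"
definition dX :: "'a \<Rightarrow> 'a \<Rightarrow> real" where "dX = compatible_metric X"

lemma topspace_E: "topspace E = \<Omega>" by (simp add: \<Omega>_def)

lemma metrizable_E: "metrizable_space E"
proof (rule Urysohn_metrization)
  show "second_countable E"
    by (rule second_countable_Alexandroff_compactification[OF lcompact hausdorff countable_base])
  show "Hausdorff_space E" using hausdorff lcompact by (simp add: Hausdorff_space_Alexandroff_compactification)
  thus "regular_space E" by (intro compact_Hausdorff_imp_regular_space) auto
qed

lemma metrizable_X: "metrizable_space X"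
  using Urysohn_metrization[OF locally_compact_Hausdorff_imp_regular_space hausdorff countable_base] lcompact hausdorff
  by blast

sublocale E: Metric_space \<Omega> dE
  using compatible_metric(1)[OF metrizable_E] by (simp only: topspace_E dE_def)

lemma mtopology_E: "E.mtopology = E"
  using compatible_metric(2)[OF metrizable_E] by (simp only: topspace_E dE_def)

sublocale X: Metric_space "topspace X" dX
  using compatible_metric(1)[OF metrizable_X] by (simp only: dX_def)

lemma mtopology_X: "X.mtopology = X"
  using compatible_metric(2)[OF metrizable_X] by (simp only: dX_def)

lemma None_in [simp]: "None \<in> \<Omega>" by (simp add: \<Omega>_def)
lemma Some_in [simp]: "Some p \<in> \<Omega> \<longleftrightarrow> p \<in> topspace X" by (auto simp: \<Omega>_def)

lemma limitin_E: "limitin E f l F \<longleftrightarrow> l \<in> \<Omega> \<and> (\<forall>e>0. \<forall>\<^sub>F x in F. f x \<in> \<Omega> \<and> dE (f x) l < e)"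
  by (rule limitin_Metric_iff[OF E.Metric_space_axioms mtopology_E])

text \<open>The metric of the compactification restricted to \<open>X\<close>: it induces the same
  topology, but points running off to infinity may come close together in it.\<close>

definition dS :: "'a \<Rightarrow> 'a \<Rightarrow> real" where "dS p q = dE (Some p) (Some q)"

sublocale S: Metric_space "topspace X" dS
  by unfold_locales (auto simp: dS_def E.commute intro: E.triangle)

lemma mtopology_S: "S.mtopology = X"
proof -
  have "openin S.mtopology V \<longleftrightarrow> openin X V" for V
  proof
    assume V: "openin X V"
    hence o: "openin E.mtopology (Some ` V)" by (simp add: mtopology_E)
    show "openin S.mtopology V" unfolding S.openin_mtopology
    proof (intro conjI allI impI)
      show "V \<subseteq> topspace X" using V openin_subset by blast
      fix p assume p: "p \<in> V"
      then obtain r where r: "r > 0" "E.mball (Some p) r \<subseteq> Some ` V"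
        using o unfolding E.openin_mtopology by blast
      have "S.mball p r \<subseteq> V"
      proof
        fix q assume "q \<in> S.mball p r"
        hence "Some q \<in> E.mball (Some p) r" by (auto simp: S.mball_def E.mball_def dS_def)
        hence "Some q \<in> Some ` V" using r(2) by (rule subsetD[rotated])
        thus "q \<in> V" by auto
      qed
      thus "\<exists>r>0. S.mball p r \<subseteq> V" using r by blast
    qed
  next
    assume V: "openin S.mtopology V"
    show "openin X V"
    proof (subst openin_subopen, intro ballI)
      fix p assume p: "p \<in> V"
      then obtain r where r: "r > 0" "S.mball p r \<subseteq> V" using V unfolding S.openin_mtopology by blast
      have pX: "p \<in> topspace X" using p V S.topspace_mtopology openin_subset by blast
      have "openin E (E.mball (Some p) r)" using E.openin_mball[of "Some p" r] by (simp add: mtopology_E)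
      hence o: "openin X {q \<in> topspace X. Some q \<in> E.mball (Some p) r}"
        by (rule openin_continuous_map_preimage[OF continuous_map_Some])
      have "p \<in> {q \<in> topspace X. Some q \<in> E.mball (Some p) r}" using pX r by simp
      moreover have "{q \<in> topspace X. Some q \<in> E.mball (Some p) r} \<subseteq> V"
        using r pX by (auto simp: S.mball_def dS_def subset_iff)
      ultimately show "\<exists>T. openin X T \<and> p \<in> T \<and> T \<subseteq> V" using o by blast
    qed
  qed
  thus ?thesis unfolding topology_eq by blast
qed

lemma dX_imp_dE_uniform:
  assumes "compactin X K" "0 < e"
  shows "\<exists>r>0. \<forall>p\<in>K. \<forall>q\<in>topspace X. dX p q < r \<longrightarrow> dE (Some p) (Some q) < e"
  using metrics_uniform_on_compact[OF X.Metric_space_axioms S.Metric_space_axioms _ _ assms(2), of K] assms(1)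
  by (simp add: mtopology_X mtopology_S dS_def)

lemma dE_imp_dX_uniform:
  assumes "compactin X K" "0 < e"
  shows "\<exists>r>0. \<forall>p\<in>K. \<forall>q\<in>topspace X. dE (Some p) (Some q) < r \<longrightarrow> dX p q < e"
  using metrics_uniform_on_compact[OF S.Metric_space_axioms X.Metric_space_axioms _ _ assms(2), of K] assms(1)
  by (simp add: mtopology_X mtopology_S dS_def)

lemma closedin_Ebig: "closedin E {z \<in> \<Omega>. c \<le> dE z None}"
proof -
  have "openin E (E.mball None c)" using E.openin_mball[of None c] by (simp add: mtopology_E)
  moreover have "{z \<in> \<Omega>. c \<le> dE z None} = \<Omega> - E.mball None c"
    by (auto simp: E.mball_def E.commute)
  ultimately show ?thesis
    using closedin_diff[OF closedin_topspace[of E], of "E.mball None c"] unfolding topspace_E by simp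
qed

text \<open>Together with the converse below this expresses containment in a compact subset of
  \<open>X\<close> by a number, the distance to \<open>None\<close>; relative compactness of a path
  thus becomes a lower bound.\<close>

lemma compactin_away:
  assumes "0 < c"
  shows "compactin X {p \<in> topspace X. c \<le> dE (Some p) None}"
proof -
  have eq: "{z \<in> \<Omega>. c \<le> dE z None} = Some ` {p \<in> topspace X. c \<le> dE (Some p) None}"
    using assms by (auto simp: \<Omega>_def)
  show ?thesis using closedin_Ebig[of c] unfolding eq by simp
qed

lemma compactin_imp_away:
  assumes "compactin X K"
  shows "\<exists>c>0. \<forall>p\<in>K. c \<le> dE (Some p) None"
proof -
  have "closedin X K" using assms hausdorff compactin_imp_closedin by blast
  hence "openin E (insert None (Some ` (topspace X - K)))"
    using assms by (auto simp: openin_Alexandroff_compactification)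
  then obtain c where c: "c > 0" "E.mball None c \<subseteq> insert None (Some ` (topspace X - K))"
    unfolding mtopology_E[symmetric] E.openin_mtopology by blast
  have "c \<le> dE (Some p) None" if p: "p \<in> K" for p
  proof (rule ccontr)
    assume "\<not> ?thesis"
    moreover have "p \<in> topspace X" using p assms compactin_subset_topspace by blast
    ultimately have "Some p \<in> E.mball None c" by (auto simp: E.mball_def E.commute)
    hence "Some p \<in> insert None (Some ` (topspace X - K))" using c(2) by (rule subsetD[rotated])
    thus False using p by auto
  qed
  thus ?thesis using c by blast
qed

definition den :: "nat \<Rightarrow> 'a option" where
  "den = (SOME f. range f \<subseteq> \<Omega> \<and> (\<forall>z\<in>\<Omega>. \<forall>e>0. \<exists>n. dE z (f n) < e))"

lemma den: "den n \<in> \<Omega>" "z \<in> \<Omega> \<Longrightarrow> 0 < e \<Longrightarrow> \<exists>n. dE z (den n) < e"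
proof -
  have "separable_space E"
    by (intro second_countable_imp_separable_space second_countable_Alexandroff_compactification lcompact hausdorff countable_base)
  then obtain C where C: "countable C" "C \<subseteq> \<Omega>" "E closure_of C = \<Omega>"
    unfolding separable_space_def topspace_E by blast
  have ne: "C \<noteq> {}" using C None_in by (metis closure_of_empty empty_iff)
  have "\<exists>n. dE z (from_nat_into C n) < e" if z: "z \<in> \<Omega>" and e: "0 < e" for z e
  proof -
    have "z \<in> E.mtopology closure_of C" using z C mtopology_E by simp
    then obtain y where "y \<in> C" "y \<in> E.mball z e" using e unfolding E.metric_closure_of by blast
    thus ?thesis using from_nat_into_surj[OF C(1)] by (metis E.in_mball)
  qed
  moreover have "range (from_nat_into C) \<subseteq> \<Omega>" using C ne by (metis range_from_nat_into)
  ultimately have "range den \<subseteq> \<Omega> \<and> (\<forall>z\<in>\<Omega>. \<forall>e>0. \<exists>n. dE z (den n) < e)"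
    unfolding den_def by (intro someI[of "\<lambda>f. range f \<subseteq> \<Omega> \<and> (\<forall>z\<in>\<Omega>. \<forall>e>0. \<exists>n. dE z (f n) < e)" "from_nat_into C"]) blast
  thus "den n \<in> \<Omega>" "z \<in> \<Omega> \<Longrightarrow> 0 < e \<Longrightarrow> \<exists>n. dE z (den n) < e" by auto
qed

end

section \<open>Cadlag paths\<close>

lemma time_homeo_inverse:
  assumes "time_homeo l"
  obtains m where "time_homeo m" "\<And>s. 0 \<le> s \<Longrightarrow> m (l s) = s" "\<And>s. 0 \<le> s \<Longrightarrow> l (m s) = s"
proof -
  note D = time_homeoD[OF assms]
  define m where "m y = (SOME s. 0 \<le> s \<and> l s = y)" for y
  have m: "0 \<le> m y \<and> l (m y) = y" if "0 \<le> y" for y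
    unfolding m_def by (rule someI_ex) (use D(5)[OF that] in blast)
  have ml: "m (l s) = s" if "0 \<le> s" for s
    using m[OF D(1)[OF that]] D(3)[of s "m (l s)"] D(3)[of "m (l s)" s] that by (auto intro: antisym simp: not_less[symmetric])
  have "strict_mono_on {0..} m"
    by (rule strict_mono_onI) (use m D(3) in \<open>metis atLeast_iff\<close>)
  moreover have "m ` {0..} = {0..}"
  proof (intro set_eqI iffI)
    fix y :: real assume "y \<in> {0..}"
    thus "y \<in> m ` {0..}" using ml[of y] D(1)[of y] by (intro image_eqI[of _ _ "l y"]) auto
  qed (use m in auto)
  ultimately show thesis using that[of m] m ml by (auto simp: time_homeo_def)
qed

lemma time_homeo_continuous:
  assumes l: "time_homeo l"
  shows "continuous_on {0..} l"
proof -
  have "continuous_on {0..} (two_sided l)" using two_sided_homeo(3)[OF l] by (rule continuous_on_subset) simp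
  thus ?thesis by (rule continuous_on_eq) (simp add: two_sided_def)
qed

lemma time_homeo_homeomorphism:
  assumes l: "time_homeo l"
  shows "\<exists>m. homeomorphism {0..} {0..} l m"
proof -
  obtain m where m: "time_homeo m" "\<And>s. 0 \<le> s \<Longrightarrow> m (l s) = s" "\<And>s. 0 \<le> s \<Longrightarrow> l (m s) = s"
    using time_homeo_inverse[OF l] by metis
  have "l ` {0..} = {0..}" "m ` {0..} = {0..}" using l m(1) by (simp_all add: time_homeo_def)
  hence "homeomorphism {0..} {0..} l m"
    using m(2,3) time_homeo_continuous[OF l] time_homeo_continuous[OF m(1)] by (simp add: homeomorphism_def)
  thus ?thesis by blast
qed

section \<open>Cadlag paths in terms of the metric of the compactification\<close>

context lc_space begin

text \<open>The bound \<open>d \<le> t\<close> keeps the window inside the nonnegative times, where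
  the values of a path are specified, and forces \<open>t > 0\<close>.\<close>

definition left_lim :: "'a path \<Rightarrow> real \<Rightarrow> 'a option \<Rightarrow> bool" where
  "left_lim x t l \<longleftrightarrow> l \<in> \<Omega> \<and> (\<forall>e>0. \<exists>d>0. d \<le> t \<and> (\<forall>u. t - d < u \<and> u < t \<longrightarrow> dE (x u) l < e))"

definition right_cts :: "'a path \<Rightarrow> real \<Rightarrow> bool" where
  "right_cts x s \<longleftrightarrow> (\<forall>e>0. \<exists>d>0. \<forall>u. s \<le> u \<and> u < s + d \<longrightarrow> dE (x u) (x s) < e)"

definition cadlag_upto :: "'a path \<Rightarrow> real \<Rightarrow> bool" where
  "cadlag_upto x T \<longleftrightarrow> 0 \<le> T \<and> (\<forall>s\<ge>0. x s \<in> \<Omega>) \<and> (\<forall>s\<ge>0. right_cts x s) \<and>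
     (\<forall>t. 0 < t \<and> t \<le> T \<longrightarrow> (\<exists>l. left_lim x t l))"

definition matched :: "real \<Rightarrow> real \<Rightarrow> 'a path \<Rightarrow> 'a path \<Rightarrow> bool" where
  "matched d T x x' \<longleftrightarrow> (\<exists>l. time_homeo l \<and>
     (\<forall>s. 0 \<le> s \<and> s \<le> T \<longrightarrow> \<bar>l s - s\<bar> \<le> d \<and> dE (x s) (x' (l s)) \<le> d))"

text \<open>The common core of both Skorokhod convergences: matching reaches a time that is late or
  at which \<open>x\<close> is already close to \<open>None\<close>. Only the size of the time
  shifts is recorded; slopes are recovered later from the weights in the templates.\<close>

definition Mconv :: "(nat \<Rightarrow> 'a path) \<Rightarrow> 'a path \<Rightarrow> bool" where
  "Mconv xk x \<longleftrightarrow> (\<forall>c>0. \<forall>N. \<forall>d>0. \<exists>T. cadlag_upto x T \<and> (N \<le> T \<or> dE (x T) None < c) \<and>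
     (\<forall>\<^sub>F k in sequentially. matched d T x (xk k)))"

lemma has_left_limit_iff:
  assumes t: "0 < t" and x: "\<forall>s\<ge>0. x s \<in> \<Omega>"
  shows "has_left_limit X x (ennreal t) l \<longleftrightarrow> left_lim x t l"
proof -
  have "(\<forall>\<^sub>F u in at_left t. x u \<in> \<Omega> \<and> dE (x u) l < e) \<longleftrightarrow>
      (\<exists>d>0. d \<le> t \<and> (\<forall>u. t - d < u \<and> u < t \<longrightarrow> dE (x u) l < e))" for e
  proof
    assume "\<forall>\<^sub>F u in at_left t. x u \<in> \<Omega> \<and> dE (x u) l < e"
    then obtain b where b: "b < t" "\<And>u. b < u \<Longrightarrow> u < t \<Longrightarrow> dE (x u) l < e"
      unfolding eventually_at_left[OF t] by auto
    thus "\<exists>d>0. d \<le> t \<and> (\<forall>u. t - d < u \<and> u < t \<longrightarrow> dE (x u) l < e)"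
      using t by (intro exI[of _ "min t (t - b)"]) auto
  next
    assume "\<exists>d>0. d \<le> t \<and> (\<forall>u. t - d < u \<and> u < t \<longrightarrow> dE (x u) l < e)"
    then obtain d where "d > 0" "d \<le> t" "\<forall>u. t - d < u \<and> u < t \<longrightarrow> dE (x u) l < e" by blast
    thus "\<forall>\<^sub>F u in at_left t. x u \<in> \<Omega> \<and> dE (x u) l < e"
      unfolding eventually_at_left[OF t] using x by (intro exI[of _ "t - d"]) auto
  qed
  thus ?thesis using t
    by (simp add: has_left_limit_def left_lim_def limitin_E ennreal_eq_0_iff)
qed

lemma right_cts_iff:
  assumes t: "0 \<le> t" and x: "\<forall>s\<ge>0. x s \<in> \<Omega>"
  shows "limitin E x (x t) (at_right t) \<longleftrightarrow> right_cts x t"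
proof -
  have "(\<forall>\<^sub>F u in at_right t. x u \<in> \<Omega> \<and> dE (x u) (x t) < e) \<longleftrightarrow>
      (\<exists>d>0. \<forall>u. t \<le> u \<and> u < t + d \<longrightarrow> dE (x u) (x t) < e)" if "e > 0" for e
  proof
    assume "\<forall>\<^sub>F u in at_right t. x u \<in> \<Omega> \<and> dE (x u) (x t) < e"
    then obtain b where b: "b > t" "\<And>u. t < u \<Longrightarrow> u < b \<Longrightarrow> dE (x u) (x t) < e"
      unfolding eventually_at_right[of t "t + 1", simplified] by auto
    have "dE (x t) (x t) < e" using x t that by simp
    hence "dE (x u) (x t) < e" if "t \<le> u" "u < b" for u using b that by (cases "u = t") auto
    thus "\<exists>d>0. \<forall>u. t \<le> u \<and> u < t + d \<longrightarrow> dE (x u) (x t) < e"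
      using b(1) by (intro exI[of _ "b - t"]) auto
  next
    assume "\<exists>d>0. \<forall>u. t \<le> u \<and> u < t + d \<longrightarrow> dE (x u) (x t) < e"
    then obtain d where "d > 0" "\<forall>u. t \<le> u \<and> u < t + d \<longrightarrow> dE (x u) (x t) < e" by blast
    thus "\<forall>\<^sub>F u in at_right t. x u \<in> \<Omega> \<and> dE (x u) (x t) < e"
      unfolding eventually_at_right[of t "t + 1", simplified] using x t by (intro exI[of _ "t + d"]) auto
  qed
  thus ?thesis using t x by (simp add: right_cts_def limitin_E)
qed

lemma D_exp_iff:
  "x \<in> D_exp X \<longleftrightarrow> x \<in> {0..} \<rightarrow>\<^sub>E \<Omega> \<and> (\<forall>t\<ge>0. x t = None \<longleftrightarrow> lifetime x \<le> ennreal t) \<and>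
     (\<forall>t\<ge>0. right_cts x t) \<and>
     (\<forall>t>0. ennreal t < lifetime x \<longrightarrow> (\<exists>p\<in>topspace X. left_lim x t (Some p)))"
proof (cases "x \<in> {0..} \<rightarrow>\<^sub>E \<Omega>")
  case True
  hence x: "\<forall>s\<ge>0. x s \<in> \<Omega>" by auto
  have "right_cts x t" if none: "\<forall>t\<ge>0. x t = None \<longleftrightarrow> lifetime x \<le> ennreal t"
    and t: "t \<ge> 0" "\<not> ennreal t < lifetime x" for t
  proof -
    have "x u = None" if "t \<le> u" for u
      using none t that by (meson ennreal_leI not_le order_trans)
    thus ?thesis by (auto simp: right_cts_def intro!: exI[of _ 1])
  qed
  thus ?thesis using True
    by (auto simp: D_exp_def has_left_limit_iff[OF _ x] right_cts_iff[OF _ x] topspace_E[unfolded topspace_Alexandroff_compactification])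
qed (auto simp: D_exp_def topspace_E[unfolded topspace_Alexandroff_compactification])

lemma D_expD:
  assumes "x \<in> D_exp X"
  shows "0 \<le> t \<Longrightarrow> x t \<in> \<Omega>" "0 \<le> t \<Longrightarrow> x t = None \<longleftrightarrow> lifetime x \<le> ennreal t"
    "0 \<le> t \<Longrightarrow> right_cts x t"
    "0 < t \<Longrightarrow> ennreal t < lifetime x \<Longrightarrow> \<exists>p\<in>topspace X. left_lim x t (Some p)"
  using assms unfolding D_exp_iff by auto

lemma D_loc_D_exp: "x \<in> D_loc X \<Longrightarrow> x \<in> D_exp X" by (simp add: D_loc_def)

text \<open>Bisection reduces the claim to a neighbourhood of one time \<open>t\<close>:
  right-continuity gives small oscillation on the right of \<open>t\<close>, the left limit on its
  left, and partitions can be concatenated.\<close>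

lemma cadlag_partition:
  assumes c: "cadlag_upto x T" and e: "0 < e"
  shows "\<exists>m (s :: nat \<Rightarrow> real). s 0 = 0 \<and> s m = T \<and> (\<forall>j<m. s j < s (Suc j)) \<and>
    (\<forall>j<m. \<forall>u v. s j \<le> u \<and> u < s (Suc j) \<and> s j \<le> v \<and> v < s (Suc j) \<longrightarrow> dE (x u) (x v) < e)"
proof -
  define P where "P a b \<longleftrightarrow> (0 \<le> a \<and> b \<le> T \<longrightarrow> (\<exists>m (s :: nat \<Rightarrow> real). s 0 = a \<and> s m = b \<and> (\<forall>j<m. s j < s (Suc j)) \<and>
    (\<forall>j<m. \<forall>u v. s j \<le> u \<and> u < s (Suc j) \<and> s j \<le> v \<and> v < s (Suc j) \<longrightarrow> dE (x u) (x v) < e)))" for a b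
  have x\<Omega>: "\<And>s. 0 \<le> s \<Longrightarrow> x s \<in> \<Omega>" and T: "0 \<le> T" using c by (auto simp: cadlag_upto_def)
  have single: "P a b" if "a \<le> b" "\<And>u v. a \<le> u \<Longrightarrow> u < b \<Longrightarrow> a \<le> v \<Longrightarrow> v < b \<Longrightarrow> dE (x u) (x v) < e" for a b
  proof (cases "a = b")
    case True
    thus ?thesis unfolding P_def by (intro impI exI[of _ 0] exI[of _ "\<lambda>_. a"]) auto
  next
    case False
    thus ?thesis unfolding P_def using that
      by (intro impI exI[of _ 1] exI[of _ "\<lambda>j. if j = 0 then a else b"]) auto
  qed
  have trans: "P a b" if ab: "P a b'" "P b' b" "a \<le> b'" "b' \<le> b" for a b' b
    unfolding P_def
  proof
    assume "0 \<le> a \<and> b \<le> T"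
    then obtain m1 s1 m2 s2 where 1: "s1 0 = a" "s1 m1 = b'" "\<forall>j<m1. s1 j < s1 (Suc j)"
       "\<forall>j<m1. \<forall>u v. s1 j \<le> u \<and> u < s1 (Suc j) \<and> s1 j \<le> v \<and> v < s1 (Suc j) \<longrightarrow> dE (x u) (x v) < e"
      and 2: "s2 0 = b'" "s2 m2 = b" "\<forall>j<m2. s2 j < s2 (Suc j)"
       "\<forall>j<m2. \<forall>u v. s2 j \<le> u \<and> u < s2 (Suc j) \<and> s2 j \<le> v \<and> v < s2 (Suc j) \<longrightarrow> dE (x u) (x v) < e"
      using ab unfolding P_def by (smt (verit))
    define s where "s j = (if j < m1 then s1 j else s2 (j - m1))" for j
    have s1: "s j = s1 j" if "j \<le> m1" for j using that 1(2) 2(1) by (auto simp: s_def)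
    have s2: "s (m1 + j) = s2 j" for j by (simp add: s_def)
    have *: "j < m1 + m2 \<Longrightarrow> (j < m1 \<and> s j = s1 j \<and> s (Suc j) = s1 (Suc j)) \<or>
        (\<exists>i<m2. s j = s2 i \<and> s (Suc j) = s2 (Suc i))" for j
      using s1[of j] s1[of "Suc j"] s2[of "j - m1"] s2[of "Suc j - m1"]
      by (cases "j < m1") (auto intro!: exI[of _ "j - m1"] simp: Suc_diff_le)
    show "\<exists>m s. s 0 = a \<and> s m = b \<and> (\<forall>j<m. s j < s (Suc j)) \<and>
      (\<forall>j<m. \<forall>u v. s j \<le> u \<and> u < s (Suc j) \<and> s j \<le> v \<and> v < s (Suc j) \<longrightarrow> dE (x u) (x v) < e)"
    proof (intro exI[of _ "m1 + m2"] exI[of _ s] conjI allI impI)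
      show "s 0 = a" using s1[of 0] 1 by simp
      show "s (m1 + m2) = b" using s2 2 by simp
      fix j assume j: "j < m1 + m2"
      show "s j < s (Suc j)" using *[OF j] 1(3) 2(3) by auto
      fix u v assume "s j \<le> u \<and> u < s (Suc j) \<and> s j \<le> v \<and> v < s (Suc j)"
      thus "dE (x u) (x v) < e" using *[OF j] 1(4) 2(4) by auto
    qed
  qed
  have "P 0 T"
  proof (rule Bolzano[OF T])
    show "P a b \<Longrightarrow> P b c \<Longrightarrow> a \<le> b \<Longrightarrow> b \<le> c \<Longrightarrow> P a c" for a b c by (rule trans)
    fix t assume t: "0 \<le> t" "t \<le> T"
    obtain d1 where d1: "d1 > 0" "\<And>u. t \<le> u \<Longrightarrow> u < t + d1 \<Longrightarrow> dE (x u) (x t) < e / 2"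
      using c t e unfolding cadlag_upto_def right_cts_def by (meson half_gt_zero)
    have "\<exists>d2>0. \<exists>l\<in>\<Omega>. \<forall>u. 0 \<le> u \<and> t - d2 < u \<and> u < t \<longrightarrow> dE (x u) l < e / 2"
    proof (cases "t = 0")
      case True
      thus ?thesis by (intro exI[of _ 1] conjI bexI[of _ None]) auto
    next
      case False
      then obtain l where "left_lim x t l" using c t unfolding cadlag_upto_def by force
      thus ?thesis using e unfolding left_lim_def by (meson half_gt_zero)
    qed
    then obtain d2 l where d2: "d2 > 0" "l \<in> \<Omega>" "\<And>u. 0 \<le> u \<Longrightarrow> t - d2 < u \<Longrightarrow> u < t \<Longrightarrow> dE (x u) l < e / 2"
      by blast
    have close: "dE y z < e" if "y \<in> \<Omega>" "z \<in> \<Omega>" "w \<in> \<Omega>" "dE y w < e / 2" "dE z w < e / 2" for y z w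
      using E.triangle[of y w z] that E.commute[of z w] by simp
    show "\<exists>d>0. \<forall>a b. a \<le> t \<and> t \<le> b \<and> b - a < d \<longrightarrow> P a b"
    proof (intro exI[of _ "min d1 d2"] conjI allI impI)
      fix a b assume ab: "a \<le> t \<and> t \<le> b \<and> b - a < min d1 d2"
      show "P a b"
      proof (cases "0 \<le> a")
        case True
        have "P a t"
        proof (rule single)
          fix u v assume uv: "a \<le> u" "u < t" "a \<le> v" "v < t"
          show "dE (x u) (x v) < e"
            by (rule close[of _ _ l]) (use uv True ab d2 x\<Omega> in auto)
        qed (use ab in auto)
        moreover have "P t b"
        proof (rule single)
          fix u v assume uv: "t \<le> u" "u < b" "t \<le> v" "v < b"
          show "dE (x u) (x v) < e"
            by (rule close[of _ _ "x t"]) (use uv True ab d1 x\<Omega> t in auto)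
        qed (use ab in auto)
        ultimately show ?thesis using trans ab by blast
      qed (simp add: P_def)
    qed (use d1 d2 in auto)
  qed
  thus ?thesis using T unfolding P_def by auto
qed

text \<open>The horizons up to which local convergence controls a path: every time before the
  lifetime, and the lifetime itself if the path is killed from inside a compact set, where, if the
  lifetime is positive, \<open>D_loc\<close> provides the left limit.\<close>

definition adm :: "'a path \<Rightarrow> real \<Rightarrow> bool" where
  "adm x T \<longleftrightarrow> 0 \<le> T \<and> (ennreal T < lifetime x \<or> lifetime x = ennreal T \<and> relatively_compact_path X x)"

lemma dE_None_pos: "z \<in> \<Omega> \<Longrightarrow> z \<noteq> None \<Longrightarrow> 0 < dE z None"
  by simp

text \<open>Bisection again, with a positive value at \<open>t\<close> for the right side and a left
  limit of positive value for the left side. The function \<open>f\<close> will be the distance to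
  \<open>None\<close> or the distance to the complement of \<open>U\<close>.\<close>

lemma bounded_below_upto:
  fixes f :: "'a option \<Rightarrow> real"
  assumes x: "\<And>t. 0 \<le> t \<Longrightarrow> x t \<in> \<Omega>" "\<And>t. 0 \<le> t \<Longrightarrow> t \<le> T \<Longrightarrow> right_cts x t" and T: "0 \<le> T"
    and f: "\<And>y z. y \<in> \<Omega> \<Longrightarrow> z \<in> \<Omega> \<Longrightarrow> f y \<le> f z + dE y z"
    and pos: "\<And>t. 0 \<le> t \<Longrightarrow> t \<le> T \<Longrightarrow> 0 < f (x t)"
    and left: "\<And>t. 0 < t \<Longrightarrow> t \<le> T \<Longrightarrow> \<exists>p. left_lim x t p \<and> 0 < f p"
  shows "\<exists>c>0. \<forall>s. 0 \<le> s \<and> s \<le> T \<longrightarrow> c \<le> f (x s)"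
proof -
  define P where "P a b \<longleftrightarrow> (\<exists>c>0. \<forall>s. 0 \<le> s \<and> a \<le> s \<and> s \<le> b \<longrightarrow> c \<le> f (x s))" for a b
  have "P 0 T"
  proof (rule Bolzano[OF T])
    fix a b c assume "P a b" "P b c"
    then obtain c1 c2 where c1: "c1 > 0" "\<And>s. 0 \<le> s \<Longrightarrow> a \<le> s \<Longrightarrow> s \<le> b \<Longrightarrow> c1 \<le> f (x s)"
      and c2: "c2 > 0" "\<And>s. 0 \<le> s \<Longrightarrow> b \<le> s \<Longrightarrow> s \<le> c \<Longrightarrow> c2 \<le> f (x s)"
      unfolding P_def by auto
    have "min c1 c2 \<le> f (x s)" if "0 \<le> s" "a \<le> s" "s \<le> c" for s
      using c1(2)[of s] c2(2)[of s] that by (cases "s \<le> b") auto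
    thus "P a c" using c1(1) c2(1) unfolding P_def by (intro exI[of _ "min c1 c2"]) auto
  next
    fix t assume t: "0 \<le> t" "t \<le> T"
    define c1 where "c1 = f (x t)"
    have c1: "c1 > 0" unfolding c1_def by (rule pos[OF t])
    obtain d1 where d1: "d1 > 0" "\<And>u. t \<le> u \<Longrightarrow> u < t + d1 \<Longrightarrow> dE (x u) (x t) < c1 / 2"
      using x(2)[OF t] c1 unfolding right_cts_def by (meson half_gt_zero)
    have r: "c1 / 2 \<le> f (x u)" if "t \<le> u" "u < t + d1" for u
      using d1(2)[OF that] f[of "x t" "x u"] E.commute[of "x t" "x u"] x(1) t that
      by (force simp: c1_def)
    have "\<exists>c2>0. \<exists>d2>0. \<forall>u. 0 \<le> u \<and> t - d2 < u \<and> u < t \<longrightarrow> c2 \<le> f (x u)"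
    proof (cases "t = 0")
      case True
      thus ?thesis by (intro exI[of _ 1] conjI exI[of _ "1::real"]) auto
    next
      case False
      then obtain p where p: "left_lim x t p" "0 < f p" using left[of t] t by auto
      then obtain d2 where d2: "d2 > 0" "\<And>u. t - d2 < u \<Longrightarrow> u < t \<Longrightarrow> dE (x u) p < f p / 2"
        unfolding left_lim_def by (meson half_gt_zero)
      have "f p / 2 \<le> f (x u)" if "0 \<le> u" "t - d2 < u" "u < t" for u
        using d2(2)[OF that(2,3)] f[of p "x u"] E.commute[of p "x u"] x(1)[OF that(1)] p
        unfolding left_lim_def by force
      thus ?thesis using p d2(1) by (intro exI[of _ "f p / 2"] conjI exI[of _ d2]) auto
    qed
    then obtain c2 d2 where c2: "c2 > 0" "d2 > 0" "\<And>u. 0 \<le> u \<Longrightarrow> t - d2 < u \<Longrightarrow> u < t \<Longrightarrow> c2 \<le> f (x u)"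
      by blast
    show "\<exists>d>0. \<forall>a b. a \<le> t \<and> t \<le> b \<and> b - a < d \<longrightarrow> P a b"
    proof (intro exI[of _ "min d1 d2"] conjI allI impI)
      fix a b assume ab: "a \<le> t \<and> t \<le> b \<and> b - a < min d1 d2"
      have "min (c1 / 2) c2 \<le> f (x s)" if "0 \<le> s" "a \<le> s" "s \<le> b" for s
        using r[of s] c2(3)[of s] that ab by (cases "t \<le> s") auto
      thus "P a b" using c1 c2(1) unfolding P_def by (intro exI[of _ "min (c1 / 2) c2"]) auto
    qed (use d1 c2 in auto)
  qed
  thus ?thesis unfolding P_def by auto
qed

lemma bounded_below_before:
  fixes f :: "'a option \<Rightarrow> real"
  assumes x: "\<And>t. 0 \<le> t \<Longrightarrow> x t \<in> \<Omega>" and l: "left_lim x r p" "0 < f p"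
    and f: "\<And>y z. y \<in> \<Omega> \<Longrightarrow> z \<in> \<Omega> \<Longrightarrow> f y \<le> f z + dE y z"
    and low: "\<And>s. s < r \<Longrightarrow> \<exists>c>0. \<forall>u. 0 \<le> u \<and> u \<le> s \<longrightarrow> c \<le> f (x u)"
  shows "\<exists>c>0. \<forall>u. 0 \<le> u \<and> u < r \<longrightarrow> c \<le> f (x u)"
proof -
  obtain d where d: "d > 0" "d \<le> r" "\<And>u. r - d < u \<Longrightarrow> u < r \<Longrightarrow> dE (x u) p < f p / 2"
    using l unfolding left_lim_def by (meson half_gt_zero)
  obtain c where c: "c > 0" "\<And>u. 0 \<le> u \<Longrightarrow> u \<le> r - d / 2 \<Longrightarrow> c \<le> f (x u)" using low[of "r - d / 2"] d(1) by auto
  have "min c (f p / 2) \<le> f (x u)" if u: "0 \<le> u" "u < r" for u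
  proof (cases "u \<le> r - d / 2")
    case True
    thus ?thesis using c(2)[of u] u by simp
  next
    case False
    hence "dE (x u) p < f p / 2" using d(1) u by (intro d(3)) auto
    moreover have "f p \<le> f (x u) + dE p (x u)" using f x[OF u(1)] l(1) by (simp add: left_lim_def)
    ultimately have "f p / 2 \<le> f (x u)" using E.commute[of p "x u"] by simp
    thus ?thesis by simp
  qed
  thus ?thesis using c(1) l(2) by (intro exI[of _ "min c (f p / 2)"]) auto
qed

lemma bounded_away:
  assumes x: "x \<in> D_exp X" and T: "0 \<le> T" "ennreal T < lifetime x"
  shows "\<exists>c>0. \<forall>s. 0 \<le> s \<and> s \<le> T \<longrightarrow> c \<le> dE (x s) None"
proof (rule bounded_below_upto[OF _ _ T(1)])
  have tl: "ennreal t < lifetime x" if "t \<le> T" for t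
    using that T by (meson ennreal_leI le_less_trans)
  show "0 < dE (x t) None" if "0 \<le> t" "t \<le> T" for t
    using D_expD(1,2)[OF x that(1)] tl[OF that(2)] by (intro dE_None_pos) auto
  show "\<exists>p. left_lim x t p \<and> 0 < dE p None" if "0 < t" "t \<le> T" for t
    using D_expD(4)[OF x that(1) tl[OF that(2)]] dE_None_pos by (metis Some_in option.distinct(1))
qed (use D_expD[OF x] E.triangle[OF _ _ None_in] in \<open>auto simp: add.commute\<close>)

lemma adm_away:
  assumes x: "x \<in> D_loc X" and T: "adm x T"
  shows "\<exists>c>0. \<forall>s. 0 \<le> s \<and> s < T \<longrightarrow> c \<le> dE (x s) None"
proof (cases "ennreal T < lifetime x")
  case True
  thus ?thesis using bounded_away[OF D_loc_D_exp[OF x], of T] T by (force simp: adm_def)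
next
  case False
  hence T': "0 \<le> T" "lifetime x = ennreal T" "relatively_compact_path X x" using T by (auto simp: adm_def)
  then obtain K where K: "compactin X K" "\<And>s. 0 \<le> s \<Longrightarrow> ennreal s < lifetime x \<Longrightarrow> x s \<in> Some ` K"
    unfolding relatively_compact_path_def by auto
  obtain c where "c > 0" "\<And>p. p \<in> K \<Longrightarrow> c \<le> dE (Some p) None" using compactin_imp_away[OF K(1)] by auto
  thus ?thesis using K(2) T' by (intro exI[of _ c]) (force simp: ennreal_less_iff)
qed

lemma adm_cadlag:
  assumes x: "x \<in> D_loc X" and T: "adm x T"
  shows "cadlag_upto x T" "\<And>t. 0 < t \<Longrightarrow> t \<le> T \<Longrightarrow> \<exists>p\<in>topspace X. left_lim x t (Some p)"
proof -
  note x' = D_loc_D_exp[OF x]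
  have \<Omega>: "\<forall>s\<ge>0. x s \<in> \<Omega>" using D_expD(1)[OF x'] by blast
  show lim: "\<exists>p\<in>topspace X. left_lim x t (Some p)" if t: "0 < t" "t \<le> T" for t
  proof (cases "ennreal t < lifetime x")
    case True
    thus ?thesis using D_expD(4)[OF x'] t by blast
  next
    case False
    moreover have "ennreal t \<le> lifetime x" using T t unfolding adm_def by (metis ennreal_leI less_imp_le order_trans)
    ultimately have lt: "lifetime x = ennreal t" by (metis leI antisym)
    hence "\<not> ennreal T < lifetime x" using t by (simp add: ennreal_less_iff)
    hence "relatively_compact_path X x" using T by (auto simp: adm_def)
    hence "\<exists>l\<in>topspace X. has_left_limit X x (lifetime x) (Some l)"
      using x t lt by (auto simp: D_loc_def)
    thus ?thesis unfolding lt using has_left_limit_iff[OF t(1) \<Omega>] by blast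
  qed
  show "cadlag_upto x T"
    unfolding cadlag_upto_def
  proof (intro conjI allI impI)
    show "\<exists>l. left_lim x t l" if "0 < t \<and> t \<le> T" for t using lim that by blast
  qed (use \<Omega> D_expD(3)[OF x'] T in \<open>auto simp: adm_def\<close>)
qed

lemma relatively_compact_if_away:
  assumes x: "x \<in> D_exp X" and c: "0 < c" "\<And>s. 0 \<le> s \<Longrightarrow> ennreal s < lifetime x \<Longrightarrow> c \<le> dE (x s) None"
  shows "relatively_compact_path X x"
  unfolding relatively_compact_path_def
proof (intro exI[of _ "{p \<in> topspace X. c \<le> dE (Some p) None}"] conjI allI impI)
  show "compactin X {p \<in> topspace X. c \<le> dE (Some p) None}" by (rule compactin_away[OF c(1)])
  fix s :: real assume s: "0 \<le> s" "ennreal s < lifetime x"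
  hence "x s \<noteq> None" "x s \<in> \<Omega>" using D_expD(1,2)[OF x s(1)] by auto
  thus "x s \<in> Some ` {p \<in> topspace X. c \<le> dE (Some p) None}" using c(2)[OF s] by (auto simp: \<Omega>_def)
qed

lemma adm_if_away:
  assumes x: "x \<in> D_exp X" and s: "0 \<le> s" and c: "0 < c" "\<And>u. 0 \<le> u \<Longrightarrow> u < s \<Longrightarrow> c \<le> dE (x u) None"
  shows "adm x s"
proof -
  have "ennreal s \<le> lifetime x" unfolding lifetime_def
  proof (rule Inf_greatest, clarify)
    fix t assume "0 \<le> t" "x t = None"
    hence "\<not> t < s" using c(2)[of t] c(1) by auto
    thus "ennreal s \<le> ennreal t" by (intro ennreal_leI) simp
  qed
  moreover have "relatively_compact_path X x" if "lifetime x = ennreal s"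
    by (rule relatively_compact_if_away[OF x c(1)]) (use c(2) in \<open>auto simp: that ennreal_less_iff\<close>)
  ultimately show ?thesis unfolding adm_def using s by (auto simp: less_le)
qed

text \<open>A path with finite lifetime that is not relatively compact comes arbitrarily close to
  \<open>None\<close> before it is killed; a relatively compact one is \<open>None\<close> at its
  lifetime, which is then admissible.\<close>

lemma adm_exhaust:
  assumes x: "x \<in> D_loc X" and c: "0 < c"
  shows "\<exists>T. adm x T \<and> (N \<le> T \<or> dE (x T) None < c)"
proof (cases "lifetime x = \<infinity>")
  case True
  thus ?thesis by (intro exI[of _ "max 0 N"]) (auto simp: adm_def)
next
  case False
  then obtain r where r: "lifetime x = ennreal r" "r \<ge> 0" by (cases "lifetime x") auto
  show ?thesis
  proof (cases "relatively_compact_path X x")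
    case True
    have "x r = None" using D_expD(2)[OF D_loc_D_exp[OF x]] r by simp
    thus ?thesis using True r c by (intro exI[of _ r]) (auto simp: adm_def)
  next
    case False
    then obtain s where "0 \<le> s" "ennreal s < lifetime x" "\<not> c \<le> dE (x s) None"
      using relatively_compact_if_away[OF D_loc_D_exp[OF x] c] by blast
    thus ?thesis by (intro exI[of _ s]) (auto simp: adm_def)
  qed
qed

text \<open>Slopes close to one keep the time shift small, and since \<open>x\<close> stays in a
  compact set before \<open>T1\<close>, uniform closeness for the metric of \<open>X\<close> there
  implies closeness for that of the compactification.\<close>

lemma local_conv_matched:
  assumes conv: "local_skorokhod_conv X xk x" and x: "x \<in> D_loc X" and xk: "\<And>k. xk k \<in> D_loc X"
    and T: "adm x T" and d: "0 < d"
  shows "\<forall>\<^sub>F k in sequentially. matched d T x (xk k)"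
proof -
  note x' = D_loc_D_exp[OF x] and xk' = D_loc_D_exp[OF xk]
  define b where "b \<longleftrightarrow> lifetime x < \<infinity> \<and> relatively_compact_path X x"
  \<comment> \<open>The horizon used by the definition of local convergence: the lifetime when the
    path is killed from inside a compact set, an alive time otherwise.\<close>
  define T1 where "T1 = (if b then enn2real (lifetime x) else T)"
  have T0: "0 \<le> T" using T by (simp add: adm_def)
  have bl: "lifetime x = ennreal T1" "0 \<le> T1" if b using that by (auto simp: b_def T1_def)
  have TT1: "T \<le> T1"
  proof (cases b)
    case True
    have "ennreal T \<le> ennreal T1" using T bl(1)[OF True] unfolding adm_def by (metis less_imp_le order_refl)
    thus ?thesis using bl(2)[OF True] by simp
  qed (simp add: T1_def)
  have nb: "ennreal T < lifetime x" if "\<not> b"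
    using T that by (auto simp: adm_def b_def)
  obtain l where l: "\<And>k. l k \<in> bilipschitz_time_changes"
    and c1: "b \<Longrightarrow> (\<forall>\<^sub>F k in sequentially. ennreal (l k T1) \<le> lifetime (xk k)) \<and>
          (\<lambda>k. SUP s\<in>{0..<T1}. ennreal (dX (the (x s)) (the (xk k (l k s))))) \<longlonglongrightarrow> 0 \<and>
          limitin E (\<lambda>k. xk k (l k T1)) None sequentially \<and>
          (\<lambda>k. log_deriv_norm (l k) T1) \<longlonglongrightarrow> 0"
    and c2: "\<not> b \<Longrightarrow> (\<forall>t\<ge>0. ennreal t < lifetime x \<longrightarrow>
          (\<forall>\<^sub>F k in sequentially. ennreal (l k t) < lifetime (xk k)) \<and>
          (\<lambda>k. SUP s\<in>{0..t}. ennreal (dX (the (x s)) (the (xk k (l k s))))) \<longlonglongrightarrow> 0 \<and>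
          (\<lambda>k. log_deriv_norm (l k) t) \<longlonglongrightarrow> 0)"
    using conv unfolding local_skorokhod_conv_def Let_def dX_def[symmetric] b_def[symmetric] T1_def
    by (cases b) auto
  have h: "time_homeo (l k)" for k using bilipschitz_imp_time_homeo[OF l] .
  have norm: "(\<lambda>k. log_deriv_norm (l k) T1) \<longlonglongrightarrow> 0"
    using c1 c2 nb T0 by (cases b) (auto simp: T1_def)
  obtain c where c: "c > 0" "\<And>s. 0 \<le> s \<Longrightarrow> s < T1 \<or> \<not> b \<and> s \<le> T1 \<Longrightarrow> c \<le> dE (x s) None"
  proof (cases b)
    case True
    have "adm x T1" using True bl[OF True] by (auto simp: adm_def b_def)
    thus ?thesis using adm_away[OF x] that True by blast
  next
    case False
    obtain c where "c > 0" "\<And>s. 0 \<le> s \<Longrightarrow> s \<le> T \<Longrightarrow> c \<le> dE (x s) None"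
      using bounded_away[OF x' T0 nb[OF False]] by auto
    thus ?thesis using False by (intro that[of c]) (auto simp: T1_def)
  qed
  define K where "K = {p \<in> topspace X. c \<le> dE (Some p) None}"
  have K: "compactin X K" unfolding K_def by (rule compactin_away[OF c(1)])
  obtain r where r: "r > 0" "\<And>p q. p \<in> K \<Longrightarrow> q \<in> topspace X \<Longrightarrow> dX p q < r \<Longrightarrow> dE (Some p) (Some q) < d"
    using dX_imp_dE_uniform[OF K d] by blast
  define I where "I = (if b then {0..<T1} else {0..T1})"
  have I: "s \<in> I \<longleftrightarrow> 0 \<le> s \<and> (s < T1 \<or> \<not> b \<and> s \<le> T1)" for s by (auto simp: I_def)
  have sup: "(\<lambda>k. SUP s\<in>I. ennreal (dX (the (x s)) (the (xk k (l k s))))) \<longlonglongrightarrow> 0"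
    using c1 c2 nb T0 by (cases b) (auto simp: I_def T1_def)
  have alive: "\<forall>\<^sub>F k in sequentially. \<forall>s\<in>I. ennreal (l k s) < lifetime (xk k)"
  proof (cases b)
    case True
    have "\<forall>\<^sub>F k in sequentially. ennreal (l k T1) \<le> lifetime (xk k)" using c1[OF True] by blast
    thus ?thesis
    proof eventually_elim
      case (elim k)
      show ?case
      proof
        fix s assume "s \<in> I"
        hence "0 \<le> s" "s < T1" using True by (auto simp: I)
        hence "l k s < l k T1" "0 \<le> l k s" using time_homeoD[OF h] by auto
        thus "ennreal (l k s) < lifetime (xk k)" using elim by (meson ennreal_lessI less_le_trans le_less_trans)
      qed
    qed
  next
    case False
    hence "\<forall>\<^sub>F k in sequentially. ennreal (l k T) < lifetime (xk k)" using c2[OF False] nb[OF False] T0 by blast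
    thus ?thesis
    proof eventually_elim
      case (elim k)
      show ?case
      proof
        fix s assume "s \<in> I"
        hence "0 \<le> s" "s \<le> T" using False by (auto simp: I T1_def)
        hence "l k s \<le> l k T" using time_homeoD(4)[OF h] T0 by auto
        thus "ennreal (l k s) < lifetime (xk k)" using elim by (meson ennreal_leI le_less_trans)
      qed
    qed
  qed
  have kill: "\<forall>\<^sub>F k in sequentially. b \<longrightarrow> dE (xk k (l k T1)) None < d"
  proof (cases b)
    case True
    hence "\<forall>\<^sub>F k in sequentially. xk k (l k T1) \<in> \<Omega> \<and> dE (xk k (l k T1)) None < d"
      using c1 d unfolding limitin_E by blast
    thus ?thesis by eventually_elim simp
  qed simp
  \<comment> \<open>Chosen so that \<open>(exp \<eta> - 1) * (T1 + 1) = d\<close>; the summand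
    \<open>1\<close> avoids a division by zero when \<open>T1 = 0\<close>.\<close>
  define \<eta> where "\<eta> = ln (1 + d / (T1 + 1))"
  have T10: "0 \<le> T1" using T0 TT1 by simp
  have \<eta>: "0 < \<eta>" "exp \<eta> = 1 + d / (T1 + 1)" using d T10 by (auto simp: \<eta>_def ln_gt_zero_iff add_pos_pos)
  have "\<forall>\<^sub>F k in sequentially. log_deriv_norm (l k) T1 < ennreal \<eta>"
    using norm \<eta>(1) by (intro order_tendstoD(2)) auto
  moreover have "\<forall>\<^sub>F k in sequentially. (SUP s\<in>I. ennreal (dX (the (x s)) (the (xk k (l k s))))) < ennreal r"
    using sup r(1) by (intro order_tendstoD(2)) auto
  ultimately show ?thesis using alive kill
  proof eventually_elim
    case (elim k)
    have time: "\<bar>l k s - s\<bar> \<le> d" if s: "0 \<le> s" "s \<le> T1" for s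
    proof -
      have "exp (- \<eta>) * s \<le> l k s" "l k s \<le> exp \<eta> * s"
        using log_deriv_norm_le_imp_bounds[OF l, of k T1 \<eta> s] elim(1) \<eta> s by auto
      moreover have "1 - exp (- \<eta>) \<le> exp \<eta> - 1"
        using exp_ge_add_one_self[of "- \<eta>"] exp_ge_add_one_self[of \<eta>] by linarith
      hence "(1 - exp (- \<eta>)) * s \<le> (exp \<eta> - 1) * s" using s by (simp add: mult_right_mono)
      moreover have "(exp \<eta> - 1) * s \<le> (exp \<eta> - 1) * (T1 + 1)" using s \<eta>(1) by (intro mult_left_mono) auto
      moreover have "(exp \<eta> - 1) * (T1 + 1) = d" using \<eta> T10 by simp
      ultimately show ?thesis by (simp add: abs_le_iff algebra_simps)
    qed
    have dist: "dE (x s) (xk k (l k s)) \<le> d" if s: "0 \<le> s" "s \<le> T" for s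
    proof (cases "s \<in> I")
      case True
      have ls: "0 \<le> l k s" using time_homeoD(1)[OF h s(1)] .
      have "ennreal (dX (the (x s)) (the (xk k (l k s)))) < ennreal r"
        using elim(2) SUP_upper[OF True, of "\<lambda>s. ennreal (dX (the (x s)) (the (xk k (l k s))))"] by (rule le_less_trans[rotated])
      hence dr: "dX (the (x s)) (the (xk k (l k s))) < r" using r(1) by (simp add: ennreal_less_iff)
      have "c \<le> dE (x s) None" using c(2)[OF s(1)] True by (simp add: I)
      hence "x s \<noteq> None" using c(1) by (cases "x s") auto
      then obtain p where p1: "x s = Some p" by auto
      have p: "x s = Some p" "p \<in> K"
        using p1 \<open>c \<le> dE (x s) None\<close> D_expD(1)[OF x' s(1)] by (auto simp: K_def)
      have "xk k (l k s) \<noteq> None" using elim(3) True D_expD(2)[OF xk' ls] by auto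
      then obtain q where q1: "xk k (l k s) = Some q" by auto
      have q: "xk k (l k s) = Some q" "q \<in> topspace X" using q1 D_expD(1)[OF xk'[of k] ls] by auto
      show ?thesis using r(2)[OF p(2) q(2)] dr p(1) q(1) by simp
    next
      case False
      \<comment> \<open>The remaining time is the lifetime itself: \<open>x\<close> is
        \<open>None\<close> there, and local convergence demands that \<open>xk k (l k T1)\<close>
        approach \<open>None\<close>.\<close>
      hence "b" "s = T1" using s TT1 by (auto simp: I)
      moreover have "x T1 = None" using D_expD(2)[OF x' T10] bl(1)[OF \<open>b\<close>] by simp
      ultimately show ?thesis using elim(4) E.commute[of None "xk k (l k T1)"] by simp
    qed
    show ?case unfolding matched_def using h time dist TT1 by (intro exI[of _ "l k"]) auto
  qed
qed

lemma local_conv_imp_Mconv: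
  assumes "local_skorokhod_conv X xk x" "x \<in> D_loc X" "\<And>k. xk k \<in> D_loc X"
  shows "Mconv xk x"
  unfolding Mconv_def
proof (intro allI impI)
  fix c N d :: real assume "c > 0" "d > 0"
  then obtain T where T: "adm x T" "N \<le> T \<or> dE (x T) None < c" using adm_exhaust[OF assms(2)] by blast
  thus "\<exists>T. cadlag_upto x T \<and> (N \<le> T \<or> dE (x T) None < c) \<and> (\<forall>\<^sub>F k in sequentially. matched d T x (xk k))"
    using adm_cadlag(1)[OF assms(2)] local_conv_matched[OF assms _ \<open>d > 0\<close>] by blast
qed

end

section \<open>A countable family of functions generating the local Skorokhod topology\<close>

context lc_space begin

text \<open>
  A template \<open>(W, c, ys, e)\<close> describes a step path with values \<open>snd ` set ys\<close>, whose \<open>j\<close>-th step ends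
  near the time \<open>fst (ys ! j)\<close>, and which then jumps to \<open>e\<close>; \<open>W\<close> weighs the errors in time, and a
  path fitting the template is at distance about \<open>c\<close> from \<open>None\<close> until then.
\<close>

type_synonym template = "nat \<times> rat \<times> (rat \<times> nat) list \<times> nat"

definition fits :: "template \<Rightarrow> real \<Rightarrow> 'a path \<Rightarrow> (nat \<Rightarrow> real) \<Rightarrow> bool" where
  "fits y r x s = (case y of (W, c, ys, e) \<Rightarrow> s 0 = 0 \<and>
    (\<forall>j<length ys. s j \<le> s (Suc j) \<and> (real W + 1) * \<bar>s (Suc j) - of_rat (fst (ys ! j))\<bar> < r \<and>
       (\<forall>u. s j \<le> u \<and> u < s (Suc j) \<longrightarrow> dE (x u) (den (snd (ys ! j))) < r \<and> of_rat c - r < dE (x u) None)) \<and>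
    dE (x (s (length ys))) (den e) < r)"

text \<open>For positive \<open>c\<close> the value \<open>c / 2\<close> is at once the default when
  nothing fits and a cap. A fit with \<open>r < c / 2\<close> stays at distance more than
  \<open>c / 2\<close> from \<open>None\<close> up to its last step, so it cannot extend beyond a
  time at which the path comes close to \<open>None\<close>; this is what makes misfits continuous
  without any control after killing.\<close>

definition misfit :: "template \<Rightarrow> 'a path \<Rightarrow> real" where
  "misfit y x = Inf (insert (max 0 (of_rat (fst (snd y)) / 2)) {r. 0 < r \<and> (\<exists>s. fits y r x s)})"

lemma misfit_bounds: "0 \<le> misfit y x" "misfit y x \<le> max 0 (of_rat (fst (snd y)) / 2)"
  unfolding misfit_def
  by (rule cInf_greatest, auto) (rule cInf_lower, auto intro!: bdd_belowI[of _ 0])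

lemma misfit_le: "0 < r \<Longrightarrow> fits y r x s \<Longrightarrow> misfit y x \<le> r"
  unfolding misfit_def by (rule cInf_lower) (auto intro!: bdd_belowI[of _ 0])

lemma misfit_lessD:
  assumes "misfit y x < b" "b \<le> of_rat (fst (snd y)) / 2"
  shows "\<exists>r s. 0 < r \<and> r < b \<and> fits y r x s"
proof -
  obtain r where "r \<in> insert (max 0 (of_rat (fst (snd y)) / 2)) {r. 0 < r \<and> (\<exists>s. fits y r x s)}" "r < b"
    using cInf_lessD[OF _ assms(1)[unfolded misfit_def]] by blast
  thus ?thesis using assms(2) by auto
qed

lemma fits_times:
  assumes "fits (W, c, ys, e) r x s"
  shows "j \<le> i \<Longrightarrow> i \<le> length ys \<Longrightarrow> s j \<le> s i" "j \<le> length ys \<Longrightarrow> 0 \<le> s j"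
    "0 \<le> u \<Longrightarrow> u < s (length ys) \<Longrightarrow> of_rat c - r < dE (x u) None"
proof -
  have st: "s j \<le> s (Suc j)" if "j < length ys" for j using assms that by (auto simp: fits_def)
  show le: "j \<le> i \<Longrightarrow> i \<le> length ys \<Longrightarrow> s j \<le> s i" for j i
  proof (induction i rule: dec_induct)
    case (step n)
    thus ?case using st[of n] by auto
  qed simp
  have s0: "s 0 = 0" using assms by (auto simp: fits_def)
  show "j \<le> length ys \<Longrightarrow> 0 \<le> s j" using le[of 0 j] s0 by simp
  show "of_rat c - r < dE (x u) None" if u: "0 \<le> u" "u < s (length ys)"
  proof -
    have ex: "u < s (length ys)" by fact
    define j where "j = (LEAST j. u < s j)"
    have j: "u < s j" "j \<le> length ys" unfolding j_def using ex by (auto intro: LeastI Least_le)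
    then obtain i where i: "j = Suc i" using s0 u by (cases j) auto
    have "\<not> u < s i" using not_less_Least[of i "\<lambda>j. u < s j"] i unfolding j_def by simp
    thus ?thesis using assms j i by (auto simp: fits_def not_less Suc_le_eq dest!: spec[of _ i])
  qed
qed

text \<open>The times of a fit are carried along by \<open>l\<close>. A time error \<open>d\<close>
  counts with the weight \<open>real W + 1\<close>, which also covers the error \<open>d\<close> in
  the values.\<close>

lemma matched_fits:
  assumes l: "time_homeo l" "\<And>s. 0 \<le> s \<Longrightarrow> s \<le> T \<Longrightarrow> \<bar>l s - s\<bar> \<le> d"
    "\<And>s. 0 \<le> s \<Longrightarrow> s \<le> T \<Longrightarrow> dE (x s) (x' (l s)) \<le> d"
    and f: "fits (W, c, ys, e) r x s" and T: "s (length ys) \<le> T"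
    and \<Omega>: "\<And>s. 0 \<le> s \<Longrightarrow> x s \<in> \<Omega>" "\<And>s. 0 \<le> s \<Longrightarrow> x' s \<in> \<Omega>"
  shows "fits (W, c, ys, e) (r + (real W + 1) * d) x' (l \<circ> s)"
proof -
  note H = time_homeoD[OF l(1)] and ft = fits_times[OF f]
  have sT: "s j \<le> T" if "j \<le> length ys" for j using ft(1)[OF that] T by auto
  have d0: "0 \<le> d" using l(2)[of 0] ft(2)[of 0] sT[of 0] by simp
  hence dW: "d \<le> (real W + 1) * d" by (simp add: mult_le_cancel_right1 algebra_simps)
  have tri: "dE (x' (l u)) z \<le> dE (x u) z + d" "dE (x u) z \<le> dE (x' (l u)) z + d" if "0 \<le> u" "u \<le> T" "z \<in> \<Omega>" for u z
    using E.triangle[of "x' (l u)" "x u" z] E.triangle[of "x u" "x' (l u)" z] E.commute[of "x u" "x' (l u)"]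
      l(3)[OF that(1,2)] \<Omega>(1)[OF that(1)] \<Omega>(2)[OF H(1)[OF that(1)]] that(3) by auto
  have main: "l (s j) \<le> l (s (Suc j)) \<and> (real W + 1) * \<bar>l (s (Suc j)) - of_rat (fst (ys ! j))\<bar> < r + (real W + 1) * d \<and>
       (\<forall>u. l (s j) \<le> u \<and> u < l (s (Suc j)) \<longrightarrow>
         dE (x' u) (den (snd (ys ! j))) < r + (real W + 1) * d \<and> of_rat c - (r + (real W + 1) * d) < dE (x' u) None)"
    if j: "j < length ys" for j
  proof (intro conjI allI impI)
    have s0: "0 \<le> s j" "0 \<le> s (Suc j)" "s j \<le> s (Suc j)" "s (Suc j) \<le> T" using ft j sT by auto
    thus "l (s j) \<le> l (s (Suc j))" using H(4) by auto
    have "(real W + 1) * \<bar>l (s (Suc j)) - of_rat (fst (ys ! j))\<bar>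
        \<le> (real W + 1) * (\<bar>s (Suc j) - of_rat (fst (ys ! j))\<bar> + d)"
      using l(2)[OF s0(2,4)] by (intro mult_left_mono) auto
    also have "\<dots> < r + (real W + 1) * d"
      using f j by (auto simp: fits_def distrib_left)
    finally show "(real W + 1) * \<bar>l (s (Suc j)) - of_rat (fst (ys ! j))\<bar> < r + (real W + 1) * d" .
    fix v assume v: "l (s j) \<le> v \<and> v < l (s (Suc j))"
    hence "0 \<le> v" using H(1)[OF s0(1)] by simp
    then obtain u where u: "0 \<le> u" "l u = v" using H(5) by blast
    hence us: "s j \<le> u" "u < s (Suc j)" using v H(3,4) s0 by auto
    hence uT: "u \<le> T" using s0 by simp
    have "dE (x u) (den (snd (ys ! j))) < r" "of_rat c - r < dE (x u) None"
      using f j us by (auto simp: fits_def)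
    thus "dE (x' v) (den (snd (ys ! j))) < r + (real W + 1) * d"
      "of_rat c - (r + (real W + 1) * d) < dE (x' v) None"
      using tri[OF u(1) uT den(1), of "snd (ys ! j)"] tri[OF u(1) uT None_in] u(2) dW by auto
  qed
  have "dE (x (s (length ys))) (den e) < r" using f by (auto simp: fits_def)
  hence "dE (x' (l (s (length ys)))) (den e) < r + (real W + 1) * d"
    using tri(1)[OF ft(2)[OF order_refl] T den(1), of e] dW by auto
  moreover have "l (s 0) = 0" using f H(2) by (auto simp: fits_def)
  ultimately show ?thesis using main by (auto simp: fits_def)
qed

text \<open>A fit below the cap ends before the horizon of \<open>Mconv\<close>, so its times can be
  carried over by the time change, and the inverse time change carries fits back. Either way the
  error grows by at most the weight times the matching error, hence both inequalities.\<close>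

lemma Mconv_misfit:
  assumes M: "Mconv xk x" and \<Omega>: "\<And>s. 0 \<le> s \<Longrightarrow> x s \<in> \<Omega>" "\<And>k s. 0 \<le> s \<Longrightarrow> xk k s \<in> \<Omega>"
  shows "(\<lambda>k. misfit y (xk k)) \<longlonglongrightarrow> misfit y x"
proof (rule tendstoI)
  fix \<eta> :: real assume \<eta>: "0 < \<eta>"
  obtain W c ys e where y: "y = (W, c, ys, e)" by (cases y)
  define C where "C = (of_rat c :: real)"
  show "\<forall>\<^sub>F k in sequentially. dist (misfit y (xk k)) (misfit y x) < \<eta>"
  proof (cases "C \<le> 0")
    case True
    have "misfit y z = 0" for z
      using misfit_bounds[of y z] True by (auto simp: y C_def)
    thus ?thesis using \<eta> by simp
  next
    case False
    hence C: "C > 0" by simp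
    define Q where "Q = (of_rat (fst (last ys)) :: real)"
    \<comment> \<open>A fit below the cap ends by \<open>N - 1\<close>, since its last time is near
      the rational \<open>Q\<close>; the extra unit absorbs the time shift
      \<open>d \<le> 1/2\<close> when fits of \<open>xk k\<close> are carried back.\<close>
    define N where "N = (if ys = [] then 0 else \<bar>Q\<bar>) + C + 1"
    define d where "d = min (1/2) (min (C / 8) (\<eta> / (4 * (real W + 1))))"
    have W: "real W + 1 > 0" by simp
    have "\<eta> / (4 * (real W + 1)) > 0" using \<eta> by (intro divide_pos_pos mult_pos_pos) auto
    hence d: "d > 0" "d \<le> 1/2" "d \<le> C / 8" "d \<le> \<eta> / (4 * (real W + 1))"
      unfolding d_def using C by linarith+
    have "b * (\<eta> / (4 * b)) = \<eta> / 4" if "b > 0" for b :: real using that by simp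
    hence dW: "(real W + 1) * d \<le> \<eta> / 4"
      using mult_left_mono[OF d(4), of "real W + 1"] W by (metis less_imp_le)
    have last: "s (length ys) \<le> N - 1" if f: "fits (W, c, ys, e) r z s" and r: "r < C / 2" for r z s
    proof (cases ys rule: rev_cases)
      case Nil
      thus ?thesis using f C by (auto simp: fits_def N_def)
    next
      case (snoc ys' q)
      hence "(real W + 1) * \<bar>s (length ys) - Q\<bar> < r"
        using f by (auto simp: fits_def Q_def dest!: spec[of _ "length ys'"])
      moreover have "\<bar>s (length ys) - Q\<bar> \<le> (real W + 1) * \<bar>s (length ys) - Q\<bar>"
        by (simp add: mult_le_cancel_right1)
      moreover have "N = \<bar>Q\<bar> + C + 1" using snoc by (simp add: N_def)
      ultimately show ?thesis using r C by linarith
    qed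
    have upper: "misfit y z' \<le> misfit y z + \<eta> / 2"
      if ex: "\<And>r s. fits (W, c, ys, e) r z s \<Longrightarrow> r < C / 2 \<Longrightarrow> \<exists>s'. fits (W, c, ys, e) (r + (real W + 1) * d) z' s'" for z z'
    proof (cases "misfit y z + \<eta> / 4 < C / 2")
      case False
      thus ?thesis using misfit_bounds(2)[of y z'] C \<eta> by (auto simp: y C_def)
    next
      case True
      obtain r s where r: "0 < r" "r < misfit y z + \<eta> / 4" "fits y r z s"
        using misfit_lessD[of y z "misfit y z + \<eta> / 4"] True \<eta> by (auto simp: y C_def)
      then obtain s' where "fits (W, c, ys, e) (r + (real W + 1) * d) z' s'"
        using ex[of r s] True by (auto simp: y)
      hence "misfit y z' \<le> r + (real W + 1) * d"
        by (intro misfit_le[OF add_pos_pos[OF r(1) mult_pos_pos[OF W d(1)]]]) (simp add: y)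
      thus ?thesis using r(2) dW by simp
    qed
    obtain T where T: "cadlag_upto x T" "N \<le> T \<or> dE (x T) None < C / 4"
        "\<forall>\<^sub>F k in sequentially. matched d T x (xk k)"
      using M[unfolded Mconv_def, rule_format, of "C / 4" d N] C d(1) by auto
    have T0: "0 \<le> T" using T(1) by (simp add: cadlag_upto_def)
    from T(3) show ?thesis
    proof eventually_elim
      case (elim k)
      then obtain l where l: "time_homeo l" "\<And>s. 0 \<le> s \<Longrightarrow> s \<le> T \<Longrightarrow> \<bar>l s - s\<bar> \<le> d"
        "\<And>s. 0 \<le> s \<Longrightarrow> s \<le> T \<Longrightarrow> dE (x s) (xk k (l s)) \<le> d"
        unfolding matched_def by blast
      obtain m where m: "time_homeo m" "\<And>s. 0 \<le> s \<Longrightarrow> m (l s) = s" "\<And>s. 0 \<le> s \<Longrightarrow> l (m s) = s"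
        by (rule time_homeo_inverse[OF l(1)]) blast
      note Hl = time_homeoD[OF l(1)] and Hm = time_homeoD[OF m(1)]
      have ml: "m s \<le> T" if "0 \<le> s" "s \<le> l T" for s
        using Hm(4)[of s "l T"] m(2)[OF T0] that Hl(1)[OF T0] by simp
      have "misfit y (xk k) \<le> misfit y x + \<eta> / 2"
      proof (rule upper)
        fix r s assume f: "fits (W, c, ys, e) r x s" and r: "r < C / 2"
        have "s (length ys) \<le> T"
        proof (rule ccontr)
          assume n: "\<not> ?thesis"
          hence "C - r < dE (x T) None" using fits_times(3)[OF f T0] by (simp add: C_def)
          thus False using n T(2) last[OF f r] r C by auto
        qed
        thus "\<exists>s'. fits (W, c, ys, e) (r + (real W + 1) * d) (xk k) s'"
          using matched_fits[OF l f _ \<Omega>] by blast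
      qed
      moreover have "misfit y x \<le> misfit y (xk k) + \<eta> / 2"
      proof (rule upper)
        fix r s assume f: "fits (W, c, ys, e) r (xk k) s" and r: "r < C / 2"
        have "s (length ys) \<le> l T"
        proof (rule ccontr)
          assume n: "\<not> ?thesis"
          hence 1: "C - r < dE (xk k (l T)) None" using fits_times(3)[OF f Hl(1)[OF T0]] by (simp add: C_def)
          have "dE (xk k (l T)) None \<le> dE (x T) None + d"
            using E.triangle[of "xk k (l T)" "x T" None] l(3)[OF T0] \<Omega>(1)[OF T0] \<Omega>(2)[OF Hl(1)[OF T0]] E.commute[of "x T"] by auto
          moreover have "T - d \<le> l T" using l(2)[OF T0] by auto
          ultimately show False using n 1 T(2) last[OF f r] r C d by auto
        qed
        moreover have "\<bar>m v - v\<bar> \<le> d" "dE (xk k v) (x (m v)) \<le> d" if v: "0 \<le> v" "v \<le> l T" for v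
          using l(2,3)[OF Hm(1)[OF v(1)] ml[OF v]] m(3)[OF v(1)] E.commute[of "xk k v" "x (m v)"] by auto
        ultimately show "\<exists>s'. fits (W, c, ys, e) (r + (real W + 1) * d) x s'"
          using matched_fits[OF m(1) _ _ f, where T="l T" and x'=x and d=d] \<Omega> by blast
      qed
      ultimately show ?case using \<eta> by (auto simp: dist_real_def)
    qed
  qed
qed

end

section \<open>Piecewise linear time changes and a diagonal choice\<close>

definition near_identity :: "real \<Rightarrow> (real \<Rightarrow> real) \<Rightarrow> bool" where
  "near_identity \<eta> l \<longleftrightarrow> l 0 = 0 \<and>
     (\<forall>u v. 0 \<le> u \<and> u \<le> v \<longrightarrow> exp (- \<eta>) * (v - u) \<le> l v - l u \<and> l v - l u \<le> exp \<eta> * (v - u)) \<and>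
     (\<exists>F. finite F \<and> (\<forall>t>0. t \<notin> F \<longrightarrow> (\<exists>D. (l has_real_derivative D) (at t))))"

lemma piecewise_linear_time_change:
  assumes "0 \<le> \<eta>" "s 0 = (0::real)" "s' 0 = (0::real)"
    "\<And>j. j < m \<Longrightarrow> s j < s (Suc j) \<and> exp (- \<eta>) * (s (Suc j) - s j) \<le> s' (Suc j) - s' j \<and>
      s' (Suc j) - s' j \<le> exp \<eta> * (s (Suc j) - s j)"
  shows "\<exists>l. near_identity \<eta> l \<and> (\<forall>j\<le>m. l (s j) = s' j)"
  using assms(4)
proof (induction m)
  case 0
  have "near_identity \<eta> (\<lambda>t. t)"
    unfolding near_identity_def
  proof (intro conjI allI impI exI[of _ "{}"])
    fix u v :: real assume uv: "0 \<le> u \<and> u \<le> v"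
    have "exp (- \<eta>) \<le> 1" "1 \<le> exp \<eta>" using assms(1) by auto
    hence "exp (- \<eta>) * (v - u) \<le> 1 * (v - u)" "1 * (v - u) \<le> exp \<eta> * (v - u)"
      using uv by (intro mult_right_mono; simp)+
    thus "exp (- \<eta>) * (v - u) \<le> v - u" "v - u \<le> exp \<eta> * (v - u)" by simp_all
  next
    fix t :: real show "\<exists>D. ((\<lambda>t. t) has_real_derivative D) (at t)"
      by (intro exI[of _ 1]) (rule DERIV_ident)
  qed auto
  thus ?case using assms(2,3) by auto
next
  case (Suc m)
  then obtain l where l: "near_identity \<eta> l" "\<And>j. j \<le> m \<Longrightarrow> l (s j) = s' j" by auto
  define a where "a = s m"
  define q where "q = (s' (Suc m) - s' m) / (s (Suc m) - s m)"
  define l' where "l' t = (if t \<le> a then l t else l a + q * (t - a))" for t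
  have sm: "s i \<le> s j" if "i \<le> j" "j \<le> Suc m" for i j
    using that
  proof (induction j rule: dec_induct)
    case (step n)
    thus ?case using Suc.prems[of n] by auto
  qed simp
  have a0: "0 \<le> a" using sm[of 0 m] assms(2) by (simp add: a_def)
  have D: "s (Suc m) - s m > 0" "exp (- \<eta>) * (s (Suc m) - s m) \<le> s' (Suc m) - s' m"
      "s' (Suc m) - s' m \<le> exp \<eta> * (s (Suc m) - s m)" using Suc.prems[of m] by auto
  have q: "exp (- \<eta>) \<le> q" "q \<le> exp \<eta>"
    using D by (auto simp: q_def pos_le_divide_eq pos_divide_le_eq)
  have lb: "exp (- \<eta>) * (v - u) \<le> l v - l u \<and> l v - l u \<le> exp \<eta> * (v - u)" if "0 \<le> u" "u \<le> v" for u v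
    using l(1) that unfolding near_identity_def by blast
  have qb: "exp (- \<eta>) * (v - u) \<le> q * (v - u) \<and> q * (v - u) \<le> exp \<eta> * (v - u)" if "u \<le> v" for u v
    using q that by (auto intro!: mult_right_mono)
  have "near_identity \<eta> l'"
    unfolding near_identity_def
  proof (intro conjI allI impI)
    show "l' 0 = 0" using l(1) a0 by (simp add: l'_def near_identity_def)
    fix u v :: real assume uv: "0 \<le> u \<and> u \<le> v"
    consider "v \<le> a" | "u \<le> a" "a < v" | "a < u" by linarith
    hence "exp (- \<eta>) * (v - u) \<le> l' v - l' u \<and> l' v - l' u \<le> exp \<eta> * (v - u)"
    proof cases
      case 1
      thus ?thesis using lb[of u v] uv by (simp add: l'_def)
    next
      case 2
      thus ?thesis using lb[of u a] qb[of a v] uv by (simp add: l'_def algebra_simps)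
    next
      case 3
      thus ?thesis using qb[of u v] uv by (simp add: l'_def algebra_simps)
    qed
    thus "exp (- \<eta>) * (v - u) \<le> l' v - l' u" "l' v - l' u \<le> exp \<eta> * (v - u)" by auto
  next
    obtain F where F: "finite F" "\<And>t. t > 0 \<Longrightarrow> t \<notin> F \<Longrightarrow> \<exists>D. (l has_real_derivative D) (at t)"
      using l(1) unfolding near_identity_def by auto
    show "\<exists>F. finite F \<and> (\<forall>t>0. t \<notin> F \<longrightarrow> (\<exists>D. (l' has_real_derivative D) (at t)))"
    proof (intro exI[of _ "insert a F"] conjI allI impI)
      fix t :: real assume t: "t > 0" "t \<notin> insert a F"
      show "\<exists>D. (l' has_real_derivative D) (at t)"
      proof (cases "t < a")
        case True
        obtain D where "(l has_real_derivative D) (at t)" using F(2) t by auto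
        hence "(l' has_real_derivative D) (at t)"
          by (rule has_field_derivative_transform_within_open[of _ _ _ "{..<a}"]) (use True in \<open>auto simp: l'_def\<close>)
        thus ?thesis by blast
      next
        case False
        hence "a < t" using t by auto
        have "((\<lambda>t. l a + q * (t - a)) has_real_derivative q) (at t)"
          by (auto intro!: derivative_eq_intros)
        hence "(l' has_real_derivative q) (at t)"
          by (rule has_field_derivative_transform_within_open[of _ _ _ "{a<..}"]) (use \<open>a < t\<close> in \<open>auto simp: l'_def\<close>)
        thus ?thesis by blast
      qed
    qed (use F in auto)
  qed
  moreover have "l' (s j) = s' j" if j: "j \<le> Suc m" for j
  proof (cases "j \<le> m")
    case True
    thus ?thesis using l(2)[of j] sm[of j m] by (simp add: l'_def a_def)
  next
    case False
    hence "j = Suc m" using j by simp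
    moreover have "q * (s (Suc m) - s m) = s' (Suc m) - s' m" using D(1) by (simp add: q_def)
    ultimately show ?thesis using D(1) l(2)[of m] by (simp add: l'_def a_def)
  qed
  ultimately show ?case by blast
qed

lemma near_identity_imp_bilipschitz:
  assumes l: "near_identity \<eta> l"
  shows "l \<in> bilipschitz_time_changes"
proof -
  have b: "exp (- \<eta>) * (v - u) \<le> l v - l u" "l v - l u \<le> exp \<eta> * (v - u)" if "0 \<le> u" "u \<le> v" for u v
    using l that unfolding near_identity_def by blast+
  have l0: "l 0 = 0" using l by (simp add: near_identity_def)
  have lt: "l u < l v" if "0 \<le> u" "u < v" for u v
  proof -
    have "0 < exp (- \<eta>) * (v - u)" using that by simp
    thus ?thesis using b(1)[of u v] that by linarith
  qed
  hence sm: "strict_mono_on {0..} l" by (auto intro!: strict_mono_onI)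
  have lip: "(exp \<eta>)-lipschitz_on {0..} l"
  proof (rule lipschitz_onI)
    fix u v :: real assume "u \<in> {0..}" "v \<in> {0..}"
    thus "dist (l u) (l v) \<le> exp \<eta> * dist u v"
      using b(2)[of u v] b(2)[of v u] lt[of u v] lt[of v u]
      by (cases u v rule: linorder_cases) (auto simp: dist_real_def abs_if)
  qed simp
  have nn: "0 \<le> l u" if "0 \<le> u" for u
  proof -
    have "0 \<le> exp (- \<eta>) * u" using that by simp
    thus ?thesis using b(1)[OF order_refl that, unfolded l0 diff_zero] by linarith
  qed
  have im: "l ` {0..} = {0..}"
  proof (intro set_eqI iffI)
    fix y :: real assume "y \<in> {0..}"
    hence y: "0 \<le> y" by simp
    have "y \<le> l (exp \<eta> * y)" using b(1)[of 0 "exp \<eta> * y"] y l0 by (simp add: mult.assoc[symmetric] exp_add[symmetric])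
    moreover have "continuous_on {0..exp \<eta> * y} l"
      using lipschitz_on_continuous_on[OF lip] continuous_on_subset by fastforce
    ultimately obtain u where "0 \<le> u" "l u = y" using IVT'[of l 0 y "exp \<eta> * y"] y l0 by auto
    thus "y \<in> l ` {0..}" by auto
  qed (use nn in auto)
  have inj: "inj_on l {0..}" using sm strict_mono_on_imp_inj_on by blast
  have inv: "inv_into {0..} l y \<in> {0..}" "l (inv_into {0..} l y) = y" if "y \<in> {0..}" for y
    using inv_into_into[of y l "{0..}"] f_inv_into_f[of y l "{0..}"] that im by simp_all
  have lipi: "(exp \<eta>)-lipschitz_on {0..} (inv_into {0..} l)"
  proof (rule lipschitz_onI)
    fix y z :: real assume yz: "y \<in> {0..}" "z \<in> {0..}"
    define u v where "u = inv_into {0..} l y" and "v = inv_into {0..} l z"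
    have uv: "0 \<le> u" "0 \<le> v" "l u = y" "l v = z" using inv yz by (auto simp: u_def v_def)
    have "exp (- \<eta>) * \<bar>v - u\<bar> \<le> \<bar>l v - l u\<bar>"
      using b(1)[of u v] b(1)[of v u] uv by (cases "u \<le> v") (auto simp: abs_if split: if_splits)
    hence "exp \<eta> * (exp (- \<eta>) * \<bar>v - u\<bar>) \<le> exp \<eta> * \<bar>l v - l u\<bar>" by (rule mult_left_mono) simp
    thus "dist (inv_into {0..} l y) (inv_into {0..} l z) \<le> exp \<eta> * dist y z"
      using uv by (simp add: dist_real_def u_def[symmetric] v_def[symmetric] mult.assoc[symmetric] exp_add[symmetric] abs_minus_commute)
  qed simp
  have loc: "locally_lipschitz_on {0..} f" if "L-lipschitz_on {0..} f" for L and f :: "real \<Rightarrow> real"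
    unfolding locally_lipschitz_on_def
    by (intro ballI exI[of _ 1] conjI exI[of _ L] lipschitz_on_subset[OF that]) auto
  show ?thesis
    using sm im inj loc[OF lip] loc[OF lipi] by (auto simp: bilipschitz_time_changes_def bij_betw_def)
qed

text \<open>The essential supremum requires measurability: off a finite set \<open>deriv l\<close>
  is the limit of the difference quotients with increments \<open>1 / Suc n\<close>, and the bounds
  on increments pass to this limit.\<close>

lemma near_identity_log_deriv_norm:
  assumes l: "near_identity \<eta> l" and \<eta>: "0 \<le> \<eta>"
  shows "log_deriv_norm l T \<le> ennreal \<eta>"
proof -
  have b: "exp (- \<eta>) * (v - u) \<le> l v - l u" "l v - l u \<le> exp \<eta> * (v - u)" if "0 \<le> u" "u \<le> v" for u v
    using l that unfolding near_identity_def by blast+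
  obtain F where F: "finite F" "\<And>t. t > 0 \<Longrightarrow> t \<notin> F \<Longrightarrow> \<exists>D. (l has_real_derivative D) (at t)"
    using l unfolding near_identity_def by auto
  define G where "G = insert 0 F"
  have lim: "(\<lambda>n. (l (t + 1 / Suc n) - l t) / (1 / Suc n)) \<longlonglongrightarrow> deriv l t" if t: "t > 0" "t \<notin> F" for t
  proof -
    obtain D where D: "(l has_real_derivative D) (at t)" using F(2) t by blast
    have "filterlim (\<lambda>n. 1 / real (Suc n)) (at 0) sequentially"
      unfolding filterlim_at using LIMSEQ_inverse_real_of_nat by (auto simp: inverse_eq_divide)
    from filterlim_compose[OF DERIV_D[OF D] this] show ?thesis
      using DERIV_imp_deriv[OF D] by simp
  qed
  define l' where "l' t = l (max 0 t)" for t
  have mono: "mono l'"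
  proof (rule monoI)
    fix u v :: real assume "u \<le> v"
    hence "0 \<le> exp (- \<eta>) * (max 0 v - max 0 u)" by (intro mult_nonneg_nonneg) auto
    moreover have "exp (- \<eta>) * (max 0 v - max 0 u) \<le> l (max 0 v) - l (max 0 u)"
      by (rule b(1)) (use \<open>u \<le> v\<close> in auto)
    ultimately show "l' u \<le> l' v" unfolding l'_def by linarith
  qed
  hence [measurable]: "l' \<in> borel_measurable borel" by (rule borel_measurable_mono)
  have "(\<lambda>t. lim (\<lambda>n. (l' (t + 1 / Suc n) - l' t) / (1 / Suc n))) \<in> borel_measurable borel"
    by (rule borel_measurable_lim_metric) measurable
  hence m0: "(\<lambda>t. ennreal \<bar>ln (lim (\<lambda>n. (l' (t + 1 / Suc n) - l' t) / (1 / Suc n)))\<bar>) \<in> borel_measurable borel"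
    by measurable
  have mA: "(\<lambda>t. ennreal \<bar>ln (lim (\<lambda>n. (l' (t + 1 / Suc n) - l' t) / (1 / Suc n)))\<bar>) \<in> borel_measurable (lebesgue_on {0..T})"
    by (rule measurable_restrict_space1[OF measurable_completion]) (use m0 in simp)
  have mB: "ennreal \<bar>ln (lim (\<lambda>n. (l' (t + 1 / Suc n) - l' t) / (1 / Suc n)))\<bar> = ennreal \<bar>ln (deriv l t)\<bar>"
    if "t \<in> space (lebesgue_on {0..T})" "t \<notin> G" for t
  proof -
    have t: "t > 0" "t \<notin> F" using that by (auto simp: G_def space_restrict_space)
    hence "lim (\<lambda>n. (l' (t + 1 / Suc n) - l' t) / (1 / Suc n)) = deriv l t"
      using lim[OF t] by (intro limI) (simp add: l'_def max_def)
    thus ?thesis by simp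
  qed
  have cG: "countable (G \<inter> {0..T})" using F(1) by (simp add: G_def countable_finite)
  have meas: "(\<lambda>t. ennreal \<bar>ln (deriv l t)\<bar>) \<in> borel_measurable (lebesgue_on {0..T})"
  proof (rule measurable_discrete_difference[OF mA cG])
    show "{t} \<in> sets (lebesgue_on {0..T})" if "t \<in> G \<inter> {0..T}" for t
      using that by (simp add: sets_restrict_space_iff)
    show "ennreal \<bar>ln (lim (\<lambda>n. (l' (t + 1 / Suc n) - l' t) / (1 / Suc n)))\<bar> = ennreal \<bar>ln (deriv l t)\<bar>"
      if "t \<in> space (lebesgue_on {0..T})" "t \<notin> G \<inter> {0..T}" for t
      using that by (intro mB) (auto simp: space_restrict_space)
  qed simp
  have bound: "ennreal \<bar>ln (deriv l t)\<bar> \<le> ennreal \<eta>" if t: "t > 0" "t \<notin> F" for t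
  proof -
    have "exp (- \<eta>) \<le> (l (t + 1 / Suc n) - l t) / (1 / Suc n)" "(l (t + 1 / Suc n) - l t) / (1 / Suc n) \<le> exp \<eta>" for n
      using b[of t "t + 1 / Suc n"] t by (auto simp: field_simps)
    hence 1: "exp (- \<eta>) \<le> deriv l t" "deriv l t \<le> exp \<eta>"
      using lim[OF t] by (auto intro: LIMSEQ_le_const LIMSEQ_le_const2)
    have pos: "0 < deriv l t" using 1(1) by (rule less_le_trans[rotated]) simp
    have "ln (exp (- \<eta>)) \<le> ln (deriv l t)" "ln (deriv l t) \<le> ln (exp \<eta>)"
      using 1 pos by (intro ln_mono; simp)+
    thus ?thesis using \<eta> by (simp add: abs_le_iff)
  qed
  have "G \<in> null_sets lebesgue" using F(1) by (simp add: G_def finite_imp_null_set_lborel null_sets_completionI)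
  hence "AE t in lebesgue. t \<notin> G" by (rule AE_not_in)
  hence "AE t in lebesgue. t \<in> {0..T} \<longrightarrow> ennreal \<bar>ln (deriv l t)\<bar> \<le> ennreal \<eta>"
    by eventually_elim (use bound in \<open>auto simp: G_def\<close>)
  hence "AE t in lebesgue_on {0..T}. ennreal \<bar>ln (deriv l t)\<bar> \<le> ennreal \<eta>"
    by (simp add: AE_restrict_space_iff)
  thus ?thesis unfolding log_deriv_norm_def using meas by (intro esssup_I)
qed

text \<open>For each \<open>k\<close> the largest \<open>n \<le> k\<close> is taken whose threshold
  \<open>K n\<close> has been passed; \<open>l0\<close> serves the finitely many \<open>k\<close>
  for which there is none.\<close>

lemma diagonal_choice:
  assumes "\<And>n::nat. \<forall>\<^sub>F k in sequentially. \<exists>l. P n l k"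
  shows "\<exists>L. (\<forall>k. L k = l0 \<or> (\<exists>n. P n (L k) k)) \<and> (\<forall>n. \<forall>\<^sub>F k in sequentially. \<exists>n'\<ge>n. P n' (L k) k)"
proof -
  obtain K where K: "\<And>n k. K n \<le> k \<Longrightarrow> \<exists>l. P n l k"
    using assms unfolding eventually_sequentially by metis
  define S where "S k = {n. n \<le> k \<and> K n \<le> k}" for k
  define N where "N k = Max (S k)" for k
  define L where "L k = (if S k = {} then l0 else SOME l. P (N k) l k)" for k
  have fin: "finite (S k)" for k by (rule finite_subset[of _ "{..k}"]) (auto simp: S_def)
  have L: "P (N k) (L k) k" if "S k \<noteq> {}" for k
  proof -
    have "N k \<in> S k" unfolding N_def using fin that by (rule Max_in)
    hence "\<exists>l. P (N k) l k" using K by (auto simp: S_def)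
    thus ?thesis using that unfolding L_def by (auto intro: someI_ex)
  qed
  show ?thesis
  proof (intro exI[of _ L] conjI allI)
    show "L k = l0 \<or> (\<exists>n. P n (L k) k)" for k using L[of k] by (cases "S k = {}") (auto simp: L_def)
    show "\<forall>\<^sub>F k in sequentially. \<exists>n'\<ge>n. P n' (L k) k" for n
      unfolding eventually_sequentially
    proof (rule exI[of _ "max n (K n)"], intro allI impI)
      fix k assume "max n (K n) \<le> k"
      hence n: "n \<in> S k" by (auto simp: S_def)
      hence "n \<le> N k" unfolding N_def using fin by simp
      thus "\<exists>n'\<ge>n. P n' (L k) k" using L[of k] n by blast
    qed
  qed
qed

lemma locate_interval:
  fixes s :: "nat \<Rightarrow> real"
  assumes "s 0 \<le> u" "u < s m"
  shows "\<exists>j<m. s j \<le> u \<and> u < s (Suc j)"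
proof -
  define j where "j = (LEAST j. u < s j)"
  have j: "u < s j" "j \<le> m" unfolding j_def using assms(2) by (auto intro: LeastI Least_le)
  then obtain i where i: "j = Suc i" using assms by (cases j) auto
  have "\<not> u < s i" using not_less_Least[of i "\<lambda>j. u < s j"] i unfolding j_def by simp
  thus ?thesis using j i by (intro exI[of _ i]) auto
qed

lemma tendsto_0_ennrealI:
  fixes f :: "'b \<Rightarrow> ennreal"
  assumes "\<And>r::real. (0::real) < r \<Longrightarrow> \<forall>\<^sub>F k in F. f k \<le> ennreal r"
  shows "(f \<longlongrightarrow> 0) F"
proof (rule order_tendstoI)
  fix a :: ennreal assume a: "0 < a"
  obtain r :: real where r: "(0::real) < r" "ennreal r < a"
  proof -
    obtain b where b: "0 < b" "b < a" using dense[OF a] by blast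
    then obtain r where "b = ennreal r" "0 \<le> r" by (cases b) (auto simp: top.extremum_strict)
    thus thesis using b that[of r] by (auto simp: ennreal_less_zero_iff)
  qed
  from assms[OF r(1)] show "\<forall>\<^sub>F k in F. f k < a"
    by eventually_elim (rule le_less_trans[OF _ r(2)])
qed simp

context lc_space begin

text \<open>The weight \<open>W\<close> is what controls slopes: a small misfit forces the times of
  the partition to agree up to a small fraction of its shortest step, so the piecewise linear
  interpolation of the times has slopes close to one.\<close>

lemma template_exists:
  assumes x: "cadlag_upto x T" and c0: "0 < c0" "\<And>s. 0 \<le> s \<Longrightarrow> s < T \<Longrightarrow> c0 \<le> dE (x s) None"
    and \<eta>: "0 < \<eta>"
  shows "\<exists>y b. misfit y x < b \<and> (\<forall>x'. (\<forall>s\<ge>0. x' s \<in> \<Omega>) \<and> misfit y x' < b \<longrightarrow>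
    (\<exists>l. near_identity \<eta> l \<and> (\<forall>s. 0 \<le> s \<and> s < T \<longrightarrow> dE (x s) (x' (l s)) < \<eta> \<and> x' (l s) \<noteq> None) \<and>
      dE (x T) (x' (l T)) < \<eta>))"
proof -
  have \<Omega>: "\<And>s. 0 \<le> s \<Longrightarrow> x s \<in> \<Omega>" and T: "0 \<le> T" using x by (auto simp: cadlag_upto_def)
  obtain c :: rat where c: "0 < (of_rat c :: real)" "of_rat c < c0"
    using of_rat_dense[OF c0(1)] by blast
  define C where "C = (of_rat c :: real)"
  \<comment> \<open>Not above the cap \<open>C / 2\<close>, so that a misfit less than
    \<open>b\<close> comes from an actual fit.\<close>
  define b where "b = min (\<eta> / 2) (C / 2)"
  have b: "0 < b" "b \<le> \<eta> / 2" "b \<le> C / 2" using \<eta> c by (auto simp: b_def C_def)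
  obtain m s where s: "s 0 = 0" "s m = T" "\<And>j. j < m \<Longrightarrow> s j < s (Suc j)"
    "\<And>j u v. j < m \<Longrightarrow> s j \<le> u \<Longrightarrow> u < s (Suc j) \<Longrightarrow> s j \<le> v \<Longrightarrow> v < s (Suc j) \<Longrightarrow> dE (x u) (x v) < b / 4"
    using cadlag_partition[OF x, of "b / 4"] b by auto
  have sm: "i \<le> j \<Longrightarrow> j \<le> m \<Longrightarrow> s i \<le> s j" for i j
  proof (induction j rule: dec_induct)
    case (step n)
    thus ?case using s(3)[of n] by auto
  qed simp
  have s0: "0 \<le> s j" if "j \<le> m" for j using sm[of 0 j] that s(1) by simp
  define gap where "gap = Min (insert 1 ((\<lambda>j. s (Suc j) - s j) ` {..<m}))"
  have gap: "0 < gap" "\<And>j. j < m \<Longrightarrow> gap \<le> s (Suc j) - s j" using s(3) by (auto simp: gap_def)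
  \<comment> \<open>The slope tolerance: the smaller of \<open>1 - exp (- \<eta>)\<close> and
    \<open>exp \<eta> - 1\<close>.\<close>
  define \<kappa> where "\<kappa> = 1 - exp (- \<eta>)"
  have "exp (- \<eta>) < 1" using \<eta> by simp
  hence \<kappa>0: "0 < \<kappa>" by (simp add: \<kappa>_def)
  have \<kappa>: "\<kappa> \<le> exp \<eta> - 1"
    using exp_ge_add_one_self[of "- \<eta>"] exp_ge_add_one_self[of \<eta>] unfolding \<kappa>_def by linarith
  \<comment> \<open>Two successive times are each off by at most
    \<open>2 * b / (real W + 1)\<close>; the sum of the two errors must not exceed
    \<open>\<kappa> * gap\<close>.\<close>
  obtain W :: nat where W: "4 * b / (\<kappa> * gap) \<le> real W" using real_arch_simple by blast
  have "4 * b \<le> real W * (\<kappa> * gap)" using W \<kappa>0 gap(1) by (simp add: pos_divide_le_eq)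
  moreover have "0 < \<kappa> * gap" using \<kappa>0 gap(1) by simp
  ultimately have W: "4 * b \<le> (real W + 1) * (\<kappa> * gap)" unfolding distrib_right by linarith
  have "\<exists>q::rat. (real W + 1) * \<bar>s (Suc j) - of_rat q\<bar> < b / 2" for j
  proof -
    define e where "e = b / (2 * (real W + 1))"
    have e: "0 < e" "(real W + 1) * e = b / 2" using b by (auto simp: e_def field_simps)
    obtain q where q: "s (Suc j) < of_rat q" "of_rat q < s (Suc j) + e" using of_rat_dense[of "s (Suc j)" "s (Suc j) + e"] e(1) by auto
    hence "(real W + 1) * \<bar>s (Suc j) - of_rat q\<bar> < (real W + 1) * e" by (intro mult_strict_left_mono) auto
    thus ?thesis using e(2) by auto
  qed
  then obtain q where q: "\<And>j. (real W + 1) * \<bar>s (Suc j) - of_rat (q j)\<bar> < b / 2" by metis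
  have "\<exists>i. j < m \<longrightarrow> dE (x (s j)) (den i) < b / 4" for j
    using den(2)[OF \<Omega>[OF s0[of j]], of "b / 4"] b by (cases "j < m") auto
  then obtain i where i: "\<And>j. j < m \<Longrightarrow> dE (x (s j)) (den (i j)) < b / 4" by metis
  obtain e where e: "dE (x T) (den e) < b / 2" using den(2)[OF \<Omega>[OF T], of "b / 2"] b by auto
  define ys where "ys = map (\<lambda>j. (q j, i j)) [0..<m]"
  have len: "length ys = m" and nth: "\<And>j. j < m \<Longrightarrow> ys ! j = (q j, i j)" by (auto simp: ys_def)
  have near: "dE (x u) (den (i j)) < b / 2" if "j < m" "s j \<le> u" "u < s (Suc j)" for j u
  proof -
    have "0 \<le> u" using s0[of j] that by simp
    thus ?thesis
      using s(4)[OF that order_refl] s(3)[OF that(1)] i[OF that(1)]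
        E.triangle[OF \<Omega>[of u] \<Omega>[OF s0[of j]] den(1)[of "i j"]] that by auto
  qed
  define y where "y = (W, c, ys, e)"
  have "fits y (b / 2) x s"
    unfolding fits_def y_def
  proof (simp only: prod.case len, intro conjI allI impI)
    fix j assume j: "j < m"
    show "s j \<le> s (Suc j)" using s(3)[OF j] by simp
    show "(real W + 1) * \<bar>s (Suc j) - of_rat (fst (ys ! j))\<bar> < b / 2" using q nth[OF j] by simp
    fix u assume u: "s j \<le> u \<and> u < s (Suc j)"
    show "dE (x u) (den (snd (ys ! j))) < b / 2" using near[OF j] u nth[OF j] by simp
    have "u < T" using u sm[of "Suc j" m] j s(2) by simp
    hence "c0 \<le> dE (x u) None" using c0(2)[of u] s0[of j] j u by auto
    thus "real_of_rat c - b / 2 < dE (x u) None" using c b by simp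
  qed (use s e in auto)
  hence "misfit y x \<le> b / 2" using b by (intro misfit_le) auto
  hence m1: "misfit y x < b" using b by simp
  have bC: "b \<le> of_rat (fst (snd y)) / 2" using b(3) by (simp add: y_def C_def)
  have "\<exists>l. near_identity \<eta> l \<and> (\<forall>u. 0 \<le> u \<and> u < T \<longrightarrow> dE (x u) (x' (l u)) < \<eta> \<and> x' (l u) \<noteq> None) \<and>
      dE (x T) (x' (l T)) < \<eta>" if x': "\<forall>s\<ge>0. x' s \<in> \<Omega>" and mf: "misfit y x' < b" for x'
  proof -
    obtain r s' where r: "0 < r" "r < b" "fits y r x' s'" using misfit_lessD[OF mf bC] by blast
    have f: "s' 0 = 0" "\<And>j. j < m \<Longrightarrow> s' j \<le> s' (Suc j)"
      "\<And>j. j < m \<Longrightarrow> (real W + 1) * \<bar>s' (Suc j) - of_rat (q j)\<bar> < b"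
      "\<And>j u. j < m \<Longrightarrow> s' j \<le> u \<Longrightarrow> u < s' (Suc j) \<Longrightarrow> dE (x' u) (den (i j)) < b \<and> C - b < dE (x' u) None"
      "dE (x' (s' m)) (den e) < b"
      using r nth by (fastforce simp: fits_def y_def len C_def)+
    have close: "(real W + 1) * \<bar>s' j - s j\<bar> \<le> 2 * b" if j: "j \<le> m" for j
    proof (cases j)
      case 0
      thus ?thesis using f(1) s(1) b by simp
    next
      case (Suc k)
      have "(real W + 1) * \<bar>s' j - s j\<bar> \<le> (real W + 1) * (\<bar>s' (Suc k) - of_rat (q k)\<bar> + \<bar>s (Suc k) - of_rat (q k)\<bar>)"
        using Suc by (intro mult_left_mono) auto
      also have "\<dots> \<le> 2 * b" using f(3)[of k] q[of k] j Suc b unfolding distrib_left by linarith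
      finally show ?thesis .
    qed
    have slope: "exp (- \<eta>) * (s (Suc j) - s j) \<le> s' (Suc j) - s' j \<and> s' (Suc j) - s' j \<le> exp \<eta> * (s (Suc j) - s j)"
      if j: "j < m" for j
    proof -
      define D where "D = s (Suc j) - s j"
      define D' where "D' = s' (Suc j) - s' j"
      have "(real W + 1) * \<bar>D' - D\<bar> \<le> (real W + 1) * (\<bar>s' (Suc j) - s (Suc j)\<bar> + \<bar>s' j - s j\<bar>)"
        by (intro mult_left_mono) (auto simp: D_def D'_def)
      also have "\<dots> \<le> 4 * b" using close[of j] close[of "Suc j"] j unfolding distrib_left by linarith
      also have "\<dots> \<le> (real W + 1) * (\<kappa> * gap)" by (rule W)
      finally have "\<bar>D' - D\<bar> \<le> \<kappa> * gap" by (subst (asm) mult_le_cancel_left_pos) auto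
      also have "\<dots> \<le> \<kappa> * D" using gap(2)[OF j] \<kappa>0 by (intro mult_left_mono) (auto simp: D_def)
      finally have DD: "\<bar>D' - D\<bar> \<le> \<kappa> * D" .
      have "0 < D" using s(3)[OF j] by (simp add: D_def)
      hence "\<kappa> * D \<le> (exp \<eta> - 1) * D" using \<kappa> by (intro mult_right_mono) auto
      hence "exp (- \<eta>) * D \<le> D'" "D' \<le> exp \<eta> * D"
        using DD by (auto simp: \<kappa>_def algebra_simps abs_le_iff)
      thus ?thesis by (simp add: D_def D'_def)
    qed
    obtain l where l: "near_identity \<eta> l" "\<And>j. j \<le> m \<Longrightarrow> l (s j) = s' j"
      using piecewise_linear_time_change[of \<eta> s s' m] \<eta> s f slope by (metis less_imp_le)
    have h: "time_homeo l" by (rule bilipschitz_imp_time_homeo[OF near_identity_imp_bilipschitz[OF l(1)]])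
    note H = time_homeoD[OF h]
    have tri: "dE a d' < \<eta>" if "dE a z < b / 2" "dE d' z < b" "a \<in> \<Omega>" "d' \<in> \<Omega>" "z \<in> \<Omega>" for a d' z
      using E.triangle[OF that(3,5,4)] that(1,2) E.commute[of d' z] b by simp
    have "dE (x u) (x' (l u)) < \<eta> \<and> x' (l u) \<noteq> None" if u: "0 \<le> u" "u < T" for u
    proof -
      obtain j where j: "j < m" "s j \<le> u" "u < s (Suc j)"
        using locate_interval[of s u m] s u by auto
      hence "l (s j) \<le> l u" "l u < l (s (Suc j))" using H(3,4) s0[of j] s0[of "Suc j"] u by auto
      hence "s' j \<le> l u" "l u < s' (Suc j)" using l(2) j by auto
      hence "dE (x' (l u)) (den (i j)) < b" "C - b < dE (x' (l u)) None" using f(4)[OF j(1)] by auto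
      moreover have "x' (l u) \<noteq> None" using calculation(2) b by (cases "x' (l u)") auto
      ultimately show ?thesis using tri[OF near[OF j]] \<Omega>[OF u(1)] x' H(1)[OF u(1)] den(1) by blast
    qed
    moreover have "dE (x T) (x' (l T)) < \<eta>"
      using tri[OF e, of "x' (l T)"] f(5) l(2)[of m] s(2) \<Omega>[OF T] x' H(1)[OF T] den(1) by auto
    ultimately show ?thesis using l(1) by blast
  qed
  thus ?thesis using m1 by blast
qed

text \<open>Templates for the accuracies \<open>1 / (n + 1)\<close> up to admissible times
  approaching the horizon are combined by the diagonal choice; the resulting time changes have
  slopes tending to one.\<close>

lemma misfit_determines_local_conv:
  assumes x: "x \<in> D_loc X" and xk: "\<And>k. xk k \<in> D_loc X"
    and conv: "\<And>y. (\<lambda>k. misfit y (xk k)) \<longlonglongrightarrow> misfit y x"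
  shows "local_skorokhod_conv X xk x"
proof -
  note x' = D_loc_D_exp[OF x] and xk' = D_loc_D_exp[OF xk]
  define b where "b \<longleftrightarrow> lifetime x < \<infinity> \<and> relatively_compact_path X x"
  define T0 where "T0 = enn2real (lifetime x)"
  \<comment> \<open>When the path is killed from inside a compact set, the horizon is the lifetime
    itself; otherwise alive times approach the lifetime, staying before it.\<close>
  obtain t :: "nat \<Rightarrow> real" where t: "\<And>n. adm x (t n)" "\<And>n. b \<Longrightarrow> t n = T0"
    "\<And>s. \<not> b \<Longrightarrow> 0 \<le> s \<Longrightarrow> ennreal s < lifetime x \<Longrightarrow> \<exists>N. \<forall>n\<ge>N. s \<le> t n \<and> ennreal (t n) < lifetime x"
  proof (cases b)
    case True
    hence "lifetime x = ennreal T0" "0 \<le> T0" by (auto simp: b_def T0_def)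
    thus ?thesis using True by (intro that[of "\<lambda>_. T0"]) (auto simp: adm_def b_def)
  next
    case nb: False
    show ?thesis
    proof (cases "lifetime x = \<infinity>")
      case True
      show ?thesis
      proof (rule that[of "\<lambda>n. real n"])
        show "\<exists>N. \<forall>n\<ge>N. s \<le> real n \<and> ennreal (real n) < lifetime x" for s
        proof -
          obtain N where "s \<le> real N" using real_arch_simple by blast
          thus ?thesis using True by (intro exI[of _ N]) auto
        qed
      qed (use nb True in \<open>auto simp: adm_def\<close>)
    next
      case False
      hence e: "lifetime x = ennreal T0" "0 \<le> T0" by (auto simp: T0_def less_top)
      have "T0 \<noteq> 0"
      proof
        assume "T0 = 0"
        hence "relatively_compact_path X x" using e
          by (auto simp: relatively_compact_path_def intro!: exI[of _ "{}"])
        thus False using nb e by (simp add: b_def)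
      qed
      hence T0: "0 < T0" using e by simp
      show ?thesis
      proof (rule that[of "\<lambda>n. T0 * (1 - 1 / (real n + 2))"])
        have lt: "T0 * (1 - 1 / (real n + 2)) < T0" "0 \<le> T0 * (1 - 1 / (real n + 2))" for n
          using T0 by (auto simp: algebra_simps divide_le_eq)
        show "adm x (T0 * (1 - 1 / (real n + 2)))" for n
          using lt[of n] e T0 by (auto simp: adm_def ennreal_less_iff)
        fix s :: real assume s: "0 \<le> s" "ennreal s < lifetime x"
        hence sT: "s < T0" using e by (simp add: ennreal_less_iff)
        obtain N :: nat where N: "T0 / (T0 - s) \<le> real N" using real_arch_simple by blast
        show "\<exists>N. \<forall>n\<ge>N. s \<le> T0 * (1 - 1 / (real n + 2)) \<and> ennreal (T0 * (1 - 1 / (real n + 2))) < lifetime x"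
        proof (intro exI[of _ N] allI impI conjI)
          fix n assume n: "N \<le> n"
          show "ennreal (T0 * (1 - 1 / (real n + 2))) < lifetime x" using lt[of n] e by (simp add: ennreal_less_iff)
          have "T0 / (T0 - s) \<le> real n + 2" using N n by linarith
          hence "T0 / (real n + 2) \<le> T0 - s" using sT by (simp add: field_simps)
          thus "s \<le> T0 * (1 - 1 / (real n + 2))" by (simp add: right_diff_distrib)
        qed
      qed (use nb in auto)
    qed
  qed
  have t0: "0 \<le> t n" for n using t(1)[of n] by (simp add: adm_def)
  define \<epsilon> where "\<epsilon> n = 1 / (real n + 1)" for n
  have \<epsilon>: "0 < \<epsilon> n" for n by (simp add: \<epsilon>_def)
  define P where "P n l k \<longleftrightarrow> near_identity (\<epsilon> n) l \<and>
     (\<forall>s. 0 \<le> s \<and> s < t n \<longrightarrow> dE (x s) (xk k (l s)) < \<epsilon> n \<and> xk k (l s) \<noteq> None) \<and> dE (x (t n)) (xk k (l (t n))) < \<epsilon> n" for n l k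
  have ev: "\<forall>\<^sub>F k in sequentially. \<exists>l. P n l k" for n
  proof -
    obtain c0 where c0: "c0 > 0" "\<And>s. 0 \<le> s \<Longrightarrow> s < t n \<Longrightarrow> c0 \<le> dE (x s) None" using adm_away[OF x t(1)] by blast
    obtain y d where y: "misfit y x < d" "\<And>x'. (\<forall>s\<ge>0. x' s \<in> \<Omega>) \<and> misfit y x' < d \<Longrightarrow>
      (\<exists>l. near_identity (\<epsilon> n) l \<and> (\<forall>s. 0 \<le> s \<and> s < t n \<longrightarrow> dE (x s) (x' (l s)) < \<epsilon> n \<and> x' (l s) \<noteq> None) \<and>
      dE (x (t n)) (x' (l (t n))) < \<epsilon> n)"
      using template_exists[OF adm_cadlag(1)[OF x t(1)] c0 \<epsilon>] by blast
    have "\<forall>\<^sub>F k in sequentially. misfit y (xk k) < d" using conv y(1) by (rule order_tendstoD)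
    thus ?thesis
      by eventually_elim (use y(2) D_expD(1)[OF xk'] in \<open>simp add: P_def\<close>)
  qed
  obtain L where L: "\<And>k. L k = (\<lambda>t. t) \<or> (\<exists>n. P n (L k) k)" "\<And>n. \<forall>\<^sub>F k in sequentially. \<exists>n'\<ge>n. P n' (L k) k"
    using diagonal_choice[of P "\<lambda>t. t", OF ev] by blast
  have "near_identity 0 (\<lambda>t. t)"
    by (auto simp: near_identity_def intro!: exI[of _ "{}"] exI[of _ 1])
  hence \<Lambda>: "L k \<in> bilipschitz_time_changes" for k
    using L(1)[of k] near_identity_imp_bilipschitz by (auto simp: P_def)
  note H = time_homeoD[OF bilipschitz_imp_time_homeo[OF \<Lambda>]]
  have small: "\<exists>n. \<forall>n'\<ge>n. \<epsilon> n' \<le> r" if r: "0 < r" for r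
  proof -
    obtain n :: nat where n: "1 / r \<le> real n" using real_arch_simple by blast
    have "\<epsilon> n' \<le> r" if "n \<le> n'" for n'
    proof -
      have "1 / r \<le> real n' + 1" using n that by linarith
      thus ?thesis using r by (simp add: \<epsilon>_def field_simps)
    qed
    thus ?thesis by blast
  qed
  have norm: "(\<lambda>k. log_deriv_norm (L k) T) \<longlonglongrightarrow> 0" for T
  proof (rule tendsto_0_ennrealI)
    fix r :: real assume r: "0 < r"
    obtain n where n: "\<forall>n'\<ge>n. \<epsilon> n' \<le> r" using small[OF r] by blast
    from L(2)[of n] show "\<forall>\<^sub>F k in sequentially. log_deriv_norm (L k) T \<le> ennreal r"
    proof eventually_elim
      case (elim k)
      then obtain n' where n': "n \<le> n'" "P n' (L k) k" by blast
      hence "log_deriv_norm (L k) T \<le> ennreal (\<epsilon> n')"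
        using \<epsilon>[of n'] by (intro near_identity_log_deriv_norm) (auto simp: P_def)
      also have "\<dots> \<le> ennreal r" using n n' by (intro ennreal_leI) auto
      finally show ?case .
    qed
  qed
  have sup: "(\<lambda>k. SUP s\<in>I. ennreal (dX (the (x s)) (the (xk k (L k s))))) \<longlonglongrightarrow> 0"
    if c: "0 < c" "\<And>s. s \<in> I \<Longrightarrow> 0 \<le> s \<and> c \<le> dE (x s) None"
      and ex: "\<And>r. 0 < r \<Longrightarrow> \<forall>\<^sub>F k in sequentially. \<forall>s\<in>I. dE (x s) (xk k (L k s)) < r \<and> xk k (L k s) \<noteq> None" for c I
  proof (rule tendsto_0_ennrealI)
    fix r :: real assume r: "0 < r"
    define K where "K = {p \<in> topspace X. c \<le> dE (Some p) None}"
    have "compactin X K" unfolding K_def by (rule compactin_away[OF c(1)])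
    then obtain r' where r': "r' > 0" "\<And>p q. p \<in> K \<Longrightarrow> q \<in> topspace X \<Longrightarrow> dE (Some p) (Some q) < r' \<Longrightarrow> dX p q < r"
      using dE_imp_dX_uniform[OF _ r] by blast
    from ex[OF r'(1)] show "\<forall>\<^sub>F k in sequentially. (SUP s\<in>I. ennreal (dX (the (x s)) (the (xk k (L k s))))) \<le> ennreal r"
    proof eventually_elim
      case (elim k)
      show ?case
      proof (rule SUP_least)
        fix s assume s: "s \<in> I"
        hence s0: "0 \<le> s" "c \<le> dE (x s) None" using c(2) by auto
        have "x s \<noteq> None" using s0(2) c(1) by (cases "x s") auto
        then obtain p where p: "x s = Some p" by auto
        obtain q where q: "xk k (L k s) = Some q" using elim s by auto
        have "q \<in> topspace X" using D_expD(1)[OF xk', of "L k s" k] H(1)[OF s0(1), of k] q by simp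
        moreover have "p \<in> K" using p s0 D_expD(1)[OF x' s0(1)] by (simp add: K_def)
        ultimately have "dX p q < r" using r'(2) elim s p q by auto
        thus "ennreal (dX (the (x s)) (the (xk k (L k s)))) \<le> ennreal r"
          using p q by (simp add: ennreal_leI)
      qed
    qed
  qed
  show ?thesis
  proof (cases b)
    case True
    have lx: "lifetime x = ennreal T0" "0 \<le> T0" using True by (auto simp: b_def T0_def)
    obtain c where c: "c > 0" "\<And>s. 0 \<le> s \<Longrightarrow> s < T0 \<Longrightarrow> c \<le> dE (x s) None"
      using adm_away[OF x t(1)[of 0]] t(2)[OF True] by auto
    have main: "\<forall>\<^sub>F k in sequentially. (\<forall>s\<in>{0..<T0}. dE (x s) (xk k (L k s)) < r \<and> xk k (L k s) \<noteq> None) \<and>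
       dE (x T0) (xk k (L k T0)) < r" if r: "0 < r" for r
    proof -
      obtain n where n: "\<forall>n'\<ge>n. \<epsilon> n' \<le> r" using small[OF r] by blast
      from L(2)[of n] show ?thesis
      proof eventually_elim
        case (elim k)
        then obtain n' where "n \<le> n'" "P n' (L k) k" by blast
        thus ?case using n t(2)[OF True] by (fastforce simp: P_def)
      qed
    qed
    have 1: "\<forall>\<^sub>F k in sequentially. ennreal (L k T0) \<le> lifetime (xk k)"
      using main[OF zero_less_one]
    proof eventually_elim
      case (elim k)
      show ?case
      proof (rule ccontr)
        assume "\<not> ?thesis"
        hence lt: "lifetime (xk k) < ennreal (L k T0)" by simp
        then obtain v where v: "lifetime (xk k) = ennreal v" "0 \<le> v" by (cases "lifetime (xk k)") auto
        hence "v < L k T0" using lt by (simp add: ennreal_less_iff)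
        obtain s where s: "0 \<le> s" "L k s = v" using H(5)[OF v(2)] by blast
        hence "s < T0" using H(3)[OF s(1) lx(2), of k] \<open>v < L k T0\<close> by simp
        hence "xk k v \<noteq> None" using elim s by auto
        thus False using D_expD(2)[OF xk' v(2)] v(1) by auto
      qed
    qed
    have 2: "(\<lambda>k. SUP s\<in>{0..<T0}. ennreal (dX (the (x s)) (the (xk k (L k s))))) \<longlonglongrightarrow> 0"
    proof (rule sup[OF c(1)])
      show "\<forall>\<^sub>F k in sequentially. \<forall>s\<in>{0..<T0}. dE (x s) (xk k (L k s)) < r \<and> xk k (L k s) \<noteq> None" if "0 < r" for r
        using main[OF that] by eventually_elim blast
    qed (use c in auto)
    have xT: "x T0 = None" using D_expD(2)[OF x' lx(2)] lx(1) by simp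
    have 3: "limitin E (\<lambda>k. xk k (L k T0)) None sequentially"
      unfolding limitin_E
    proof (intro conjI allI impI)
      fix e :: real assume "0 < e"
      from main[OF this] show "\<forall>\<^sub>F k in sequentially. xk k (L k T0) \<in> \<Omega> \<and> dE (xk k (L k T0)) None < e"
        by eventually_elim (use D_expD(1)[OF xk' H(1)[OF lx(2)]] xT E.commute in auto)
    qed simp
    show ?thesis
      unfolding local_skorokhod_conv_def Let_def dX_def[symmetric] T0_def[symmetric]
      using True \<Lambda> 1 2 3 norm[of T0] unfolding b_def by (intro exI[of _ L]) simp
  next
    case False
    have main: "\<forall>\<^sub>F k in sequentially. \<forall>s\<in>{0..u}. dE (x s) (xk k (L k s)) < r \<and> xk k (L k s) \<noteq> None"
      if u: "0 \<le> u" "ennreal u < lifetime x" and r: "0 < r" for r u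
    proof -
      \<comment> \<open>Templates exclude the value \<open>None\<close> only strictly before
        \<open>t n\<close>, so a later time \<open>w\<close> that is still alive is
        interposed.\<close>
      obtain w where w: "u < w" "ennreal w < lifetime x"
      proof (cases "lifetime x")
        case (real v)
        hence "u < v" using u by (simp add: ennreal_less_iff)
        thus ?thesis using that[of "(u + v) / 2"] real u by (simp add: ennreal_less_iff)
      next
        case top
        thus ?thesis using that[of "u + 1"] by simp
      qed
      obtain N where N: "\<And>n. N \<le> n \<Longrightarrow> w \<le> t n" using t(3)[OF False _ w(2)] u w by fastforce
      obtain n where n: "\<forall>n'\<ge>n. \<epsilon> n' \<le> r" using small[OF r] by blast
      from L(2)[of "max n N"] show ?thesis
      proof eventually_elim
        case (elim k)
        then obtain n' where n': "max n N \<le> n'" "P n' (L k) k" by blast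
        have "u < t n'" using N[of n'] n' w by simp
        thus ?case using n n' by (fastforce simp: P_def)
      qed
    qed
    have "(\<forall>\<^sub>F k in sequentially. ennreal (L k u) < lifetime (xk k)) \<and>
          (\<lambda>k. SUP s\<in>{0..u}. ennreal (dX (the (x s)) (the (xk k (L k s))))) \<longlonglongrightarrow> 0"
      if u: "0 \<le> u" "ennreal u < lifetime x" for u
    proof
      show "\<forall>\<^sub>F k in sequentially. ennreal (L k u) < lifetime (xk k)"
        using main[OF u zero_less_one]
      proof eventually_elim
        case (elim k)
        hence "xk k (L k u) \<noteq> None" using u by auto
        thus ?case using D_expD(2)[OF xk' H(1)[OF u(1)]] by (simp add: not_le[symmetric])
      qed
      obtain c where "c > 0" "\<And>s. 0 \<le> s \<Longrightarrow> s \<le> u \<Longrightarrow> c \<le> dE (x s) None" using bounded_away[OF x' u] by auto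
      thus "(\<lambda>k. SUP s\<in>{0..u}. ennreal (dX (the (x s)) (the (xk k (L k s))))) \<longlonglongrightarrow> 0"
        by (intro sup[of c] main[OF u]) auto
    qed
    thus ?thesis
      unfolding local_skorokhod_conv_def Let_def dX_def[symmetric]
      using False \<Lambda> norm unfolding b_def by (intro exI[of _ L]) auto
  qed
qed

end

section \<open>Topologies given by sequences, Borel sets and the weak topology\<close>

lemma limitin_seq_topology:
  assumes "range xk \<subseteq> D" "x \<in> D" "conv xk x"
  shows "limitin (seq_topology D conv) xk x sequentially"
  unfolding limitin_def using assms by (auto simp: openin_seq_topology)

lemma continuous_map_from_seq_topology:
  assumes "f \<in> D \<rightarrow> topspace T"
    and "\<And>xk x. range xk \<subseteq> D \<Longrightarrow> x \<in> D \<Longrightarrow> conv xk x \<Longrightarrow> limitin T (\<lambda>k. f (xk k)) (f x) sequentially"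
  shows "continuous_map (seq_topology D conv) T f"
  unfolding continuous_map_def
proof (intro conjI allI impI)
  fix V assume V: "openin T V"
  show "openin (seq_topology D conv) {x \<in> topspace (seq_topology D conv). f x \<in> V}"
    unfolding openin_seq_topology
  proof (intro conjI allI ballI impI)
    fix xk x assume x: "x \<in> {x \<in> topspace (seq_topology D conv). f x \<in> V}"
      and c: "range xk \<subseteq> D \<and> conv xk x"
    hence "\<forall>\<^sub>F k in sequentially. f (xk k) \<in> V"
      using assms(2)[of xk x] V unfolding limitin_def by auto
    thus "\<forall>\<^sub>F k in sequentially. xk k \<in> {x \<in> topspace (seq_topology D conv). f x \<in> V}"
      by eventually_elim (use c in auto)
  qed simp
qed (use assms(1) in simp)

lemma space_borel_of [simp]: "space (borel_of T) = topspace T"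
  unfolding borel_of_def by (rule space_measure_of) (auto dest: openin_subset)

lemma sets_borel_of: "sets (borel_of T) = sigma_sets (topspace T) {V. openin T V}"
  unfolding borel_of_def by (rule sets_measure_of) (auto dest: openin_subset)

lemma openin_borel_of: "openin T V \<Longrightarrow> V \<in> sets (borel_of T)"
  by (simp add: sets_borel_of)

lemma measurable_into_borel_of:
  assumes "\<And>x. x \<in> space N \<Longrightarrow> f x \<in> topspace T" "\<And>V. openin T V \<Longrightarrow> f -` V \<inter> space N \<in> sets N"
  shows "f \<in> measurable N (borel_of T)"
  unfolding borel_of_def by (rule measurable_sigma_sets[OF sets_measure_of]) (use assms in \<open>auto dest: openin_subset\<close>)

lemma continuous_map_measurable_borel_of:
  fixes f :: "'a \<Rightarrow> 'b::topological_space"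
  assumes "continuous_map T euclidean f"
  shows "f \<in> borel_measurable (borel_of T)"
proof (rule borel_measurableI)
  fix S :: "'b set" assume "open S"
  hence "openin T {x \<in> topspace T. f x \<in> S}" using openin_continuous_map_preimage[OF assms] by simp
  moreover have "f -` S \<inter> space (borel_of T) = {x \<in> topspace T. f x \<in> S}" by auto
  ultimately show "f -` S \<inter> space (borel_of T) \<in> sets (borel_of T)" by (simp add: openin_borel_of)
qed

lemma tendsto_fun_iff:
  fixes f :: "'b \<Rightarrow> nat \<Rightarrow> real"
  shows "(f \<longlongrightarrow> l) F \<longleftrightarrow> (\<forall>n. ((\<lambda>k. f k n) \<longlongrightarrow> l n) F)"
  using limitin_componentwise[of "\<lambda>_. euclideanreal" UNIV f l F]
  by (simp add: euclidean_product_topology)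

lemma weak_topology_continuous:
  assumes P: "continuous_map Y (weak_topology T) P"
    and f: "continuous_map T euclideanreal f" "bounded (f ` topspace T)"
  shows "continuous_map Y euclideanreal (\<lambda>a. \<integral>x. f x \<partial>P a)"
  unfolding continuous_map_def
proof (intro conjI allI impI)
  fix V :: "real set" assume V: "openin euclideanreal V"
  have "openin (weak_topology T) {M \<in> prob_measures T. (\<integral>x. f x \<partial>M) \<in> V}"
    unfolding weak_topology_def openin_topology_generated_by_iff
    by (rule generate_topology_on.Basis) (use f V in auto)
  hence "openin Y {a \<in> topspace Y. P a \<in> {M \<in> prob_measures T. (\<integral>x. f x \<partial>M) \<in> V}}"
    by (rule openin_continuous_map_preimage[OF P])
  moreover have "P a \<in> prob_measures T" if "a \<in> topspace Y" for a
    using continuous_map_image_subset_topspace[OF P] that unfolding topspace_weak_topology by auto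
  hence "{a \<in> topspace Y. P a \<in> {M \<in> prob_measures T. (\<integral>x. f x \<partial>M) \<in> V}} = {a \<in> topspace Y. (\<integral>x. f x \<partial>P a) \<in> V}"
    by auto
  ultimately show "openin Y {a \<in> topspace Y. (\<integral>x. f x \<partial>P a) \<in> V}" by simp
qed auto

section \<open>Borel sets of the local topology\<close>

context lc_space begin

abbreviation DL :: "'a path set" where "DL \<equiv> D_loc X"
abbreviation BL :: "'a path measure" where "BL \<equiv> borel_of (local_skorokhod X)"

lemma topspace_local [simp]: "topspace (local_skorokhod X) = DL"
  by (simp add: local_skorokhod_def)

text \<open>The misfits of all templates, enumerated. Convergence of these coordinates is local
  convergence, which makes the local topology accessible to metric arguments although it is given by
  its convergent sequences only.\<close>

definition emb :: "'a path \<Rightarrow> nat \<Rightarrow> real" where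
  "emb x n = misfit (from_nat n) x"

lemma local_conv_iff_emb:
  assumes "x \<in> DL" "\<And>k. xk k \<in> DL"
  shows "local_skorokhod_conv X xk x \<longleftrightarrow> (\<lambda>k. emb (xk k)) \<longlonglongrightarrow> emb x"
proof
  assume "local_skorokhod_conv X xk x"
  hence "Mconv xk x" using local_conv_imp_Mconv assms by blast
  hence "(\<lambda>k. misfit y (xk k)) \<longlonglongrightarrow> misfit y x" for y
    by (rule Mconv_misfit) (use assms D_expD(1) D_loc_D_exp in blast)+
  thus "(\<lambda>k. emb (xk k)) \<longlonglongrightarrow> emb x" by (simp add: tendsto_fun_iff emb_def)
next
  assume e: "(\<lambda>k. emb (xk k)) \<longlonglongrightarrow> emb x"
  have "(\<lambda>k. misfit y (xk k)) \<longlonglongrightarrow> misfit y x" for y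
    using e[unfolded tendsto_fun_iff, rule_format, of "to_nat y"] by (simp add: emb_def)
  thus "local_skorokhod_conv X xk x" by (rule misfit_determines_local_conv[OF assms])
qed

lemma emb_imp_Mconv:
  assumes "x \<in> DL" "\<And>k. xk k \<in> DL" "(\<lambda>k. emb (xk k)) \<longlonglongrightarrow> emb x"
  shows "Mconv xk x"
  using local_conv_imp_Mconv[of xk x] local_conv_iff_emb[of x xk] assms by blast

lemma continuous_emb: "continuous_map (local_skorokhod X) euclidean emb"
  unfolding local_skorokhod_def
proof (rule continuous_map_from_seq_topology)
  fix xk x assume "range xk \<subseteq> DL" "x \<in> DL" "local_skorokhod_conv X xk x"
  thus "limitin euclidean (\<lambda>k. emb (xk k)) (emb x) sequentially"
    using local_conv_iff_emb[of x xk] by auto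
qed simp

lemma emb_measurable [measurable]: "emb \<in> borel_measurable BL"
  by (rule continuous_map_measurable_borel_of[OF continuous_emb])

text \<open>The complement of \<open>V\<close> is sequentially closed, so no sequence in its image
  under \<open>emb\<close> converges to \<open>emb x\<close> with \<open>x\<close> in
  \<open>V\<close>. Consequently measurability into the local Borel sets can be tested on the
  countably many misfits.\<close>

lemma openin_local_emb:
  assumes V: "openin (local_skorokhod X) V"
  shows "\<exists>W. open W \<and> V = {x \<in> DL. emb x \<in> W}"
proof (intro exI conjI)
  let ?W = "- closure (emb ` (DL - V))"
  show "open ?W" by (simp add: open_Compl)
  have VD: "V \<subseteq> DL" using openin_subset[OF V] by simp
  have "emb x \<notin> closure (emb ` (DL - V))" if x: "x \<in> V" for x
  proof
    assume "emb x \<in> closure (emb ` (DL - V))"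
    then obtain z where z: "\<And>n. z n \<in> emb ` (DL - V)" "z \<longlonglongrightarrow> emb x" unfolding closure_sequential by blast
    hence "\<forall>n. \<exists>y. y \<in> DL - V \<and> z n = emb y" by blast
    then obtain xk where xk: "\<And>n. xk n \<in> DL - V" "\<And>n. z n = emb (xk n)" by metis
    have "z = (\<lambda>n. emb (xk n))" using xk(2) by auto
    hence "local_skorokhod_conv X xk x" using local_conv_iff_emb[of x xk] x VD xk z by auto
    hence "\<forall>\<^sub>F k in sequentially. xk k \<in> V"
      using V x xk(1) unfolding local_skorokhod_def openin_seq_topology by (metis DiffD1 image_subsetI)
    then obtain k where "xk k \<in> V" using eventually_happens'[OF sequentially_bot] by blast
    thus False using xk(1)[of k] by simp
  qed
  thus "V = {x \<in> DL. emb x \<in> ?W}"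
    using VD closure_subset[of "emb ` (DL - V)"] by auto
qed

lemma measurable_into_BL:
  assumes h: "\<And>\<omega>. \<omega> \<in> space N \<Longrightarrow> h \<omega> \<in> DL" and m: "\<And>y. (\<lambda>\<omega>. misfit y (h \<omega>)) \<in> borel_measurable N"
  shows "h \<in> measurable N BL"
proof (rule measurable_into_borel_of)
  fix V assume "openin (local_skorokhod X) V"
  then obtain W where W: "open W" "V = {x \<in> DL. emb x \<in> W}" using openin_local_emb by blast
  have "(\<lambda>\<omega>. emb (h \<omega>)) \<in> borel_measurable N"
    by (rule measurable_coordinatewise_then_product) (simp add: emb_def m)
  hence "(\<lambda>\<omega>. emb (h \<omega>)) -` W \<inter> space N \<in> sets N" using W(1) by (simp add: measurable_sets)
  moreover have "h -` V \<inter> space N = (\<lambda>\<omega>. emb (h \<omega>)) -` W \<inter> space N" using h W by auto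
  ultimately show "h -` V \<inter> space N \<in> sets N" by simp
qed (use h in simp)

lemma matched_mono: "matched d T x x' \<Longrightarrow> d \<le> d' \<Longrightarrow> T' \<le> T \<Longrightarrow> matched d' T' x x'"
  unfolding matched_def by (meson order_trans)

lemma Mconv_matched_upto:
  assumes M: "Mconv xk x" and c: "0 < c" "\<And>u. 0 \<le> u \<Longrightarrow> u < r \<Longrightarrow> c \<le> dE (x u) None" and d: "0 < d"
  shows "\<forall>\<^sub>F k in sequentially. matched d r x (xk k)"
proof -
  obtain T where T: "cadlag_upto x T" "r \<le> T \<or> dE (x T) None < c" "\<forall>\<^sub>F k in sequentially. matched d T x (xk k)"
    using M[unfolded Mconv_def, rule_format, OF c(1) d] by blast
  have "r \<le> T" using T(2) c(2)[of T] T(1) unfolding cadlag_upto_def by (metis not_le)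
  with T(3) show ?thesis by (auto elim!: eventually_mono intro: matched_mono)
qed

lemma matched_inverse:
  assumes "matched d T x x'" "0 \<le> T"
  obtains l where "time_homeo l" "\<And>s. 0 \<le> s \<Longrightarrow> s \<le> T \<Longrightarrow> \<bar>l s - s\<bar> \<le> d"
    "\<And>s. 0 \<le> s \<Longrightarrow> s \<le> T \<Longrightarrow> dE (x s) (x' (l s)) \<le> d"
    "\<And>v. 0 \<le> v \<Longrightarrow> v \<le> l T \<Longrightarrow> \<exists>w. 0 \<le> w \<and> w \<le> T \<and> l w = v \<and> \<bar>v - w\<bar> \<le> d \<and> dE (x w) (x' v) \<le> d"
proof -
  obtain l where l: "time_homeo l" "\<And>s. 0 \<le> s \<Longrightarrow> s \<le> T \<Longrightarrow> \<bar>l s - s\<bar> \<le> d"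
    "\<And>s. 0 \<le> s \<Longrightarrow> s \<le> T \<Longrightarrow> dE (x s) (x' (l s)) \<le> d" using assms(1) unfolding matched_def by blast
  note H = time_homeoD[OF l(1)]
  have "\<exists>w. 0 \<le> w \<and> w \<le> T \<and> l w = v \<and> \<bar>v - w\<bar> \<le> d \<and> dE (x w) (x' v) \<le> d" if v: "0 \<le> v" "v \<le> l T" for v
  proof -
    obtain w where w: "0 \<le> w" "l w = v" using H(5)[OF v(1)] by blast
    hence "w \<le> T" using H(4)[OF w(1) assms(2)] v by simp
    thus ?thesis using l(2,3)[OF w(1)] w by auto
  qed
  thus thesis using l by (intro that[of l]) auto
qed

lemma DL_paths: "x \<in> DL \<Longrightarrow> 0 \<le> t \<Longrightarrow> x t \<in> \<Omega>"
  using D_expD(1) D_loc_D_exp by blast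

lemma DL_right: "x \<in> DL \<Longrightarrow> 0 \<le> t \<Longrightarrow> 0 < e \<Longrightarrow> \<exists>d>0. \<forall>u. t \<le> u \<and> u < t + d \<longrightarrow> dE (x u) (x t) < e"
  using D_expD(3)[OF D_loc_D_exp] unfolding right_cts_def by blast

text \<open>
  The value at \<open>t\<close> is not a continuous function of the path; the open sets used here only ask for
  some values shortly after \<open>t\<close>.
\<close>

lemma coordinate_measurable_Some:
  assumes t: "0 \<le> t" and V: "openin E V" "None \<notin> V"
  shows "{x \<in> DL. x t \<in> V} \<in> sets BL"
proof -
  \<comment> \<open>Staying away from \<open>None\<close> up to \<open>r2\<close> brings
    \<open>r2\<close> within reach of local convergence, and the strict slack \<open>c < c'\<close>
    makes the set open.\<close>
  define A where "A n c = {x \<in> DL. \<exists>c'>c. \<exists>r1 r2. t < r1 \<and> r1 < r2 \<and> r2 < t + 1 / Suc n \<and>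
    (\<forall>u z. r1 \<le> u \<and> u \<le> r2 \<and> z \<in> \<Omega> - V \<longrightarrow> c' \<le> dE (x u) z) \<and> (\<forall>u. 0 \<le> u \<and> u \<le> r2 \<longrightarrow> c' \<le> dE (x u) None)}"
    for n :: nat and c :: real
  have AI: "y \<in> A n c" if "y \<in> DL" "c < c'" "t < r1" "r1 < r2" "r2 < t + 1 / Suc n"
    "\<And>u z. r1 \<le> u \<Longrightarrow> u \<le> r2 \<Longrightarrow> z \<in> \<Omega> - V \<Longrightarrow> c' \<le> dE (y u) z" "\<And>u. 0 \<le> u \<Longrightarrow> u \<le> r2 \<Longrightarrow> c' \<le> dE (y u) None"
    for y n c c' r1 r2
    unfolding A_def using that by blast
  have V\<Omega>: "V \<subseteq> \<Omega>" using openin_subset[OF V(1)] topspace_E by simp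
  have open_A: "openin (local_skorokhod X) (A n c)" if c: "0 \<le> c" for n c
    unfolding local_skorokhod_def openin_seq_topology
  proof (intro conjI allI ballI impI)
    show "A n c \<subseteq> DL" by (auto simp: A_def)
    fix xk x assume x: "x \<in> A n c" and xk: "range xk \<subseteq> DL \<and> local_skorokhod_conv X xk x"
    hence xD: "x \<in> DL" "\<And>k. xk k \<in> DL" by (auto simp: A_def)
    hence M: "Mconv xk x" using local_conv_imp_Mconv xk by blast
    obtain c' r1 r2 where A: "c < c'" "t < r1" "r1 < r2" "r2 < t + 1 / Suc n"
      "\<And>u z. r1 \<le> u \<Longrightarrow> u \<le> r2 \<Longrightarrow> z \<in> \<Omega> - V \<Longrightarrow> c' \<le> dE (x u) z" "\<And>u. 0 \<le> u \<Longrightarrow> u \<le> r2 \<Longrightarrow> c' \<le> dE (x u) None"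
      using x unfolding A_def by auto
    define d where "d = min ((r2 - r1) / 3) ((c' - c) / 2)"
    have d: "0 < d" "d \<le> (r2 - r1) / 3" "d \<le> (c' - c) / 2" using A(1,3) unfolding d_def min_def by (simp_all add: field_simps split: if_splits)
    have "\<forall>\<^sub>F k in sequentially. matched d r2 x (xk k)"
      by (rule Mconv_matched_upto[OF M, of c']) (use A c d in auto)
    thus "\<forall>\<^sub>F k in sequentially. xk k \<in> A n c"
    proof eventually_elim
      case (elim k)
      have r2: "0 \<le> r2" using A t by simp
      obtain l where l: "time_homeo l" "\<And>s. 0 \<le> s \<Longrightarrow> s \<le> r2 \<Longrightarrow> \<bar>l s - s\<bar> \<le> d"
        "\<And>v. 0 \<le> v \<Longrightarrow> v \<le> l r2 \<Longrightarrow> \<exists>w. 0 \<le> w \<and> w \<le> r2 \<and> l w = v \<and> \<bar>v - w\<bar> \<le> d \<and> dE (x w) (xk k v) \<le> d"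
        using matched_inverse[OF elim r2] by metis
      have lr: "r2 - d \<le> l r2" using l(2)[OF r2 order_refl] by auto
      have far: "c' - d \<le> dE (xk k v) z" if v: "0 \<le> v" "v \<le> r2 - d" and z: "z \<in> \<Omega>"
        "\<And>w. 0 \<le> w \<Longrightarrow> w \<le> r2 \<Longrightarrow> \<bar>v - w\<bar> \<le> d \<Longrightarrow> c' \<le> dE (x w) z" for v z
      proof -
        obtain w where w: "0 \<le> w" "w \<le> r2" "\<bar>v - w\<bar> \<le> d" "dE (x w) (xk k v) \<le> d"
          using l(3)[of v] v lr by auto
        thus ?thesis using z(2)[OF w(1,2,3)] E.triangle[OF DL_paths[OF xD(1) w(1)] DL_paths[OF xD(2) v(1)] z(1), of k] by simp
      qed
      have 1: "(c' + c) / 2 \<le> dE (xk k u) z" if "r1 + d \<le> u" "u \<le> r2 - d" "z \<in> \<Omega> - V" for u z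
      proof -
        have "c' - d \<le> dE (xk k u) z" using that A(2,5) t d by (intro far) auto
        thus ?thesis using d by (simp add: field_simps)
      qed
      have 2: "(c' + c) / 2 \<le> dE (xk k u) None" if "0 \<le> u" "u \<le> r2 - d" for u
      proof -
        have "c' - d \<le> dE (xk k u) None" using that A(6) by (intro far) auto
        thus ?thesis using d by (simp add: field_simps)
      qed
      show ?case
      proof (rule AI[of _ _ "(c' + c) / 2" "r1 + d" "r2 - d"])
        show "r1 + d < r2 - d" using d(2) A(3) by (simp add: field_simps)
        show "t < r1 + d" using A(2) d(1) by simp
        show "r2 - d < t + 1 / Suc n" using A(4) d(1) by simp
        show "c < (c' + c) / 2" using A(1) by (simp add: field_simps)
      qed (use xD 1 2 in simp_all)
    qed
  qed
  \<comment> \<open>One \<open>m\<close> for all \<open>n\<close>: the distance to the complement of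
    \<open>V\<close> is bounded below at times arbitrarily soon after \<open>t\<close>, and
    right-continuity excludes that \<open>x t\<close> itself lies in this complement.\<close>
  have "{x \<in> DL. x t \<in> V} = (\<Union>m. \<Inter>n. A n (1 / Suc m))"
  proof (intro set_eqI iffI)
    fix x assume x: "x \<in> {x \<in> DL. x t \<in> V}"
    hence xD: "x \<in> DL" and xt: "x t \<in> V" by auto
    have "openin E.mtopology V" using V(1) by (simp add: mtopology_E)
    then obtain r where r: "r > 0" "E.mball (x t) r \<subseteq> V" using xt unfolding E.openin_mtopology by blast
    have rz: "r \<le> dE (x t) z" if "z \<in> \<Omega> - V" for z
    proof (rule ccontr)
      assume "\<not> ?thesis"
      hence "z \<in> E.mball (x t) r" using that xt V\<Omega> by (auto simp: E.mball_def)
      hence "z \<in> V" using r(2) by (rule subsetD[rotated])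
      thus False using that by simp
    qed
    obtain d where d: "d > 0" "\<And>u. t \<le> u \<Longrightarrow> u < t + d \<Longrightarrow> dE (x u) (x t) < r / 2"
      using DL_right[OF xD t, of "r / 2"] r by auto
    have "x t \<noteq> None" using xt V(2) by metis
    hence "ennreal t < lifetime x" using D_expD(2)[OF D_loc_D_exp[OF xD] t] by (simp add: not_le)
    then obtain c0 where c0: "c0 > 0" "\<And>s. 0 \<le> s \<Longrightarrow> s \<le> t \<Longrightarrow> c0 \<le> dE (x s) None"
      using bounded_away[OF D_loc_D_exp[OF xD] t] by blast
    have far: "r / 2 \<le> dE (x u) z" if "t \<le> u" "u < t + d" "z \<in> \<Omega> - V" for u z
      using rz[OF that(3)] d(2)[OF that(1,2)] E.triangle[of "x t" "x u" z] E.commute[of "x t" "x u"]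
        DL_paths[OF xD, of u] DL_paths[OF xD t] that t by (auto simp del: E.mdist_pos_eq)
    define c' where "c' = min (r / 2) c0"
    have c': "0 < c'" using r c0 by (simp add: c'_def)
    obtain m where m: "1 / Suc m < c'" using nat_approx_posE[OF c'] by blast
    have "x \<in> A n (1 / Suc m)" for n
    proof -
      define e where "e = min d (1 / Suc n)"
      have e: "0 < e" "e \<le> d" "e \<le> 1 / Suc n" using d(1) by (auto simp: e_def)
      show ?thesis
      proof (rule AI[of _ _ c' "t + e / 3" "t + e / 2"])
        show "c' \<le> dE (x u) z" if "t + e / 3 \<le> u" "u \<le> t + e / 2" "z \<in> \<Omega> - V" for u z
          using far[of u z] that e by (auto simp: c'_def)
        show "c' \<le> dE (x u) None" if "0 \<le> u" "u \<le> t + e / 2" for u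
          using far[of u None] c0(2)[of u] that e V(2) by (cases "u \<le> t") (auto simp: c'_def)
        show "t + e / 2 < t + 1 / real (Suc n)" using e by linarith
      qed (use xD m e in auto)
    qed
    thus "x \<in> (\<Union>m. \<Inter>n. A n (1 / Suc m))" by blast
  next
    fix x assume "x \<in> (\<Union>m. \<Inter>n. A n (1 / Suc m))"
    then obtain m where m: "\<And>n. x \<in> A n (1 / Suc m)" by blast
    have xD: "x \<in> DL" using m[of 0] by (simp add: A_def)
    have "x t \<in> V"
    proof (rule ccontr)
      assume nV: "x t \<notin> V"
      obtain d where d: "d > 0" "\<And>u. t \<le> u \<Longrightarrow> u < t + d \<Longrightarrow> dE (x u) (x t) < 1 / Suc m"
        using DL_right[OF xD t, of "1 / Suc m"] by auto
      obtain n where n: "1 / Suc n < d" using nat_approx_posE[OF d(1)] by blast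
      obtain c' r1 r2 where "1 / Suc m < c'" "t < r1" "r1 < r2" "r2 < t + 1 / Suc n"
         "\<And>u z. r1 \<le> u \<Longrightarrow> u \<le> r2 \<Longrightarrow> z \<in> \<Omega> - V \<Longrightarrow> c' \<le> dE (x u) z"
        using m[of n] unfolding A_def by auto
      moreover have "x t \<in> \<Omega> - V" using nV DL_paths[OF xD t] by simp
      ultimately have "1 / Suc m < c'" "c' \<le> dE (x r1) (x t)" "dE (x r1) (x t) < 1 / Suc m"
        using d(2)[of r1] n by auto
      thus False by (meson less_le_trans less_asym)
    qed
    thus "x \<in> {x \<in> DL. x t \<in> V}" using xD by simp
  qed
  moreover have "(\<Union>m. \<Inter>n. A n (1 / Suc m)) \<in> sets BL"
    using open_A by (intro sets.countable_UN image_subsetI sets.countable_INT openin_borel_of) auto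
  ultimately show ?thesis by simp
qed

lemma coordinate_measurable:
  assumes t: "0 \<le> t" and V: "openin E V"
  shows "{x \<in> DL. x t \<in> V} \<in> sets BL"
proof (cases "None \<in> V")
  case False
  thus ?thesis using coordinate_measurable_Some assms by blast
next
  case True
  have "openin E (Some ` topspace X)" by simp
  hence S: "{x \<in> DL. x t \<in> Some ` topspace X} \<in> sets BL"
    by (intro coordinate_measurable_Some[OF t]) auto
  have "openin E (V \<inter> Some ` topspace X)" using V by (intro openin_Int) auto
  hence VS: "{x \<in> DL. x t \<in> V \<inter> Some ` topspace X} \<in> sets BL"
    by (intro coordinate_measurable_Some[OF t]) auto
  have "DL \<in> sets BL" using sets.top[of BL] by simp
  moreover have "{x \<in> DL. x t \<in> V} = {x \<in> DL. x t \<in> V \<inter> Some ` topspace X} \<union> (DL - {x \<in> DL. x t \<in> Some ` topspace X})"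
    using True DL_paths[OF _ t] openin_subset[OF V] unfolding \<Omega>_def by auto metis
  ultimately show ?thesis using S VS by auto
qed

end

section \<open>Measurability by coordinates\<close>

lemma near_identity_close:
  assumes l: "near_identity \<eta> l" and \<eta>: "exp \<eta> = 1 + d / (T + 1)" and s: "0 \<le> s" "s \<le> T" and d: "0 < d"
  shows "\<bar>l s - s\<bar> \<le> d"
proof -
  have "exp (- \<eta>) * (s - 0) \<le> l s - l 0" "l s - l 0 \<le> exp \<eta> * (s - 0)" "l 0 = 0"
    using l s unfolding near_identity_def by blast+
  hence b: "exp (- \<eta>) * s \<le> l s" "l s \<le> exp \<eta> * s" by auto
  have "1 - exp (- \<eta>) \<le> exp \<eta> - 1"
    using exp_ge_add_one_self[of "- \<eta>"] exp_ge_add_one_self[of \<eta>] by linarith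
  hence "(1 - exp (- \<eta>)) * s \<le> (exp \<eta> - 1) * s" using s by (simp add: mult_right_mono)
  moreover have "(exp \<eta> - 1) * s \<le> d"
  proof -
    have "d / (T + 1) * s \<le> d / (T + 1) * (T + 1)" using s d by (intro mult_left_mono) auto
    thus ?thesis using s \<eta> by simp
  qed
  ultimately show ?thesis using b by (simp add: abs_le_iff algebra_simps)
qed

context lc_space begin

definition rounding :: "nat \<Rightarrow> 'a option \<Rightarrow> nat" where
  "rounding n z = (LEAST i. dE z (den i) < 1 / (real n + 1))"

definition step_path :: "nat \<Rightarrow> nat list \<Rightarrow> 'a path" where
  "step_path n is s = (if nat \<lfloor>(real n + 1) * s\<rfloor> < length is then den (is ! nat \<lfloor>(real n + 1) * s\<rfloor>) else None)"

text \<open>Each cell is represented by the value at its right end, in keeping with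
  right-continuity. The \<open>Suc n * Suc n\<close> cells of length \<open>1 / (n + 1)\<close>
  reach up to time \<open>n + 1\<close>, and the result ranges over a countable set.\<close>

definition sample :: "nat \<Rightarrow> 'a path \<Rightarrow> nat list" where
  "sample n x = map (\<lambda>i. rounding n (x (real (Suc i) / (real n + 1)))) [0..<Suc n * Suc n]"

lemma rounding: "z \<in> \<Omega> \<Longrightarrow> dE z (den (rounding n z)) < 1 / (real n + 1)"
  unfolding rounding_def by (rule LeastI_ex) (intro den(2); simp)

lemma step_path_sample:
  assumes x: "x \<in> DL" and v: "0 \<le> v" and i: "i = nat \<lfloor>(real n + 1) * v\<rfloor>" "real (Suc i) / (real n + 1) < real n + 1"
  shows "dE (x (real (Suc i) / (real n + 1))) (step_path n (sample n x) v) < 1 / (real n + 1)"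
proof -
  have "real (Suc i) < (real n + 1) * (real n + 1)" using i(2) by (simp add: divide_less_eq)
  moreover have e: "real n + 1 = real (Suc n)" by simp
  ultimately have "Suc i < Suc n * Suc n" unfolding e of_nat_mult[symmetric] of_nat_less_iff by simp
  hence il: "i < Suc n * Suc n" by linarith
  hence "step_path n (sample n x) v = den (rounding n (x (real (Suc i) / (real n + 1))))"
    using i(1) by (simp add: step_path_def sample_def del: upt_Suc mult_Suc mult_Suc_right)
  thus ?thesis using rounding[OF DL_paths[OF x], of "real (Suc i) / (real n + 1)"] by simp
qed

text \<open>Sampling disturbs the steps of a partition of \<open>x\<close> only near their ends.
  Moving the jump times to suitable grid points repairs this by a time change whose slopes tend to
  one as the grid becomes fine compared with the shortest step.\<close>

lemma sample_Mconv:
  assumes x: "x \<in> DL"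
  shows "Mconv (\<lambda>n. step_path n (sample n x)) x"
  unfolding Mconv_def
proof (intro allI impI)
  fix c N d :: real assume c: "0 < c" and d: "0 < d"
  obtain T where T: "adm x T" "N \<le> T \<or> dE (x T) None < c" using adm_exhaust[OF x c] by blast
  have cad: "cadlag_upto x T" by (rule adm_cadlag(1)[OF x T(1)])
  have T0: "0 \<le> T" using T(1) by (simp add: adm_def)
  define \<eta> where "\<eta> = ln (1 + d / (T + 1))"
  have \<eta>: "0 < \<eta>" "exp \<eta> = 1 + d / (T + 1)" using d T0 by (auto simp: \<eta>_def ln_gt_zero_iff add_pos_pos)
  obtain m s where s: "s 0 = 0" "s m = T" "\<And>j. j < m \<Longrightarrow> s j < s (Suc j)"
    "\<And>j u v. j < m \<Longrightarrow> s j \<le> u \<Longrightarrow> u < s (Suc j) \<Longrightarrow> s j \<le> v \<Longrightarrow> v < s (Suc j) \<Longrightarrow> dE (x u) (x v) < d / 2"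
    using cadlag_partition[OF cad, of "d / 2"] d by auto
  have sm: "i \<le> j \<Longrightarrow> j \<le> m \<Longrightarrow> s i \<le> s j" for i j
  proof (induction j rule: dec_induct)
    case (step n)
    thus ?case using s(3)[of n] by auto
  qed simp
  have s0: "0 \<le> s j" if "j \<le> m" for j using sm[of 0 j] that s(1) by simp
  have sp: "0 < s (Suc j)" if "j < m" for j using s0[of j] s(3)[OF that] that by simp
  define gap where "gap = Min (insert 1 ((\<lambda>j. s (Suc j) - s j) ` {..<m}))"
  have gap: "0 < gap" "\<And>j. j < m \<Longrightarrow> gap \<le> s (Suc j) - s j" using s(3) by (auto simp: gap_def)
  define \<kappa> where "\<kappa> = 1 - exp (- \<eta>)"
  have "exp (- \<eta>) < 1" using \<eta> by simp
  hence \<kappa>0: "0 < \<kappa>" by (simp add: \<kappa>_def)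
  have \<kappa>: "\<kappa> \<le> exp \<eta> - 1"
    using exp_ge_add_one_self[of "- \<eta>"] exp_ge_add_one_self[of \<eta>] unfolding \<kappa>_def by linarith
  obtain \<delta> where \<delta>: "\<delta> > 0" "\<And>u. T \<le> u \<Longrightarrow> u < T + \<delta> \<Longrightarrow> dE (x u) (x T) < d / 2"
    using DL_right[OF x T0, of "d / 2"] d by auto
  \<comment> \<open>The four bounds serve, in this order, the slopes, right-continuity at
    \<open>T\<close>, the error of the values, and staying within the sampled times.\<close>
  define \<theta> where "\<theta> = Min {\<kappa> * gap, \<delta>, d / 2, 1}"
  have \<theta>: "0 < \<theta>" "\<theta> \<le> \<kappa> * gap" "\<theta> \<le> \<delta>" "\<theta> \<le> d / 2" "\<theta> \<le> 1" using \<kappa>0 gap(1) \<delta> d by (auto simp: \<theta>_def)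
  obtain M :: nat where M: "1 / \<theta> + T + 1 \<le> real M" using real_arch_simple by blast
  have "matched d T x (step_path n (sample n x))" if n: "M \<le> n" for n
  proof -
    define B where "B = real n + 1"
    have "1 / \<theta> + T + 1 < B" using M n by (simp add: B_def)
    moreover have "0 < 1 / \<theta>" using \<theta>(1) by simp
    ultimately have B: "1 / \<theta> < B" "T + 1 < B" "0 < B" using T0 by linarith+
    have B\<theta>: "1 / B < \<theta>" using B(1,3) \<theta>(1) by (simp add: field_simps)
    \<comment> \<open>Jump times are moved to the last grid point strictly before
      \<open>s j\<close>, because the cell starting there is the first one whose sample is taken at
      or after \<open>s j\<close>. The time \<open>0\<close> stays fixed.\<close>
    define s' where "s' j = (if j = 0 then 0 else (real_of_int \<lceil>B * s j\<rceil> - 1) / B)" for j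
    have s's: "s j - 1 / B \<le> s' j" "s' j \<le> s j" for j
    proof -
      have "B * s j \<le> real_of_int \<lceil>B * s j\<rceil>" "real_of_int \<lceil>B * s j\<rceil> - 1 \<le> B * s j" by linarith+
      thus "s j - 1 / B \<le> s' j" "s' j \<le> s j" using B(3) s(1) by (auto simp: s'_def field_simps)
    qed
    have slope: "exp (- \<eta>) * (s (Suc j) - s j) \<le> s' (Suc j) - s' j \<and> s' (Suc j) - s' j \<le> exp \<eta> * (s (Suc j) - s j)"
      if j: "j < m" for j
    proof -
      define D where "D = s (Suc j) - s j"
      define D' where "D' = s' (Suc j) - s' j"
      have "\<bar>D' - D\<bar> \<le> 1 / B" using s's[of j] s's[of "Suc j"] unfolding D_def D'_def by linarith
      also have "\<dots> \<le> \<kappa> * gap" using B\<theta> \<theta>(2) by simp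
      also have "\<dots> \<le> \<kappa> * D" using gap(2)[OF j] \<kappa>0 by (intro mult_left_mono) (auto simp: D_def)
      finally have DD: "\<bar>D' - D\<bar> \<le> \<kappa> * D" .
      have "0 < D" using s(3)[OF j] by (simp add: D_def)
      hence "\<kappa> * D \<le> (exp \<eta> - 1) * D" using \<kappa> by (intro mult_right_mono) auto
      hence "exp (- \<eta>) * D \<le> D'" "D' \<le> exp \<eta> * D"
        using DD by (auto simp: \<kappa>_def algebra_simps abs_le_iff)
      thus ?thesis by (simp add: D_def D'_def)
    qed
    have s'0: "s' 0 = 0" by (simp add: s'_def)
    obtain l where l: "near_identity \<eta> l" "\<And>j. j \<le> m \<Longrightarrow> l (s j) = s' j"
      using piecewise_linear_time_change[of \<eta> s s' m] \<eta> s(1,3) slope s'0 by (metis less_imp_le)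
    have h: "time_homeo l" by (rule bilipschitz_imp_time_homeo[OF near_identity_imp_bilipschitz[OF l(1)]])
    note H = time_homeoD[OF h]
    have tri: "dE a b \<le> d" if "dE a z < d / 2" "dE z b < 1 / B" "a \<in> \<Omega>" "b \<in> \<Omega>" "z \<in> \<Omega>" for a b z
      using E.triangle[OF that(3,5,4)] that(1,2) B\<theta> \<theta>(4) by linarith
    have sp\<Omega>: "step_path n is v \<in> \<Omega>" for "is" v by (simp add: step_path_def den(1))
    have dist: "dE (x u) (step_path n (sample n x) (l u)) \<le> d" if u: "0 \<le> u" "u \<le> T" for u
    proof -
      define v where "v = l u"
      define i where "i = nat \<lfloor>B * v\<rfloor>"
      define w where "w = real (Suc i) / B"
      have v0: "0 \<le> v" using H(1)[OF u(1)] by (simp add: v_def)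
      have ri: "real i = real_of_int \<lfloor>B * v\<rfloor>" using v0 B(3) by (simp add: i_def)
      have lower: "s j \<le> w" if j: "j \<le> m" "s' j \<le> v" for j
      proof (cases "j = 0")
        case True
        thus ?thesis using s(1) B(3) by (simp add: w_def)
      next
        case False
        hence "real_of_int \<lceil>B * s j\<rceil> - 1 \<le> B * v" using j(2) B(3) by (simp add: s'_def field_simps)
        hence "\<lceil>B * s j\<rceil> - 1 \<le> \<lfloor>B * v\<rfloor>" by linarith
        hence "B * s j \<le> real i + 1" using ri by linarith
        thus ?thesis using B(3) by (simp add: w_def field_simps)
      qed
      have w0: "0 \<le> w" using B(3) by (simp add: w_def)
      have "dE (x u) (x w) < d / 2 \<and> w < B"
      proof (cases "u = T")
        case True
        hence vm: "v = s' m" using l(2)[of m] s(2) by (simp add: v_def)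
        hence 1: "T \<le> w" using lower[of m] s(2) by simp
        have "w < T + \<theta>"
        proof -
          have "w \<le> T + 1 / B"
          proof (cases "m = 0")
            case True
            hence "v = 0" using vm by (simp add: s'_def)
            thus ?thesis using T0 by (simp add: w_def i_def)
          next
            case False
            have "B * v = real_of_int \<lceil>B * T\<rceil> - 1" using False vm s(2) B(3) by (simp add: s'_def)
            hence "real i \<le> B * T" using ri by linarith
            thus ?thesis using B(3) by (simp add: w_def field_simps)
          qed
          thus ?thesis using B\<theta> by simp
        qed
        hence "dE (x w) (x T) < d / 2" "w < B" using \<delta>(2)[OF 1] \<theta> B by auto
        thus ?thesis using True E.commute[of "x T" "x w"] by simp
      next
        case False
        hence "u < s m" using u s(2) by simp
        then obtain j where j: "j < m" "s j \<le> u" "u < s (Suc j)"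
          using locate_interval[of s u m] s(1) u by auto
        have "l (s j) \<le> l u" "l u < l (s (Suc j))" using H(3,4) s0[of j] s0[of "Suc j"] u j by auto
        hence v: "s' j \<le> v" "v < s' (Suc j)" using l(2) j by (auto simp: v_def)
        have 1: "s j \<le> w" using lower[of j] j v by simp
        have "B * v < real_of_int \<lceil>B * s (Suc j)\<rceil> - 1" using v(2) B(3) by (simp add: s'_def field_simps)
        hence "real_of_int \<lfloor>B * v\<rfloor> < real_of_int (\<lceil>B * s (Suc j)\<rceil> - 1)" by linarith
        hence "\<lfloor>B * v\<rfloor> + 1 \<le> \<lceil>B * s (Suc j)\<rceil> - 1" unfolding of_int_less_iff by simp
        hence "real_of_int \<lfloor>B * v\<rfloor> + 1 \<le> real_of_int \<lceil>B * s (Suc j)\<rceil> - 1" by linarith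
        moreover have "real_of_int \<lceil>B * s (Suc j)\<rceil> - 1 < B * s (Suc j)" by linarith
        ultimately have "real i + 1 < B * s (Suc j)" using ri by linarith
        hence 2: "w < s (Suc j)" using B(3) by (simp add: w_def field_simps)
        have "s (Suc j) \<le> T" using sm[of "Suc j" m] j s(2) by simp
        thus ?thesis using s(4)[OF j(1) j(2,3) 1 2] 2 B by simp
      qed
      hence d1: "dE (x u) (x w) < d / 2" and wB: "w < B" by auto
      have "dE (x w) (step_path n (sample n x) v) < 1 / B"
        unfolding w_def B_def by (rule step_path_sample[OF x v0]) (use wB in \<open>simp_all only: i_def w_def B_def\<close>)
      thus ?thesis unfolding v_def[symmetric] by (rule tri[OF d1 _ DL_paths[OF x u(1)] sp\<Omega> DL_paths[OF x w0]])
    qed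
    have time: "\<bar>l u - u\<bar> \<le> d" if u: "0 \<le> u" "u \<le> T" for u
      by (rule near_identity_close[OF l(1) \<eta>(2) u d])
    show ?thesis unfolding matched_def using h dist time by blast
  qed
  thus "\<exists>T. cadlag_upto x T \<and> (N \<le> T \<or> dE (x T) None < c) \<and>
      (\<forall>\<^sub>F n in sequentially. matched d T x (step_path n (sample n x)))"
    using cad T(2) unfolding eventually_sequentially by blast
qed

lemma mball_open: "openin E (E.mball z r)"
  using E.openin_mball[of z r] by (simp add: mtopology_E)

text \<open>A sample depends on finitely many coordinates and takes countably many values, so its
  misfit is measurable; the misfits of the samples converge to that of the path.\<close>

lemma misfit_measurable_coordinates:
  assumes h: "\<And>\<omega>. \<omega> \<in> space N \<Longrightarrow> h \<omega> \<in> DL"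
    and m: "\<And>t V. 0 \<le> t \<Longrightarrow> openin E V \<Longrightarrow> {\<omega> \<in> space N. h \<omega> t \<in> V} \<in> sets N"
  shows "(\<lambda>\<omega>. misfit y (h \<omega>)) \<in> borel_measurable N"
proof (rule borel_measurable_LIMSEQ_real)
  have near: "{\<omega> \<in> space N. dE (h \<omega> t) (den i) < r} \<in> sets N" if t: "0 \<le> t" for t i r
  proof -
    have "{\<omega> \<in> space N. dE (h \<omega> t) (den i) < r} = {\<omega> \<in> space N. h \<omega> t \<in> E.mball (den i) r}"
      using DL_paths[OF h t] den(1) by (auto simp: E.mball_def E.commute)
    thus ?thesis using m[OF t mball_open] by simp
  qed
  have rnd: "{\<omega> \<in> space N. rounding n (h \<omega> t) = i} \<in> sets N" if t: "0 \<le> t" for n t i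
  proof -
    have "rounding n z = i \<longleftrightarrow> dE z (den i) < 1 / (real n + 1) \<and> (\<forall>j\<in>{..<i}. \<not> dE z (den j) < 1 / (real n + 1))"
      if z: "z \<in> \<Omega>" for z
    proof
      assume eq: "rounding n z = i"
      have "\<not> dE z (den j) < 1 / (real n + 1)" if "j < i" for j
        using not_less_Least[of j "\<lambda>j. dE z (den j) < 1 / (real n + 1)"] that eq[unfolded rounding_def] by simp
      thus "dE z (den i) < 1 / (real n + 1) \<and> (\<forall>j\<in>{..<i}. \<not> dE z (den j) < 1 / (real n + 1))"
        using rounding[OF z, of n] eq by simp
    next
      assume *: "dE z (den i) < 1 / (real n + 1) \<and> (\<forall>j\<in>{..<i}. \<not> dE z (den j) < 1 / (real n + 1))"
      show "rounding n z = i" unfolding rounding_def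
      proof (rule Least_equality)
        fix j assume "dE z (den j) < 1 / (real n + 1)"
        thus "i \<le> j" using * by (meson lessThan_iff not_le)
      qed (use * in simp)
    qed
    hence "{\<omega> \<in> space N. rounding n (h \<omega> t) = i} = {\<omega> \<in> space N. dE (h \<omega> t) (den i) < 1 / (real n + 1)} -
        (\<Union>j\<in>{..<i}. {\<omega> \<in> space N. dE (h \<omega> t) (den j) < 1 / (real n + 1)})"
      using DL_paths[OF h t] by auto
    thus ?thesis using near[OF t] by auto
  qed
  have smp: "(\<lambda>\<omega>. sample n (h \<omega>)) \<in> measurable N (count_space UNIV)" for n
    unfolding measurable_count_space_eq2_countable
  proof (intro conjI ballI)
    fix ks :: "nat list"
    have "sample n x = ks \<longleftrightarrow> length ks = Suc n * Suc n \<and> (\<forall>i\<in>{..<Suc n * Suc n}. rounding n (x (real (Suc i) / (real n + 1))) = ks ! i)" for x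
      unfolding sample_def by (auto simp: list_eq_iff_nth_eq simp del: upt_Suc mult_Suc mult_Suc_right)
    hence "(\<lambda>\<omega>. sample n (h \<omega>)) -` {ks} \<inter> space N =
       (if length ks = Suc n * Suc n then space N \<inter> (\<Inter>i\<in>{..<Suc n * Suc n}. {\<omega> \<in> space N. rounding n (h \<omega> (real (Suc i) / (real n + 1))) = ks ! i}) else {})"
      by (auto simp del: mult_Suc mult_Suc_right)
    also have "\<dots> \<in> sets N"
    proof (cases "length ks = Suc n * Suc n")
      case True
      have "(\<Inter>i\<in>{..<Suc n * Suc n}. {\<omega> \<in> space N. rounding n (h \<omega> (real (Suc i) / (real n + 1))) = ks ! i}) \<in> sets N"
        by (intro sets.finite_INT rnd) auto
      thus ?thesis unfolding if_P[OF True] by (rule sets.Int[OF sets.top])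
    qed simp
    finally show "(\<lambda>\<omega>. sample n (h \<omega>)) -` {ks} \<inter> space N \<in> sets N" .
  qed auto
  show "(\<lambda>\<omega>. misfit y (step_path n (sample n (h \<omega>)))) \<in> borel_measurable N" for n
    by (rule measurable_compose[OF smp, of "\<lambda>ks. misfit y (step_path n ks)"]) simp
  fix \<omega> assume "\<omega> \<in> space N"
  thus "(\<lambda>n. misfit y (step_path n (sample n (h \<omega>)))) \<longlonglongrightarrow> misfit y (h \<omega>)"
    using DL_paths[OF h] by (intro Mconv_misfit sample_Mconv h) (auto simp: step_path_def den(1))
qed

lemma measurable_into_BL_coordinates:
  assumes "\<And>\<omega>. \<omega> \<in> space N \<Longrightarrow> h \<omega> \<in> DL"
    and "\<And>t V. 0 \<le> t \<Longrightarrow> openin E V \<Longrightarrow> {\<omega> \<in> space N. h \<omega> t \<in> V} \<in> sets N"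
  shows "h \<in> measurable N BL"
  using assms by (intro measurable_into_BL misfit_measurable_coordinates) auto

end

section \<open>The global Skorokhod topology\<close>

lemma time_homeo_extend:
  assumes l: "time_homeo l" and T: "0 \<le> T"
  shows "time_homeo (\<lambda>s. if s \<le> T then l s else l T + (s - T))"
proof -
  note H = time_homeoD[OF l]
  let ?m = "\<lambda>s. if s \<le> T then l s else l T + (s - T)"
  have "strict_mono_on {0..} ?m"
  proof (rule strict_mono_onI)
    fix r s :: real assume rs: "r \<in> {0..}" "s \<in> {0..}" "r < s"
    show "?m r < ?m s"
    proof (cases "r \<le> T")
      case True
      hence "l r \<le> l T" using H(4)[of r T] rs T by simp
      thus ?thesis using True rs H(3)[of r s] by auto
    qed (use rs in auto)
  qed
  moreover have "?m ` {0..} = {0..}"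
  proof (intro set_eqI iffI)
    fix y assume "y \<in> ?m ` {0..}"
    then obtain s where s: "0 \<le> s" "y = ?m s" by auto
    thus "y \<in> {0..}" using H(1)[OF s(1)] H(1)[OF T] by (cases "s \<le> T") simp_all
  next
    fix y :: real assume "y \<in> {0..}"
    hence y: "0 \<le> y" by simp
    show "y \<in> ?m ` {0..}"
    proof (cases "y \<le> l T")
      case True
      obtain s where s: "0 \<le> s" "l s = y" using H(5)[OF y] by blast
      hence "s \<le> T" using H(4)[OF s(1) T] True by simp
      thus ?thesis using s by (intro image_eqI[of _ _ s]) auto
    next
      case False
      thus ?thesis using T by (intro image_eqI[of _ _ "T + (y - l T)"]) auto
    qed
  qed
  ultimately show ?thesis by (simp add: time_homeo_def)
qed

context lc_space begin

abbreviation DG :: "'a path set" where "DG \<equiv> D_global X"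

lemma D_global_iff:
  "x \<in> DG \<longleftrightarrow> x \<in> {0..} \<rightarrow>\<^sub>E \<Omega> \<and> (\<forall>t\<ge>0. right_cts x t) \<and> (\<forall>t>0. \<exists>l. left_lim x t l)"
proof (cases "x \<in> {0..} \<rightarrow>\<^sub>E \<Omega>")
  case True
  hence x: "\<forall>s\<ge>0. x s \<in> \<Omega>" by auto
  have "(\<forall>t>0. \<exists>l. has_left_limit X x (ennreal t) l) \<longleftrightarrow> (\<forall>t>0. \<exists>l. left_lim x t l)"
    by (metis has_left_limit_iff[OF _ x])
  thus ?thesis using True
    by (simp add: D_global_def right_cts_iff[OF _ x] topspace_E[unfolded topspace_Alexandroff_compactification])
qed (auto simp: D_global_def topspace_E[unfolded topspace_Alexandroff_compactification])

lemma global_conv_imp_matched: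
  assumes conv: "global_skorokhod_conv X xk x" and x: "x \<in> DG" and xk: "\<And>k. xk k \<in> DG" and T: "0 \<le> T" and d: "0 < d"
  shows "\<forall>\<^sub>F k in sequentially. matched d T x (xk k)"
proof -
  obtain l where l: "\<And>k. strict_mono_on {0..} (l k) \<and> (\<exists>m. homeomorphism {0..} {0..} (l k) m)"
    "\<And>t. 0 \<le> t \<Longrightarrow> (\<lambda>k. SUP s\<in>{0..t}. ennreal (dE (x s) (xk k (l k s)))) \<longlonglongrightarrow> 0"
    "\<And>t. 0 \<le> t \<Longrightarrow> (\<lambda>k. SUP s\<in>{0..t}. ennreal \<bar>l k s - s\<bar>) \<longlonglongrightarrow> 0"
    using conv unfolding global_skorokhod_conv_def dE_def[symmetric] by blast
  have h: "time_homeo (l k)" for k using l(1)[of k] by (auto simp: time_homeo_def homeomorphism_def)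
  have "\<forall>\<^sub>F k in sequentially. (SUP s\<in>{0..T}. ennreal (dE (x s) (xk k (l k s)))) < ennreal d"
    using l(2)[OF T] d by (intro order_tendstoD(2)) auto
  moreover have "\<forall>\<^sub>F k in sequentially. (SUP s\<in>{0..T}. ennreal \<bar>l k s - s\<bar>) < ennreal d"
    using l(3)[OF T] d by (intro order_tendstoD(2)) auto
  ultimately show ?thesis
  proof eventually_elim
    case (elim k)
    have "\<bar>l k s - s\<bar> \<le> d \<and> dE (x s) (xk k (l k s)) \<le> d" if "0 \<le> s" "s \<le> T" for s
    proof -
      have s: "s \<in> {0..T}" using that by simp
      have "ennreal (dE (x s) (xk k (l k s))) \<le> ennreal d" "ennreal \<bar>l k s - s\<bar> \<le> ennreal d"
        using SUP_upper[OF s, of "\<lambda>s. ennreal (dE (x s) (xk k (l k s)))"] SUP_upper[OF s, of "\<lambda>s. ennreal \<bar>l k s - s\<bar>"] elim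
        by (meson less_imp_le order_trans)+
      thus ?thesis using d by simp
    qed
    thus ?case unfolding matched_def using h by blast
  qed
qed

lemma global_conv_imp_Mconv:
  assumes "global_skorokhod_conv X xk x" "x \<in> DG" "\<And>k. xk k \<in> DG"
  shows "Mconv xk x"
  unfolding Mconv_def
proof (intro allI impI)
  fix c N d :: real assume "0 < c" "0 < d"
  have "cadlag_upto x (max 0 N)" using assms(2) unfolding D_global_iff cadlag_upto_def by auto
  thus "\<exists>T. cadlag_upto x T \<and> (N \<le> T \<or> dE (x T) None < c) \<and> (\<forall>\<^sub>F k in sequentially. matched d T x (xk k))"
    using global_conv_imp_matched[OF assms, of "max 0 N" d] \<open>0 < d\<close> by (intro exI[of _ "max 0 N"]) auto
qed

text \<open>The time changes found for each horizon and accuracy depend on both; the diagonal choice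
  merges them into one sequence that works for all horizons.\<close>

lemma matched_imp_global_conv:
  assumes m: "\<And>N d. 0 \<le> N \<Longrightarrow> 0 < d \<Longrightarrow> \<forall>\<^sub>F k in sequentially. matched d N x (xk k)"
  shows "global_skorokhod_conv X xk x"
proof -
  define P where "P n l k \<longleftrightarrow> time_homeo l \<and> (\<forall>s. 0 \<le> s \<and> s \<le> real n \<longrightarrow>
      \<bar>l s - s\<bar> \<le> 1 / (real n + 1) \<and> dE (x s) (xk k (l s)) \<le> 1 / (real n + 1))" for n l k
  have "\<forall>\<^sub>F k in sequentially. \<exists>l. P n l k" for n
    using m[of "real n" "1 / (real n + 1)"] by (simp add: matched_def P_def)
  then obtain L where L: "\<And>k. L k = (\<lambda>t. t) \<or> (\<exists>n. P n (L k) k)" "\<And>n. \<forall>\<^sub>F k in sequentially. \<exists>n'\<ge>n. P n' (L k) k"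
    using diagonal_choice[of P "\<lambda>t. t"] by blast
  have "time_homeo (\<lambda>t. t)" by (auto simp: time_homeo_def strict_mono_onI)
  hence h: "time_homeo (L k)" for k using L(1)[of k] by (auto simp: P_def)
  have ev: "\<forall>\<^sub>F k in sequentially. \<forall>s\<in>{0..t}. \<bar>L k s - s\<bar> \<le> r \<and> dE (x s) (xk k (L k s)) \<le> r" if r: "0 < r" for t r
  proof -
    obtain n :: nat where n: "1 / r + \<bar>t\<bar> \<le> real n" using real_arch_simple by blast
    from L(2)[of n] show ?thesis
    proof eventually_elim
      case (elim k)
      then obtain n' where n': "n \<le> n'" "P n' (L k) k" by blast
      have "0 < 1 / r" using r by simp
      hence "1 / r \<le> real n' + 1" "t \<le> real n'" using n n'(1) by linarith+
      hence "1 / (real n' + 1) \<le> r" using r by (simp add: field_simps)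
      thus ?case using n'(2) \<open>t \<le> real n'\<close> unfolding P_def by fastforce
    qed
  qed
  have "(\<lambda>k. SUP s\<in>{0..t}. ennreal (dE (x s) (xk k (L k s)))) \<longlonglongrightarrow> 0" "(\<lambda>k. SUP s\<in>{0..t}. ennreal \<bar>L k s - s\<bar>) \<longlonglongrightarrow> 0" for t
  proof -
    show "(\<lambda>k. SUP s\<in>{0..t}. ennreal (dE (x s) (xk k (L k s)))) \<longlonglongrightarrow> 0"
      by (rule tendsto_0_ennrealI, rule eventually_mono[OF ev]) (auto intro!: SUP_least ennreal_leI)
    show "(\<lambda>k. SUP s\<in>{0..t}. ennreal \<bar>L k s - s\<bar>) \<longlonglongrightarrow> 0"
      by (rule tendsto_0_ennrealI, rule eventually_mono[OF ev]) (auto intro!: SUP_least ennreal_leI)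
  qed
  moreover have "strict_mono_on {0..} (L k) \<and> (\<exists>m. homeomorphism {0..} {0..} (L k) m)" for k
    using h time_homeo_homeomorphism by (auto simp: time_homeo_def)
  ultimately show ?thesis unfolding global_skorokhod_conv_def dE_def[symmetric] by blast
qed

lemma misfit_continuous_global: "continuous_map (global_skorokhod X) euclideanreal (misfit y)"
  unfolding global_skorokhod_def
proof (rule continuous_map_from_seq_topology)
  fix xk x assume "range xk \<subseteq> DG" and x: "x \<in> DG" and c: "global_skorokhod_conv X xk x"
  hence xk: "\<And>k. xk k \<in> DG" by blast
  have "x s \<in> \<Omega>" "xk k s \<in> \<Omega>" if "0 \<le> s" for s k using x xk[of k] that unfolding D_global_iff by auto
  thus "limitin euclideanreal (\<lambda>k. misfit y (xk k)) (misfit y x) sequentially"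
    using Mconv_misfit[OF global_conv_imp_Mconv[OF c x xk]] by simp
qed simp

end

section \<open>Distance to the complement of the open set, and paths killed from inside it\<close>

locale lc_open = lc_space +
  fixes U :: "'a set"
  assumes U: "openin X U"
begin

text \<open>Since \<open>None\<close> belongs to the complement, this also bounds the distance to
  \<open>None\<close> from below: a path on which \<open>\<rho>\<close> has a positive lower bound
  stays in a compact subset of \<open>U\<close>.\<close>

definition \<rho> :: "'a option \<Rightarrow> real" where
  "\<rho> z = Inf (dE z ` (\<Omega> - Some ` U))"

lemma None_compl: "None \<in> \<Omega> - Some ` U" by auto

lemma compl_image_ne: "dE z ` (\<Omega> - Some ` U) \<noteq> {}"
  using None_compl by blast

lemma \<rho>_le: "w \<in> \<Omega> - Some ` U \<Longrightarrow> \<rho> z \<le> dE z w"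
  unfolding \<rho>_def by (rule cInf_lower) (auto intro!: bdd_belowI[of _ 0])

lemma \<rho>_nonneg: "0 \<le> \<rho> z"
  unfolding \<rho>_def by (rule cInf_greatest[OF compl_image_ne]) auto

lemma \<rho>_None_le: "\<rho> z \<le> dE z None"
  by (rule \<rho>_le[OF None_compl])

lemma \<rho>_Lipschitz:
  assumes "y \<in> \<Omega>" "z \<in> \<Omega>"
  shows "\<rho> y \<le> \<rho> z + dE y z"
proof -
  have "\<rho> y - dE y z \<le> \<rho> z"
    unfolding \<rho>_def[of z]
  proof (rule cInf_greatest[OF compl_image_ne])
    fix a assume "a \<in> dE z ` (\<Omega> - Some ` U)"
    then obtain w where w: "w \<in> \<Omega> - Some ` U" "a = dE z w" by blast
    thus "\<rho> y - dE y z \<le> a" using \<rho>_le[OF w(1), of y] E.triangle[of y z w] assms by auto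
  qed
  thus ?thesis by simp
qed

lemma \<rho>_zero: "z \<in> \<Omega> \<Longrightarrow> z \<notin> Some ` U \<Longrightarrow> \<rho> z = 0"
  using \<rho>_le[of z z] \<rho>_nonneg[of z] by auto

lemma \<rho>_pos_iff:
  assumes z: "z \<in> \<Omega>"
  shows "0 < \<rho> z \<longleftrightarrow> z \<in> Some ` U"
proof
  assume "z \<in> Some ` U"
  moreover have "openin E.mtopology (Some ` U)" using U by (simp add: mtopology_E)
  ultimately obtain r where r: "r > 0" "E.mball z r \<subseteq> Some ` U" unfolding E.openin_mtopology by blast
  have "r \<le> \<rho> z" unfolding \<rho>_def
  proof (rule cInf_greatest[OF compl_image_ne])
    fix a assume "a \<in> dE z ` (\<Omega> - Some ` U)"
    then obtain w where w: "w \<in> \<Omega>" "w \<notin> Some ` U" "a = dE z w" by blast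
    show "r \<le> a"
    proof (rule ccontr)
      assume "\<not> r \<le> a"
      hence "w \<in> E.mball z r" using w z by simp
      hence "w \<in> Some ` U" using r(2) by (rule subsetD[rotated])
      thus False using w(2) by simp
    qed
  qed
  thus "0 < \<rho> z" using r by simp
next
  assume "0 < \<rho> z"
  thus "z \<in> Some ` U" using \<rho>_zero[OF z] by force
qed

lemma \<rho>_gt_open: "openin E {z \<in> \<Omega>. c < \<rho> z}"
  unfolding mtopology_E[symmetric] E.openin_mtopology
proof (intro conjI allI impI)
  fix z assume z: "z \<in> {z \<in> \<Omega>. c < \<rho> z}"
  show "\<exists>r>0. E.mball z r \<subseteq> {z \<in> \<Omega>. c < \<rho> z}"
  proof (intro exI[of _ "\<rho> z - c"] conjI subsetI)
    fix y assume "y \<in> E.mball z (\<rho> z - c)"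
    thus "y \<in> {z \<in> \<Omega>. c < \<rho> z}" using \<rho>_Lipschitz[of z y] by auto
  qed (use z in simp)
qed auto

abbreviation LU :: "'a path set" where "LU \<equiv> left_limit_in X U"

lemma LU_DL: "x \<in> LU \<Longrightarrow> x \<in> DL"
  by (simp add: left_limit_in_def)

lemma LU_limit:
  assumes x: "x \<in> LU" and T: "lifetime x = ennreal T" "0 < T"
  shows "\<exists>p\<in>U. left_lim x T (Some p)"
proof -
  have "\<exists>l\<in>U. has_left_limit X x (lifetime x) (Some l)" using x T by (simp add: left_limit_in_def)
  thus ?thesis unfolding T(1) using has_left_limit_iff[OF T(2)] DL_paths[OF LU_DL[OF x]] by blast
qed

lemma LU_subset_DG: "LU \<subseteq> DG"
proof
  fix x assume x: "x \<in> LU"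
  note xD = D_loc_D_exp[OF LU_DL[OF x]]
  have lim: "\<exists>l. left_lim x t l" if t: "0 < t" for t
  proof (cases "lifetime x" "ennreal t" rule: linorder_cases)
    case greater
    thus ?thesis using D_expD(4)[OF xD t] by blast
  next
    case equal
    thus ?thesis using LU_limit[OF x _ t] by blast
  next
    case less
    then obtain T where T: "lifetime x = ennreal T" "0 \<le> T" by (cases "lifetime x") auto
    hence "T < t" using less by (simp add: ennreal_less_iff)
    have "x u = None" if "T \<le> u" for u
      using D_expD(2)[OF xD, of u] that T by (simp add: ennreal_leI)
    hence "left_lim x t None" unfolding left_lim_def
      using \<open>T < t\<close> T(2) by (auto intro!: exI[of _ "t - T"])
    thus ?thesis by blast
  qed
  have "x \<in> {0..} \<rightarrow>\<^sub>E \<Omega>" using xD unfolding D_exp_iff by blast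
  thus "x \<in> DG" unfolding D_global_iff using D_expD(3)[OF xD] lim by blast
qed

lemma coordinate_open_measurable:
  assumes "0 \<le> t" "openin E V" shows "{x \<in> DL. x t \<in> V} \<in> sets BL" "{x \<in> DL. x t \<notin> V} \<in> sets BL"
proof -
  show m: "{x \<in> DL. x t \<in> V} \<in> sets BL" by (rule coordinate_measurable[OF assms])
  have eq: "{x \<in> DL. x t \<notin> V} = space BL - {x \<in> DL. x t \<in> V}" by auto
  show "{x \<in> DL. x t \<notin> V} \<in> sets BL" unfolding eq by (rule sets.compl_sets[OF m])
qed

lemma coordinate_None_measurable:
  assumes "0 \<le> t" shows "{x \<in> DL. x t = None} \<in> sets BL" "{x \<in> DL. x t \<noteq> None} \<in> sets BL"
proof -
  have iff: "x t = None \<longleftrightarrow> x t \<notin> Some ` topspace X" if "x \<in> DL" for x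
    using DL_paths[OF that assms] unfolding \<Omega>_def by (cases "x t") auto
  hence iff': "x t \<noteq> None \<longleftrightarrow> x t \<in> Some ` topspace X" if "x \<in> DL" for x
    using that by simp
  have "{x \<in> DL. x t = None} = {x \<in> DL. x t \<notin> Some ` topspace X}"
    by (rule Collect_cong, rule conj_cong[OF refl iff])
  moreover have "{x \<in> DL. x t \<noteq> None} = {x \<in> DL. x t \<in> Some ` topspace X}"
    by (rule Collect_cong, rule conj_cong[OF refl iff'])
  ultimately show "{x \<in> DL. x t = None} \<in> sets BL" "{x \<in> DL. x t \<noteq> None} \<in> sets BL"
    using coordinate_open_measurable[OF assms, of "Some ` topspace X"] by auto
qed

lemma right_cts_limit_le:
  assumes "x \<in> DL" "0 \<le> t" "t < b" and f: "\<And>y z. y \<in> \<Omega> \<Longrightarrow> z \<in> \<Omega> \<Longrightarrow> f y \<le> f z + dE y z"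
    and c: "\<And>r. r \<in> \<rat> \<Longrightarrow> t < r \<Longrightarrow> r < b \<Longrightarrow> c \<le> f (x r)"
  shows "c \<le> f (x t)"
proof (rule field_le_epsilon)
  fix e :: real assume "0 < e"
  then obtain d where d: "d > 0" "\<And>u. t \<le> u \<Longrightarrow> u < t + d \<Longrightarrow> dE (x u) (x t) < e"
    using DL_right[OF assms(1,2)] by blast
  obtain r where r: "r \<in> \<rat>" "t < r" "r < min b (t + d)"
    using Rats_dense_in_real[of t "min b (t + d)"] assms(3) d(1) by auto
  hence "c \<le> f (x r)" using c by auto
  also have "\<dots> \<le> f (x t) + dE (x r) (x t)" using DL_paths[OF assms(1)] r assms(2) by (intro f) auto
  finally show "c \<le> f (x t) + e" using d(2)[of r] r by auto
qed

text \<open>A left limit in \<open>U\<close> amounts to a lower bound for \<open>\<rho>\<close>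
  shortly before the killing: such a bound makes the path relatively compact, \<open>D_loc\<close>
  then supplies the limit, and \<open>\<rho>\<close> is positive there. Rational times suffice by
  right-continuity, whence measurability.\<close>

lemma LU_eq:
  "LU = {x \<in> DL. x 0 = None} \<union> (\<Inter>n. {x \<in> DL. x (real n) \<noteq> None}) \<union>
     (\<Union>m. \<Union>q\<in>{q\<in>\<rat>. 0 \<le> q}. {x \<in> DL. x q \<noteq> None} \<inter>
       (\<Inter>r\<in>{r\<in>\<rat>. q < r}. {x \<in> DL. x r = None} \<union> {x \<in> DL. x r \<in> {z \<in> \<Omega>. 1 / Suc m < \<rho> z}}))"
  (is "_ = ?A \<union> ?B \<union> ?C")
proof (intro set_eqI iffI)
  fix x assume x: "x \<in> LU"
  note xL = LU_DL[OF x] and xD = D_loc_D_exp[OF LU_DL[OF x]]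
  consider "lifetime x = \<infinity>" | "lifetime x = 0" | T where "lifetime x = ennreal T" "0 < T"
    by (cases "lifetime x") (auto simp: less_le)
  thus "x \<in> ?A \<union> ?B \<union> ?C"
  proof cases
    case 1
    hence "x (real n) \<noteq> None" for n using D_expD(2)[OF xD, of "real n"] by (simp add: top_unique)
    hence "x \<in> ?B" using xL by blast
    thus ?thesis by blast
  next
    case 2
    thus ?thesis using xL D_expD(2)[OF xD, of 0] by auto
  next
    case 3
    then obtain p where p: "p \<in> U" "left_lim x T (Some p)" using LU_limit[OF x] by blast
    define c where "c = \<rho> (Some p)"
    have p\<Omega>: "Some p \<in> \<Omega>" using p U openin_subset by fastforce
    hence c: "0 < c" unfolding c_def using p by (subst \<rho>_pos_iff) auto
    obtain d where d: "d > 0" "d \<le> T" "\<And>u. T - d < u \<Longrightarrow> u < T \<Longrightarrow> dE (x u) (Some p) < c / 2"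
      using p(2) c unfolding left_lim_def by (meson half_gt_zero)
    obtain m where m: "1 / Suc m < c / 2" using nat_approx_posE[of "c / 2"] c by auto
    obtain q where q: "q \<in> \<rat>" "T - d < q" "q < T" using Rats_dense_in_real[of "T - d" T] d(1) by auto
    have "x q \<noteq> None" using D_expD(2)[OF xD, of q] q d 3 by (auto simp: not_le ennreal_less_iff)
    moreover have "x r = None \<or> x r \<in> {z \<in> \<Omega>. 1 / Suc m < \<rho> z}" if r: "q < r" for r
    proof (cases "r < T")
      case True
      have r0: "0 \<le> r" using q d r by simp
      have "c \<le> \<rho> (x r) + dE (Some p) (x r)" unfolding c_def by (rule \<rho>_Lipschitz[OF p\<Omega> DL_paths[OF xL r0]])
      moreover have "dE (Some p) (x r) < c / 2" using d(3)[of r] q r True E.commute[of "x r" "Some p"] by simp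
      ultimately show ?thesis using m DL_paths[OF xL r0] by auto
    next
      case False
      thus ?thesis using D_expD(2)[OF xD, of r] 3 by (simp add: ennreal_leI)
    qed
    ultimately have "x \<in> ?C" using xL q d by (intro UN_I[of m] UN_I[of q]) auto
    thus ?thesis by (rule UnI2)
  qed
next
  fix x assume x: "x \<in> ?A \<union> ?B \<union> ?C"
  hence xL: "x \<in> DL" by auto
  note xD = D_loc_D_exp[OF xL]
  have "\<exists>l\<in>U. has_left_limit X x (lifetime x) (Some l)" if lt: "0 < lifetime x" "lifetime x < \<infinity>"
  proof -
    obtain T where T: "lifetime x = ennreal T" "0 < T" using lt by (cases "lifetime x") auto
    have "x \<notin> ?A" using D_expD(2)[OF xD, of 0] lt by (auto simp: not_le)
    moreover have "x \<notin> ?B"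
    proof
      assume B: "x \<in> ?B"
      obtain n where "T \<le> real n" using real_arch_simple by blast
      hence "x (real n) = None" using D_expD(2)[OF xD, of "real n"] T by (simp add: ennreal_leI)
      moreover have "x (real n) \<noteq> None" using B by blast
      ultimately show False by blast
    qed
    ultimately have "x \<in> ?C" using x by blast
    then obtain m q where q: "q \<in> \<rat>" "0 \<le> q" "x q \<noteq> None"
      "\<And>r. r \<in> \<rat> \<Longrightarrow> q < r \<Longrightarrow> x r = None \<or> 1 / Suc m < \<rho> (x r)" by fastforce
    define c where "c = 1 / real (Suc m)"
    have c: "0 < c" by (simp add: c_def)
    have qT: "q < T" using D_expD(2)[OF xD q(2)] q(2,3) T by (simp add: not_le ennreal_less_iff)
    have big: "c \<le> \<rho> (x u)" if u: "q \<le> u" "u < T" for u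
    proof (rule right_cts_limit_le[OF xL _ u(2), of \<rho>])
      show "0 \<le> u" using u q by simp
      fix r assume r: "r \<in> \<rat>" "u < r" "r < T"
      hence "x r \<noteq> None" using D_expD(2)[OF xD, of r] T u q by (auto simp: not_le ennreal_less_iff)
      thus "c \<le> \<rho> (x r)" using q(4)[OF r(1)] r u by (auto simp: c_def)
    qed (rule \<rho>_Lipschitz)
    obtain c1 where c1: "c1 > 0" "\<And>s. 0 \<le> s \<Longrightarrow> s \<le> q \<Longrightarrow> c1 \<le> dE (x s) None"
    proof -
      have "ennreal q < lifetime x" using qT T q(2) by (simp add: ennreal_less_iff)
      thus ?thesis using bounded_away[OF xD q(2)] that by blast
    qed
    have "adm x T"
    proof (rule adm_if_away[OF xD less_imp_le[OF T(2)], of "min c c1"])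
      fix s :: real assume s: "0 \<le> s" "s < T"
      thus "min c c1 \<le> dE (x s) None"
        using c1(2)[OF s(1)] big[of s] \<rho>_None_le[of "x s"] by (cases "s \<le> q") auto
    qed (use c c1 in simp)
    then obtain p where p: "p \<in> topspace X" and ll: "left_lim x T (Some p)" using adm_cadlag(2)[OF xL _ T(2) order_refl] by blast
    have "c / 2 \<le> \<rho> (Some p)"
    proof -
      obtain d where d: "d > 0" "d \<le> T" "\<And>u. T - d < u \<Longrightarrow> u < T \<Longrightarrow> dE (x u) (Some p) < c / 2"
        using ll c unfolding left_lim_def by (meson half_gt_zero)
      obtain u where u: "max q (T - d) < u" "u < T" using dense[of "max q (T - d)" T] qT d by auto
      hence "\<rho> (x u) \<le> \<rho> (Some p) + dE (x u) (Some p)" using DL_paths[OF xL] q p by (intro \<rho>_Lipschitz) auto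
      thus ?thesis using big[of u] d(3)[of u] u by auto
    qed
    hence "Some p \<in> Some ` U" using c p \<rho>_pos_iff[of "Some p"] by auto
    thus ?thesis using ll has_left_limit_iff[OF T(2)] DL_paths[OF xL] T(1) by auto
  qed
  thus "x \<in> LU" using xL by (simp add: left_limit_in_def)
qed

lemma LU_measurable: "LU \<in> sets BL"
proof -
  have c: "countable {q\<in>(\<rat>::real set). P q}" for P
    by (rule countable_subset[OF _ countable_rat]) auto
  have C: "{x \<in> DL. x q \<noteq> None} \<inter>
       (\<Inter>r\<in>{r\<in>\<rat>. q < r}. {x \<in> DL. x r = None} \<union> {x \<in> DL. x r \<in> {z \<in> \<Omega>. b < \<rho> z}}) \<in> sets BL"
    if "0 \<le> q" for q b :: real
  proof (intro sets.Int sets.countable_INT' c)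
    obtain r where "r \<in> \<rat>" "q < r" "r < q + 1" using Rats_dense_in_real[of q "q + 1"] by auto
    thus "{r \<in> \<rat>. q < r} \<noteq> {}" by blast
    show "(\<lambda>r. {x \<in> DL. x r = None} \<union> {x \<in> DL. x r \<in> {z \<in> \<Omega>. b < \<rho> z}}) ` {r \<in> \<rat>. q < r} \<subseteq> sets BL"
      using that by (intro image_subsetI sets.Un coordinate_None_measurable coordinate_open_measurable \<rho>_gt_open) auto
  qed (use that coordinate_None_measurable in auto)
  show ?thesis unfolding LU_eq
    by (intro sets.Un sets.countable_UN' sets.countable_INT image_subsetI coordinate_None_measurable c C) auto
qed

text \<open>
  Local convergence to a path that is killed does not control the approximating paths after their
  killing time; they must not come back from a neighbourhood of \<open>None\<close>.
\<close>

definition returns :: "rat \<times> rat \<Rightarrow> 'a path set" where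
  "returns = (\<lambda>(N, c). \<Union>u\<in>{u\<in>\<rat>. 0 \<le> u}. \<Union>v\<in>{v\<in>\<rat>. u < v \<and> v < of_rat N}.
     {x \<in> DL. x u \<in> E.mball None (of_rat c / 2)} \<inter> {x \<in> DL. x v \<in> \<Omega> - {z \<in> \<Omega>. dE z None \<le> of_rat c}})"

lemma far_open: "openin E (\<Omega> - {z \<in> \<Omega>. dE z None \<le> c})"
proof -
  have "openin E.mtopology (\<Omega> - E.mcball None c)"
    using E.closedin_mcball[of None c] by (simp add: closedin_def)
  moreover have "\<Omega> - E.mcball None c = \<Omega> - {z \<in> \<Omega>. dE z None \<le> c}" by (auto simp: E.mcball_def E.commute)
  ultimately show ?thesis by (simp add: mtopology_E)
qed

lemma returns_measurable: "returns i \<in> sets BL"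
proof -
  have c: "countable {q\<in>(\<rat>::real set). P q}" for P
    by (rule countable_subset[OF _ countable_rat]) auto
  show ?thesis unfolding returns_def
    by (cases i, simp only: prod.case)
      (intro sets.countable_UN' image_subsetI c sets.Int coordinate_open_measurable mball_open far_open; simp)
qed

text \<open>The indicators of return events need not be continuous in the path, but for Borel sets
  it is enough that the added coordinates are measurable and that convergence of all of them implies
  global convergence on \<open>LU\<close>.\<close>

definition embG :: "'a path \<Rightarrow> nat \<Rightarrow> real" where
  "embG x n = (if even n then emb x (n div 2) else indicat_real (returns (from_nat (n div 2))) x)"

lemma embG_measurable: "embG \<in> borel_measurable BL"
proof (rule measurable_coordinatewise_then_product)
  fix n
  have "(\<lambda>x. emb x (n div 2)) \<in> borel_measurable BL"
    by (rule measurable_compose[OF emb_measurable borel_measurable_continuous_onI[OF continuous_on_product_coordinates]])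
  moreover have "indicat_real (returns (from_nat (n div 2))) \<in> borel_measurable BL"
    using returns_measurable by measurable
  ultimately show "(\<lambda>x. embG x n) \<in> borel_measurable BL"
    by (cases "even n") (simp_all add: embG_def)
qed

text \<open>Up to \<open>T\<close> local convergence matches the paths. At the matched time
  \<open>xk k\<close> is close to \<open>None\<close>, and as it does not return, it stays close
  until after \<open>N\<close>, while \<open>x\<close> is \<open>None\<close> from \<open>T\<close>
  on.\<close>

lemma killed_matched:
  assumes x: "x \<in> LU" and xk: "\<And>k. xk k \<in> LU" and M: "Mconv xk x"
    and ret: "\<And>i. x \<notin> returns i \<Longrightarrow> \<forall>\<^sub>F k in sequentially. xk k \<notin> returns i"
    and T: "lifetime x = ennreal T" "0 \<le> T" "T \<le> N" and d: "0 < d"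
  shows "\<forall>\<^sub>F k in sequentially. matched d N x (xk k)"
proof -
  note xL = LU_DL[OF x] and xkL = LU_DL[OF xk] and xD = D_loc_D_exp[OF LU_DL[OF x]]
  have None: "x u = None" if "T \<le> u" for u using D_expD(2)[OF xD, of u] T that by (simp add: ennreal_leI)
  have "adm x T"
  proof (cases "T = 0")
    case True
    thus ?thesis using T by (auto simp: adm_def relatively_compact_path_def intro!: exI[of _ "{}"])
  next
    case False
    then obtain p where p: "p \<in> U" "left_lim x T (Some p)" using LU_limit[OF x T(1)] T(2) by auto
    define c where "c = dE (Some p) None"
    have "p \<in> topspace X" using p U openin_subset by blast
    hence c: "0 < c" unfolding c_def by (intro dE_None_pos) auto
    obtain e where e: "e > 0" "e \<le> T" "\<And>u. T - e < u \<Longrightarrow> u < T \<Longrightarrow> dE (x u) (Some p) < c / 2"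
      using p(2) c unfolding left_lim_def by (meson half_gt_zero)
    have "ennreal (T - e / 2) < lifetime x" using e T by (simp add: ennreal_less_iff)
    then obtain c1 where c1: "c1 > 0" "\<And>s. 0 \<le> s \<Longrightarrow> s \<le> T - e / 2 \<Longrightarrow> c1 \<le> dE (x s) None"
      using bounded_away[OF xD, of "T - e / 2"] e by auto
    have "relatively_compact_path X x"
    proof (rule relatively_compact_if_away[OF xD, of "min c1 (c / 2)"])
      fix s :: real assume s: "0 \<le> s" "ennreal s < lifetime x"
      hence sT: "s < T" using T by (simp add: ennreal_less_iff)
      show "min c1 (c / 2) \<le> dE (x s) None"
      proof (cases "s \<le> T - e / 2")
        case False
        hence "dE (x s) (Some p) < c / 2" using e(3)[of s] e(1) sT by simp
        moreover have "c \<le> dE (x s) (Some p) + dE (x s) None"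
          using E.triangle[of "Some p" "x s" None] DL_paths[OF xL s(1)] \<open>p \<in> topspace X\<close> E.commute[of "x s" "Some p"]
          by (simp add: c_def)
        ultimately show ?thesis by simp
      next
        case True
        thus ?thesis using c1(2)[OF s(1)] by simp
      qed
    qed (use c1 c in simp)
    thus ?thesis using T by (simp add: adm_def)
  qed
  then obtain c0 where c0: "c0 > 0" "\<And>s. 0 \<le> s \<Longrightarrow> s < T \<Longrightarrow> c0 \<le> dE (x s) None" using adm_away[OF xL] by blast
  \<comment> \<open>Below \<open>c0\<close>, so that \<open>x\<close> comes within
    \<open>c / 2\<close> of \<open>None\<close> only at or after its killing and does not belong to
    the return event; below \<open>d\<close> for the final estimate.\<close>
  obtain c :: rat where c: "0 < (of_rat c :: real)" "of_rat c < min c0 d" using of_rat_dense[of 0 "min c0 d"] c0(1) d by auto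
  define C where "C = (of_rat c :: real)"
  have C: "0 < C" "C < c0" "C < d" using c by (auto simp: C_def)
  obtain N' :: rat where N': "N + d + 1 < (of_rat N' :: real)" using of_rat_dense[of "N + d + 1" "N + d + 2"] by auto
  have "x \<notin> returns (N', c)"
  proof
    assume "x \<in> returns (N', c)"
    then obtain u v where uv: "0 \<le> u" "u < v" "dE None (x u) < C / 2" "\<not> dE (x v) None \<le> C"
      by (auto simp: returns_def C_def)
    show False
    proof (cases "u < T")
      case True
      thus False using c0(2)[of u] uv C E.commute[of None "x u"] by simp
    next
      case False
      thus False using None[of v] uv C by simp
    qed
  qed
  from ret[OF this] have r: "\<forall>\<^sub>F k in sequentially. xk k \<notin> returns (N', c)" .
  define e where "e = C / 4"
  have e: "0 < e" "e < d" "e < C / 2" using C by (auto simp: e_def)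
  have "\<forall>\<^sub>F k in sequentially. matched e T x (xk k)"
    by (rule Mconv_matched_upto[OF M c0 e(1)])
  with r show ?thesis
  proof eventually_elim
    case (elim k)
    obtain l where l: "time_homeo l" "\<And>s. 0 \<le> s \<Longrightarrow> s \<le> T \<Longrightarrow> \<bar>l s - s\<bar> \<le> e"
      "\<And>s. 0 \<le> s \<Longrightarrow> s \<le> T \<Longrightarrow> dE (x s) (xk k (l s)) \<le> e"
      using elim(2) unfolding matched_def by blast
    note H = time_homeoD[OF l(1)]
    have lT: "0 \<le> l T" using H(1)[OF T(2)] .
    have nearT: "dE (xk k (l T)) None \<le> e" using l(3)[OF T(2) order_refl] None[of T] E.commute[of None "xk k (l T)"] by simp
    have stay: "dE (xk k v) None \<le> C" if v: "l T < v" "v < of_rat N'" for v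
    proof (rule ccontr)
      assume n: "\<not> ?thesis"
      \<comment> \<open>Return events are formulated with rational times; right-continuity moves
        \<open>l T\<close> and \<open>v\<close> to rational times slightly later.\<close>
      obtain a where a: "a > 0" "\<And>u. l T \<le> u \<Longrightarrow> u < l T + a \<Longrightarrow> dE (xk k u) (xk k (l T)) < C / 2 - e"
        using DL_right[OF xkL lT, of "C / 2 - e" k] e by auto
      obtain b where b: "b > 0" "\<And>u. v \<le> u \<Longrightarrow> u < v + b \<Longrightarrow> dE (xk k u) (xk k v) < dE (xk k v) None - C"
        using DL_right[OF xkL, of v "dE (xk k v) None - C" k] n lT v by auto
      obtain u where u: "u \<in> \<rat>" "l T < u" "u < min (l T + a) v" using Rats_dense_in_real[of "l T" "min (l T + a) v"] a v by auto
      obtain w where w: "w \<in> \<rat>" "v < w" "w < min (v + b) (of_rat N')" using Rats_dense_in_real[of v "min (v + b) (of_rat N')"] b v by auto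
      have pos: "0 \<le> u" "0 \<le> v" "0 \<le> w" using lT u v w by auto
      have "dE (xk k u) None < C / 2"
        using a(2)[of u] u nearT E.triangle[OF DL_paths[OF xkL pos(1)] DL_paths[OF xkL lT] None_in, of k k] by auto
      moreover have "C < dE (xk k w) None"
        using b(2)[of w] w E.triangle[OF DL_paths[OF xkL pos(2)] DL_paths[OF xkL pos(3)] None_in, of k k] E.commute[of "xk k v" "xk k w"] by auto
      ultimately have "xk k \<in> returns (N', c)"
        unfolding returns_def using u w pos v DL_paths[OF xkL pos(1)] DL_paths[OF xkL pos(3)] xkL E.commute[of None "xk k u"]
        by (simp only: prod.case, intro UN_I[of u] UN_I[of w]) (auto simp: C_def)
      thus False using elim(1) by simp
    qed
    define l' where "l' s = (if s \<le> T then l s else l T + (s - T))" for s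
    have "time_homeo l'" unfolding l'_def by (rule time_homeo_extend[OF l(1) T(2)])
    moreover have "\<bar>l' s - s\<bar> \<le> d \<and> dE (x s) (xk k (l' s)) \<le> d" if s: "0 \<le> s" "s \<le> N" for s
    proof (cases "s \<le> T")
      case True
      thus ?thesis using l(2,3)[OF s(1) True] e by (simp add: l'_def)
    next
      case False
      have b: "\<bar>l T - T\<bar> \<le> e" using l(2)[OF T(2) order_refl] .
      have "l T < l' s" "l' s < of_rat N'" using False b e s N' by (auto simp: l'_def)
      hence "dE (xk k (l' s)) None \<le> C" by (rule stay)
      thus ?thesis using None[of s] False C b e E.commute[of None "xk k (l' s)"] by (auto simp: l'_def)
    qed
    ultimately show ?case unfolding matched_def by blast
  qed
qed

lemma embG_imp_global_conv:
  assumes x: "x \<in> LU" and xk: "\<And>k. xk k \<in> LU" and conv: "(\<lambda>k. embG (xk k)) \<longlonglongrightarrow> embG x"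
  shows "global_skorokhod_conv X xk x"
proof (rule matched_imp_global_conv)
  fix N d :: real assume N: "0 \<le> N" and d: "0 < d"
  have c: "(\<lambda>k. embG (xk k) n) \<longlonglongrightarrow> embG x n" for n using conv by (simp add: tendsto_fun_iff)
  have "(\<lambda>k. emb (xk k)) \<longlonglongrightarrow> emb x"
    unfolding tendsto_fun_iff
  proof
    fix n show "(\<lambda>k. emb (xk k) n) \<longlonglongrightarrow> emb x n" using c[of "2 * n"] by (simp add: embG_def)
  qed
  hence M: "Mconv xk x" using emb_imp_Mconv[of x xk] LU_DL x xk by blast
  have ret: "\<forall>\<^sub>F k in sequentially. xk k \<notin> returns i" if "x \<notin> returns i" for i
  proof -
    have "(\<lambda>k. indicat_real (returns i) (xk k)) \<longlonglongrightarrow> indicat_real (returns i) x"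
      using c[of "2 * to_nat i + 1"] by (simp add: embG_def)
    hence "\<forall>\<^sub>F k in sequentially. indicat_real (returns i) (xk k) < 1"
      using that by (intro order_tendstoD(2)) auto
    thus ?thesis by eventually_elim (auto simp: indicator_def split: if_splits)
  qed
  note xD = D_loc_D_exp[OF LU_DL[OF x]]
  show "\<forall>\<^sub>F k in sequentially. matched d N x (xk k)"
  proof (cases "ennreal N < lifetime x")
    case True
    then obtain c where "c > 0" "\<And>s. 0 \<le> s \<Longrightarrow> s \<le> N \<Longrightarrow> c \<le> dE (x s) None" using bounded_away[OF xD N] by blast
    thus ?thesis by (intro Mconv_matched_upto[OF M, of c] d) auto
  next
    case False
    then obtain T where "lifetime x = ennreal T" "0 \<le> T" by (cases "lifetime x") (auto simp: top_unique)
    moreover hence "T \<le> N" using False N by (simp add: ennreal_less_iff not_less)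
    ultimately show ?thesis using killed_matched[OF x xk M ret _ _ _ d] by blast
  qed
qed

abbreviation GU :: "'a path topology" where "GU \<equiv> subtopology (global_skorokhod X) LU"

lemma topspace_GU [simp]: "topspace GU = LU"
  using LU_subset_DG by (auto simp: global_skorokhod_def)

text \<open>By the sequential characterisation, a set open for the global topology is relatively
  open in \<open>LU\<close> in the coordinates \<open>embG\<close>, and these are Borel for the
  local topology.\<close>

lemma openin_GU_measurable:
  assumes "openin GU V" shows "V \<in> sets BL"
proof -
  obtain G where G: "openin (global_skorokhod X) G" "V = G \<inter> LU" using assms by (auto simp: openin_subtopology)
  let ?W = "- closure (embG ` (LU - V))"
  have "embG x \<notin> closure (embG ` (LU - V))" if x: "x \<in> V" for x
  proof
    assume "embG x \<in> closure (embG ` (LU - V))"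
    then obtain z where z: "\<And>n. z n \<in> embG ` (LU - V)" "z \<longlonglongrightarrow> embG x" unfolding closure_sequential by blast
    hence "\<forall>n. \<exists>y. y \<in> LU - V \<and> z n = embG y" by blast
    then obtain xk where xk: "\<And>n. xk n \<in> LU - V" "\<And>n. z n = embG (xk n)" by metis
    have "z = (\<lambda>n. embG (xk n))" using xk(2) by auto
    hence "global_skorokhod_conv X xk x" using embG_imp_global_conv[of x xk] x G(2) xk(1) z(2) by auto
    moreover have "range xk \<subseteq> DG" using xk(1) LU_subset_DG by blast
    ultimately have "\<forall>\<^sub>F k in sequentially. xk k \<in> G"
      using G x unfolding global_skorokhod_def openin_seq_topology by auto
    then obtain k where "xk k \<in> G" using eventually_happens'[OF sequentially_bot] by blast
    thus False using xk(1)[of k] G(2) by simp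
  qed
  hence "V = LU \<inter> (embG -` ?W \<inter> space BL)"
    using G(2) closure_subset[of "embG ` (LU - V)"] LU_DL by auto
  moreover have "embG -` ?W \<inter> space BL \<in> sets BL"
    by (rule measurable_sets[OF embG_measurable]) (simp add: open_Compl borel_open)
  ultimately show ?thesis using LU_measurable by (metis sets.Int)
qed

text \<open>Misfits are continuous for the global topology, and globally open sets are Borel for the
  local one, whence the two inclusions. A law constructed on the local Borel sets thus restricts to
  the Borel sets of \<open>GU\<close>.\<close>

lemma sets_restrict_LU:
  assumes M: "sets M = sets BL"
  shows "sets (restrict_space M LU) = sets (borel_of GU)"
proof -
  have LU_M: "LU \<inter> space M \<in> sets M" using LU_measurable M sets_eq_imp_space_eq[OF M] LU_DL
    by (simp add: Int_absorb2 subset_iff)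
  have sp: "space M = DL" using sets_eq_imp_space_eq[OF M] by simp
  show ?thesis
  proof
    have id: "(\<lambda>x. x) \<in> measurable (borel_of GU) BL"
    proof (rule measurable_into_BL)
      show "(\<lambda>x. misfit y x) \<in> borel_measurable (borel_of GU)" for y
        by (intro continuous_map_measurable_borel_of continuous_map_from_subtopology misfit_continuous_global)
    qed (simp add: LU_DL)
    show "sets (restrict_space M LU) \<subseteq> sets (borel_of GU)"
    proof
      fix A assume "A \<in> sets (restrict_space M LU)"
      then obtain B where "B \<in> sets BL" "A = LU \<inter> B" using M by (auto simp: sets_restrict_space)
      thus "A \<in> sets (borel_of GU)" using measurable_sets[OF id, of B] unfolding space_borel_of topspace_GU
        by (simp add: Int_commute)
    qed
    show "sets (borel_of GU) \<subseteq> sets (restrict_space M LU)"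
      unfolding sets_borel_of
    proof (rule sets.sigma_sets_subset'[where M="restrict_space M LU"])
      show "{V. openin GU V} \<subseteq> sets (restrict_space M LU)"
      proof
        fix V assume "V \<in> {V. openin GU V}"
        hence "V \<in> sets M" "V \<subseteq> LU" using openin_GU_measurable M openin_subset[of GU V] by auto
        thus "V \<in> sets (restrict_space M LU)" using sets_restrict_space_iff[OF LU_M] by simp
      qed
      show "topspace GU \<in> sets (restrict_space M LU)"
        unfolding topspace_GU using sets.top[of "restrict_space M LU"] LU_DL sp by (simp add: space_restrict_space Int_absorb2 subset_iff)
    qed
  qed
qed

end

section \<open>Slowing down near the complement of the open set\<close>

text \<open>A sum of ramps: the \<open>n\<close>-th starts at \<open>2 * (1/2)^n\<close>, so at
  \<open>r \<le> 2 * (1/2)^n\<close> only later ramps count, and the running minima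
  \<open>\<theta>\<close> bound their sum. The factor \<open>2\<close> leaves room for the
  oscillation of a path around a point of level \<open>n\<close>.\<close>

lemma rate_function:
  fixes \<epsilon> :: "nat \<Rightarrow> real"
  assumes \<epsilon>: "\<And>n. 0 < \<epsilon> n"
  shows "\<exists>\<gamma>. continuous_on UNIV \<gamma> \<and> (\<forall>r\<le>(0::real). \<gamma> r = 0) \<and> (\<forall>r>0. 0 < \<gamma> r) \<and> (\<forall>r. \<gamma> r \<le> (1::real)) \<and>
    (\<forall>r s. r \<le> s \<longrightarrow> \<gamma> r \<le> \<gamma> s) \<and> (\<forall>r n. r \<le> 2 * (1/2)^n \<longrightarrow> \<gamma> r \<le> \<epsilon> n / (real n + 1))"
proof -
  define \<theta> where "\<theta> n = Min (insert 1 ((\<lambda>i. \<epsilon> i / (real i + 1)) ` {..n}))" for n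
  have \<theta>: "0 < \<theta> n" "\<theta> n \<le> 1" for n
    using \<epsilon> by (auto simp: \<theta>_def intro!: divide_pos_pos)
  have \<theta>3: "\<theta> n \<le> \<epsilon> n / (real n + 1)" for n
    unfolding \<theta>_def by (rule Min_le) auto
  have dec: "\<theta> n \<le> \<theta> m" if "m \<le> n" for m n
    unfolding \<theta>_def using that by (intro Min_antimono) auto
  define \<phi> where "\<phi> n r = min 1 (max 0 (r - 2 * (1/2)^n))" for n and r :: real
  define f where "f n r = \<theta> n * (1/2)^(n+2) * \<phi> n r" for n r
  have f: "0 \<le> f n r" "f n r \<le> \<theta> n * (1/2)^(n+2)" for n r
    using \<theta>(1)[of n] by (auto simp: f_def \<phi>_def intro!: mult_nonneg_nonneg mult_left_le)
  have sg: "(\<lambda>n. (1/2::real)^(n+2)) sums (1/2)"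
    using sums_mult[OF geometric_sums[of "1/2::real"], of "1/4"] by (simp add: power_add)
  have bound: "f n r \<le> (1/2)^(n+2)" for n r
  proof -
    have "\<theta> n * (1/2)^(n+2) \<le> 1 * (1/2)^(n+2)" by (rule mult_right_mono[OF \<theta>(2)]) simp
    thus ?thesis using f(2)[of n r] by linarith
  qed
  have summ: "summable (\<lambda>n. f n r)" for r
    by (rule summable_comparison_test'[OF sums_summable[OF sg], of 0]) (use f(1) bound in \<open>auto simp: abs_of_nonneg\<close>)
  define \<gamma> where "\<gamma> r = (\<Sum>n. f n r)" for r
  have "uniform_limit UNIV (\<lambda>n r. \<Sum>i<n. f i r) \<gamma> sequentially"
    unfolding \<gamma>_def by (rule Weierstrass_m_test[OF _ sums_summable[OF sg]]) (use f(1) bound in \<open>auto simp: abs_of_nonneg\<close>)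
  hence cont: "continuous_on UNIV \<gamma>"
    by (rule uniform_limit_theorem[rotated])
      (auto simp: f_def \<phi>_def intro!: always_eventually continuous_intros)
  have zero: "\<gamma> r = 0" if "r \<le> 0" for r
  proof -
    have "f n r = 0" for n
    proof -
      have "r - 2 * (1/2)^n \<le> 0" using that zero_less_power[of "1/2::real" n] by linarith
      thus ?thesis by (simp add: f_def \<phi>_def)
    qed
    thus ?thesis by (simp add: \<gamma>_def)
  qed
  have pos: "0 < \<gamma> r" if r: "0 < r" for r
  proof -
    obtain n where n: "(1/2::real)^n < r / 2" using real_arch_pow_inv[of "r / 2" "1/2"] r by auto
    have "0 < f n r" using n \<theta>(1)[of n] by (simp add: f_def \<phi>_def)
    also have "f n r \<le> \<gamma> r"
      unfolding \<gamma>_def using sum_le_suminf[OF summ, of "{n}" r] f(1) by simp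
    finally show ?thesis .
  qed
  have one: "\<gamma> r \<le> 1" for r
  proof -
    have "\<gamma> r \<le> (\<Sum>n. (1/2::real)^(n+2))" unfolding \<gamma>_def
      by (rule suminf_le[OF bound summ sums_summable[OF sg]])
    thus ?thesis using sums_unique[OF sg] by simp
  qed
  have mono: "\<gamma> r \<le> \<gamma> s" if "r \<le> s" for r s
    unfolding \<gamma>_def using that \<theta>(1)
    by (intro suminf_le[OF _ summ summ]) (auto simp: f_def \<phi>_def less_imp_le intro!: mult_left_mono)
  have small: "\<gamma> r \<le> \<epsilon> n / (real n + 1)" if r: "r \<le> 2 * (1/2)^n" for r n
  proof -
    have "f i r \<le> \<theta> n * (1/2)^(i+2)" for i
    proof (cases "i \<le> n")
      case True
      hence "(1/2::real)^n \<le> (1/2)^i" by (intro power_decreasing) auto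
      hence "r - 2 * (1/2)^i \<le> 0" using r by linarith
      hence "f i r = 0" by (simp add: f_def \<phi>_def)
      thus ?thesis using \<theta>(1)[of n] by simp
    next
      case False
      hence "\<theta> i * (1/2)^(i+2) \<le> \<theta> n * (1/2)^(i+2)" using dec[of n i] by (intro mult_right_mono) auto
      thus ?thesis using f(2)[of i r] by linarith
    qed
    hence "\<gamma> r \<le> (\<Sum>i. \<theta> n * (1/2)^(i+2))" unfolding \<gamma>_def
      by (rule suminf_le[OF _ summ sums_summable[OF sums_mult[OF sg]]])
    also have "\<dots> = \<theta> n * (1/2)" using sums_unique[OF sums_mult[OF sg, of "\<theta> n"]] by simp
    also have "\<dots> \<le> \<theta> n" using \<theta>(1)[of n] by simp
    also have "\<dots> \<le> \<epsilon> n / (real n + 1)" by (rule \<theta>3)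
    finally show ?thesis .
  qed
  show ?thesis by (intro exI[of _ \<gamma>] conjI allI impI cont) (simp_all add: zero pos one mono small del: mult_le_cancel_left_pos)
qed

section \<open>Semicontinuity of integrals along a weakly continuous family\<close>

context lc_space begin

lemma prob_measuresD:
  assumes "M \<in> prob_measures (local_skorokhod X)"
  shows "prob_space M" "sets M = sets BL" "space M = DL"
  using assms sets_eq_imp_space_eq[of M BL] by (auto simp: prob_measures_def)

lemma weak_continuous_prob:
  "continuous_map Y (weak_topology T) P \<Longrightarrow> a \<in> topspace Y \<Longrightarrow> P a \<in> prob_measures T"
  using continuous_map_image_subset_topspace unfolding topspace_weak_topology[symmetric] by fast

lemma continuous_emb_compose:
  fixes F :: "(nat \<Rightarrow> real) \<Rightarrow> real"
  assumes "continuous_on UNIV F"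
  shows "continuous_map (local_skorokhod X) euclideanreal (\<lambda>x. F (emb x))"
  using continuous_map_compose[OF continuous_emb, of euclideanreal F] assms by (simp add: o_def)

lemma integrable_emb:
  fixes F :: "(nat \<Rightarrow> real) \<Rightarrow> real"
  assumes M: "M \<in> prob_measures (local_skorokhod X)" and F: "continuous_on UNIV F" "\<And>z. \<bar>F z\<bar> \<le> B"
  shows "integrable M (\<lambda>x. F (emb x))"
proof -
  interpret prob_space M by (rule prob_measuresD(1)[OF M])
  have "(\<lambda>x. F (emb x)) \<in> borel_measurable BL"
    by (rule continuous_map_measurable_borel_of[OF continuous_emb_compose[OF F(1)]])
  hence "(\<lambda>x. F (emb x)) \<in> borel_measurable M"
    using measurable_cong_sets[OF prob_measuresD(2)[OF M] refl] by blast
  thus ?thesis using F(2) by (intro integrable_const_bound[where B=B]) auto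
qed

text \<open>
  The function \<open>h\<close> is upper semicontinuous only on the sets \<open>G m\<close>; its \<open>j\<close>-Lipschitz upper envelope over
  \<open>G m\<close> is continuous everywhere and decreases to \<open>h\<close> on \<open>G m\<close>.
\<close>

lemma integral_upper_semicontinuous:
  fixes h :: "'a path \<Rightarrow> real"
  assumes P: "continuous_map Y (weak_topology (local_skorokhod X)) P" and G: "\<And>m. G m \<in> sets BL"
    and tail: "\<And>a \<eta>. a \<in> topspace Y \<Longrightarrow> (0::real) < \<eta> \<Longrightarrow> \<exists>V m. openin Y V \<and> a \<in> V \<and> (\<forall>b\<in>V. measure (P b) (DL - G m) \<le> \<eta>)"
    and h: "h \<in> borel_measurable BL" "\<And>x. \<bar>h x\<bar> \<le> C"
    and seq: "\<And>m xk x q. (\<And>k. xk k \<in> G m) \<Longrightarrow> x \<in> G m \<Longrightarrow> (\<lambda>k. emb (xk k)) \<longlonglongrightarrow> emb x \<Longrightarrow> h x < q \<Longrightarrow> \<forall>\<^sub>F k in sequentially. h (xk k) < q"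
  shows "openin Y {a \<in> topspace Y. (\<integral>x. h x \<partial>P a) < t}"
proof (subst openin_subopen, intro ballI)
  fix a assume "a \<in> {a \<in> topspace Y. (\<integral>x. h x \<partial>P a) < t}"
  hence a: "a \<in> topspace Y" "(\<integral>x. h x \<partial>P a) < t" by auto
  note PM = weak_continuous_prob[OF P]
  have C0: "0 \<le> C" using h(2)[of undefined] by linarith
  \<comment> \<open>A quarter of the gap: one part for the complement of \<open>G m\<close> at
    \<open>a\<close>, one for the convergence of the envelopes, one for the complement at nearby
    \<open>b\<close>; the last keeps the inequality strict.\<close>
  define \<delta> where "\<delta> = (t - (\<integral>x. h x \<partial>P a)) / 4"
  have \<delta>: "0 < \<delta>" "t = (\<integral>x. h x \<partial>P a) + 4 * \<delta>" using a(2) by (simp_all add: \<delta>_def field_simps)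
  have "0 < \<delta> / (2 * C + 1)" using \<delta>(1) C0 by (intro divide_pos_pos) auto
  from tail[OF a(1) this] obtain V m where V: "openin Y V" "a \<in> V" "\<forall>b\<in>V. measure (P b) (DL - G m) \<le> \<delta> / (2 * C + 1)"
    by blast
  have off: "2 * C * measure (P b) (DL - G m) \<le> \<delta>" if "b \<in> V" for b
  proof -
    have "2 * C * measure (P b) (DL - G m) \<le> (2 * C + 1) * measure (P b) (DL - G m)" by (intro mult_right_mono) auto
    also have "\<dots> \<le> \<delta>" using V(3)[rule_format, OF that] C0 by (simp add: field_simps)
    finally show ?thesis .
  qed
  \<comment> \<open>Inserting \<open>- C\<close> keeps the supremum defined when \<open>G m\<close>
    is empty and bounds the envelope from below everywhere.\<close>
  define F where "F j z = Sup (insert (- C) ((\<lambda>x. h x - real j * dist (emb x) z) ` G m))" for j :: nat and z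
  have hC: "h x \<le> C" "- C \<le> h x" for x using h(2)[of x] by (auto simp: abs_le_iff)
  have bdd: "bdd_above (insert (- C) ((\<lambda>x. h x - real j * dist (emb x) z) ` G m))" for j z
  proof (rule bdd_aboveI[of _ C])
    fix y assume "y \<in> insert (- C) ((\<lambda>x. h x - real j * dist (emb x) z) ` G m)"
    then consider "y = - C" | x where "y = h x - real j * dist (emb x) z" by blast
    thus "y \<le> C"
    proof cases
      case (2 x)
      have "0 \<le> real j * dist (emb x) z" by simp
      thus ?thesis using 2 hC(1)[of x] by linarith
    qed (use C0 in simp)
  qed
  have Flow: "- C \<le> F j z" for j z unfolding F_def by (rule cSup_upper[OF _ bdd]) simp
  have Fge: "h x - real j * dist (emb x) z \<le> F j z" if "x \<in> G m" for j z x
    unfolding F_def by (rule cSup_upper[OF _ bdd]) (use that in blast)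
  have Fle: "F j z \<le> b" if b: "- C \<le> b" "\<And>x. x \<in> G m \<Longrightarrow> h x - real j * dist (emb x) z \<le> b" for j z b
    unfolding F_def by (rule cSup_least) (use b in auto)
  have FC: "F j z \<le> C" for j z
  proof (rule Fle)
    fix x
    have "0 \<le> real j * dist (emb x) z" by simp
    thus "h x - real j * dist (emb x) z \<le> C" using hC(1)[of x] by linarith
  qed (use C0 in simp)
  have FL: "F j z \<le> F j w + real j * dist z w" for j z w
  proof (rule Fle)
    have "0 \<le> real j * dist z w" by simp
    thus "- C \<le> F j w + real j * dist z w" using Flow[of j w] by linarith
    fix x assume x: "x \<in> G m"
    have "real j * dist (emb x) w \<le> real j * (dist (emb x) z + dist z w)" by (intro mult_left_mono dist_triangle) simp
    thus "h x - real j * dist (emb x) z \<le> F j w + real j * dist z w"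
      using Fge[OF x, of j w] by (simp add: distrib_left)
  qed
  have Fcont: "continuous_on UNIV (F j)" for j
  proof (rule lipschitz_on_continuous_on)
    show "(real j)-lipschitz_on UNIV (F j)"
    proof (rule lipschitz_onI)
      fix z w
      show "dist (F j z) (F j w) \<le> real j * dist z w"
        using FL[of j z w] FL[of j w z] by (simp add: dist_real_def abs_le_iff dist_commute)
    qed simp
  qed
  have Fabs: "\<bar>F j z\<bar> \<le> C" for j z using FC[of j z] Flow[of j z] by (simp add: abs_le_iff)
  have Flim: "(\<lambda>j. F j (emb x)) \<longlonglongrightarrow> h x" if x: "x \<in> G m" for x
  proof (rule order_tendstoI)
    show "\<forall>\<^sub>F j in sequentially. y < F j (emb x)" if "y < h x" for y
      using that Fge[OF x, of _ "emb x"] by (intro always_eventually allI) (simp add: less_le_trans)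
    fix y assume y: "h x < y"
    show "\<forall>\<^sub>F j in sequentially. F j (emb x) < y"
    proof (rule ccontr)
      assume "\<not> ?thesis"
      hence "\<forall>i. \<exists>j\<ge>i. y \<le> F j (emb x)" by (simp add: eventually_sequentially not_less)
      then obtain J where J: "\<And>i. i \<le> J i" "\<And>i. y \<le> F (J i) (emb x)" by metis
      \<comment> \<open>Near-maximisers \<open>xk\<close> exist for arbitrarily large slopes;
        boundedness of \<open>h\<close> forces them to converge to \<open>x\<close> in the
        coordinates \<open>emb\<close>, and \<open>h (xk i) > q > h x\<close> contradicts the
        semicontinuity on \<open>G m\<close>.\<close>
      define q where "q = (h x + y) / 2"
      have q: "h x < q" "q < y" using y by (auto simp: q_def)
      have "\<exists>x'\<in>G m. q < h x' - real (J i) * dist (emb x') (emb x)" for i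
      proof (rule ccontr)
        assume "\<not> ?thesis"
        hence "F (J i) (emb x) \<le> q" using q(1) hC(2)[of x] by (intro Fle) (auto simp: not_less)
        thus False using J(2)[of i] q(2) by linarith
      qed
      then obtain xk where xk: "\<And>i. xk i \<in> G m" "\<And>i. q < h (xk i) - real (J i) * dist (emb (xk i)) (emb x)" by metis
      have d: "real i * dist (emb (xk i)) (emb x) \<le> 2 * C" for i
      proof -
        have "real i * dist (emb (xk i)) (emb x) \<le> real (J i) * dist (emb (xk i)) (emb x)"
          using J(1)[of i] by (intro mult_right_mono) auto
        thus ?thesis using xk(2)[of i] hC(1)[of "xk i"] hC(2)[of x] q(1) by linarith
      qed
      have "(\<lambda>i. emb (xk i)) \<longlonglongrightarrow> emb x"
      proof (rule tendstoI)
        fix e :: real assume e: "0 < e"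
        obtain N :: nat where N: "2 * C / e < real N" using reals_Archimedean2 by blast
        have "dist (emb (xk i)) (emb x) < e" if i: "N \<le> i" for i
        proof (rule ccontr)
          assume "\<not> ?thesis"
          hence "real N * e \<le> real i * dist (emb (xk i)) (emb x)" using i e by (intro mult_mono) auto
          hence "real N * e \<le> 2 * C" using d[of i] by linarith
          thus False using N e by (simp add: field_simps)
        qed
        thus "\<forall>\<^sub>F i in sequentially. dist (emb (xk i)) (emb x) < e" by (auto simp: eventually_sequentially)
      qed
      hence "\<forall>\<^sub>F i in sequentially. h (xk i) < q" by (rule seq[OF xk(1) x _ q(1)])
      then obtain i where "h (xk i) < q" using eventually_happens'[OF sequentially_bot] by blast
      moreover have "0 \<le> real (J i) * dist (emb (xk i)) (emb x)" by simp
      ultimately show False using xk(2)[of i] by linarith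
    qed
  qed
  have meas: "f \<in> borel_measurable (P b)" if "b \<in> topspace Y" "f \<in> borel_measurable BL" for b and f :: "'a path \<Rightarrow> real"
    using measurable_cong_sets[OF prob_measuresD(2)[OF PM[OF that(1)]] refl] that(2) by blast
  have Gs: "DL - G m \<in> sets (P b)" if "b \<in> topspace Y" for b
    using sets.compl_sets[OF G[of m]] prob_measuresD(2)[OF PM[OF that]] by simp
  have hint: "integrable (P b) h" if b: "b \<in> topspace Y" for b
  proof -
    interpret prob_space "P b" by (rule prob_measuresD(1)[OF PM[OF b]])
    show ?thesis using h(2) by (intro integrable_const_bound[of _ C] AE_I2 meas[OF b h(1)]) simp
  qed
  have Fint: "integrable (P b) (\<lambda>x. F j (emb x))" if b: "b \<in> topspace Y" for b j
    by (rule integrable_emb[OF PM[OF b] Fcont Fabs])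
  have "\<exists>j. (\<integral>x. F j (emb x) \<partial>P a) < (\<integral>x. h x \<partial>P a) + 2 * \<delta>"
  proof -
    interpret prob_space "P a" by (rule prob_measuresD(1)[OF PM[OF a(1)]])
    \<comment> \<open>Off \<open>G m\<close> the envelopes need not approach \<open>h\<close>; there
      they are replaced by the constant \<open>C\<close>, which costs at most \<open>2 * C\<close>
      times the probability of the complement.\<close>
    define \<psi> where "\<psi> j x = F j (emb x) + (C - F j (emb x)) * indicat_real (DL - G m) x" for j x
    define \<psi>' where "\<psi>' x = h x + (C - h x) * indicat_real (DL - G m) x" for x
    have Fm: "(\<lambda>x. F j (emb x)) \<in> borel_measurable (P a)" for j using Fint[OF a(1)] by blast
    have \<psi>m: "\<psi> j \<in> borel_measurable (P a)" for j unfolding \<psi>_def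
      using Fm Gs[OF a(1)] by (intro borel_measurable_add borel_measurable_times borel_measurable_diff borel_measurable_indicator) auto
    have \<psi>'m: "\<psi>' \<in> borel_measurable (P a)" unfolding \<psi>'_def
      using meas[OF a(1) h(1)] Gs[OF a(1)] by (intro borel_measurable_add borel_measurable_times borel_measurable_diff borel_measurable_indicator) auto
    have \<psi>b: "\<bar>\<psi> j x\<bar> \<le> C" "F j (emb x) \<le> \<psi> j x" for j x
      using Fabs[of j "emb x"] FC[of j "emb x"] C0 by (auto simp: \<psi>_def indicator_def)
    have \<psi>'b: "\<bar>\<psi>' x\<bar> \<le> C" "\<psi>' x \<le> h x + 2 * C * indicat_real (DL - G m) x" for x
      using h(2)[of x] hC[of x] C0 by (auto simp: \<psi>'_def indicator_def)
    have int: "integrable (P a) (\<psi> j)" "integrable (P a) \<psi>'" for j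
      using \<psi>b(1) \<psi>'b(1) \<psi>m \<psi>'m by (auto intro!: integrable_const_bound[of _ C])
    have "(\<lambda>j. \<integral>x. \<psi> j x \<partial>P a) \<longlonglongrightarrow> (\<integral>x. \<psi>' x \<partial>P a)"
    proof (rule integral_dominated_convergence[where w="\<lambda>_. C"])
      show "AE x in P a. (\<lambda>j. \<psi> j x) \<longlonglongrightarrow> \<psi>' x"
      proof (rule AE_I2)
        fix x assume "x \<in> space (P a)"
        hence xD: "x \<in> DL" using prob_measuresD(3)[OF PM[OF a(1)]] by simp
        show "(\<lambda>j. \<psi> j x) \<longlonglongrightarrow> \<psi>' x"
        proof (cases "x \<in> G m")
          case True
          thus ?thesis using Flim[OF True] by (simp add: \<psi>_def \<psi>'_def)
        qed (use xD in \<open>simp add: \<psi>_def \<psi>'_def\<close>)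
      qed
      show "AE x in P a. norm (\<psi> j x) \<le> C" for j using \<psi>b(1) by (intro AE_I2) simp
    qed (use \<psi>m \<psi>'m in auto)
    moreover have "(\<integral>x. \<psi>' x \<partial>P a) < (\<integral>x. h x \<partial>P a) + 2 * \<delta>"
    proof -
      have ind: "integrable (P a) (\<lambda>x. 2 * C * indicat_real (DL - G m) x)"
        using Gs[OF a(1)] by (intro integrable_mult_right) (simp add: emeasure_eq_measure)
      have "(\<integral>x. \<psi>' x \<partial>P a) \<le> (\<integral>x. h x + 2 * C * indicat_real (DL - G m) x \<partial>P a)"
        by (intro integral_mono int Bochner_Integration.integrable_add hint[OF a(1)] ind \<psi>'b)
      also have "\<dots> = (\<integral>x. h x \<partial>P a) + 2 * C * measure (P a) (DL - G m)"
        using hint[OF a(1)] ind Gs[OF a(1)] by simp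
      finally show ?thesis using off[OF V(2)] \<delta>(1) by linarith
    qed
    ultimately have "\<forall>\<^sub>F j in sequentially. (\<integral>x. \<psi> j x \<partial>P a) < (\<integral>x. h x \<partial>P a) + 2 * \<delta>" by (rule order_tendstoD)
    then obtain j where "(\<integral>x. \<psi> j x \<partial>P a) < (\<integral>x. h x \<partial>P a) + 2 * \<delta>" using eventually_happens'[OF sequentially_bot] by blast
    moreover have "(\<integral>x. F j (emb x) \<partial>P a) \<le> (\<integral>x. \<psi> j x \<partial>P a)"
      by (intro integral_mono int Fint[OF a(1)] \<psi>b)
    ultimately show ?thesis by (intro exI[of _ j]) linarith
  qed
  then obtain j where j: "(\<integral>x. F j (emb x) \<partial>P a) < (\<integral>x. h x \<partial>P a) + 2 * \<delta>" by blast
  define W where "W = V \<inter> {b \<in> topspace Y. (\<integral>x. F j (emb x) \<partial>P b) \<in> {..<(\<integral>x. h x \<partial>P a) + 2 * \<delta>}}"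
  have "bounded ((\<lambda>x. F j (emb x)) ` topspace (local_skorokhod X))"
    using Fabs by (auto simp: bounded_iff intro!: exI[of _ C])
  hence "continuous_map Y euclideanreal (\<lambda>b. \<integral>x. F j (emb x) \<partial>P b)"
    by (rule weak_topology_continuous[OF P continuous_emb_compose[OF Fcont]])
  from openin_continuous_map_preimage[OF this, of "{..<(\<integral>x. h x \<partial>P a) + 2 * \<delta>}"] have "openin Y W"
    unfolding W_def by (intro openin_Int V(1)) simp
  moreover have "a \<in> W" unfolding W_def using V(2) a(1) j by simp
  moreover have "W \<subseteq> {b \<in> topspace Y. (\<integral>x. h x \<partial>P b) < t}"
  proof
    fix b assume "b \<in> W"
    hence b: "b \<in> V" "b \<in> topspace Y" "(\<integral>x. F j (emb x) \<partial>P b) < (\<integral>x. h x \<partial>P a) + 2 * \<delta>" by (auto simp: W_def)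
    interpret prob_space "P b" by (rule prob_measuresD(1)[OF PM[OF b(2)]])
    have ind: "integrable (P b) (\<lambda>x. 2 * C * indicat_real (DL - G m) x)"
      using Gs[OF b(2)] by (intro integrable_mult_right) (simp add: emeasure_eq_measure)
    have "(\<integral>x. h x \<partial>P b) \<le> (\<integral>x. F j (emb x) + 2 * C * indicat_real (DL - G m) x \<partial>P b)"
    proof (rule integral_mono[OF hint[OF b(2)] Bochner_Integration.integrable_add[OF Fint[OF b(2)] ind]])
      fix x assume "x \<in> space (P b)"
      hence xD: "x \<in> DL" using prob_measuresD(3)[OF PM[OF b(2)]] by simp
      show "h x \<le> F j (emb x) + 2 * C * indicat_real (DL - G m) x"
      proof (cases "x \<in> G m")
        case True
        thus ?thesis using Fge[OF True, of j "emb x"] by simp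
      next
        case False
        thus ?thesis using xD Flow[of j "emb x"] hC(1)[of x] by simp
      qed
    qed
    also have "\<dots> = (\<integral>x. F j (emb x) \<partial>P b) + 2 * C * measure (P b) (DL - G m)"
      using Fint[OF b(2)] ind Gs[OF b(2)] by simp
    finally have "(\<integral>x. h x \<partial>P b) < t" using off[OF b(1)] b(3) \<delta> by linarith
    thus "b \<in> {b \<in> topspace Y. (\<integral>x. h x \<partial>P b) < t}" using b(2) by simp
  qed
  ultimately show "\<exists>W. openin Y W \<and> a \<in> W \<and> W \<subseteq> {b \<in> topspace Y. (\<integral>x. h x \<partial>P b) < t}" by blast
qed

end

section \<open>Paths rushing through a level of the distance\<close>

context lc_open begin

text \<open>
  The paths that come within \<open>2\<^sup>-\<^sup>n\<close> of the complement of \<open>U\<close> before the time \<open>n\<close>, but rush through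
  this level: the clock is slowed down only by the time spent there.
\<close>

definition bad :: "nat \<Rightarrow> real \<Rightarrow> 'a path set" where
  "bad n e = {x \<in> DL. \<exists>s. 0 \<le> s \<and> s \<le> real n \<and> (1/2)^(n+1) \<le> \<rho> (x s) \<and> \<rho> (x s) \<le> (1/2)^n \<and>
     (\<forall>u. 0 \<le> u \<and> u < s \<longrightarrow> (1/2)^(n+1) \<le> \<rho> (x u)) \<and>
     \<not> (\<exists>a b. 0 \<le> a \<and> a \<le> s \<and> s \<le> b \<and> e \<le> b - a \<and> (\<forall>u. a \<le> u \<and> u < b \<longrightarrow> dE (x u) (x s) \<le> (1/2)^(n+2)))}"

lemma bad_mono: "e \<le> e' \<Longrightarrow> bad n e \<subseteq> bad n e'"
proof
  fix x assume e: "e \<le> e'" and x: "x \<in> bad n e"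
  hence "x \<in> DL" by (simp add: bad_def)
  obtain s where s: "0 \<le> s \<and> s \<le> real n \<and> (1/2)^(n+1) \<le> \<rho> (x s) \<and> \<rho> (x s) \<le> (1/2)^n \<and>
     (\<forall>u. 0 \<le> u \<and> u < s \<longrightarrow> (1/2)^(n+1) \<le> \<rho> (x u))"
    and n: "\<not> (\<exists>a b. 0 \<le> a \<and> a \<le> s \<and> s \<le> b \<and> e \<le> b - a \<and> (\<forall>u. a \<le> u \<and> u < b \<longrightarrow> dE (x u) (x s) \<le> (1/2)^(n+2)))"
    using x unfolding bad_def by blast
  have "\<not> (\<exists>a b. 0 \<le> a \<and> a \<le> s \<and> s \<le> b \<and> e' \<le> b - a \<and> (\<forall>u. a \<le> u \<and> u < b \<longrightarrow> dE (x u) (x s) \<le> (1/2)^(n+2)))"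
    using n order_trans[OF e] by blast
  thus "x \<in> bad n e'" using \<open>x \<in> DL\<close> s unfolding bad_def by blast
qed

text \<open>The times \<open>s k\<close> are bounded, so a subsequence tends to some
  \<open>r\<close>. On either side of \<open>r\<close> the limit path has small oscillation for a
  positive time, and the time changes hand this on to \<open>xk k\<close> around \<open>s k\<close>,
  giving stays longer than \<open>\<epsilon> k\<close>. The lower bound on \<open>\<rho>\<close>
  before \<open>s k\<close> keeps these times within the horizon of local convergence.\<close>

lemma bad_not_limit:
  assumes conv: "local_skorokhod_conv X xk x" and x: "x \<in> DL"
    and xk: "\<And>k. xk k \<in> bad n (\<epsilon> k)" and \<epsilon>: "\<epsilon> \<longlonglongrightarrow> 0"
  shows False
proof -
  have xkD: "xk k \<in> DL" for k using xk[of k] by (simp add: bad_def)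
  have "\<forall>k. \<exists>s. 0 \<le> s \<and> s \<le> real n \<and> (1/2)^(n+1) \<le> \<rho> (xk k s) \<and>
     (\<forall>u. 0 \<le> u \<and> u < s \<longrightarrow> (1/2)^(n+1) \<le> \<rho> (xk k u)) \<and>
     (\<forall>a b. 0 \<le> a \<longrightarrow> a \<le> s \<longrightarrow> s \<le> b \<longrightarrow> (\<forall>u. a \<le> u \<and> u < b \<longrightarrow> dE (xk k u) (xk k s) \<le> (1/2)^(n+2)) \<longrightarrow> b - a < \<epsilon> k)" (is "\<forall>k. ?Q k")
  proof
    fix k
    obtain s where "0 \<le> s" "s \<le> real n" "(1/2)^(n+1) \<le> \<rho> (xk k s)" "\<forall>u. 0 \<le> u \<and> u < s \<longrightarrow> (1/2)^(n+1) \<le> \<rho> (xk k u)"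
      and n: "\<not> (\<exists>a b. 0 \<le> a \<and> a \<le> s \<and> s \<le> b \<and> \<epsilon> k \<le> b - a \<and> (\<forall>u. a \<le> u \<and> u < b \<longrightarrow> dE (xk k u) (xk k s) \<le> (1/2)^(n+2)))"
      using xk[of k] unfolding bad_def by blast
    moreover have "b - a < \<epsilon> k" if "0 \<le> a" "a \<le> s" "s \<le> b" "\<forall>u. a \<le> u \<and> u < b \<longrightarrow> dE (xk k u) (xk k s) \<le> (1/2)^(n+2)" for a b
      using n that not_less by blast
    ultimately show "?Q k" by blast
  qed
  then obtain s where s: "\<And>k. 0 \<le> s k" "\<And>k. s k \<le> real n" "\<And>k. (1/2)^(n+1) \<le> \<rho> (xk k (s k))"
    "\<And>k u. 0 \<le> u \<Longrightarrow> u < s k \<Longrightarrow> (1/2)^(n+1) \<le> \<rho> (xk k u)"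
    "\<And>k a b. 0 \<le> a \<Longrightarrow> a \<le> s k \<Longrightarrow> s k \<le> b \<Longrightarrow> (\<And>u. a \<le> u \<Longrightarrow> u < b \<Longrightarrow> dE (xk k u) (xk k (s k)) \<le> (1/2)^(n+2)) \<Longrightarrow> b - a < \<epsilon> k"
    by metis
  have "\<forall>k. s k \<in> {0..real n}" using s by auto
  then obtain r \<phi> where r: "r \<in> {0..real n}" "strict_mono \<phi>" "(s \<circ> \<phi>) \<longlonglongrightarrow> r"
    using compact_Icc[of 0 "real n", unfolded compact_def] by metis
  \<comment> \<open>An eighth of the oscillation \<open>(1/2)^(n+2)\<close> allowed in
    \<open>bad\<close>: two oscillations of \<open>2 * h\<close> and two matching errors of at most
    \<open>h\<close> fit into it.\<close>
  define h :: real where "h = (1/2)^(n+5)"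
  have h: "0 < h" "(1/2)^(n+1) = 16 * h" "(1/2)^(n+2) = 8 * h" by (simp_all add: h_def power_add power_one_over)
  obtain T where T: "adm x T" "real n + 2 \<le> T \<or> dE (x T) None < (1/2)^(n+2)"
    using adm_exhaust[OF x, of "(1/2)^(n+2)" "real n + 2"] by auto
  have T0: "0 \<le> T" using T(1) by (simp add: adm_def)
  have clock: "\<forall>\<^sub>F k in sequentially. \<exists>l w. time_homeo l \<and> (\<forall>u. 0 \<le> u \<and> u \<le> T \<longrightarrow> \<bar>l u - u\<bar> \<le> \<delta> \<and> dE (x u) (xk k (l u)) \<le> \<delta>) \<and>
      0 \<le> w \<and> w < T \<and> l w = s k"
    if \<delta>: "0 < \<delta>" "\<delta> \<le> h" "\<delta> \<le> 1" for \<delta>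
  proof -
    have "\<forall>\<^sub>F k in sequentially. matched \<delta> T x (xk k)"
      by (rule local_conv_matched[OF conv x xkD T(1) \<delta>(1)])
    thus ?thesis
    proof eventually_elim
      case (elim k)
      obtain l where l: "time_homeo l" "\<And>u. 0 \<le> u \<Longrightarrow> u \<le> T \<Longrightarrow> \<bar>l u - u\<bar> \<le> \<delta>" "\<And>u. 0 \<le> u \<Longrightarrow> u \<le> T \<Longrightarrow> dE (x u) (xk k (l u)) \<le> \<delta>"
        using elim unfolding matched_def by blast
      note H = time_homeoD[OF l(1)]
      have "s k < l T"
      proof (rule ccontr)
        assume n: "\<not> s k < l T"
        have "T - \<delta> \<le> l T" using l(2)[OF T0 order_refl] by auto
        hence "\<not> real n + 2 \<le> T" using n s(2)[of k] \<delta>(3) by linarith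
        hence near: "dE (x T) None < 8 * h" using T(2) h by simp
        have "16 * h \<le> \<rho> (xk k (l T))"
          using s(3)[of k] s(4)[OF H(1)[OF T0], of k] n h by (cases "l T = s k") auto
        also have "\<dots> \<le> \<rho> (x T) + dE (xk k (l T)) (x T)"
          using DL_paths[OF x T0] DL_paths[OF xkD H(1)[OF T0]] by (intro \<rho>_Lipschitz) auto
        also have "\<dots> \<le> dE (x T) None + \<delta>"
          using \<rho>_None_le[of "x T"] l(3)[OF T0 order_refl] E.commute[of "xk k (l T)" "x T"] by simp
        finally show False using near \<delta>(2) h(1) by linarith
      qed
      moreover obtain w where w: "0 \<le> w" "l w = s k" using H(5)[OF s(1)] by blast
      ultimately have "w < T" using H(3)[OF w(1) T0] by simp
      thus ?case using l w by blast
    qed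
  qed
  have r0: "0 \<le> r" using r(1) by simp
  have ev_r: "\<forall>\<^sub>F j in sequentially. \<bar>s (\<phi> j) - r\<bar> < \<delta>" if "0 < \<delta>" for \<delta>
    using tendstoD[OF r(3) that] by (simp add: dist_real_def)
  have rT: "r \<le> T"
  proof (rule ccontr)
    assume n: "\<not> r \<le> T"
    define \<delta> where "\<delta> = min (min h 1) ((r - T) / 2)"
    have \<delta>: "0 < \<delta>" "\<delta> \<le> h" "\<delta> \<le> 1" "2 * \<delta> \<le> r - T" using n h by (auto simp: \<delta>_def min_def field_simps)
    have "\<forall>\<^sub>F j in sequentially. False"
      using ev_r[OF \<delta>(1)] eventually_subseq[OF r(2) clock[OF \<delta>(1-3)]]
    proof eventually_elim
      case (elim j)
      then obtain l w where lw: "\<And>u. 0 \<le> u \<Longrightarrow> u \<le> T \<Longrightarrow> \<bar>l u - u\<bar> \<le> \<delta>" "0 \<le> w" "w < T" "l w = s (\<phi> j)" by blast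
      hence "s (\<phi> j) \<le> w + \<delta>" using lw(1)[of w] by auto
      thus False using elim(1) lw(3) \<delta>(4) by linarith
    qed
    thus False by simp
  qed
  note cad = adm_cadlag[OF x T(1)]
  obtain d1 where d1: "d1 > 0" "\<And>u. r \<le> u \<Longrightarrow> u < r + d1 \<Longrightarrow> dE (x u) (x r) < 2 * h"
    using DL_right[OF x r0, of "2 * h"] h by auto
  obtain d2 y where d2: "d2 > 0" "y \<in> \<Omega>" "r \<noteq> 0 \<Longrightarrow> d2 \<le> r" "\<And>u. 0 \<le> u \<Longrightarrow> r - d2 < u \<Longrightarrow> u < r \<Longrightarrow> dE (x u) y < 2 * h"
  proof (cases "r = 0")
    case True
    thus ?thesis by (intro that[of 1 None]) auto
  next
    case False
    then obtain y where y: "left_lim x r y" using cad(2)[of r] r0 rT by auto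
    have "0 < 2 * h" using h by simp
    then obtain d where "d > 0" "d \<le> r" "\<forall>u. r - d < u \<and> u < r \<longrightarrow> dE (x u) y < 2 * h"
      using y unfolding left_lim_def by blast
    thus ?thesis using y by (intro that[of d y]) (auto simp: left_lim_def)
  qed
  \<comment> \<open>If \<open>r = T\<close>, the matched times \<open>w < T\<close> all lie to the
    left of \<open>r\<close>, and \<open>r1\<close> only has to keep \<open>\<omega>\<close>
    positive.\<close>
  define r1 where "r1 = (if r < T then min (r + d1) T else r + d1)"
  define \<omega> where "\<omega> = min (d2 / 2) (r1 - r)"
  have \<omega>: "0 < \<omega>" using d1 d2 by (auto simp: \<omega>_def r1_def)
  define \<delta> where "\<delta> = min (min h 1) (\<omega> / 4)"
  have \<delta>: "0 < \<delta>" "\<delta> \<le> h" "\<delta> \<le> 1" "4 * \<delta> \<le> \<omega>" using \<omega> h by (auto simp: \<delta>_def min_def field_simps)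
  have "\<forall>\<^sub>F k in sequentially. \<epsilon> k < \<omega> / 2" using \<epsilon> \<omega> by (intro order_tendstoD(2)) auto
  from eventually_subseq[OF r(2) this] ev_r[OF \<delta>(1)] eventually_subseq[OF r(2) clock[OF \<delta>(1-3)]]
  have "\<forall>\<^sub>F j in sequentially. False"
  proof eventually_elim
    case (elim j)
    define k where "k = \<phi> j"
    obtain l w where l: "time_homeo l" "\<And>u. 0 \<le> u \<Longrightarrow> u \<le> T \<Longrightarrow> \<bar>l u - u\<bar> \<le> \<delta>" "\<And>u. 0 \<le> u \<Longrightarrow> u \<le> T \<Longrightarrow> dE (x u) (xk k (l u)) \<le> \<delta>"
      and w: "0 \<le> w" "w < T" "l w = s k" using elim(3) unfolding k_def by blast
    note H = time_homeoD[OF l(1)]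
    have wr: "\<bar>w - r\<bar> < 2 * \<delta>" using l(2)[of w] w elim(2) unfolding k_def[symmetric] by linarith
    have main: False if ab: "0 \<le> a" "a \<le> w" "w < b" "b \<le> T" "\<omega> \<le> b - a" and z: "z \<in> \<Omega>"
      "\<And>u. a \<le> u \<Longrightarrow> u < b \<Longrightarrow> dE (x u) z < 2 * h" for a b z
    proof -
      have "l b - l a < \<epsilon> k"
      proof (rule s(5))
        show "0 \<le> l a" using H(1) ab by simp
        show "l a \<le> s k" "s k \<le> l b" using H(4)[of a w] H(4)[of w b] ab w by auto
        fix v assume v: "l a \<le> v" "v < l b"
        hence v0: "0 \<le> v" using H(1)[OF ab(1)] by simp
        obtain u where u: "0 \<le> u" "l u = v" using H(5)[OF v0] by blast
        have uab: "a \<le> u" "u < b" using v u H(4)[of a u] H(3)[of u b] ab w by auto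
        have uT: "u \<le> T" using uab ab by simp
        have in\<Omega>: "x u \<in> \<Omega>" "x w \<in> \<Omega>" "xk k v \<in> \<Omega>" "xk k (s k) \<in> \<Omega>"
          using DL_paths[OF x] DL_paths[OF xkD] u w v0 s(1) by auto
        have "dE (xk k v) (xk k (s k)) \<le> dE (xk k v) (x u) + (dE (x u) z + (dE z (x w) + dE (x w) (xk k (s k))))"
          using E.triangle[of "xk k v" "x u" "xk k (s k)"] E.triangle[of "x u" z "xk k (s k)"] E.triangle[of z "x w" "xk k (s k)"] in\<Omega> z(1)
          by linarith
        also have "\<dots> \<le> \<delta> + (2 * h + (2 * h + \<delta>))"
          using l(3)[OF u(1) uT] l(3)[of w] w u(2) z(2)[OF uab] z(2)[of w] ab E.commute[of "xk k v" "x u"] E.commute[of z "x w"]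
          by (intro add_mono) auto
        also have "\<dots> \<le> 8 * h" using \<delta>(2) h(1) by linarith
        finally show "dE (xk k v) (xk k (s k)) \<le> (1/2)^(n+2)" using h by simp
      qed
      moreover have "b - \<delta> \<le> l b" "l a \<le> a + \<delta>" using l(2)[of a] l(2)[of b] ab w by auto
      ultimately show False using elim(1) ab(5) \<delta>(4) unfolding k_def[symmetric] by linarith
    qed
    \<comment> \<open>The matched time \<open>w\<close> lies on one side of \<open>r\<close>, and
      the interval on that side is used; across \<open>r\<close> the path may jump.\<close>
    show False
    proof (cases "r \<le> w")
      case True
      hence rT': "r < T" using w by simp
      hence r1: "r1 = min (r + d1) T" by (simp add: r1_def)
      have "w < r1"
      proof -
        have "2 * \<delta> < \<omega>" "\<omega> \<le> r1 - r" using \<delta> \<omega> by (auto simp: \<omega>_def)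
        thus ?thesis using wr by linarith
      qed
      moreover have "\<omega> \<le> r1 - r" by (simp add: \<omega>_def)
      ultimately show False
        using True d1 r1 r0 DL_paths[OF x r0] by (intro main[of r r1 "x r"]) auto
    next
      case False
      hence rn: "r \<noteq> 0" using w by auto
      have a0: "0 \<le> r - d2 / 2" using d2(1,3) rn by auto
      have \<omega>d: "\<omega> \<le> d2 / 2" unfolding \<omega>_def by (rule min.cobounded1)
      hence "r - d2 / 2 \<le> w" using wr \<delta>(1,4) by linarith
      moreover have "\<omega> \<le> r - (r - d2 / 2)" using \<omega>d by simp
      ultimately show False
        using False d2 a0 rT by (intro main[of "r - d2 / 2" r y]) auto
    qed
  qed
  thus False by simp
qed

text \<open>The closure makes the set measurable, whereas \<open>bad\<close> quantifies over
  uncountably many times, and it makes the indicator upper semicontinuous in the coordinates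
  \<open>emb\<close>.\<close>

definition clbad :: "nat \<Rightarrow> real \<Rightarrow> 'a path set" where
  "clbad n e = {x \<in> DL. emb x \<in> closure (emb ` bad n e)}"

lemma clbad_measurable: "clbad n e \<in> sets BL"
proof -
  have "emb -` closure (emb ` bad n e) \<inter> space BL \<in> sets BL"
    by (rule measurable_sets[OF emb_measurable]) simp
  moreover have "emb -` closure (emb ` bad n e) \<inter> space BL = clbad n e" by (auto simp: clbad_def)
  ultimately show ?thesis by simp
qed

lemma bad_subset_clbad: "bad n e \<subseteq> clbad n e"
  using closure_subset[of "emb ` bad n e"] by (auto simp: clbad_def bad_def)

text \<open>A Dini argument: the closures decrease to the empty set, because ever faster paths have
  no limit, so their probabilities tend to zero at every \<open>a\<close>. Upper semicontinuity
  makes the sets of parameters with small probability open, and finitely many of them cover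
  \<open>C\<close>.\<close>

lemma clbad_uniformly_small:
  assumes P: "continuous_map Y (weak_topology (local_skorokhod X)) P" and C: "compactin Y C" and \<eta>: "0 < \<eta>"
  shows "\<exists>e>0. \<forall>a\<in>C. measure (P a) (clbad n e) \<le> \<eta>"
proof -
  note PM = weak_continuous_prob[OF P]
  have CY: "C \<subseteq> topspace Y" using C compactin_subset_topspace by blast
  define e where "e j = 1 / (real j + 1)" for j :: nat
  have e: "0 < e j" for j by (simp add: e_def)
  define F where "F j = clbad n (e j)" for j
  have dec: "F i \<subseteq> F j" if "j \<le> i" for i j
  proof -
    have "bad n (e i) \<subseteq> bad n (e j)" using that by (intro bad_mono) (simp add: e_def frac_le)
    hence "closure (emb ` bad n (e i)) \<subseteq> closure (emb ` bad n (e j))" by (intro closure_mono image_mono)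
    thus ?thesis by (auto simp: F_def clbad_def)
  qed
  have Fs: "F j \<in> sets (P a)" if "a \<in> topspace Y" for a j
    unfolding F_def using clbad_measurable prob_measuresD(2)[OF PM[OF that]] by simp
  have empty: "(\<Inter>j. F j) = {}"
  proof (rule equals0I)
    fix x assume x: "x \<in> (\<Inter>j. F j)"
    have "\<exists>y\<in>bad n (e j). dist (emb y) (emb x) < e j" for j
    proof -
      have "emb x \<in> closure (emb ` bad n (e j))" using x by (auto simp: F_def clbad_def)
      thus ?thesis using e[of j] unfolding closure_approachable by blast
    qed
    then obtain xk where xk: "\<And>j. xk j \<in> bad n (e j)" "\<And>j. dist (emb (xk j)) (emb x) < e j" by metis
    have xD: "x \<in> DL" using x by (auto simp: F_def clbad_def)
    have e0: "e \<longlonglongrightarrow> 0" unfolding e_def using LIMSEQ_inverse_real_of_nat by (simp add: inverse_eq_divide add.commute)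
    have "(\<lambda>j. dist (emb (xk j)) (emb x)) \<longlonglongrightarrow> 0"
      using xk(2) by (intro tendsto_sandwich[OF _ _ tendsto_const e0] always_eventually allI zero_le_dist) (rule less_imp_le)
    hence "(\<lambda>j. emb (xk j)) \<longlonglongrightarrow> emb x" by (rule tendsto_dist_iff[THEN iffD2])
    moreover have "xk j \<in> DL" for j using xk(1)[of j] by (simp add: bad_def)
    ultimately have "local_skorokhod_conv X xk x" using local_conv_iff_emb[of x xk] xD by simp
    thus False by (rule bad_not_limit[OF _ xD xk(1) e0])
  qed
  have op: "openin Y {a \<in> topspace Y. measure (P a) (F j) < \<eta>}" for j
  proof -
    have "openin Y {a \<in> topspace Y. (\<integral>x. indicat_real (F j) x \<partial>P a) < \<eta>}"
    \<comment> \<open>The indicator of a closed set is upper semicontinuous everywhere, so the whole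
      space can be taken for every \<open>G m\<close>.\<close>
    proof (rule integral_upper_semicontinuous[where G="\<lambda>_. DL" and C=1, OF P])
      show "DL \<in> sets BL" using sets.top[of BL] by simp
      show "\<exists>V m. openin Y V \<and> a \<in> V \<and> (\<forall>b\<in>V. measure (P b) (DL - DL) \<le> \<eta>)" if "a \<in> topspace Y" "0 < \<eta>" for a \<eta>
        using that by (intro exI[of _ "topspace Y"]) simp
      show "indicat_real (F j) \<in> borel_measurable BL" unfolding F_def using clbad_measurable by simp
      show "\<bar>indicat_real (F j) x\<bar> \<le> 1" for x by (simp add: indicator_def)
      fix xk x q assume xk: "\<And>k. xk k \<in> DL" and x: "x \<in> DL" and c: "(\<lambda>k. emb (xk k)) \<longlonglongrightarrow> emb x"
        and q: "indicat_real (F j) x < q"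
      show "\<forall>\<^sub>F k in sequentially. indicat_real (F j) (xk k) < q"
      proof (cases "x \<in> F j")
        case True
        thus ?thesis using q by (intro always_eventually allI) (auto simp: indicator_def)
      next
        case False
        hence "emb x \<in> - closure (emb ` bad n (e j))" using x by (simp add: F_def clbad_def)
        hence "\<forall>\<^sub>F k in sequentially. emb (xk k) \<in> - closure (emb ` bad n (e j))"
          by (intro topological_tendstoD[OF c]) auto
        thus ?thesis by (rule eventually_mono) (use q False in \<open>auto simp: F_def clbad_def\<close>)
      qed
    qed
    also have "{a \<in> topspace Y. (\<integral>x. indicat_real (F j) x \<partial>P a) < \<eta>} = {a \<in> topspace Y. measure (P a) (F j) < \<eta>}"
      using Fs by auto
    finally show ?thesis .
  qed
  have "\<exists>\<F>. finite \<F> \<and> \<F> \<subseteq> range (\<lambda>j. {a \<in> topspace Y. measure (P a) (F j) < \<eta>}) \<and> C \<subseteq> \<Union>\<F>"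
  proof (rule compactinD[OF C])
    show "C \<subseteq> \<Union> (range (\<lambda>j. {a \<in> topspace Y. measure (P a) (F j) < \<eta>}))"
    proof
      fix a assume "a \<in> C"
      hence a: "a \<in> topspace Y" using CY by blast
      interpret prob_space "P a" by (rule prob_measuresD(1)[OF PM[OF a]])
      have "(\<lambda>j. measure (P a) (F j)) \<longlonglongrightarrow> measure (P a) (\<Inter>j. F j)"
        using Fs[OF a] dec by (intro finite_Lim_measure_decseq) (auto simp: decseq_def)
      hence "\<forall>\<^sub>F j in sequentially. measure (P a) (F j) < \<eta>" using \<eta> unfolding empty by (intro order_tendstoD(2)) auto
      then obtain j where "measure (P a) (F j) < \<eta>" using eventually_happens'[OF sequentially_bot] by blast
      thus "a \<in> \<Union> (range (\<lambda>j. {a \<in> topspace Y. measure (P a) (F j) < \<eta>}))" using a by auto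
    qed
  qed (use op in auto)
  then obtain \<F> where \<F>: "finite \<F>" "\<F> \<subseteq> range (\<lambda>j. {a \<in> topspace Y. measure (P a) (F j) < \<eta>})" "C \<subseteq> \<Union>\<F>" by blast
  obtain J where "finite J" "\<F> = (\<lambda>j. {a \<in> topspace Y. measure (P a) (F j) < \<eta>}) ` J"
    using finite_subset_image[OF \<F>(1,2)] by blast
  with \<F>(3) have J: "finite J" "C \<subseteq> (\<Union>j\<in>J. {a \<in> topspace Y. measure (P a) (F j) < \<eta>})" by simp_all
  define j where "j = Max (insert 0 J)"
  have "measure (P a) (F j) \<le> \<eta>" if a: "a \<in> C" for a
  proof -
    obtain i where i: "i \<in> J" "a \<in> topspace Y" "measure (P a) (F i) < \<eta>" using J(2) a by auto
    interpret prob_space "P a" by (rule prob_measuresD(1)[OF PM[OF i(2)]])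
    have "i \<le> j" unfolding j_def using J(1) i(1) by simp
    hence "measure (P a) (F j) \<le> measure (P a) (F i)" using dec Fs[OF i(2)] by (intro finite_measure_mono) auto
    thus ?thesis using i(3) by simp
  qed
  thus ?thesis using e unfolding F_def by blast
qed

end

section \<open>Left limits, and the time before the complement of \<open>U\<close> is
  reached\<close>

context lc_space begin

lemma left_lim_near:
  assumes "left_lim x t l" "0 < e" "b < t"
  shows "\<exists>u. 0 < u \<and> b < u \<and> u < t \<and> dE (x u) l < e"
proof -
  obtain d where d: "d > 0" "d \<le> t" "\<And>u. t - d < u \<Longrightarrow> u < t \<Longrightarrow> dE (x u) l < e"
    using assms unfolding left_lim_def by blast
  have "max b (t - d) < t" using d assms by simp
  then obtain u where "max b (t - d) < u" "u < t" using dense by blast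
  thus ?thesis using d by (intro exI[of _ u]) auto
qed

lemma left_lim_unique:
  assumes l: "left_lim x t l" and l': "left_lim x t l'" and x: "\<And>u. 0 \<le> u \<Longrightarrow> x u \<in> \<Omega>" and t: "0 < t"
  shows "l = l'"
proof (rule ccontr)
  assume n: "l \<noteq> l'"
  have lO: "l \<in> \<Omega>" "l' \<in> \<Omega>" using l l' by (auto simp: left_lim_def)
  hence e: "0 < dE l l' / 2" using n by simp
  obtain d where d: "d > 0" "d \<le> t" "\<And>u. t - d < u \<Longrightarrow> u < t \<Longrightarrow> dE (x u) l < dE l l' / 2"
    using l e unfolding left_lim_def by blast
  obtain u where u: "0 < u" "t - d < u" "u < t" "dE (x u) l' < dE l l' / 2"
    using left_lim_near[OF l' e, of "t - d"] d by auto
  have "dE l l' \<le> dE l (x u) + dE (x u) l'" using u lO x by (intro E.triangle) auto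
  thus False using d(3)[OF u(2,3)] u(4) E.commute[of l "x u"] by simp
qed

lemma left_limit_eq:
  assumes x: "x \<in> D_exp X" and t: "0 < t" and l: "left_lim x t l"
  shows "left_limit X x (ennreal t) = l"
proof -
  have \<Omega>: "\<forall>s\<ge>0. x s \<in> \<Omega>" using D_expD(1)[OF x] by blast
  show ?thesis unfolding left_limit_def has_left_limit_iff[OF t \<Omega>]
    using l left_lim_unique[OF _ _ _ t] D_expD(1)[OF x] by (intro the_equality) blast+
qed

end

context lc_open begin

lemma Some_U_subset: "p \<in> U \<Longrightarrow> p \<in> topspace X"
  using openin_subset[OF U] by blast

lemma \<rho>_left_lim_ge:
  assumes l: "left_lim x t l" and t: "0 < t" and x: "\<And>u. 0 \<le> u \<Longrightarrow> x u \<in> \<Omega>" and c: "\<And>u. 0 \<le> u \<Longrightarrow> u < t \<Longrightarrow> c \<le> \<rho> (x u)"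
  shows "c \<le> \<rho> l"
proof (rule field_le_epsilon)
  fix e :: real assume e: "0 < e"
  obtain u where u: "0 < u" "u < t" "dE (x u) l < e" using left_lim_near[OF l e, of 0] t by auto
  thus "c \<le> \<rho> l + e" using c[of u] \<rho>_Lipschitz[of "x u" l] x[of u] l by (auto simp: left_lim_def)
qed

lemma \<rho>_right_cts:
  assumes x: "x \<in> DL" and t: "0 \<le> t" and e: "0 < e"
  shows "\<exists>d>0. \<forall>u. t \<le> u \<and> u < t + d \<longrightarrow> \<bar>\<rho> (x u) - \<rho> (x t)\<bar> < e"
proof -
  obtain d where d: "d > 0" "\<forall>u. t \<le> u \<and> u < t + d \<longrightarrow> dE (x u) (x t) < e" using DL_right[OF assms] by blast
  have "\<bar>\<rho> (x u) - \<rho> (x t)\<bar> < e" if "t \<le> u" "u < t + d" for u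
    using d(2) that \<rho>_Lipschitz[of "x u" "x t"] \<rho>_Lipschitz[of "x t" "x u"] DL_paths[OF x] t E.commute[of "x u" "x t"]
    by (smt (verit))
  thus ?thesis using d(1) by blast
qed

text \<open>A single lower bound keeps the values and the left limits inside \<open>U\<close> at
  once; the condition is equivalent to \<open>s\<close> lying before the exit time.\<close>

definition alive :: "'a path \<Rightarrow> real \<Rightarrow> bool" where
  "alive x s \<longleftrightarrow> (\<exists>c>0. \<forall>u. 0 \<le> u \<and> u \<le> s \<longrightarrow> c \<le> \<rho> (x u))"

lemma alive_mono: "alive x s \<Longrightarrow> r \<le> s \<Longrightarrow> alive x r"
  unfolding alive_def by (meson order_trans)

lemma alive_pos: "alive x s \<Longrightarrow> 0 \<le> u \<Longrightarrow> u \<le> s \<Longrightarrow> 0 < \<rho> (x u)"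
  unfolding alive_def by (meson less_le_trans)

lemma alive_in_U: "x \<in> DL \<Longrightarrow> alive x s \<Longrightarrow> 0 \<le> u \<Longrightarrow> u \<le> s \<Longrightarrow> x u \<in> Some ` U"
  using alive_pos \<rho>_pos_iff DL_paths by blast

text \<open>The lower bound is asked strictly before \<open>s\<close> only. So the lemma also
  applies at the end of the alive period, where it shows that \<open>\<rho>\<close> must vanish if
  it was bounded below until then.\<close>

lemma alive_extend:
  assumes x: "x \<in> DL" and s: "0 \<le> s" "\<And>u. 0 \<le> u \<Longrightarrow> u < s \<Longrightarrow> c \<le> \<rho> (x u)" "0 < c" and xs: "0 < \<rho> (x s)"
  shows "\<exists>s'>s. alive x s'"
proof -
  obtain d where d: "d > 0" "\<And>u. s \<le> u \<Longrightarrow> u < s + d \<Longrightarrow> \<bar>\<rho> (x u) - \<rho> (x s)\<bar> < \<rho> (x s) / 2"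
    using \<rho>_right_cts[OF x s(1), of "\<rho> (x s) / 2"] xs by auto
  have "min c (\<rho> (x s) / 2) \<le> \<rho> (x u)" if "0 \<le> u" "u \<le> s + d / 2" for u
  proof (cases "u < s")
    case True
    thus ?thesis using s(2)[of u] that by simp
  next
    case False
    hence "\<bar>\<rho> (x u) - \<rho> (x s)\<bar> < \<rho> (x s) / 2" using that d(1) by (intro d(2)) auto
    hence "\<rho> (x s) / 2 \<le> \<rho> (x u)" by linarith
    thus ?thesis by simp
  qed
  hence "alive x (s + d / 2)" unfolding alive_def using s(3) xs by (intro exI[of _ "min c (\<rho> (x s) / 2)"]) auto
  thus ?thesis using d(1) by (intro exI[of _ "s + d / 2"]) auto
qed

lemma alive_later:
  assumes x: "x \<in> DL" and s: "0 \<le> s" "alive x s"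
  shows "\<exists>s'>s. alive x s'"
proof -
  obtain c where "c > 0" "\<And>u. 0 \<le> u \<Longrightarrow> u \<le> s \<Longrightarrow> c \<le> \<rho> (x u)" using s(2) unfolding alive_def by blast
  thus ?thesis using alive_extend[OF x s(1), of c] alive_pos[OF s(2,1) order_refl] by auto
qed

lemma alive_left_lim:
  assumes x: "x \<in> DL" and s: "alive x s" and t: "0 < t" "t \<le> s"
  shows "\<exists>p\<in>U. left_lim x t (Some p)"
proof -
  obtain c where c: "c > 0" "\<And>u. 0 \<le> u \<Longrightarrow> u \<le> s \<Longrightarrow> c \<le> \<rho> (x u)" using s unfolding alive_def by blast
  have "x t \<in> Some ` U" using alive_in_U[OF x s, of t] t by simp
  hence "ennreal t < lifetime x" using D_expD(2)[OF D_loc_D_exp[OF x], of t] t by (auto simp: not_le[symmetric])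
  then obtain p where p: "p \<in> topspace X" "left_lim x t (Some p)" using D_expD(4)[OF D_loc_D_exp[OF x] t(1)] by blast
  have "c \<le> \<rho> (Some p)" by (rule \<rho>_left_lim_ge[OF p(2) t(1) DL_paths[OF x]]) (use c t in auto)
  hence "p \<in> U" using \<rho>_pos_iff[of "Some p"] p(1) c(1) by auto
  thus ?thesis using p by blast
qed

text \<open>A path alive at \<open>s\<close> is alive a little longer, which makes the inequality
  strict. Conversely, values and left limits in \<open>U\<close> up to \<open>s\<close> have a
  common lower bound by bisection.\<close>

lemma exit_time_alive:
  assumes x: "x \<in> DL" and s: "0 \<le> s"
  shows "ennreal s < exit_time X U x \<longleftrightarrow> alive x s"
proof
  have \<Omega>: "\<forall>s\<ge>0. x s \<in> \<Omega>" using DL_paths[OF x] by blast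
  assume a: "alive x s"
  obtain s' where s': "s < s'" "alive x s'" using alive_later[OF x s a] by blast
  have "ennreal s' \<le> exit_time X U x"
    unfolding exit_time_def
  proof (rule Inf_greatest, clarify)
    fix t :: real assume t: "0 \<le> t" and n: "0 < t \<and> \<not> (\<exists>l\<in>U. has_left_limit X x (ennreal t) (Some l)) \<or> x t \<notin> Some ` U"
    have "\<not> t \<le> s'"
    proof
      assume "t \<le> s'"
      hence ts: "t \<le> s'" .
      have "x t \<in> Some ` U" by (rule alive_in_U[OF x s'(2) t ts])
      moreover have "\<exists>p\<in>U. has_left_limit X x (ennreal t) (Some p)" if "0 < t"
        using alive_left_lim[OF x s'(2) that ts] has_left_limit_iff[OF that \<Omega>] by blast
      ultimately show False using n by blast
    qed
    thus "ennreal s' \<le> ennreal t" by (intro ennreal_leI) simp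
  qed
  thus "ennreal s < exit_time X U x" using s s'(1) ennreal_less_iff[OF s, of s'] less_le_trans by blast
next
  have \<Omega>: "\<forall>s\<ge>0. x s \<in> \<Omega>" using DL_paths[OF x] by blast
  assume e: "ennreal s < exit_time X U x"
  have in_U: "x t \<in> Some ` U" "0 < t \<Longrightarrow> \<exists>l\<in>U. left_lim x t (Some l)" if t: "0 \<le> t" "t \<le> s" for t
  proof -
    have et: "ennreal t < exit_time X U x" using e t ennreal_leI le_less_trans by blast
    have n: "\<not> (0 < t \<and> \<not> (\<exists>l\<in>U. has_left_limit X x (ennreal t) (Some l)) \<or> x t \<notin> Some ` U)"
    proof
      assume "0 < t \<and> \<not> (\<exists>l\<in>U. has_left_limit X x (ennreal t) (Some l)) \<or> x t \<notin> Some ` U"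
      hence "exit_time X U x \<le> ennreal t" unfolding exit_time_def using t(1) by (intro Inf_lower) blast
      thus False using et by simp
    qed
    thus "x t \<in> Some ` U" by blast
    show "\<exists>l\<in>U. left_lim x t (Some l)" if "0 < t" using n that has_left_limit_iff[OF that \<Omega>] by blast
  qed
  have \<rho>U: "0 < \<rho> z" if "z \<in> Some ` U" for z
    using that \<rho>_pos_iff[of z] Some_U_subset by auto
  show "alive x s" unfolding alive_def
  proof (rule bounded_below_upto[OF DL_paths[OF x] _ s \<rho>_Lipschitz])
    show "right_cts x t" if "0 \<le> t" for t by (rule D_expD(3)[OF D_loc_D_exp[OF x] that])
    show "0 < \<rho> (x t)" if "0 \<le> t" "t \<le> s" for t using in_U(1)[OF that] \<rho>U by blast
    show "\<exists>p. left_lim x t p \<and> 0 < \<rho> p" if "0 < t" "t \<le> s" for t using in_U(2)[of t] that \<rho>U by force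
  qed
qed

lemma \<rho>_coordinate_measurable:
  assumes "0 \<le> t" shows "(\<lambda>x. \<rho> (x t)) \<in> borel_measurable BL"
  unfolding borel_measurable_iff_greater
proof
  fix a
  have "{x \<in> space BL. a < \<rho> (x t)} = {x \<in> DL. x t \<in> {z \<in> \<Omega>. a < \<rho> z}}" using DL_paths assms by auto
  thus "{x \<in> space BL. a < \<rho> (x t)} \<in> sets BL" using coordinate_measurable[OF assms \<rho>_gt_open] by simp
qed

text \<open>Path values are limits of values at grid times approached from the right. The maximum
  with \<open>0\<close> avoids negative times, where a path is \<open>undefined\<close>.\<close>

lemma \<rho>_jointly_measurable: "(\<lambda>(u, x). \<rho> (x (max 0 u))) \<in> borel_measurable (lborel \<Otimes>\<^sub>M BL)"
proof (rule borel_measurable_LIMSEQ_real)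
  define r where "r n i = real (Suc i) / (real n + 1)" for n i :: nat
  define k where "k n u = nat \<lfloor>(real n + 1) * max 0 u\<rfloor>" for n :: nat and u :: real
  show "(\<lambda>z. \<rho> (snd z (r n (k n (fst z))))) \<in> borel_measurable (lborel \<Otimes>\<^sub>M BL)" for n
  proof (rule measurable_compose_countable[where f="\<lambda>i z. \<rho> (snd z (r n i))" and g="\<lambda>z. k n (fst z)"])
    show "(\<lambda>z. \<rho> (snd z (r n i))) \<in> borel_measurable (lborel \<Otimes>\<^sub>M BL)" for i
      by (rule measurable_compose[OF measurable_snd \<rho>_coordinate_measurable]) (simp add: r_def)
    show "(\<lambda>z. k n (fst z)) \<in> measurable (lborel \<Otimes>\<^sub>M BL) (count_space UNIV)"
      unfolding k_def by measurable
  qed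
  fix z :: "real \<times> 'a path" assume "z \<in> space (lborel \<Otimes>\<^sub>M BL)"
  then obtain u x where z: "z = (u, x)" "x \<in> DL" by (auto simp: space_pair_measure)
  define v where "v = max 0 u"
  have v: "0 \<le> v" by (simp add: v_def)
  have r: "v \<le> r n (k n u)" "r n (k n u) \<le> v + 1 / (real n + 1)" for n
  proof -
    have "real (k n u) = of_int \<lfloor>(real n + 1) * v\<rfloor>" using v by (simp add: k_def v_def)
    hence "(real n + 1) * v \<le> real (Suc (k n u))" "real (Suc (k n u)) \<le> (real n + 1) * v + 1" by linarith+
    moreover have "(v + 1 / (real n + 1)) * (real n + 1) = (real n + 1) * v + 1" by (simp add: field_simps)
    ultimately show "v \<le> r n (k n u)" "r n (k n u) \<le> v + 1 / (real n + 1)"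
      unfolding r_def by (simp_all add: pos_le_divide_eq pos_divide_le_eq mult.commute)
  qed
  have "(\<lambda>n. \<rho> (x (r n (k n u)))) \<longlonglongrightarrow> \<rho> (x v)"
  proof (rule tendstoI)
    fix e :: real assume "0 < e"
    then obtain d where d: "d > 0" "\<And>w. v \<le> w \<Longrightarrow> w < v + d \<Longrightarrow> \<bar>\<rho> (x w) - \<rho> (x v)\<bar> < e"
      using \<rho>_right_cts[OF z(2) v] by blast
    have "\<forall>\<^sub>F n in sequentially. 1 / (real n + 1) < d"
      using order_tendstoD(2)[OF LIMSEQ_inverse_real_of_nat d(1)] by (simp add: inverse_eq_divide add.commute)
    thus "\<forall>\<^sub>F n in sequentially. dist (\<rho> (x (r n (k n u)))) (\<rho> (x v)) < e"
    proof eventually_elim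
      case (elim n)
      thus ?case using d(2)[OF r(1)[of n]] r(2)[of n] by (simp add: dist_real_def)
    qed
  qed
  thus "(\<lambda>n. \<rho> (snd z (r n (k n (fst z))))) \<longlonglongrightarrow> (case z of (u, x) \<Rightarrow> \<rho> (x (max 0 u)))"
    by (simp add: z v_def)
qed

end

section \<open>Structure of the time change\<close>

locale lc_rate = lc_open +
  fixes \<gamma> :: "real \<Rightarrow> real"
  assumes \<gamma>_cont: "continuous_on UNIV \<gamma>" and \<gamma>_zero: "\<And>r. r \<le> 0 \<Longrightarrow> \<gamma> r = 0" and \<gamma>_pos: "\<And>r. 0 < r \<Longrightarrow> 0 < \<gamma> r"
    and \<gamma>_le1: "\<And>r. \<gamma> r \<le> 1" and \<gamma>_mono: "\<And>r s. r \<le> s \<Longrightarrow> \<gamma> r \<le> \<gamma> s"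
begin

definition g :: "'a \<Rightarrow> real" where "g y = \<gamma> (\<rho> (Some y))"

abbreviation T :: "'a path \<Rightarrow> 'a path" where "T \<equiv> time_change X g"

text \<open>The clock as a real number. A Bochner integral is informative only where the rate is
  integrable, which a positive lower bound on \<open>\<rho>\<close> ensures; at the exit time itself
  \<open>Aint\<close> is used.\<close>

definition A :: "'a path \<Rightarrow> real \<Rightarrow> real" where
  "A x s = (LINT v:{0..<s}|lborel. 1 / \<gamma> (\<rho> (x v)))"

abbreviation \<sigma> :: "'a path \<Rightarrow> ennreal" where "\<sigma> x \<equiv> exit_time X {y \<in> topspace X. g y \<noteq> 0} x"

lemma support_g: "{y \<in> topspace X. g y \<noteq> 0} = U"
proof -
  have "g y \<noteq> 0 \<longleftrightarrow> y \<in> U" if "y \<in> topspace X" for y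
    using \<rho>_pos_iff[of "Some y"] that \<gamma>_pos[of "\<rho> (Some y)"] \<gamma>_zero[of "\<rho> (Some y)"]
    by (fastforce simp: g_def not_less[symmetric])
  thus ?thesis using Some_U_subset by auto
qed

lemma \<sigma>_alive: "x \<in> DL \<Longrightarrow> 0 \<le> s \<Longrightarrow> ennreal s < \<sigma> x \<longleftrightarrow> alive x s"
  unfolding support_g by (rule exit_time_alive)

lemma \<gamma>_measurable [measurable]: "\<gamma> \<in> borel_measurable borel"
  by (rule borel_measurable_continuous_onI[OF \<gamma>_cont])

lemma \<rho>_path_measurable:
  assumes "x \<in> DL"
  shows "(\<lambda>v. \<rho> (x (max 0 v))) \<in> borel_measurable lborel"
proof -
  have "(\<lambda>v. (v, x)) \<in> measurable lborel (lborel \<Otimes>\<^sub>M BL)" using assms by (intro measurable_Pair) auto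
  from measurable_compose[OF this \<rho>_jointly_measurable] show ?thesis by simp
qed

lemma rate_measurable: "x \<in> DL \<Longrightarrow> (\<lambda>v. 1 / \<gamma> (\<rho> (x (max 0 v)))) \<in> borel_measurable lborel"
  using measurable_compose[OF \<rho>_path_measurable \<gamma>_measurable] by simp

lemma rate_integrable:
  assumes x: "x \<in> DL" and c: "0 < c" "\<And>u. 0 \<le> u \<Longrightarrow> u < s \<Longrightarrow> c \<le> \<rho> (x u)" and r: "0 \<le> r"
  shows "set_integrable lborel {r..<s} (\<lambda>v. 1 / \<gamma> (\<rho> (x v)))"
proof -
  have "set_integrable lborel {r..<s} (\<lambda>v. q)" for q :: real
    by (cases "r \<le> s") (auto simp: set_integrable_def)
  thus ?thesis
  proof (rule set_integrable_bound[where f="\<lambda>_. 1 / \<gamma> c"])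
    have "(\<lambda>v. indicat_real {r..<s} v *\<^sub>R (1 / \<gamma> (\<rho> (x (max 0 v))))) \<in> borel_measurable lborel"
      using rate_measurable[OF x] by (intro borel_measurable_scaleR) auto
    also have "(\<lambda>v. indicat_real {r..<s} v *\<^sub>R (1 / \<gamma> (\<rho> (x (max 0 v))))) = (\<lambda>v. indicat_real {r..<s} v *\<^sub>R (1 / \<gamma> (\<rho> (x v))))"
      using r by (auto simp: fun_eq_iff indicator_def max_def)
    finally show "set_borel_measurable lborel {r..<s} (\<lambda>v. 1 / \<gamma> (\<rho> (x v)))" unfolding set_borel_measurable_def .
    have "norm (1 / \<gamma> (\<rho> (x v))) \<le> norm (1 / \<gamma> c)" if "v \<in> {r..<s}" for v
    proof -
      have "\<gamma> c \<le> \<gamma> (\<rho> (x v))" using that r by (intro \<gamma>_mono c(2)) auto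
      thus ?thesis using \<gamma>_pos[OF c(1)] by (simp add: frac_le)
    qed
    thus "AE v in lborel. v \<in> {r..<s} \<longrightarrow> norm (1 / \<gamma> (\<rho> (x v))) \<le> norm (1 / \<gamma> c)" by (intro AE_I2) blast
  qed
qed

lemma A_split:
  assumes x: "x \<in> DL" and c: "0 < c" "\<And>u. 0 \<le> u \<Longrightarrow> u < s \<Longrightarrow> c \<le> \<rho> (x u)" and r: "0 \<le> r" "r \<le> s"
  shows "A x s = A x r + (LINT v:{r..<s}|lborel. 1 / \<gamma> (\<rho> (x v)))"
proof -
  have eq: "{0..<s} = {0..<r} \<union> {r..<s}" using r by auto
  show ?thesis unfolding A_def eq
  proof (rule set_integral_Un)
    show "set_integrable lborel {0..<r} (\<lambda>v. 1 / \<gamma> (\<rho> (x v)))"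
      by (rule set_integrable_subset[OF rate_integrable[OF x c order_refl]]) (use r in auto)
    show "set_integrable lborel {r..<s} (\<lambda>v. 1 / \<gamma> (\<rho> (x v)))" by (rule rate_integrable[OF x c r(1)])
  qed auto
qed

text \<open>Since \<open>\<gamma> \<le> 1\<close>, new time passes at least as fast as old time. The
  third bound is the one that makes the clock explode: a stay where \<open>\<gamma>\<close> is small
  yields a large amount of new time.\<close>

lemma A_increment:
  assumes x: "x \<in> DL" and c: "0 < c" "\<And>u. 0 \<le> u \<Longrightarrow> u < s \<Longrightarrow> c \<le> \<rho> (x u)" and r: "0 \<le> r" "r \<le> s"
  shows "s - r \<le> A x s - A x r" "A x s - A x r \<le> (s - r) / \<gamma> c"
    "(\<And>v. r \<le> v \<Longrightarrow> v < s \<Longrightarrow> \<gamma> (\<rho> (x v)) \<le> \<delta>) \<Longrightarrow> 0 < \<delta> \<Longrightarrow> (s - r) / \<delta> \<le> A x s - A x r"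
proof -
  have int: "set_integrable lborel {r..<s} (\<lambda>v. 1 / \<gamma> (\<rho> (x v)))" by (rule rate_integrable[OF x c r(1)])
  have D: "A x s - A x r = (LINT v:{r..<s}|lborel. 1 / \<gamma> (\<rho> (x v)))" using A_split[OF assms] by simp
  have const: "set_integrable lborel {r..<s} (\<lambda>v. q)" "(LINT v:{r..<s}|lborel. q) = (s - r) * q" for q :: real
    using r by (auto simp: set_integrable_def set_lebesgue_integral_def)
  have lo: "\<gamma> c \<le> \<gamma> (\<rho> (x v))" "0 < \<gamma> (\<rho> (x v))" if "r \<le> v" "v < s" for v
  proof -
    show "\<gamma> c \<le> \<gamma> (\<rho> (x v))" using that r by (intro \<gamma>_mono c(2)) auto
    thus "0 < \<gamma> (\<rho> (x v))" using \<gamma>_pos[OF c(1)] by linarith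
  qed
  have lower: "(s - r) / \<delta> \<le> A x s - A x r" if \<delta>: "\<And>v. r \<le> v \<Longrightarrow> v < s \<Longrightarrow> \<gamma> (\<rho> (x v)) \<le> \<delta>" "0 < \<delta>" for \<delta>
  proof -
    have "(LINT v:{r..<s}|lborel. 1 / \<delta>) \<le> (LINT v:{r..<s}|lborel. 1 / \<gamma> (\<rho> (x v)))"
      using lo(2) \<delta> by (intro set_integral_mono const(1) int) (auto intro!: frac_le)
    thus ?thesis unfolding D const by simp
  qed
  show "s - r \<le> A x s - A x r" using lower[of 1] \<gamma>_le1 by simp
  show "(\<And>v. r \<le> v \<Longrightarrow> v < s \<Longrightarrow> \<gamma> (\<rho> (x v)) \<le> \<delta>) \<Longrightarrow> 0 < \<delta> \<Longrightarrow> (s - r) / \<delta> \<le> A x s - A x r" by (rule lower)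
  have "(LINT v:{r..<s}|lborel. 1 / \<gamma> (\<rho> (x v))) \<le> (LINT v:{r..<s}|lborel. 1 / \<gamma> c)"
    using lo \<gamma>_pos[OF c(1)] by (intro set_integral_mono const(1) int) (auto intro!: frac_le)
  thus "A x s - A x r \<le> (s - r) / \<gamma> c" unfolding D const by simp
qed

lemma A_0 [simp]: "A x 0 = 0"
  by (simp add: A_def set_lebesgue_integral_def)

lemma A_alive:
  assumes x: "x \<in> DL" and s: "alive x s" and r: "0 \<le> r" "r \<le> s"
  shows "s - r \<le> A x s - A x r"
  using assms A_increment(1)[OF x _ _ r] unfolding alive_def by (metis less_imp_le)

lemma A_ge: "x \<in> DL \<Longrightarrow> alive x s \<Longrightarrow> 0 \<le> s \<Longrightarrow> s \<le> A x s"
  using A_alive[of x s 0] by simp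

lemma A_less_iff:
  assumes x: "x \<in> DL" and "alive x s" "alive x r" "0 \<le> s" "0 \<le> r"
  shows "A x r < A x s \<longleftrightarrow> r < s"
  using A_alive[OF x \<open>alive x s\<close>, of r] A_alive[OF x \<open>alive x r\<close>, of s] assms by linarith

definition Aint :: "'a path \<Rightarrow> real \<Rightarrow> ennreal" where
  "Aint x s = (\<integral>\<^sup>+v\<in>{0..<s}. 1 / ennreal (\<gamma> (\<rho> (x v))) \<partial>lborel)"

lemma Aint_eq:
  assumes x: "x \<in> DL" and c: "0 < c" "\<And>u. 0 \<le> u \<Longrightarrow> u < s \<Longrightarrow> c \<le> \<rho> (x u)"
  shows "Aint x s = ennreal (A x s)"
proof -
  have "Aint x s = (\<integral>\<^sup>+v. ennreal (indicat_real {0..<s} v *\<^sub>R (1 / \<gamma> (\<rho> (x v)))) \<partial>lborel)"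
    unfolding Aint_def
  proof (rule nn_integral_cong)
    fix v
    have "0 < \<gamma> (\<rho> (x v))" if "v \<in> {0..<s}" using \<gamma>_pos[of "\<rho> (x v)"] c(1) c(2)[of v] that by auto
    thus "1 / ennreal (\<gamma> (\<rho> (x v))) * indicator {0..<s} v = ennreal (indicat_real {0..<s} v *\<^sub>R (1 / \<gamma> (\<rho> (x v))))"
      using divide_ennreal[of 1 "\<gamma> (\<rho> (x v))"] by (auto simp: indicator_def)
  qed
  also have "\<dots> = ennreal (A x s)" unfolding A_def set_lebesgue_integral_def
  proof (rule nn_integral_eq_integral)
    show "integrable lborel (\<lambda>v. indicat_real {0..<s} v *\<^sub>R (1 / \<gamma> (\<rho> (x v))))"
      using rate_integrable[OF x c order_refl] unfolding set_integrable_def by simp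
    show "AE v in lborel. 0 \<le> indicat_real {0..<s} v *\<^sub>R (1 / \<gamma> (\<rho> (x v)))"
      using \<gamma>_mono[of 0] \<gamma>_zero[of 0] \<rho>_nonneg by (intro AE_I2) auto
  qed
  finally show ?thesis .
qed

lemma clock_Aint:
  assumes x: "x \<in> DL" and s: "0 \<le> s" "ennreal s \<le> \<sigma> x"
  shows "clock X g x (ennreal s) = Aint x s"
proof -
  have "(\<integral>\<^sup>+u\<in>{u. 0 \<le> u \<and> ennreal u < ennreal s}. 1 / ennreal (g (the (x u))) \<partial>lborel) = Aint x s"
    unfolding Aint_def
  proof (rule nn_integral_cong)
    fix u :: real
    have eq: "g (the (x u)) = \<gamma> (\<rho> (x u))" if u: "0 \<le> u" "u < s"
    proof -
      have "ennreal u < \<sigma> x" using u s(2) by (intro less_le_trans[OF _ s(2)]) (simp add: ennreal_less_iff)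
      hence "x u \<in> Some ` U" using \<sigma>_alive[OF x u(1)] alive_in_U[OF x _ u(1) order_refl] by simp
      thus ?thesis by (auto simp: g_def)
    qed
    show "1 / ennreal (g (the (x u))) * indicator {u. 0 \<le> u \<and> ennreal u < ennreal s} u =
        1 / ennreal (\<gamma> (\<rho> (x u))) * indicator {0..<s} u"
      using eq by (auto simp: indicator_def ennreal_less_iff)
  qed
  thus ?thesis using s by (simp add: clock_def)
qed

lemma clock_alive:
  assumes x: "x \<in> DL" and s: "0 \<le> s" "alive x s"
  shows "clock X g x (ennreal s) = ennreal (A x s)"
proof -
  obtain c where "c > 0" "\<And>u. 0 \<le> u \<Longrightarrow> u \<le> s \<Longrightarrow> c \<le> \<rho> (x u)" using s(2) unfolding alive_def by blast
  hence "Aint x s = ennreal (A x s)" by (intro Aint_eq[OF x, of c]) auto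
  thus ?thesis using clock_Aint[OF x s(1)] \<sigma>_alive[OF x s(1)] s(2) by simp
qed

lemma clock_late: "\<sigma> x < w \<Longrightarrow> clock X g x w = \<infinity>"
  unfolding clock_def not_le[symmetric] by simp

text \<open>Past the exit time the clock is infinite, before it the clock is below \<open>t\<close>;
  the infimum is thus the exit time, whatever the clock does there.\<close>

lemma inverse_clock_eq_exit:
  assumes x: "x \<in> DL" and late: "\<And>s. 0 \<le> s \<Longrightarrow> alive x s \<Longrightarrow> ennreal (A x s) < t"
  shows "inverse_clock X g x t = \<sigma> x"
proof (rule antisym)
  show "\<sigma> x \<le> inverse_clock X g x t" unfolding inverse_clock_def
  proof (rule Inf_greatest, clarify)
    fix u assume u: "t \<le> clock X g x u"
    show "\<sigma> x \<le> u"
    proof (rule ccontr)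
      assume n: "\<not> \<sigma> x \<le> u"
      hence "u < \<infinity>" by (metis infinity_ennreal_def not_le top.not_eq_extremum top_greatest)
      then obtain r where r: "u = ennreal r" "0 \<le> r" by (cases u) auto
      hence "alive x r" using n unfolding r(1) not_le \<sigma>_alive[OF x r(2)] by simp
      thus False using u late[OF r(2)] clock_alive[OF x r(2)] r(1) by (simp add: not_le[symmetric])
    qed
  qed
  show "inverse_clock X g x t \<le> \<sigma> x"
  proof (rule dense_ge)
    fix w assume "\<sigma> x < w"
    thus "inverse_clock X g x t \<le> w" unfolding inverse_clock_def
      by (intro Inf_lower) (simp add: clock_late)
  qed
qed

lemma inverse_clock_infinity: "x \<in> DL \<Longrightarrow> inverse_clock X g x \<infinity> = \<sigma> x"
  by (rule inverse_clock_eq_exit) simp_all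

lemma T_alive:
  assumes x: "x \<in> DL" and s: "0 \<le> s" "alive x s"
  shows "T x (A x s) = x s"
proof -
  obtain s' where s': "s < s'" "alive x s'" using alive_later[OF x s] by blast
  have A0: "0 \<le> A x s" using A_ge[OF x s(2,1)] s(1) by simp
  have inv: "inverse_clock X g x (ennreal (A x s)) = ennreal s"
  proof (rule antisym)
    show "inverse_clock X g x (ennreal (A x s)) \<le> ennreal s" unfolding inverse_clock_def
      by (intro Inf_lower) (simp add: clock_alive[OF x s])
    show "ennreal s \<le> inverse_clock X g x (ennreal (A x s))" unfolding inverse_clock_def
    proof (rule Inf_greatest, clarify)
      fix u assume u: "ennreal (A x s) \<le> clock X g x u"
      show "ennreal s \<le> u"
      proof (rule ccontr)
        assume n: "\<not> ennreal s \<le> u"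
        then obtain r where r: "u = ennreal r" "0 \<le> r" "r < s"
          by (cases u) (auto simp: not_le ennreal_less_iff top_unique)
        have al: "alive x r" using alive_mono[OF s(2)] r(3) by simp
        hence "A x r < A x s" using A_less_iff[OF x s(2) al s(1) r(2)] r(3) by simp
        moreover have "0 \<le> A x r" using A_ge[OF x al r(2)] r(2) by simp
        ultimately show False using u clock_alive[OF x r(2) al] r(1) by (simp add: ennreal_less_iff not_le[symmetric])
      qed
    qed
  qed
  \<comment> \<open>The path is alive slightly beyond \<open>s\<close>, where the clock has already
    exceeded \<open>A x s\<close>; so the first branch of \<open>time_change\<close> is not
    taken.\<close>
  have "\<not> clock X g x (\<sigma> x) \<le> ennreal (A x s)"
  proof
    assume n: "clock X g x (\<sigma> x) \<le> ennreal (A x s)"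
    have s'0: "0 \<le> s'" using s s' by simp
    have l: "ennreal s' < \<sigma> x" using \<sigma>_alive[OF x s'0] s'(2) by simp
    have "ennreal (A x s') = (\<integral>\<^sup>+u\<in>{u. 0 \<le> u \<and> ennreal u < ennreal s'}. 1 / ennreal (g (the (x u))) \<partial>lborel)"
      using clock_alive[OF x s'0 s'(2)] unfolding clock_def if_P[OF less_imp_le[OF l]] by simp
    also have "\<dots> \<le> (\<integral>\<^sup>+u\<in>{u. 0 \<le> u \<and> ennreal u < \<sigma> x}. 1 / ennreal (g (the (x u))) \<partial>lborel)"
      using l by (intro nn_integral_mono) (auto simp: indicator_def dest: less_trans)
    also have "\<dots> \<le> ennreal (A x s)" using n by (simp add: clock_def)
    finally have "A x s' \<le> A x s" using A0 by simp
    thus False using A_less_iff[OF x s'(2) s(2) s'0 s(1)] s'(1) by simp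
  qed
  thus ?thesis unfolding time_change_def Let_def inverse_clock_infinity[OF x] inv
    using A0 s(1) by (simp add: path_at_def inv)
qed

text \<open>The new times from which on the path is frozen. Being alive extends a little to the
  right, so the clock does not attain its supremum over alive times, and the strict inequality
  includes that supremum among the late times.\<close>

definition late :: "'a path \<Rightarrow> real \<Rightarrow> bool" where
  "late x t \<longleftrightarrow> (\<forall>s\<ge>0. alive x s \<longrightarrow> A x s < t)"

text \<open>When \<open>r\<close> is the exit time, \<open>time_change\<close> freezes the path at
  its left limit in this case and at the value \<open>x r\<close> otherwise.\<close>

abbreviation soft_exit :: "'a path \<Rightarrow> real \<Rightarrow> bool" where
  "soft_exit x r \<equiv> 0 < r \<and> (\<exists>l\<in>topspace X. \<rho> (Some l) = 0 \<and> left_lim x r (Some l))"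

lemma T_late:
  assumes x: "x \<in> DL" and t: "0 \<le> t" and late: "late x t"
  shows "\<exists>r\<ge>0. (\<forall>s\<ge>0. alive x s \<longleftrightarrow> s < r) \<and>
    (if soft_exit x r then left_lim x r (T x t) else T x t = x r)"
proof -
  have \<Omega>: "\<forall>s\<ge>0. x s \<in> \<Omega>" using DL_paths[OF x] by blast
  have late': "A x s < t" if "0 \<le> s" "alive x s" for s using late that by (simp add: late_def)
  have fin: "\<sigma> x < \<infinity>"
  proof (rule ccontr)
    assume "\<not> \<sigma> x < \<infinity>"
    hence "\<sigma> x = \<infinity>" unfolding infinity_ennreal_def by (rule contrapos_np) (simp add: top.not_eq_extremum)
    hence al: "alive x (t + 1)" using \<sigma>_alive[OF x, of "t + 1"] t by simp
    thus False using A_ge[OF x al] late'[of "t + 1"] t by simp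
  qed
  then obtain r where r: "\<sigma> x = ennreal r" "0 \<le> r" by (cases "\<sigma> x") auto
  have al: "alive x s \<longleftrightarrow> s < r" if "0 \<le> s" for s using \<sigma>_alive[OF x that] r that by (simp add: ennreal_less_iff)
  have "Aint x r \<le> ennreal t"
  proof (cases "r = 0")
    case True
    thus ?thesis by (simp add: Aint_def)
  next
    case False
    define f where "f v = 1 / ennreal (\<gamma> (\<rho> (x (max 0 v))))" for v
    define a where "a n = r * (1 - 1 / (real n + 1))" for n :: nat
    have a: "0 \<le> a n" "a n < r" for n using False r(2) by (auto simp: a_def field_simps)
    note [measurable] = \<rho>_path_measurable[OF x]
    have f[measurable]: "f \<in> borel_measurable lborel" unfolding f_def by measurable
    have em: "emeasure (density lborel f) {0..<s} = Aint x s" for s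
      unfolding Aint_def by (subst emeasure_density) (auto simp: f_def indicator_def intro!: nn_integral_cong)
    have un: "(\<Union>n. {0..<a n}) = {0..<r}"
    proof
      show "(\<Union>n. {0..<a n}) \<subseteq> {0..<r}" using a(2) by (fastforce intro: less_trans)
      show "{0..<r} \<subseteq> (\<Union>n. {0..<a n})"
      proof
        fix v assume v: "v \<in> {0..<r}"
        obtain n :: nat where "r / (r - v) < real n" using reals_Archimedean2 by blast
        hence "r < real n * (r - v)" using v by (simp add: field_simps)
        hence "r < (real n + 1) * (r - v)" using v by (simp add: algebra_simps)
        hence "v < a n" by (simp add: a_def field_simps)
        thus "v \<in> (\<Union>n. {0..<a n})" using v by auto
      qed
    qed
    have "incseq (\<lambda>n. {0..<a n})"
    proof (rule incseq_SucI)
      fix n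
      have "1 / (real (Suc n) + 1) \<le> 1 / (real n + 1)" by (simp add: frac_le)
      hence "a n \<le> a (Suc n)" unfolding a_def using r(2) by (intro mult_left_mono) auto
      thus "{0..<a n} \<subseteq> {0..<a (Suc n)}" by auto
    qed
    hence "Aint x r = (SUP n. Aint x (a n))"
      using SUP_emeasure_incseq[of "\<lambda>n. {0..<a n}" "density lborel f"] un by (simp add: em image_subset_iff)
    also have "\<dots> \<le> ennreal t"
    proof (rule SUP_least)
      fix n
      have an: "alive x (a n)" using al a by simp
      have "Aint x (a n) = ennreal (A x (a n))"
        using clock_alive[OF x a(1) an] clock_Aint[OF x a(1) less_imp_le] \<sigma>_alive[OF x a(1), of n] an by simp
      thus "Aint x (a n) \<le> ennreal t" using late'[OF a(1) an] by (simp add: ennreal_leI)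
    qed
    finally show ?thesis .
  qed
  hence clk: "clock X g x (\<sigma> x) \<le> ennreal t" using clock_Aint[OF x r(2)] r(1) by simp
  have inv: "inverse_clock X g x (ennreal t) = \<sigma> x"
    by (rule inverse_clock_eq_exit[OF x]) (use late' A_ge[OF x] in \<open>force simp: ennreal_less_iff\<close>)
  have g0: "g l = 0 \<longleftrightarrow> \<rho> (Some l) = 0" if "l \<in> topspace X" for l
    using \<gamma>_pos[of "\<rho> (Some l)"] \<gamma>_zero[of "\<rho> (Some l)"] \<rho>_nonneg[of "Some l"] by (cases "\<rho> (Some l) = 0") (auto simp: g_def)
  have ll: "has_left_limit X x (\<sigma> x) (Some l) \<longleftrightarrow> 0 < r \<and> left_lim x r (Some l)" for l
  proof (cases "0 < r")
    case True
    thus ?thesis using has_left_limit_iff[OF True \<Omega>] r by simp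
  qed (use r in \<open>simp add: has_left_limit_def\<close>)
  have "if soft_exit x r then left_lim x r (T x t) else T x t = x r"
  proof (cases "soft_exit x r")
    case True
    then obtain l where l: "l \<in> topspace X" "\<rho> (Some l) = 0" "left_lim x r (Some l)" "0 < r" by blast
    hence "T x t = left_limit X x (ennreal r)"
      unfolding time_change_def Let_def inverse_clock_infinity[OF x] using clk t g0[OF l(1)] ll r(1) by auto
    thus ?thesis using True left_limit_eq[OF D_loc_D_exp[OF x] l(4,3)] l by simp
  next
    case False
    hence "\<not> (\<exists>l\<in>topspace X. g l = 0 \<and> has_left_limit X x (\<sigma> x) (Some l))" using ll g0 by blast
    hence "T x t = path_at x (\<sigma> x)"
      unfolding time_change_def Let_def inverse_clock_infinity[OF x] using t by (auto simp: inv)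
    thus ?thesis using False r by (auto simp: path_at_def)
  qed
  thus ?thesis using r(2) al by blast
qed

end

section \<open>Regularity of the time-changed path\<close>

context lc_space begin

text \<open>By right-continuity a finite infimum of the times with value \<open>None\<close> is
  again such a time, and absorption then identifies the lifetime.\<close>

lemma D_exp_of_absorbing:
  assumes y: "y \<in> {0..} \<rightarrow>\<^sub>E \<Omega>" and r: "\<And>t. 0 \<le> t \<Longrightarrow> right_cts y t"
    and None: "\<And>s t. 0 \<le> s \<Longrightarrow> s \<le> t \<Longrightarrow> y s = None \<Longrightarrow> y t = None"
    and left: "\<And>t. 0 < t \<Longrightarrow> y t \<noteq> None \<Longrightarrow> \<exists>p\<in>topspace X. left_lim y t (Some p)"
  shows "y \<in> D_exp X"
proof -
  have life: "y t = None \<longleftrightarrow> lifetime y \<le> ennreal t" if t: "0 \<le> t" for t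
  proof
    assume "y t = None"
    thus "lifetime y \<le> ennreal t" unfolding lifetime_def using t by (intro Inf_lower) blast
  next
    assume l: "lifetime y \<le> ennreal t"
    show "y t = None"
    proof (rule ccontr)
      assume n: "y t \<noteq> None"
      have \<Omega>: "y u \<in> \<Omega>" if "0 \<le> u" for u using y that by auto
      hence e: "0 < dE (y t) None" using n t by (intro dE_None_pos) auto
      then obtain d where d: "d > 0" "\<And>u. t \<le> u \<Longrightarrow> u < t + d \<Longrightarrow> dE (y u) (y t) < dE (y t) None"
        using r[OF t] unfolding right_cts_def by blast
      have "ennreal (t + d) \<le> lifetime y" unfolding lifetime_def
      proof (rule Inf_greatest, clarify)
        fix s assume s: "0 \<le> s" "y s = None"
        have "t < s" using None[OF s(1) _ s(2), of t] n by force
        thus "ennreal (t + d) \<le> ennreal s"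
          using d(2)[of s] s(2) E.commute[of None "y t"] by (intro ennreal_leI) force
      qed
      hence "ennreal (t + d) \<le> ennreal t" using l by (rule order_trans)
      thus False using t d(1) by simp
    qed
  qed
  show ?thesis unfolding D_exp_iff
  proof (intro conjI allI impI)
    show "y \<in> {0..} \<rightarrow>\<^sub>E \<Omega>" by (rule y)
    show "right_cts y t" if "0 \<le> t" for t by (rule r[OF that])
    show "y t = None \<longleftrightarrow> lifetime y \<le> ennreal t" if "0 \<le> t" for t by (rule life[OF that])
    show "\<exists>p\<in>topspace X. left_lim y t (Some p)" if "0 < t" "ennreal t < lifetime y" for t
      using left[OF that(1)] life[of t] that by (simp add: not_le[symmetric])
  qed
qed

end

context lc_rate begin

lemma late_mono: "late x t \<Longrightarrow> t \<le> v \<Longrightarrow> late x v"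
  unfolding late_def by (meson less_le_trans)

lemma A_reaches:
  assumes x: "x \<in> DL" and s: "0 \<le> s" "s \<le> s'" and c: "0 < c" "\<And>u. 0 \<le> u \<Longrightarrow> u < s' \<Longrightarrow> c \<le> \<rho> (x u)"
    and t: "A x s \<le> t" "t \<le> A x s'"
  shows "\<exists>r. s \<le> r \<and> r \<le> s' \<and> A x r = t"
proof -
  have "\<bar>A x v - A x u\<bar> \<le> 1 / \<gamma> c * \<bar>v - u\<bar>" if "u \<in> {s..s'}" "v \<in> {s..s'}" for u v
  proof -
    have *: "\<bar>A x v - A x u\<bar> \<le> 1 / \<gamma> c * \<bar>v - u\<bar>" if "s \<le> u" "u \<le> v" "v \<le> s'" for u v
      using A_increment(1,2)[OF x c(1), of v u] c(2) s that by auto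
    show ?thesis using *[of u v] *[of v u] that by (cases "u \<le> v") (auto simp: abs_minus_commute)
  qed
  hence "(1 / \<gamma> c)-lipschitz_on {s..s'} (A x)"
    using \<gamma>_pos[OF c(1)] by (intro lipschitz_onI) (auto simp: dist_real_def)
  hence "continuous_on {s..s'} (A x)" by (rule lipschitz_on_continuous_on)
  thus ?thesis using IVT'[OF t s(2)] by blast
qed

lemma T_times:
  assumes x: "x \<in> DL" and t: "0 \<le> t" and n: "\<not> late x t"
  shows "\<exists>s\<ge>0. alive x s \<and> A x s = t"
proof -
  obtain s where s: "0 \<le> s" "alive x s" "t \<le> A x s" using n unfolding late_def by force
  obtain c where "0 < c" "\<And>u. 0 \<le> u \<Longrightarrow> u \<le> s \<Longrightarrow> c \<le> \<rho> (x u)" using s(2) unfolding alive_def by blast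
  then obtain r where "0 \<le> r" "r \<le> s" "A x r = t" using A_reaches[OF x order_refl s(1), of c t] t s(3) by auto
  thus ?thesis using alive_mono[OF s(2)] by blast
qed

lemma T_late_const:
  assumes x: "x \<in> DL" and t: "0 \<le> t" "late x t" "t \<le> v"
  shows "T x v = T x t"
proof -
  obtain r where r: "0 \<le> r" "\<forall>s\<ge>0. alive x s \<longleftrightarrow> s < r"
    "if soft_exit x r then left_lim x r (T x t) else T x t = x r"
    using T_late[OF x t(1,2)] by blast
  obtain q where q: "0 \<le> q" "\<forall>s\<ge>0. alive x s \<longleftrightarrow> s < q"
    "if soft_exit x q then left_lim x q (T x v) else T x v = x q"
    using T_late[OF x _ late_mono[OF t(2,3)]] t by auto
  have qr: "q = r"
    using r(2)[rule_format, OF q(1)] r(2)[rule_format, OF r(1)] q(2)[rule_format, OF q(1)] q(2)[rule_format, OF r(1)]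
    by (cases q r rule: linorder_cases) auto
  show ?thesis
  proof (cases "soft_exit x r")
    case True
    hence "left_lim x r (T x t)" "left_lim x r (T x v)" using r(3) q(3) unfolding qr by simp_all
    thus ?thesis using left_lim_unique[of x r "T x v" "T x t"] DL_paths[OF x] True by blast
  next
    case False
    hence "T x t = x r" "T x v = x r" using r(3) q(3) unfolding qr if_not_P[OF False] by simp_all
    thus ?thesis by simp
  qed
qed

text \<open>The clock maps left neighbourhoods of \<open>r\<close> to left neighbourhoods of
  \<open>t\<close>, since every new time before \<open>t\<close> is visited. The last hypothesis
  prevents times beyond \<open>r\<close> from being mapped below \<open>t\<close>.\<close>

lemma left_lim_transfer:
  assumes x: "x \<in> DL" and r: "0 < r" "\<And>u. 0 \<le> u \<Longrightarrow> u < r \<Longrightarrow> alive x u \<and> A x u < t" and l: "left_lim x r p"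
    and t: "\<And>v. 0 \<le> v \<Longrightarrow> v < t \<Longrightarrow> \<not> late x v" and at_end: "alive x r \<Longrightarrow> t \<le> A x r"
  shows "left_lim (T x) t p"
  unfolding left_lim_def
proof (intro conjI allI impI)
  show "p \<in> \<Omega>" using l by (simp add: left_lim_def)
  fix e :: real assume "0 < e"
  then obtain d where d: "d > 0" "d \<le> r" "\<And>u. r - d < u \<Longrightarrow> u < r \<Longrightarrow> dE (x u) p < e"
    using l unfolding left_lim_def by blast
  define w where "w = r - d / 2"
  have w: "0 \<le> w" "w < r" "r - d < w" using d(1,2) by (auto simp: w_def)
  have Aw: "0 \<le> A x w" "A x w < t" using A_ge[OF x _ w(1)] r(2)[OF w(1,2)] w(1) by auto
  have "dE (T x v) p < e" if v: "A x w < v" "v < t" for v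
  proof -
    obtain u where u: "0 \<le> u" "alive x u" "A x u = v" using T_times[OF x _ t, of v] v Aw by auto
    have "w < u" using A_less_iff[OF x u(2) _ u(1) w(1)] r(2)[OF w(1,2)] u(3) v(1) by simp
    moreover have "u < r"
    proof (rule ccontr)
      assume n: "\<not> u < r"
      hence al: "alive x r" using alive_mono[OF u(2)] by simp
      hence "A x r \<le> A x u" using A_alive[OF x u(2), of r] r(1) n by simp
      thus False using at_end[OF al] u(3) v(2) by simp
    qed
    ultimately have "dE (x u) p < e" using d(3)[of u] w(3) by simp
    thus ?thesis using T_alive[OF x u(1,2)] u(3) by simp
  qed
  thus "\<exists>d>0. d \<le> t \<and> (\<forall>u. t - d < u \<and> u < t \<longrightarrow> dE (T x u) p < e)"
    using Aw by (intro exI[of _ "t - A x w"]) auto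
qed

lemma not_late: "0 \<le> s \<Longrightarrow> alive x s \<Longrightarrow> v \<le> A x s \<Longrightarrow> \<not> late x v"
  unfolding late_def by (meson not_le)

lemma T_in: "x \<in> DL \<Longrightarrow> T x \<in> {0..} \<rightarrow>\<^sub>E \<Omega>"
proof
  fix t :: real assume x: "x \<in> DL" and "t \<in> {0..}"
  hence t: "0 \<le> t" by simp
  show "T x t \<in> \<Omega>"
  proof (cases "late x t")
    case True
    then obtain r where "0 \<le> r" "left_lim x r (T x t) \<or> T x t = x r" using T_late[OF x t True] by (metis (no_types))
    thus ?thesis using DL_paths[OF x] by (auto simp: left_lim_def)
  next
    case False
    then obtain s where "0 \<le> s" "alive x s" "A x s = t" using T_times[OF x t] by blast
    thus ?thesis using T_alive[OF x, of s] DL_paths[OF x, of s] by simp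
  qed
qed (simp add: time_change_def)

lemma T_right_cts:
  assumes x: "x \<in> DL" and t: "0 \<le> t"
  shows "right_cts (T x) t"
  unfolding right_cts_def
proof (intro allI impI)
  fix e :: real assume e: "0 < e"
  show "\<exists>d>0. \<forall>u. t \<le> u \<and> u < t + d \<longrightarrow> dE (T x u) (T x t) < e"
  proof (cases "late x t")
    case True
    have "T x t \<in> \<Omega>" using T_in[OF x] t by auto
    hence "dE (T x u) (T x t) = 0" if "t \<le> u" for u using T_late_const[OF x t True that] by simp
    thus ?thesis using e by (intro exI[of _ 1]) simp
  next
    case False
    then obtain s where s: "0 \<le> s" "alive x s" "A x s = t" using T_times[OF x t] by blast
    obtain s' where s': "s < s'" "alive x s'" using alive_later[OF x s(1,2)] by blast
    obtain d where d: "d > 0" "\<And>u. s \<le> u \<Longrightarrow> u < s + d \<Longrightarrow> dE (x u) (x s) < e" using DL_right[OF x s(1) e] by blast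
    define w where "w = min s' (s + d / 2)"
    have w: "s < w" "alive x w" "0 \<le> w" "w < s + d"
      using s' d(1) s(1) alive_mono[OF s'(2), of w] by (auto simp: w_def)
    have tw: "t < A x w" using A_less_iff[OF x w(2) s(2) w(3) s(1)] w(1) s(3) by simp
    have "dE (T x u) (T x t) < e" if u: "t \<le> u" "u < A x w" for u
    proof -
      have "\<not> late x u" by (rule not_late[OF w(3,2)]) (use u in simp)
      then obtain v where v: "0 \<le> v" "alive x v" "A x v = u" using T_times[OF x, of u] u t by auto
      have "s \<le> v" using A_less_iff[OF x s(2) v(2) s(1) v(1)] u s(3) v(3) by auto
      moreover have "v < w" using A_less_iff[OF x w(2) v(2) w(3) v(1)] u v(3) by simp
      ultimately have "dE (x v) (x s) < e" using d(2) w(4) by simp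
      thus ?thesis using T_alive[OF x v(1,2)] T_alive[OF x s(1,2)] v(3) s(3) by simp
    qed
    thus ?thesis using tw by (intro exI[of _ "A x w - t"]) auto
  qed
qed

lemma T_left:
  assumes x: "x \<in> DL" and t: "0 < t" and ne: "T x t \<noteq> None"
  shows "\<exists>p\<in>topspace X. left_lim (T x) t (Some p)"
proof (cases "late x t")
  case False
  then obtain s where s: "0 \<le> s" "alive x s" "A x s = t" using T_times[OF x less_imp_le[OF t]] by blast
  have s0: "0 < s" using s t by (cases "s = 0") auto
  obtain p where p: "p \<in> U" "left_lim x s (Some p)" using alive_left_lim[OF x s(2) s0 order_refl] by blast
  have "left_lim (T x) t (Some p)"
  proof (rule left_lim_transfer[OF x s0 _ p(2)])
    show "alive x u \<and> A x u < t" if "0 \<le> u" "u < s" for u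
      using alive_mono[OF s(2), of u] A_less_iff[OF x s(2) _ s(1) that(1)] that(2) s(3) by simp
    show "\<not> late x v" if "v < t" for v by (rule not_late[OF s(1,2)]) (use that s(3) in simp)
  qed (use s(3) in simp)
  thus ?thesis using Some_U_subset[OF p(1)] by blast
next
  case True
  show ?thesis
  proof (cases "\<exists>v. 0 \<le> v \<and> v < t \<and> late x v")
    case True
    then obtain v where v: "0 \<le> v" "v < t" "late x v" by blast
    have c: "T x u = T x t" if "v \<le> u" for u
      using T_late_const[OF x v(1,3) that] T_late_const[OF x v(1,3), of t] v(2) by simp
    obtain p where p: "T x t = Some p" using ne by blast
    have "T x t \<in> \<Omega>" using T_in[OF x] t by auto
    hence "dE (T x u) (T x t) = 0" if "v < u" for u using c[of u] that by simp
    hence "left_lim (T x) t (T x t)"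
      unfolding left_lim_def using v \<open>T x t \<in> \<Omega>\<close> by (intro conjI allI impI exI[of _ "t - v"]) auto
    thus ?thesis using p \<open>T x t \<in> \<Omega>\<close> by auto
  next
    case False
    hence nl: "\<not> late x v" if "0 \<le> v" "v < t" for v using that by blast
    obtain r where r: "0 \<le> r" "\<forall>s\<ge>0. alive x s \<longleftrightarrow> s < r"
      "if soft_exit x r then left_lim x r (T x t) else T x t = x r"
      using T_late[OF x less_imp_le[OF t] \<open>late x t\<close>] by blast
    have r0: "0 < r" using nl[of 0] t r(1,2) unfolding late_def by force
    have "\<exists>p\<in>topspace X. left_lim x r (Some p)"
    proof (rule ccontr)
      assume n: "\<not> ?thesis"
      hence "x r \<noteq> None" using r(3) ne by auto
      hence "ennreal r < lifetime x" using D_expD(2)[OF D_loc_D_exp[OF x] r(1)] by (simp add: not_le)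
      thus False using D_expD(4)[OF D_loc_D_exp[OF x] r0] n by blast
    qed
    then obtain p where p: "p \<in> topspace X" "left_lim x r (Some p)" by blast
    have "left_lim (T x) t (Some p)"
      by (rule left_lim_transfer[OF x r0 _ p(2) nl]) (use r(1,2) \<open>late x t\<close> in \<open>auto simp: late_def\<close>)
    thus ?thesis using p(1) by blast
  qed
qed

lemma T_None:
  assumes x: "x \<in> DL" and t: "0 \<le> t" "T x t = None"
  shows "late x t"
proof (rule ccontr)
  assume "\<not> late x t"
  then obtain s where s: "0 \<le> s" "alive x s" "A x s = t" using T_times[OF x t(1)] by blast
  hence "x s = None" using T_alive[OF x s(1,2)] t(2) by simp
  thus False using alive_in_U[OF x s(2,1) order_refl] by auto
qed

lemma T_D_exp: "x \<in> DL \<Longrightarrow> T x \<in> D_exp X"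
proof (rule D_exp_of_absorbing)
  assume x: "x \<in> DL"
  show "T x \<in> {0..} \<rightarrow>\<^sub>E \<Omega>" by (rule T_in[OF x])
  show "right_cts (T x) t" if "0 \<le> t" for t by (rule T_right_cts[OF x that])
  show "T x t = None" if "0 \<le> s" "s \<le> t" "T x s = None" for s t
    using T_late_const[OF x that(1) T_None[OF x that(1,3)] that(2)] that(3) by simp
  show "\<exists>p\<in>topspace X. left_lim (T x) t (Some p)" if "0 < t" "T x t \<noteq> None" for t by (rule T_left[OF x that])
qed

lemma T_killed:
  assumes x: "x \<in> DL" and l: "lifetime (T x) = ennreal l" "0 < l"
  shows "late x l" "\<And>v. 0 \<le> v \<Longrightarrow> v < l \<Longrightarrow> \<not> late x v"
proof -
  note D = D_expD(2)[OF T_D_exp[OF x]]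
  have N: "T x l = None" using D[of l] l by simp
  show "late x l" using T_None[OF x _ N] l by simp
  show "\<not> late x v" if v: "0 \<le> v" "v < l" for v
  proof
    assume "late x v"
    hence "T x v = None" using T_late_const[OF x v(1) _ less_imp_le[OF v(2)]] N by simp
    thus False using D[OF v(1)] l v by simp
  qed
qed

text \<open>If the time-changed path is killed after staying in a compact set, then \<open>x\<close>
  stayed in that set before its exit; \<open>x\<close> therefore has a left limit there, which the
  clock carries over.\<close>

lemma T_DL:
  assumes x: "x \<in> DL"
  shows "T x \<in> DL"
proof -
  have "\<exists>p\<in>topspace X. has_left_limit X (T x) (lifetime (T x)) (Some p)"
    if l: "0 < lifetime (T x)" "lifetime (T x) < \<infinity>" and rc: "relatively_compact_path X (T x)"
  proof -
    have \<Omega>: "\<forall>s\<ge>0. T x s \<in> \<Omega>" using T_in[OF x] by auto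
    obtain t where t: "lifetime (T x) = ennreal t" "0 < t"
      using l by (cases "lifetime (T x)") (auto simp: ennreal_less_iff)
    note late = T_killed[OF x t]
    obtain r where r: "0 \<le> r" "\<forall>s\<ge>0. alive x s \<longleftrightarrow> s < r"
      using T_late[OF x less_imp_le[OF t(2)] late(1)] by blast
    have r0: "0 < r" using late(2)[of 0] t r(1,2) unfolding late_def by force
    have At: "alive x u \<and> A x u < t" if "0 \<le> u" "u < r" for u using r(2) that late(1) unfolding late_def by blast
    obtain K where K: "compactin X K" "\<And>s. 0 \<le> s \<Longrightarrow> ennreal s < lifetime (T x) \<Longrightarrow> T x s \<in> Some ` K"
      using rc unfolding relatively_compact_path_def by blast
    obtain c where c: "c > 0" "\<And>p. p \<in> K \<Longrightarrow> c \<le> dE (Some p) None" using compactin_imp_away[OF K(1)] by blast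
    have "adm x r"
    proof (rule adm_if_away[OF D_loc_D_exp[OF x] r(1) c(1)])
      fix s assume s: "0 \<le> s" "s < r"
      have "0 \<le> A x s" using A_ge[OF x _ s(1)] At[OF s] s(1) by force
      hence "T x (A x s) \<in> Some ` K" using At[OF s] t by (intro K(2)) (auto simp: ennreal_less_iff)
      thus "c \<le> dE (x s) None" using T_alive[OF x s(1)] At[OF s] c(2) by auto
    qed
    then obtain p where p: "p \<in> topspace X" and p': "left_lim x r (Some p)"
      using adm_cadlag(2)[OF x _ r0 order_refl] by blast
    have "left_lim (T x) t (Some p)"
      by (rule left_lim_transfer[OF x r0 At p' late(2)]) (use r(1,2) in auto)
    thus ?thesis using p has_left_limit_iff[OF t(2) \<Omega>] t(1) by auto
  qed
  thus ?thesis unfolding D_loc_def using T_D_exp[OF x] by blast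
qed

text \<open>If the clock explodes whenever the path leaves \<open>U\<close> without jumping, the time-changed path can
  only be killed by a jump from \<open>U\<close>.\<close>

lemma T_LU:
  assumes x: "x \<in> DL"
    and good: "\<And>B. (\<And>s. 0 \<le> s \<Longrightarrow> alive x s \<Longrightarrow> A x s \<le> B) \<Longrightarrow> \<exists>c>0. \<forall>s\<ge>0. alive x s \<longrightarrow> c \<le> \<rho> (x s)"
  shows "T x \<in> LU"
proof -
  have "\<exists>p\<in>U. has_left_limit X (T x) (lifetime (T x)) (Some p)"
    if l: "0 < lifetime (T x)" "lifetime (T x) < \<infinity>"
  proof -
    have \<Omega>: "\<forall>s\<ge>0. T x s \<in> \<Omega>" using T_in[OF x] by auto
    obtain t where t: "lifetime (T x) = ennreal t" "0 < t"
      using l by (cases "lifetime (T x)") (auto simp: ennreal_less_iff)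
    note late = T_killed[OF x t]
    obtain c where c: "c > 0" "\<And>s. 0 \<le> s \<Longrightarrow> alive x s \<Longrightarrow> c \<le> \<rho> (x s)"
      using good[of t] late(1) unfolding late_def by force
    have c': "c \<le> \<rho> (T x v)" if "0 \<le> v" "v < t" for v
      using T_times[OF x that(1) late(2)[OF that]] T_alive[OF x] c(2) by metis
    have "relatively_compact_path X (T x)"
    proof (rule relatively_compact_if_away[OF T_D_exp[OF x] c(1)])
      show "c \<le> dE (T x s) None" if "0 \<le> s" "ennreal s < lifetime (T x)" for s
        using c'[of s] that \<rho>_None_le[of "T x s"] by (simp add: t ennreal_less_iff)
    qed
    then obtain p where p: "p \<in> topspace X" "has_left_limit X (T x) (lifetime (T x)) (Some p)"
      using T_DL[OF x] l unfolding D_loc_def by blast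
    have "left_lim (T x) t (Some p)" using p(2) has_left_limit_iff[OF t(2) \<Omega>] t(1) by simp
    hence "c \<le> \<rho> (Some p)" using \<rho>_left_lim_ge[OF _ t(2), of "T x" "Some p" c] \<Omega> c' by blast
    hence "p \<in> U" using \<rho>_pos_iff[of "Some p"] p(1) c(1) by auto
    thus ?thesis using p(2) by blast
  qed
  thus ?thesis unfolding left_limit_in_def using T_DL[OF x] by blast
qed

end

section \<open>Measurability of the time change\<close>

lemma pred_countable_bounded:
  assumes "countable I" "\<And>i. i \<in> I \<Longrightarrow> Measurable.pred M (P i)"
  shows "Measurable.pred M (\<lambda>x. \<forall>i\<in>I. P i x)" "Measurable.pred M (\<lambda>x. \<exists>i\<in>I. P i x)"
  using assms unfolding pred_def
  by (auto intro!: sets.sets_Collect_countable_All' sets.sets_Collect_countable_Ex')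

context lc_space begin

text \<open>The limit lies in \<open>V\<close> if and only if the sequence finally stays in an open
  ball whose closed version is contained in \<open>V\<close>; balls with centres
  \<open>den i\<close> and radii \<open>1 / (k + 1)\<close> suffice, and these are countably
  many.\<close>

lemma limit_measurable:
  assumes V: "openin E V" and z: "\<And>n W. openin E W \<Longrightarrow> {\<omega> \<in> space N. z n \<omega> \<in> W} \<in> sets N"
    and in\<Omega>: "\<And>n \<omega>. \<omega> \<in> space N \<Longrightarrow> z n \<omega> \<in> \<Omega>" "\<And>\<omega>. \<omega> \<in> space N \<Longrightarrow> z' \<omega> \<in> \<Omega>"
    and lim: "\<And>\<omega> e. \<omega> \<in> space N \<Longrightarrow> 0 < e \<Longrightarrow> \<forall>\<^sub>F n in sequentially. dE (z n \<omega>) (z' \<omega>) < e"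
  shows "{\<omega> \<in> space N. z' \<omega> \<in> V} \<in> sets N"
proof -
  define I where "I = {(i, k :: nat). E.mcball (den i) (1 / (real k + 1)) \<subseteq> V}"
  have "z' \<omega> \<in> V \<longleftrightarrow> (\<exists>ik\<in>I. \<exists>m. \<forall>n\<ge>m. z n \<omega> \<in> E.mball (den (fst ik)) (1 / (real (snd ik) + 1)))" (is "_ \<longleftrightarrow> ?R")
    if \<omega>: "\<omega> \<in> space N" for \<omega>
  proof
    assume "z' \<omega> \<in> V"
    then obtain r where r: "0 < r" "E.mball (z' \<omega>) r \<subseteq> V"
      using V unfolding mtopology_E[symmetric] E.openin_mtopology by blast
    obtain k :: nat where k: "2 / r < real k" using reals_Archimedean2 by blast
    define q where "q = 1 / (real k + 1)"
    have q: "0 < q" "2 * q < r"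
      using k r(1) by (auto simp: q_def field_simps)
    obtain i where i: "dE (z' \<omega>) (den i) < q / 2" using den(2)[OF in\<Omega>(2)[OF \<omega>], of "q / 2"] q by auto
    have "E.mcball (den i) q \<subseteq> E.mball (z' \<omega>) r"
      using i q E.triangle[OF in\<Omega>(2)[OF \<omega>] den(1)[of i]] in\<Omega>(2)[OF \<omega>] by (fastforce simp: E.in_mcball E.in_mball)
    hence "(i, k) \<in> I" using r(2) by (auto simp: I_def q_def)
    moreover have "\<forall>\<^sub>F n in sequentially. z n \<omega> \<in> E.mball (den i) q"
      using lim[OF \<omega> half_gt_zero[OF q(1)]]
    proof eventually_elim
      case (elim n)
      thus ?case
        using i E.triangle[OF den(1)[of i] in\<Omega>(2)[OF \<omega>] in\<Omega>(1)[OF \<omega>, of n]] den(1)[of i] in\<Omega>(1)[OF \<omega>, of n]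
          E.commute[of "z n \<omega>" "z' \<omega>"] E.commute[of "den i" "z' \<omega>"] by (simp add: E.in_mball)
    qed
    ultimately show ?R unfolding eventually_sequentially q_def by force
  next
    assume ?R
    then obtain ik m where ik: "ik \<in> I" "\<forall>n\<ge>m. z n \<omega> \<in> E.mball (den (fst ik)) (1 / (real (snd ik) + 1))" by blast
    obtain i k where "ik = (i, k)" by (cases ik)
    hence I: "(i, k) \<in> I" and m: "\<And>n. n \<ge> m \<Longrightarrow> z n \<omega> \<in> E.mball (den i) (1 / (real k + 1))" using ik by simp_all
    have "dE (den i) (z' \<omega>) \<le> 1 / (real k + 1)"
    proof (rule field_le_epsilon)
      fix e :: real assume "0 < e"
      then obtain m' where m': "\<And>n. n \<ge> m' \<Longrightarrow> dE (z n \<omega>) (z' \<omega>) < e"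
        using lim[OF \<omega>] unfolding eventually_sequentially by blast
      show "dE (den i) (z' \<omega>) \<le> 1 / (real k + 1) + e"
        using m[of "max m m'"] m'[of "max m m'"] E.triangle[OF den(1)[of i] in\<Omega>(1)[OF \<omega>, of "max m m'"] in\<Omega>(2)[OF \<omega>]]
        by (simp add: E.in_mball)
    qed
    thus "z' \<omega> \<in> V" using I in\<Omega>(2)[OF \<omega>] den(1)[of i] by (auto simp: I_def E.in_mcball)
  qed
  hence "{\<omega> \<in> space N. z' \<omega> \<in> V} = {\<omega> \<in> space N. \<exists>ik\<in>I. \<exists>m. \<forall>n\<ge>m. z n \<omega> \<in> E.mball (den (fst ik)) (1 / (real (snd ik) + 1))}" by blast
  also have "\<dots> \<in> sets N"
    using z[OF mball_open] by (intro sets.sets_Collect_countable_Bex sets.sets_Collect_countable_Ex sets.sets_Collect_countable_All) auto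
  finally show ?thesis .
qed

end

context lc_rate begin

text \<open>A soft exit expressed with rational times: staying away from \<open>None\<close> yields
  a left limit in \<open>X\<close>, by \<open>D_loc\<close>, and values of \<open>\<rho>\<close>
  arbitrarily close to \<open>0\<close> put this limit outside \<open>U\<close>.\<close>

definition soft :: "'a path \<Rightarrow> bool" where
  "soft x \<longleftrightarrow> alive x 0 \<and> (\<exists>j::nat. \<forall>q\<in>{q\<in>\<rat>. 0 \<le> q}. alive x q \<longrightarrow> 1 / (real j + 1) \<le> dE (x q) None) \<and>
     (\<forall>j::nat. \<exists>q\<in>{q\<in>\<rat>. 0 \<le> q}. alive x q \<and> \<rho> (x q) < 1 / (real j + 1))"

lemma soft_iff:
  assumes x: "x \<in> DL" and r: "0 \<le> r" "\<forall>s\<ge>0. alive x s \<longleftrightarrow> s < r"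
  shows "soft x \<longleftrightarrow> soft_exit x r"
proof
  assume s: "soft x"
  hence r0: "0 < r" using r by (auto simp: soft_def)
  obtain j :: nat where j: "\<And>q. q \<in> \<rat> \<Longrightarrow> 0 \<le> q \<Longrightarrow> q < r \<Longrightarrow> 1 / (real j + 1) \<le> dE (x q) None"
    using s r(2) unfolding soft_def by auto
  have away: "1 / (real j + 1) \<le> dE (x u) None" if u: "0 \<le> u" "u < r" for u
    by (rule right_cts_limit_le[OF x u, where f="\<lambda>z. dE z None"])
      (use j u E.triangle[OF _ _ None_in] in \<open>auto simp: add.commute\<close>)
  obtain p where p: "p \<in> topspace X" "left_lim x r (Some p)"
    using adm_cadlag(2)[OF x adm_if_away[OF D_loc_D_exp[OF x] r(1) _ away] r0 order_refl] by auto
  have "\<rho> (Some p) = 0"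
  proof (rule ccontr)
    assume "\<rho> (Some p) \<noteq> 0"
    hence "0 < \<rho> (Some p)" using \<rho>_nonneg[of "Some p"] by linarith
    moreover have "\<exists>c>0. \<forall>v. 0 \<le> v \<and> v \<le> u \<longrightarrow> c \<le> \<rho> (x v)" if "u < r" for u
    proof -
      have "alive x (max 0 u)" using r(2) r0 that by simp
      thus ?thesis using alive_mono[of x "max 0 u" u] unfolding alive_def by simp
    qed
    ultimately obtain m where m: "0 < m" and ge: "\<And>u. 0 \<le> u \<Longrightarrow> u < r \<Longrightarrow> m \<le> \<rho> (x u)"
      using bounded_below_before[OF DL_paths[OF x] p(2) _ \<rho>_Lipschitz] by blast
    obtain i :: nat where i: "1 / m < real i" using reals_Archimedean2 by blast
    hence "1 / (real i + 1) < m" using m by (simp add: field_simps)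
    moreover obtain q where "0 \<le> q" "alive x q" "\<rho> (x q) < 1 / (real i + 1)" using s unfolding soft_def by auto
    ultimately show False using ge[of q] r(2) by force
  qed
  thus "soft_exit x r" using r0 p by blast
next
  assume "soft_exit x r"
  then obtain l where r0: "0 < r" and l: "l \<in> topspace X" "\<rho> (Some l) = 0" "left_lim x r (Some l)" by blast
  have a: "alive x 0" using r r0 by simp
  have lN: "0 < dE (Some l) None" using l(1) by (intro dE_None_pos) auto
  have tri: "\<And>y z. y \<in> \<Omega> \<Longrightarrow> z \<in> \<Omega> \<Longrightarrow> dE y None \<le> dE z None + dE y z"
    using E.triangle[OF _ _ None_in] by (simp add: add.commute)
  have "\<exists>c>0. \<forall>v. 0 \<le> v \<and> v \<le> u \<longrightarrow> c \<le> dE (x v) None" if "u < r" for u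
  proof -
    have "alive x (max 0 u)" using r(2) r0 that by simp
    then obtain c where "c > 0" "\<forall>v. 0 \<le> v \<and> v \<le> max 0 u \<longrightarrow> c \<le> \<rho> (x v)" unfolding alive_def by blast
    thus ?thesis using \<rho>_None_le by (intro exI[of _ c]) (meson max.coboundedI2 order_trans)
  qed
  then obtain m where m: "0 < m" and ge: "\<And>u. 0 \<le> u \<Longrightarrow> u < r \<Longrightarrow> m \<le> dE (x u) None"
    using bounded_below_before[OF DL_paths[OF x] l(3) lN tri] by blast
  obtain i :: nat where i: "1 / m < real i" using reals_Archimedean2 by blast
  hence "1 / (real i + 1) \<le> m" using m by (simp add: field_simps)
  hence 1: "\<forall>q\<in>{q\<in>\<rat>. 0 \<le> q}. alive x q \<longrightarrow> 1 / (real i + 1) \<le> dE (x q) None"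
    using ge r(2) by (auto intro: order_trans)
  have 2: "\<exists>q\<in>{q\<in>\<rat>. 0 \<le> q}. alive x q \<and> \<rho> (x q) < 1 / (real j + 1)" for j :: nat
  proof -
    obtain d where d: "d > 0" "d \<le> r" "\<And>u. r - d < u \<Longrightarrow> u < r \<Longrightarrow> dE (x u) (Some l) < 1 / (real j + 1)"
    proof -
      have "0 < 1 / (real j + 1)" by simp
      thus ?thesis using that l(3) unfolding left_lim_def by blast
    qed
    obtain q where q: "q \<in> \<rat>" "r - d < q" "q < r" using Rats_dense_in_real[of "r - d" r] d(1) by auto
    hence "\<rho> (x q) < 1 / (real j + 1)"
      using d(2) d(3)[of q] \<rho>_Lipschitz[of "x q" "Some l"] DL_paths[OF x, of q] l(1,2) by simp
    thus ?thesis using q d(2) r(2) by auto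
  qed
  show "soft x" unfolding soft_def using a 1 2 by blast
qed

lemma alive_measurable:
  assumes r: "0 \<le> r"
  shows "Measurable.pred BL (\<lambda>x. alive x r)"
proof -
  define Q where "Q = insert r {q\<in>\<rat>. 0 \<le> q \<and> q < r}"
  have Q: "countable Q" unfolding Q_def by (intro countable_insert countable_subset[OF _ countable_rat]) auto
  have eq: "alive x r \<longleftrightarrow> (\<exists>j::nat. \<forall>u\<in>Q. 1 / (real j + 1) \<le> \<rho> (x u))" if x: "x \<in> space BL" for x
  proof
    assume "alive x r"
    then obtain c where c: "c > 0" "\<And>u. 0 \<le> u \<Longrightarrow> u \<le> r \<Longrightarrow> c \<le> \<rho> (x u)" unfolding alive_def by blast
    obtain j :: nat where "1 / c < real j" using reals_Archimedean2 by blast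
    hence "1 / (real j + 1) \<le> c" using c(1) by (simp add: field_simps)
    thus "\<exists>j::nat. \<forall>u\<in>Q. 1 / (real j + 1) \<le> \<rho> (x u)"
      using c(2) r by (intro exI[of _ j]) (auto simp: Q_def intro: order_trans)
  next
    assume "\<exists>j::nat. \<forall>u\<in>Q. 1 / (real j + 1) \<le> \<rho> (x u)"
    then obtain j :: nat where j: "\<forall>u\<in>Q. 1 / (real j + 1) \<le> \<rho> (x u)" by blast
    have "1 / (real j + 1) \<le> \<rho> (x u)" if u: "0 \<le> u" "u \<le> r" for u
    proof (cases "u = r")
      case False
      hence ur: "u < r" using u by simp
      show ?thesis
        by (rule right_cts_limit_le[OF _ u(1) ur \<rho>_Lipschitz]) (use x j u in \<open>auto simp: Q_def\<close>)
    qed (use j in \<open>simp add: Q_def\<close>)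
    thus "alive x r" unfolding alive_def by (intro exI[of _ "1 / (real j + 1)"]) auto
  qed
  have "Measurable.pred BL (\<lambda>x. \<exists>j::nat. \<forall>u\<in>Q. 1 / (real j + 1) \<le> \<rho> (x u))"
  proof (intro pred_intros_countable pred_countable_bounded Q)
    fix j :: nat and u assume "u \<in> Q"
    hence [measurable]: "(\<lambda>x. \<rho> (x u)) \<in> borel_measurable BL" using r by (intro \<rho>_coordinate_measurable) (auto simp: Q_def)
    show "Measurable.pred BL (\<lambda>x. 1 / (real j + 1) \<le> \<rho> (x u))" by measurable
  qed
  thus ?thesis using measurable_cong[of BL "\<lambda>x. alive x r", OF eq] by simp
qed

lemma Aint_measurable: "(\<lambda>x. Aint x r) \<in> borel_measurable BL"
proof -
  have m: "(\<lambda>(x, v). \<rho> (x (max 0 v))) \<in> borel_measurable (BL \<Otimes>\<^sub>M lborel)"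
    using measurable_compose[OF measurable_pair_swap' \<rho>_jointly_measurable] by (simp add: case_prod_beta')
  have "(\<lambda>(x, v). 1 / ennreal (\<gamma> (\<rho> (x (max 0 v)))) * indicator {0..<r} v) \<in> borel_measurable (BL \<Otimes>\<^sub>M lborel)"
  proof -
    have [measurable]: "(\<lambda>z. \<rho> (fst z (max 0 (snd z)))) \<in> borel_measurable (BL \<Otimes>\<^sub>M lborel)" using m by (simp add: case_prod_beta')
    show ?thesis unfolding case_prod_beta' by measurable
  qed
  hence "(\<lambda>x. \<integral>\<^sup>+v\<in>{0..<r}. 1 / ennreal (\<gamma> (\<rho> (x (max 0 v)))) \<partial>lborel) \<in> borel_measurable BL"
    by (rule lborel.borel_measurable_nn_integral)
  also have "(\<lambda>x. \<integral>\<^sup>+v\<in>{0..<r}. 1 / ennreal (\<gamma> (\<rho> (x (max 0 v)))) \<partial>lborel) = (\<lambda>x. Aint x r)"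
    unfolding Aint_def by (intro ext nn_integral_cong) (auto simp: indicator_def)
  finally show ?thesis .
qed

lemma Aint_alive:
  assumes "x \<in> DL" "0 \<le> s" "alive x s" shows "Aint x s = ennreal (A x s)"
  using clock_alive[OF assms] clock_Aint[OF assms(1,2) less_imp_le] \<sigma>_alive[OF assms(1,2)] assms(3) by simp

lemma rational_pos: "countable {q::real. q \<in> \<rat> \<and> 0 \<le> q}"
  by (rule countable_subset[OF _ countable_rat]) auto

lemma late_measurable:
  assumes t: "0 \<le> t"
  shows "Measurable.pred BL (\<lambda>x. late x t)"
proof -
  have eq: "late x t \<longleftrightarrow> (\<forall>q\<in>{q\<in>\<rat>. 0 \<le> q}. alive x q \<longrightarrow> Aint x q < ennreal t)" if x: "x \<in> space BL" for x
  proof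
    have xD: "x \<in> DL" using x by simp
    assume l: "late x t"
    show "\<forall>q\<in>{q\<in>\<rat>. 0 \<le> q}. alive x q \<longrightarrow> Aint x q < ennreal t"
    proof clarify
      fix q :: real assume q: "0 \<le> q" "alive x q"
      hence "0 \<le> A x q" using A_ge[OF xD q(2,1)] by simp
      thus "Aint x q < ennreal t" using Aint_alive[OF xD q] l q by (auto simp: late_def ennreal_less_iff)
    qed
  next
    have xD: "x \<in> DL" using x by simp
    assume l: "\<forall>q\<in>{q\<in>\<rat>. 0 \<le> q}. alive x q \<longrightarrow> Aint x q < ennreal t"
    show "late x t" unfolding late_def
    proof (intro allI impI)
      fix s assume s: "0 \<le> s" "alive x s"
      then obtain s' where s': "s < s'" "alive x s'" using alive_later[OF xD] by blast
      obtain q where q: "q \<in> \<rat>" "s < q" "q < s'" using Rats_dense_in_real[OF s'(1)] by blast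
      have qa: "0 \<le> q" "alive x q" using s q alive_mono[OF s'(2)] by auto
      have "ennreal (A x q) < ennreal t" using l q(1) qa Aint_alive[OF xD qa] by auto
      moreover have "0 \<le> A x q" using A_ge[OF xD qa(2,1)] qa(1) by simp
      ultimately have "A x q < t" by (simp add: ennreal_less_iff)
      thus "A x s < t" using A_less_iff[OF xD qa(2) s(2) qa(1) s(1)] q(2) by simp
    qed
  qed
  have "Measurable.pred BL (\<lambda>x. \<forall>q\<in>{q\<in>\<rat>. 0 \<le> q}. alive x q \<longrightarrow> Aint x q < ennreal t)"
  proof (intro pred_countable_bounded rational_pos)
    fix q :: real assume q: "q \<in> {q \<in> \<rat>. 0 \<le> q}"
    have [measurable]: "Measurable.pred BL (\<lambda>x. alive x q)" using q by (intro alive_measurable) simp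
    note [measurable] = Aint_measurable[of q]
    show "Measurable.pred BL (\<lambda>x. alive x q \<longrightarrow> Aint x q < ennreal t)" by measurable
  qed
  thus ?thesis using measurable_cong[of BL "\<lambda>x. late x t", OF eq] by simp
qed

lemma soft_measurable: "Measurable.pred BL soft"
proof -
  have Nn: "Measurable.pred BL (\<lambda>x. 1 / (real j + 1) \<le> dE (x q) None)" if q: "0 \<le> q" for j :: nat and q
  proof -
    have eq: "{x \<in> space BL. 1 / (real j + 1) \<le> dE (x q) None} = {x \<in> DL. x q \<notin> E.mball None (1 / (real j + 1))}"
      using DL_paths[OF _ q] by (auto simp: E.in_mball E.commute)
    show ?thesis unfolding pred_def eq by (rule coordinate_open_measurable(2)[OF q mball_open])
  qed
  have al: "Measurable.pred BL (\<lambda>x. alive x q)" "(\<lambda>x. \<rho> (x q)) \<in> borel_measurable BL" if "0 \<le> q" for q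
    using alive_measurable[OF that] \<rho>_coordinate_measurable[OF that] by auto
  note [measurable] = al(1)[OF order_refl]
  have [measurable]: "Measurable.pred BL (\<lambda>x. \<exists>j::nat. \<forall>q\<in>{q\<in>\<rat>. 0 \<le> q}. alive x q \<longrightarrow> 1 / (real j + 1) \<le> dE (x q) None)"
  proof (intro pred_intros_countable pred_countable_bounded rational_pos)
    fix j :: nat and q :: real assume q: "q \<in> {q \<in> \<rat>. 0 \<le> q}"
    hence "0 \<le> q" by simp
    note [measurable] = Nn[OF this, of j] al[OF this]
    show "Measurable.pred BL (\<lambda>x. alive x q \<longrightarrow> 1 / (real j + 1) \<le> dE (x q) None)" by measurable
  qed
  have [measurable]: "Measurable.pred BL (\<lambda>x. \<forall>j::nat. \<exists>q\<in>{q\<in>\<rat>. 0 \<le> q}. alive x q \<and> \<rho> (x q) < 1 / (real j + 1))"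
  proof (intro pred_intros_countable pred_countable_bounded rational_pos)
    fix j :: nat and q :: real assume q: "q \<in> {q \<in> \<rat>. 0 \<le> q}"
    hence "0 \<le> q" by simp
    note [measurable] = al[OF this]
    show "Measurable.pred BL (\<lambda>x. alive x q \<and> \<rho> (x q) < 1 / (real j + 1))" by measurable
  qed
  show ?thesis unfolding soft_def[abs_def] by measurable
qed

text \<open>The stopping time is approximated on a grid by the least index at which the clock has
  passed \<open>t\<close> or the path is no longer alive. This index is measurable, and the values
  at the grid times converge to \<open>T x t\<close>.\<close>

lemma T_measurable: "T \<in> measurable BL BL"
proof (rule measurable_into_BL_coordinates)
  show "T \<omega> \<in> DL" if "\<omega> \<in> space BL" for \<omega> using T_DL that by simp
  fix t :: real and V assume t: "0 \<le> t" and V: "openin E V"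
  define s where "s n i = real i / (real n + 1)" for n i :: nat
  have s0: "0 \<le> s n i" for n i by (simp add: s_def)
  have sSuc: "s n (Suc i) = s n i + 1 / (real n + 1)" for n i by (simp add: s_def field_simps)
  define P where "P n i x \<longleftrightarrow> \<not> (alive x (s n i) \<and> Aint x (s n i) \<le> ennreal t)" for n i x
  define L where "L n x = (LEAST i. P n i x)" for n x
  \<comment> \<open>Grid times from the right give the value; at a soft exit the left limit is
    wanted, and the preceding grid time lies before the exit.\<close>
  define M where "M n x = (if late x t \<and> soft x then L n x - 1 else L n x)" for n x
  note [measurable] = late_measurable[OF t] soft_measurable alive_measurable[OF s0] Aint_measurable
  have Pm: "Measurable.pred BL (P n i)" for n i
    unfolding P_def by measurable
  have Lm[measurable]: "L n \<in> measurable BL (count_space UNIV)" for n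
    unfolding L_def by (rule measurable_Least) (rule Pm)
  have Mm: "M n \<in> measurable BL (count_space UNIV)" for n
    unfolding M_def by measurable
  show "{\<omega> \<in> space BL. T \<omega> t \<in> V} \<in> sets BL"
  proof (rule limit_measurable[OF V, where z="\<lambda>n x. x (s n (M n x))"])
    show "x (s n (M n x)) \<in> \<Omega>" if "x \<in> space BL" for n x using that by (intro DL_paths s0) simp
    show "T x t \<in> \<Omega>" if "x \<in> space BL" for x using T_in[of x] that t by auto
    fix n W assume W: "openin E W"
    have "{x \<in> space BL. x (s n (M n x)) \<in> W} = (\<Union>i. (M n -` {i} \<inter> space BL) \<inter> {x \<in> DL. x (s n i) \<in> W})" by auto
    also have "\<dots> \<in> sets BL"
      by (rule sets.countable_UN'', simp, rule sets.Int[OF measurable_sets[OF Mm] coordinate_measurable[OF s0 W]]) simp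
    finally show "{x \<in> space BL. x (s n (M n x)) \<in> W} \<in> sets BL" .
  next
    fix x and e :: real assume "x \<in> space BL" and e: "0 < e"
    hence x: "x \<in> DL" by simp
    have inv: "\<forall>\<^sub>F n in sequentially. 1 / (real n + 1) < d" if "0 < d" for d
      using order_tendstoD(2)[OF LIMSEQ_inverse_real_of_nat that] by (simp add: inverse_eq_divide add.commute)
    have Pex: "P n i x" if "t < s n i" for n i
    proof -
      have "\<not> ennreal (A x (s n i)) \<le> ennreal t" if al: "alive x (s n i)"
        using A_ge[OF x al s0] \<open>t < s n i\<close> t by simp
      thus ?thesis using Aint_alive[OF x s0, of n i] by (auto simp: P_def)
    qed
    have "\<exists>i. t < s n i" for n
    proof -
      obtain i :: nat where "t * (real n + 1) < real i" using reals_Archimedean2 by blast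
      thus ?thesis by (intro exI[of _ i]) (simp add: s_def field_simps)
    qed
    hence PL: "P n (L n x) x" for n unfolding L_def using Pex LeastI_ex by metis
    have L_least: "\<not> P n i x" if "i < L n x" for n i using that unfolding L_def by (rule not_less_Least)
    have Pnot: "\<not> P n i x \<longleftrightarrow> alive x (s n i) \<and> A x (s n i) \<le> t" for n i
      using Aint_alive[OF x s0, of n i] t by (auto simp: P_def)
    show "\<forall>\<^sub>F n in sequentially. dE (x (s n (M n x))) (T x t) < e"
    proof (cases "late x t")
      case False
      obtain r where r: "0 \<le> r" "alive x r" "A x r = t" using T_times[OF x t False] by blast
      obtain d where d: "d > 0" "\<And>u. r \<le> u \<Longrightarrow> u < r + d \<Longrightarrow> dE (x u) (x r) < e" using DL_right[OF x r(1) e] by blast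
      have le: "\<not> P n i x \<longleftrightarrow> s n i \<le> r" for n i
        unfolding Pnot using A_less_iff[OF x _ r(2) s0 r(1)] alive_mono[OF r(2)] r(3) by (metis not_less)
      show ?thesis using inv[OF d(1)]
      proof eventually_elim
        case (elim n)
        have "r < s n (L n x)" using le[of n "L n x"] PL[of n] by simp
        moreover have "s n (L n x) \<le> r + 1 / (real n + 1)"
        proof (cases "L n x")
          case 0
          thus ?thesis using r(1) by (simp add: s_def)
        next
          case (Suc i)
          thus ?thesis using L_least[of i n] le[of n i] sSuc[of n i] by simp
        qed
        ultimately have "dE (x (s n (L n x))) (x r) < e" using elim by (intro d(2)) auto
        thus ?case using False T_alive[OF x r(1,2)] r(3) by (simp add: M_def)
      qed
    next
      case True
      obtain r where r: "0 \<le> r" "\<forall>s\<ge>0. alive x s \<longleftrightarrow> s < r"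
        "if soft_exit x r then left_lim x r (T x t) else T x t = x r"
        using T_late[OF x t True] by blast
      have le: "\<not> P n i x \<longleftrightarrow> s n i < r" for n i
        unfolding Pnot using r(2) s0 True by (auto simp: late_def intro: less_imp_le)
      have L1: "r \<le> s n (L n x)" for n using le PL[of n] by force
      have L2: "L n x = Suc i \<Longrightarrow> s n i < r" for n i using L_least[of i n] le by simp
      show ?thesis
      proof (cases "soft x")
        case True
        hence r0: "0 < r" and l: "left_lim x r (T x t)" using soft_iff[OF x r(1,2)] r(3) by auto
        obtain d where d: "d > 0" "\<And>u. r - d < u \<Longrightarrow> u < r \<Longrightarrow> dE (x u) (T x t) < e"
          using l e unfolding left_lim_def by blast
        show ?thesis using inv[OF d(1)]
        proof eventually_elim
          case (elim n)
          obtain i where i: "L n x = Suc i" using L1[of n] r0 by (cases "L n x") (auto simp: s_def)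
          hence "dE (x (s n i)) (T x t) < e" using elim L1[of n] L2[OF i] sSuc[of n i] by (intro d(2)) auto
          thus ?case using True \<open>late x t\<close> i by (simp add: M_def)
        qed
      next
        case False
        hence T: "T x t = x r" using soft_iff[OF x r(1,2)] r(3) by auto
        obtain d where d: "d > 0" "\<And>u. r \<le> u \<Longrightarrow> u < r + d \<Longrightarrow> dE (x u) (x r) < e" using DL_right[OF x r(1) e] by blast
        show ?thesis using inv[OF d(1)]
        proof eventually_elim
          case (elim n)
          have "s n (L n x) < r + d"
          proof (cases "L n x")
            case 0
            thus ?thesis using r(1) d(1) by (simp add: s_def)
          next
            case (Suc i)
            thus ?thesis using L2[OF Suc] sSuc[of n i] elim by simp
          qed
          hence "dE (x (s n (L n x))) (x r) < e" using L1 by (intro d(2)) auto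
          thus ?case using False T by (simp add: M_def)
        qed
      qed
    qed
  qed
qed

end

section \<open>Continuity of the time change\<close>

lemma dyadic_level:
  assumes p: "0 < p" "p < (1/2::real)^n0"
  shows "\<exists>n\<ge>n0. (1/2)^(n+1) \<le> p \<and> p < (1/2)^n"
proof -
  obtain j0 where "(1/2::real)^j0 < p" using real_arch_pow_inv[of p "1/2"] p by auto
  hence ex: "\<exists>j. (1/2::real)^j \<le> p" using less_imp_le by blast
  define j where "j = (LEAST j. (1/2::real)^j \<le> p)"
  have j: "(1/2)^j \<le> p" unfolding j_def using ex by (rule LeastI_ex)
  have n0: "n0 < j"
  proof (rule ccontr)
    assume "\<not> n0 < j"
    hence "(1/2::real)^n0 \<le> (1/2)^j" by (intro power_decreasing) auto
    thus False using j p(2) by linarith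
  qed
  then obtain n where n: "j = Suc n" by (cases j) auto
  have "\<not> (1/2::real)^n \<le> p" using not_less_Least[of n "\<lambda>j. (1/2::real)^j \<le> p"] n unfolding j_def by simp
  thus ?thesis using j n n0 by (intro exI[of _ n]) auto
qed

lemma piecewise_time_homeo:
  fixes f :: "real \<Rightarrow> real"
  assumes S: "0 \<le> S" and f0: "f 0 = 0" and mono: "\<And>s t. 0 \<le> s \<Longrightarrow> s < t \<Longrightarrow> t \<le> S \<Longrightarrow> f s < f t"
    and surj: "\<And>y. 0 \<le> y \<Longrightarrow> y \<le> f S \<Longrightarrow> \<exists>t. 0 \<le> t \<and> t \<le> S \<and> f t = y"
  shows "time_homeo (\<lambda>t. if t \<le> S then f t else f S + (t - S))" (is "time_homeo ?l")
proof -
  have fge: "0 \<le> f t" if "0 \<le> t" "t \<le> S" for t using mono[of 0 t] f0 that by (cases "t = 0") auto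
  have less: "?l s < ?l t" if st: "0 \<le> s" "s < t" for s t
  proof (cases "t \<le> S")
    case True
    thus ?thesis using mono[of s t] st by simp
  next
    case False
    consider "s < S" | "s = S" | "S < s" by linarith
    thus ?thesis
    proof cases
      case 1
      thus ?thesis using mono[OF st(1) 1] st False by simp
    qed (use st False in simp_all)
  qed
  have "strict_mono_on {0..} ?l" by (intro strict_mono_onI less) auto
  moreover have "?l ` {0..} = {0..}"
  proof
    show "?l ` {0..} \<subseteq> {0..}"
    proof (intro image_subsetI)
      fix t :: real assume "t \<in> {0..}"
      thus "?l t \<in> {0..}" using fge[of t] fge[OF S order_refl] by (cases "t \<le> S") simp_all
    qed
    show "{0..} \<subseteq> ?l ` {0..}"
    proof
      fix y :: real assume y: "y \<in> {0..}"
      show "y \<in> ?l ` {0..}"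
      proof (cases "y \<le> f S")
        case True
        then obtain t where "0 \<le> t" "t \<le> S" "f t = y" using surj y by auto
        thus ?thesis by (intro image_eqI[of _ _ t]) auto
      next
        case False
        thus ?thesis using S by (intro image_eqI[of _ _ "S + (y - f S)"]) auto
      qed
    qed
  qed
  ultimately show ?thesis unfolding time_homeo_def by blast
qed

context lc_space begin

text \<open>Partitions with oscillation below \<open>1 / (n + 1)\<close>, for all \<open>n\<close>,
  have countably many points in total, and away from these the path is continuous.\<close>

lemma cadlag_continuity_points:
  assumes x: "cadlag_upto x s"
  shows "\<exists>D. countable D \<and> (\<forall>v. 0 \<le> v \<and> v < s \<and> v \<notin> D \<longrightarrow>
    (\<forall>e>0. \<exists>d>0. \<forall>u. \<bar>u - v\<bar> < d \<longrightarrow> dE (x u) (x v) < e))"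
proof -
  have "\<forall>n. \<exists>m (p :: nat \<Rightarrow> real). p 0 = 0 \<and> p m = s \<and> (\<forall>j<m. p j < p (Suc j)) \<and>
    (\<forall>j<m. \<forall>u v. p j \<le> u \<and> u < p (Suc j) \<and> p j \<le> v \<and> v < p (Suc j) \<longrightarrow> dE (x u) (x v) < 1 / (real n + 1))"
    using cadlag_partition[OF x] by simp
  then obtain m p where p: "\<And>n. p n 0 = (0::real)" "\<And>n. p n (m n) = s"
    "\<And>n j u v. j < m n \<Longrightarrow> p n j \<le> u \<Longrightarrow> u < p n (Suc j) \<Longrightarrow> p n j \<le> v \<Longrightarrow> v < p n (Suc j) \<Longrightarrow> dE (x u) (x v) < 1 / (real n + 1)"
    by metis
  define D where "D = (\<Union>n j::nat. {p n j})"
  have "\<exists>d>0. \<forall>u. \<bar>u - v\<bar> < d \<longrightarrow> dE (x u) (x v) < e" if v: "0 \<le> v" "v < s" "v \<notin> D" and e: "0 < e" for v e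
  proof -
    obtain n :: nat where "1 / e < real n" using reals_Archimedean2 by blast
    hence n: "1 / (real n + 1) < e" using e by (simp add: field_simps)
    obtain j where j: "j < m n" "p n j \<le> v" "v < p n (Suc j)"
      using locate_interval[of "p n" v "m n"] p(1,2) v by auto
    have "p n j \<noteq> v" using v(3) by (auto simp: D_def)
    hence "p n j < v" using j(2) by simp
    moreover have "dE (x u) (x v) < e" if "\<bar>u - v\<bar> < min (v - p n j) (p n (Suc j) - v)" for u
    proof -
      have "p n j \<le> u" "u < p n (Suc j)" using that by linarith+
      thus ?thesis using p(3)[OF j(1) _ _ j(2,3), of u] n by simp
    qed
    ultimately show ?thesis using j(3) by (intro exI[of _ "min (v - p n j) (p n (Suc j) - v)"]) auto
  qed
  moreover have "countable D" unfolding D_def by auto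
  ultimately show ?thesis by blast
qed

end

context lc_rate begin

text \<open>The rates converge at the continuity points of \<open>x\<close>, hence almost
  everywhere, and are dominated because \<open>\<rho>\<close> stays above \<open>c / 2\<close>. One
  estimate of the integrated difference then serves all \<open>u\<close> at once, up to the rate
  bound times the time shift. The lower bound is asked strictly before \<open>s\<close>, so
  \<open>s\<close> may be the time of a jump out of \<open>U\<close>.\<close>

lemma clock_convergence:
  assumes x: "x \<in> DL" and xk: "\<And>k. xk k \<in> DL" and M: "Mconv xk x" and s: "0 \<le> s"
    and c: "0 < c" "\<forall>u\<ge>0. u < s \<longrightarrow> c \<le> \<rho> (x u)" and d: "0 < d"
  shows "\<forall>\<^sub>F k in sequentially. \<exists>l. time_homeo l \<and>
    (\<forall>u. 0 \<le> u \<and> u \<le> s \<longrightarrow> \<bar>l u - u\<bar> \<le> d \<and> dE (x u) (xk k (l u)) \<le> d \<and> \<bar>A (xk k) (l u) - A x u\<bar> \<le> d) \<and>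
    (\<forall>v. 0 \<le> v \<and> v < l s \<longrightarrow> c / 2 \<le> \<rho> (xk k v))"
proof -
  note c = c(1) c(2)[rule_format]
  define P where "P n l k \<longleftrightarrow> time_homeo l \<and>
    (\<forall>u. 0 \<le> u \<and> u \<le> s \<longrightarrow> \<bar>l u - u\<bar> \<le> 1 / (real n + 1) \<and> dE (x u) (xk k (l u)) \<le> 1 / (real n + 1))" for n :: nat and l k
  have away: "c \<le> dE (x u) None" if "0 \<le> u" "u < s" for u using c(2)[OF that] \<rho>_None_le[of "x u"] by simp
  have "\<forall>\<^sub>F k in sequentially. \<exists>l. P n l k" for n
  proof -
    have "\<forall>\<^sub>F k in sequentially. matched (1 / (real n + 1)) s x (xk k)" by (rule Mconv_matched_upto[OF M c(1) away]) auto
    thus ?thesis by (rule eventually_mono) (auto simp: matched_def P_def)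
  qed
  from diagonal_choice[of P, OF this, of "\<lambda>t. t"] obtain L where
    L0: "\<And>k. L k = (\<lambda>t. t) \<or> (\<exists>n. P n (L k) k)" and L1: "\<And>n. \<forall>\<^sub>F k in sequentially. \<exists>n'\<ge>n. P n' (L k) k" by blast
  have th: "time_homeo (L k)" for k
  proof (cases "L k = (\<lambda>t. t)")
    case True
    have "(\<lambda>t. t) ` {0..} = {0::real..}" by auto
    thus ?thesis unfolding True time_homeo_def by (auto intro: strict_mono_onI)
  qed (use L0[of k] in \<open>auto simp: P_def\<close>)
  note H = time_homeoD[OF th]
  have close: "\<forall>\<^sub>F k in sequentially. \<forall>u. 0 \<le> u \<and> u \<le> s \<longrightarrow> \<bar>L k u - u\<bar> \<le> e \<and> dE (x u) (xk k (L k u)) \<le> e" if e: "0 < e" for e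
  proof -
    obtain n :: nat where "1 / e < real n" using reals_Archimedean2 by blast
    hence n: "1 / (real n + 1) \<le> e" using e by (simp add: field_simps)
    show ?thesis using L1[of n]
    proof eventually_elim
      case (elim k)
      then obtain n' where n': "n \<le> n'" "P n' (L k) k" by blast
      have "1 / (real n' + 1) \<le> 1 / (real n + 1)" using n'(1) by (simp add: frac_le)
      hence "1 / (real n' + 1) \<le> e" using n by linarith
      thus ?case using n'(2) unfolding P_def by (meson order_trans)
    qed
  qed
  have low: "\<forall>\<^sub>F k in sequentially. \<forall>v. 0 \<le> v \<and> v < L k s \<longrightarrow> c / 2 \<le> \<rho> (xk k v)"
    using close[OF half_gt_zero[OF c(1)]]
  proof eventually_elim
    case (elim k)
    show ?case
    proof (intro allI impI)
      fix v assume v: "0 \<le> v \<and> v < L k s"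
      then obtain w where w: "0 \<le> w" "L k w = v" using H(5)[of v k] by blast
      hence ws: "w < s" using H(3)[of w s k] v s by simp
      hence "dE (x w) (xk k v) \<le> c / 2" using elim w by auto
      thus "c / 2 \<le> \<rho> (xk k v)"
        using \<rho>_Lipschitz[of "x w" "xk k v"] DL_paths[OF x w(1)] DL_paths[OF xk, of v k] v c(2)[OF w(1) ws] by simp
    qed
  qed
  define K where "K = 1 / \<gamma> (c / 2)"
  have K0: "0 < K" using \<gamma>_pos[of "c / 2"] c(1) by (simp add: K_def)
  have rateK: "0 \<le> 1 / \<gamma> (\<rho> z)" "1 / \<gamma> (\<rho> z) \<le> K" if "c / 2 \<le> \<rho> z" for z
  proof -
    have "0 < \<gamma> (c / 2)" "\<gamma> (c / 2) \<le> \<gamma> (\<rho> z)" using \<gamma>_pos[of "c / 2"] c(1) \<gamma>_mono[OF that] by auto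
    thus "0 \<le> 1 / \<gamma> (\<rho> z)" "1 / \<gamma> (\<rho> z) \<le> K" by (auto simp: K_def frac_le)
  qed
  \<comment> \<open>The cuts at \<open>K\<close> and \<open>s + 1\<close> provide an integrable
    majorant for all \<open>k\<close>; for large \<open>k\<close> they change nothing on
    \<open>[0, L k s)\<close>.\<close>
  define \<psi> where "\<psi> k v = indicat_real {0..<min (L k s) (s + 1)} v * min K \<bar>1 / \<gamma> (\<rho> (xk k v))\<bar>" for k v
  define \<phi> where "\<phi> v = indicat_real {0..<s} v * (1 / \<gamma> (\<rho> (x v)))" for v
  have \<phi>b: "0 \<le> \<phi> v" "\<phi> v \<le> K" for v
  proof -
    have "0 \<le> \<phi> v \<and> \<phi> v \<le> K"
    proof (cases "0 \<le> v \<and> v < s")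
      case True
      hence "c / 2 \<le> \<rho> (x v)" using c(1) c(2)[of v] by simp
      thus ?thesis using rateK[of "x v"] True by (simp add: \<phi>_def)
    qed (use K0 in \<open>auto simp: \<phi>_def indicator_def\<close>)
    thus "0 \<le> \<phi> v" "\<phi> v \<le> K" by auto
  qed
  have \<psi>b: "0 \<le> \<psi> k v" "\<psi> k v \<le> K * indicat_real {0..<s+1} v" for k v
    using K0 by (auto simp: \<psi>_def indicator_def)
  have \<phi>b': "\<phi> v \<le> K * indicat_real {0..<s+1} v" for v
    using \<phi>b[of v] by (cases "v \<in> {0..<s}") (auto simp: \<phi>_def indicator_def)
  have diffb: "\<bar>\<psi> k v - \<phi> v\<bar> \<le> K * indicat_real {0..<s+1} v" for k v
    using \<phi>b(1)[of v] \<phi>b'[of v] \<psi>b[of k v] by (simp only: abs_le_iff) linarith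
  have mult_ind: "\<bar>indicat_real S v * f\<bar> \<le> b" if "0 \<le> f" "f \<le> b" for S :: "real set" and v f b
    using that by (cases "v \<in> S") auto
  have \<phi>m[measurable]: "\<phi> \<in> borel_measurable lborel"
  proof -
    have [measurable]: "(\<lambda>v. 1 / \<gamma> (\<rho> (x (max 0 v)))) \<in> borel_measurable lborel" by (rule rate_measurable[OF x])
    have "\<phi> = (\<lambda>v. indicat_real {0..<s} v * (1 / \<gamma> (\<rho> (x (max 0 v)))))" by (auto simp: \<phi>_def fun_eq_iff indicator_def)
    also have "\<dots> \<in> borel_measurable lborel" by measurable
    finally show ?thesis .
  qed
  have \<psi>m[measurable]: "\<psi> k \<in> borel_measurable lborel" for k
  proof -
    have [measurable]: "(\<lambda>v. 1 / \<gamma> (\<rho> (xk k (max 0 v)))) \<in> borel_measurable lborel" by (rule rate_measurable[OF xk])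
    have "\<psi> k = (\<lambda>v. indicat_real {0..<min (L k s) (s + 1)} v * min K \<bar>1 / \<gamma> (\<rho> (xk k (max 0 v)))\<bar>)"
      by (auto simp: \<psi>_def fun_eq_iff indicator_def)
    also have "\<dots> \<in> borel_measurable lborel" by measurable
    finally show ?thesis .
  qed
  obtain D where D: "countable D" "\<forall>v. 0 \<le> v \<and> v < s \<and> v \<notin> D \<longrightarrow>
    (\<forall>e>0. \<exists>d>0. \<forall>u. \<bar>u - v\<bar> < d \<longrightarrow> dE (x u) (x v) < e)"
    using cadlag_continuity_points[OF adm_cadlag(1)[OF x adm_if_away[OF D_loc_D_exp[OF x] s c(1) away]]] by blast
  have lim: "(\<lambda>k. \<psi> k v) \<longlonglongrightarrow> \<phi> v" if v: "v \<notin> insert s D" for v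
  proof -
    consider "v < 0" | "s < v" | "0 \<le> v" "v < s" using v by force
    thus ?thesis
    proof cases
      case 1
      thus ?thesis by (simp add: \<psi>_def \<phi>_def)
    next
      case 2
      hence "0 < v - s" by simp
      from close[OF this] have "\<forall>\<^sub>F k in sequentially. \<psi> k v = 0"
      proof eventually_elim
        case (elim k)
        hence "\<bar>L k s - s\<bar> \<le> v - s" using s by blast
        hence "L k s \<le> v" by linarith
        thus "\<psi> k v = 0" by (simp add: \<psi>_def)
      qed
      thus ?thesis using 2 by (simp add: \<phi>_def tendsto_eventually)
    next
      case 3
      have "(\<lambda>k. \<rho> (xk k v)) \<longlonglongrightarrow> \<rho> (x v)"
      proof (rule tendstoI)
        fix e :: real assume e: "0 < e"
        obtain q where q: "q > 0" "\<And>u. \<bar>u - v\<bar> < q \<Longrightarrow> dE (x u) (x v) < e / 2"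
          using D(2)[rule_format, of v "e / 2"] 3 v e by auto
        define e' where "e' = min (e / 2) (min (q / 2) ((s - v) / 2))"
        have "0 < e'" using e q(1) 3(2) by (simp add: e'_def)
        moreover have "e' \<le> e / 2" "e' \<le> q / 2" "e' \<le> (s - v) / 2" unfolding e'_def by linarith+
        ultimately have "0 < e'" "e' \<le> e / 2" "e' \<le> q / 2" "e' \<le> (s - v) / 2" by blast+
        hence e': "0 < e'" "e' \<le> e / 2" "e' < q" "e' < s - v" using q(1) 3(2) by auto
        show "\<forall>\<^sub>F k in sequentially. dist (\<rho> (xk k v)) (\<rho> (x v)) < e" using close[OF e'(1)]
        proof eventually_elim
          case (elim k)
          have Ls: "v < L k s" using elim s e'(4) by force
          \<comment> \<open>The value of \<open>xk k\<close> at \<open>v\<close> is compared with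
            that of \<open>x\<close> at the preimage \<open>w\<close>, which is close to the
            continuity point \<open>v\<close>.\<close>
          obtain w where w: "0 \<le> w" "L k w = v" using H(5)[OF 3(1)] by blast
          have ws: "w < s" using H(3)[of w s k] w Ls s by simp
          have "\<bar>v - w\<bar> \<le> e'" "dE (x w) (xk k v) \<le> e'" using elim w ws by auto
          hence "dE (x w) (x v) < e / 2" "dE (x w) (xk k v) \<le> e / 2" using e' q(2)[of w] by auto
          hence "dE (xk k v) (x v) < e"
            using E.triangle[of "xk k v" "x w" "x v"] DL_paths[OF x] DL_paths[OF xk] w 3(1) E.commute[of "x w" "xk k v"] by force
          thus ?case
            using \<rho>_Lipschitz[of "xk k v" "x v"] \<rho>_Lipschitz[of "x v" "xk k v"] DL_paths[OF x 3(1)] DL_paths[OF xk 3(1), of k]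
              E.commute[of "xk k v" "x v"] by (simp add: dist_real_def abs_less_iff)
        qed
      qed
      hence "(\<lambda>k. \<gamma> (\<rho> (xk k v))) \<longlonglongrightarrow> \<gamma> (\<rho> (x v))"
        using \<gamma>_cont by (intro isCont_tendsto_compose[of _ \<gamma>]) (auto simp: continuous_on_eq_continuous_at)
      moreover have "0 < \<gamma> (\<rho> (x v))" using c(1) c(2)[OF 3] by (intro \<gamma>_pos) simp
      ultimately have l: "(\<lambda>k. min K \<bar>1 / \<gamma> (\<rho> (xk k v))\<bar>) \<longlonglongrightarrow> min K \<bar>1 / \<gamma> (\<rho> (x v))\<bar>"
        by (intro tendsto_min tendsto_rabs tendsto_divide tendsto_const) auto
      have eq: "min K \<bar>1 / \<gamma> (\<rho> (x v))\<bar> = \<phi> v" using rateK[of "x v"] c(1) c(2)[OF 3] 3 by (simp add: \<phi>_def)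
      have "\<forall>\<^sub>F k in sequentially. min K \<bar>1 / \<gamma> (\<rho> (xk k v))\<bar> = \<psi> k v"
      proof -
        have "0 < (s - v) / 2" using 3 by simp
        from close[OF this] show ?thesis
        proof eventually_elim
          case (elim k)
          hence "\<bar>L k s - s\<bar> \<le> (s - v) / 2" using s by blast
          hence "s - L k s \<le> (s - v) / 2" by linarith
          hence "v < L k s" using 3 by (simp add: field_simps)
          thus ?case using 3 by (simp add: \<psi>_def)
        qed
      qed
      thus ?thesis by (rule Lim_transform_eventually[OF l[unfolded eq]])
    qed
  qed
  have dominated: "(\<lambda>k. \<integral>v. \<bar>\<psi> k v - \<phi> v\<bar> \<partial>lborel) \<longlonglongrightarrow> (\<integral>v. 0 \<partial>(lborel :: real measure))"
  proof (rule integral_dominated_convergence[where w="\<lambda>v. K * indicat_real {0..<s+1} v"])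
    have "insert s D \<in> null_sets lborel" using D(1) by (intro countable_imp_null_set_lborel) simp
    thus "AE v in lborel. (\<lambda>k. \<bar>\<psi> k v - \<phi> v\<bar>) \<longlonglongrightarrow> 0"
    proof (rule AE_I')
      show "{v \<in> space lborel. \<not> (\<lambda>k. \<bar>\<psi> k v - \<phi> v\<bar>) \<longlonglongrightarrow> 0} \<subseteq> insert s D"
      proof (rule subsetI, rule ccontr)
        fix v assume v: "v \<in> {v \<in> space lborel. \<not> (\<lambda>k. \<bar>\<psi> k v - \<phi> v\<bar>) \<longlonglongrightarrow> 0}" "v \<notin> insert s D"
        show False using tendsto_rabs_zero[OF LIM_zero[OF lim[OF v(2)]]] v(1) by (elim CollectE conjE notE)
      qed
    qed
    show "AE v in lborel. norm \<bar>\<psi> k v - \<phi> v\<bar> \<le> K * indicat_real {0..<s+1} v" for k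
      using diffb by (intro AE_I2) simp
  next
    show "integrable lborel (\<lambda>v. K * indicat_real {0..<s+1} v)" using s by (intro integrable_mult_right) simp
  qed simp_all
  define \<eta> where "\<eta> = d / (2 * (K + 1))"
  have \<eta>: "0 < \<eta>" using d K0 by (simp add: \<eta>_def)
  have ev1: "\<forall>\<^sub>F k in sequentially. (\<integral>v. \<bar>\<psi> k v - \<phi> v\<bar> \<partial>lborel) < d / 2"
    using order_tendstoD(2)[OF dominated, of "d / 2"] d by simp
  have "0 < min (min d \<eta>) 1" using d \<eta> by simp
  from close[OF this] low ev1 show ?thesis
  proof eventually_elim
    case (elim k)
    have dist: "\<bar>L k u - u\<bar> \<le> d" "\<bar>L k u - u\<bar> \<le> \<eta>" "\<bar>L k u - u\<bar> \<le> 1" "dE (x u) (xk k (L k u)) \<le> d" if "0 \<le> u" "u \<le> s" for u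
      using elim(1) that by auto
    have "\<bar>A (xk k) (L k u) - A x u\<bar> \<le> d" if u: "0 \<le> u" "u \<le> s" for u
    proof -
      have Lu: "0 \<le> L k u" "L k u \<le> L k s" "L k s \<le> s + 1" using H(1)[OF u(1)] H(4)[OF u(1) s] u(2) dist(3)[OF s order_refl] by (auto simp: abs_le_iff)
      have Ak: "A (xk k) (L k u) = (\<integral>v. indicat_real {0..<L k u} v * \<psi> k v \<partial>lborel)"
        unfolding A_def set_lebesgue_integral_def
      proof (rule Bochner_Integration.integral_cong[OF refl])
        fix v
        show "indicat_real {0..<L k u} v *\<^sub>R (1 / \<gamma> (\<rho> (xk k v))) = indicat_real {0..<L k u} v * \<psi> k v"
        proof (cases "v \<in> {0..<L k u}")
          case True
          hence v: "0 \<le> v \<and> v < L k s" "v < s + 1" using Lu(2) dist(3)[OF s order_refl] by auto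
          hence "c / 2 \<le> \<rho> (xk k v)" using elim(2) by blast
          from rateK[OF this] show ?thesis using True v by (simp add: \<psi>_def)
        qed simp
      qed
      have Ax: "A x u = (\<integral>v. indicat_real {0..<u} v * \<phi> v \<partial>lborel)"
        unfolding A_def set_lebesgue_integral_def using u
        by (intro Bochner_Integration.integral_cong) (auto simp: \<phi>_def indicator_def)
      have bnd: "integrable lborel f" if "f \<in> borel_measurable lborel" "\<And>v. \<bar>f v\<bar> \<le> K * indicat_real {0..<s+1} v" for f :: "real \<Rightarrow> real"
        by (rule Bochner_Integration.integrable_bound[where f="\<lambda>v. K * indicat_real {0..<s+1} v"]) (use that s K0 in auto)
      have i1: "integrable lborel (\<lambda>v. indicat_real {0..<L k u} v * \<psi> k v)"
        by (rule bnd) (simp, rule mult_ind[OF \<psi>b])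
      have i2: "integrable lborel (\<lambda>v. indicat_real {0..<u} v * \<phi> v)"
        by (rule bnd) (simp, rule mult_ind[OF \<phi>b(1) \<phi>b'])
      have i3: "integrable lborel (\<lambda>v. \<bar>\<psi> k v - \<phi> v\<bar>)"
        by (rule bnd) (use diffb in simp_all)
      have i4: "integrable lborel (\<lambda>v. K * indicat_real {min u (L k u)..<max u (L k u)} v)" by auto
      have "\<bar>A (xk k) (L k u) - A x u\<bar> = \<bar>\<integral>v. indicat_real {0..<L k u} v * \<psi> k v - indicat_real {0..<u} v * \<phi> v \<partial>lborel\<bar>"
        unfolding Ak Ax using i1 i2 by simp
      also have "\<dots> \<le> (\<integral>v. \<bar>indicat_real {0..<L k u} v * \<psi> k v - indicat_real {0..<u} v * \<phi> v\<bar> \<partial>lborel)"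
        by (rule integral_abs_bound)
      also have "\<dots> \<le> (\<integral>v. \<bar>\<psi> k v - \<phi> v\<bar> + K * indicat_real {min u (L k u)..<max u (L k u)} v \<partial>lborel)"
      proof (rule integral_mono)
        fix v
        show "\<bar>indicat_real {0..<L k u} v * \<psi> k v - indicat_real {0..<u} v * \<phi> v\<bar>
            \<le> \<bar>\<psi> k v - \<phi> v\<bar> + K * indicat_real {min u (L k u)..<max u (L k u)} v"
          using \<phi>b[of v] \<psi>b[of k v] K0 by (auto simp: indicator_def min_def max_def split: if_splits)
      qed (use i1 i2 i3 i4 in auto)
      also have "\<dots> = (\<integral>v. \<bar>\<psi> k v - \<phi> v\<bar> \<partial>lborel) + K * \<bar>L k u - u\<bar>"
        using i3 i4 by (simp add: min_def max_def)
      also have "\<dots> \<le> d / 2 + K * \<eta>" using elim(3) dist(2)[OF u] K0 by (intro add_mono mult_left_mono) auto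
      also have "\<dots> \<le> d" using d K0 by (simp add: \<eta>_def field_simps)
      finally show ?thesis .
    qed
    thus ?case using th dist elim(2) by (intro exI[of _ "L k"]) auto
  qed
qed

end

section \<open>Explosion of the clock\<close>

locale lc_good = lc_rate +
  fixes \<epsilon> :: "nat \<Rightarrow> real"
  assumes \<epsilon>_pos: "\<And>n. 0 < \<epsilon> n" and \<gamma>_small: "\<And>r n. r \<le> 2 * (1/2)^n \<Longrightarrow> \<gamma> r \<le> \<epsilon> n / (real n + 1)"
begin

definition good :: "nat \<Rightarrow> 'a path set" where
  "good m = {x \<in> DL. \<forall>n\<ge>m. x \<notin> bad n (\<epsilon> n)}"

text \<open>
  A path that comes close to the complement of \<open>U\<close> and stays there for the time \<open>\<epsilon> n\<close> runs through
  at least \<open>n + 1\<close> units of the new time, because \<open>\<gamma> \<le> \<epsilon> n / (n + 1)\<close> at this level.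
\<close>

lemma not_bad_gain:
  assumes x: "x \<in> DL" and nb: "x \<notin> bad n (\<epsilon> n)" and s: "0 \<le> s" "s \<le> real n"
    and \<rho>s: "(1/2)^(n+1) \<le> \<rho> (x s)" "\<rho> (x s) \<le> (1/2)^n" and before: "\<And>u. 0 \<le> u \<Longrightarrow> u < s \<Longrightarrow> (1/2)^(n+1) \<le> \<rho> (x u)"
  shows "\<exists>a b. 0 \<le> a \<and> a \<le> s \<and> s \<le> b \<and> a < b \<and> (\<forall>u. a \<le> u \<and> u < b \<longrightarrow> dE (x u) (x s) \<le> (1/2)^(n+2)) \<and>
    (\<forall>u. 0 \<le> u \<and> u < b \<longrightarrow> (1/2)^(n+2) \<le> \<rho> (x u)) \<and> real n + 1 \<le> A x b - A x a"
proof -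
  have "\<exists>a b. 0 \<le> a \<and> a \<le> s \<and> s \<le> b \<and> \<epsilon> n \<le> b - a \<and> (\<forall>u. a \<le> u \<and> u < b \<longrightarrow> dE (x u) (x s) \<le> (1/2)^(n+2))"
    using nb x s \<rho>s before unfolding bad_def by blast
  then obtain a b where ab: "0 \<le> a" "a \<le> s" "s \<le> b" "\<epsilon> n \<le> b - a"
    and near: "\<And>u. a \<le> u \<Longrightarrow> u < b \<Longrightarrow> dE (x u) (x s) \<le> (1/2)^(n+2)" by blast
  have p: "(1/2::real)^(n+1) = 2 * (1/2)^(n+2)" "(1/2::real)^n = 4 * (1/2)^(n+2)" "0 < (1/2::real)^(n+2)" by (simp_all add: power_add)
  have \<Omega>: "x u \<in> \<Omega>" if "0 \<le> u" for u using DL_paths[OF x that] .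
  have close: "(1/2)^(n+2) \<le> \<rho> (x u)" "\<rho> (x u) \<le> 2 * (1/2)^n" if u: "a \<le> u" "u < b" for u
  proof -
    have u0: "0 \<le> u" using ab u by simp
    show "(1/2)^(n+2) \<le> \<rho> (x u)"
      using \<rho>_Lipschitz[OF \<Omega>[OF s(1)] \<Omega>[OF u0]] near[OF u] \<rho>s(1) p E.commute[of "x s" "x u"] by linarith
    show "\<rho> (x u) \<le> 2 * (1/2)^n"
      using \<rho>_Lipschitz[OF \<Omega>[OF u0] \<Omega>[OF s(1)]] near[OF u] \<rho>s(2) p by linarith
  qed
  have low: "(1/2)^(n+2) \<le> \<rho> (x u)" if u: "0 \<le> u" "u < b" for u
  proof (cases "u < s")
    case True
    thus ?thesis using before[OF u(1)] p by linarith
  qed (use close(1)[of u] u ab in simp)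
  have \<delta>: "0 < \<epsilon> n / (real n + 1)" using \<epsilon>_pos[of n] by simp
  have "(b - a) / (\<epsilon> n / (real n + 1)) \<le> A x b - A x a"
    by (rule A_increment(3)[OF x p(3) low ab(1) _ \<gamma>_small[OF close(2)] \<delta>]) (use ab in auto)
  moreover have "\<epsilon> n / (\<epsilon> n / (real n + 1)) \<le> (b - a) / (\<epsilon> n / (real n + 1))"
    using ab(4) \<delta> by (intro divide_right_mono) auto
  moreover have "\<epsilon> n / (\<epsilon> n / (real n + 1)) = real n + 1" using \<epsilon>_pos[of n] by (simp add: field_simps)
  ultimately have "real n + 1 \<le> A x b - A x a" by linarith
  moreover have "a < b" using ab(4) \<epsilon>_pos[of n] by linarith
  ultimately show ?thesis using ab near low by (intro exI[of _ a] exI[of _ b]) auto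
qed

text \<open>Otherwise \<open>\<rho>\<close> falls below \<open>(1/2)^n\<close> for some
  \<open>n > B\<close> while the path is alive; not being bad at that level, the path collects
  \<open>n + 1\<close> units of new time there, too many for the bound \<open>B\<close>.\<close>

lemma good_explodes:
  assumes x: "x \<in> good m" and B: "\<And>s. 0 \<le> s \<Longrightarrow> alive x s \<Longrightarrow> A x s \<le> B"
  shows "\<exists>c>0. \<forall>s\<ge>0. alive x s \<longrightarrow> c \<le> \<rho> (x s)"
proof (rule ccontr)
  assume n: "\<not> ?thesis"
  have xD: "x \<in> DL" using x by (simp add: good_def)
  \<comment> \<open>Not below \<open>m\<close>, for the path not to be bad at the levels used, and
    beyond \<open>B\<close> for two reasons: \<open>s \<le> A x s \<le> B\<close> must stay below
    the time \<open>n\<close> allowed in \<open>bad\<close>, and the gain \<open>n + 1\<close> must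
    contradict the bound.\<close>
  define n0 where "n0 = max m (nat \<lceil>\<bar>B\<bar> + 1\<rceil>)"
  have n0: "m \<le> n0" "\<bar>B\<bar> + 1 \<le> real n0" by (auto simp: n0_def) linarith
  obtain s0 where s0: "0 \<le> s0" "alive x s0" "\<rho> (x s0) < (1/2)^n0"
    using n by (metis not_le zero_less_power half_gt_zero zero_less_one)
  \<comment> \<open>The level is taken from the infimum up to \<open>s0\<close> rather than from the
    value at \<open>s0\<close>, since \<open>bad\<close> asks for the lower bound
    \<open>(1/2)^(n+1)\<close> at all earlier times.\<close>
  define p where "p = (INF u\<in>{0..s0}. \<rho> (x u))"
  have bdd: "bdd_below ((\<lambda>u. \<rho> (x u)) ` {0..s0})" using \<rho>_nonneg by (intro bdd_belowI2[of _ 0])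
  have ple: "p \<le> \<rho> (x u)" if "0 \<le> u" "u \<le> s0" for u unfolding p_def using that by (intro cINF_lower[OF bdd]) auto
  have p0: "0 < p"
  proof -
    obtain c where c: "c > 0" "\<And>u. 0 \<le> u \<Longrightarrow> u \<le> s0 \<Longrightarrow> c \<le> \<rho> (x u)" using s0(2) unfolding alive_def by blast
    have "c \<le> p" unfolding p_def using c(2) s0(1) by (intro cINF_greatest) auto
    thus ?thesis using c(1) by simp
  qed
  have "p < (1/2)^n0" using ple[OF s0(1) order_refl] s0(3) by simp
  then obtain n where n: "n0 \<le> n" "(1/2)^(n+1) \<le> p" "p < (1/2)^n" using dyadic_level[OF p0] by blast
  obtain s where s: "0 \<le> s" "s \<le> s0" "\<rho> (x s) < (1/2)^n"
  proof -
    have "\<exists>u\<in>{0..s0}. \<rho> (x u) < (1/2)^n"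
      using n(3) cINF_less_iff[OF _ bdd] s0(1) unfolding p_def by auto
    thus ?thesis using that by auto
  qed
  have "s \<le> A x s" by (rule A_ge[OF xD alive_mono[OF s0(2) s(2)] s(1)])
  hence sn: "s \<le> real n" using B[OF s(1) alive_mono[OF s0(2) s(2)]] n0(2) n(1) by linarith
  have nb: "x \<notin> bad n (\<epsilon> n)" using x n0(1) n(1) by (simp add: good_def)
  have low: "(1/2)^(n+1) \<le> \<rho> (x u)" if "0 \<le> u" "u \<le> s" for u using ple[of u] that n(2) s(2) by simp
  obtain a b where ab: "0 \<le> a" "a \<le> s" "s \<le> b" "a < b" "\<And>u. 0 \<le> u \<Longrightarrow> u < b \<Longrightarrow> (1/2)^(n+2) \<le> \<rho> (x u)"
    "real n + 1 \<le> A x b - A x a"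
    using not_bad_gain[OF xD nb s(1) sn low[OF s(1) order_refl] less_imp_le[OF s(3)]] low by fastforce
  have h0: "0 < (1/2::real)^(n+2)" by simp
  note h = h0 \<gamma>_pos[OF h0]
  \<comment> \<open>The path need not be alive at \<open>b\<close>. Stepping back by at most
    \<open>\<gamma> ((1/2)^(n+2))\<close> loses at most one unit of new time.\<close>
  define b' where "b' = max a (b - \<gamma> ((1/2)^(n+2)))"
  have b': "a \<le> b'" "b' < b" "0 \<le> b'" "b - b' \<le> \<gamma> ((1/2)^(n+2))" using ab(1,4) h(2) by (auto simp: b'_def)
  have "alive x b'" unfolding alive_def using ab(5) b'(2) h(1) by (intro exI[of _ "(1/2)^(n+2)"]) auto
  hence "A x b' \<le> B" using B b'(3) by blast
  moreover have "A x b - A x b' \<le> (b - b') / \<gamma> ((1/2)^(n+2))"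
    using b' by (intro A_increment(2)[OF xD h0 ab(5)]) auto
  moreover have "(b - b') / \<gamma> ((1/2)^(n+2)) \<le> 1" using b'(4) h(2) by simp
  moreover have "0 \<le> A x a" using A_increment(1)[OF xD h0 ab(5), of 0] ab(1,4)
    A_increment(1)[OF xD h0, of a 0] ab(5) by force
  ultimately have "real n + 1 \<le> B + 1" using ab(6) by linarith
  thus False using n0(2) n(1) by linarith
qed

lemma T_good:
  assumes x: "x \<in> good m" shows "T x \<in> LU"
proof (rule T_LU)
  show "x \<in> DL" using x by (simp add: good_def)
qed (rule good_explodes[OF x])

end

section \<open>Matching of time-changed paths\<close>

context lc_rate begin

text \<open>The lower bound before \<open>r\<close> excludes a left limit outside \<open>U\<close>,
  so the exit is not soft and the path is frozen at \<open>x r\<close>.\<close>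

lemma T_jump:
  assumes x: "x \<in> DL" and r: "0 \<le> r" and c: "0 < c" "\<And>u. 0 \<le> u \<Longrightarrow> u < r \<Longrightarrow> c \<le> \<rho> (x u)"
    and xr: "\<rho> (x r) = 0" and t: "A x r \<le> t"
  shows "T x t = x r"
proof -
  have al: "alive x s \<longleftrightarrow> s < r" if s: "0 \<le> s" for s
  proof
    show "alive x s \<Longrightarrow> s < r" using alive_pos[of x s r] r xr by force
    assume "s < r"
    thus "alive x s" unfolding alive_def using c by (intro exI[of _ c]) auto
  qed
  have At: "A x s < t" if "0 \<le> s" "alive x s" for s
    using A_increment(1)[OF x c that(1)] al[OF that(1)] that t by fastforce
  have "0 \<le> A x r" using A_increment(1)[OF x c order_refl r] r by simp
  hence t0: "0 \<le> t" using t by simp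
  obtain q where q: "0 \<le> q" "\<forall>s\<ge>0. alive x s \<longleftrightarrow> s < q"
    "if soft_exit x q then left_lim x q (T x t) else T x t = x q"
    using T_late[OF x t0] At unfolding late_def by blast
  have qr: "q = r" using q(2)[rule_format, OF q(1)] q(2)[rule_format, OF r] al[OF q(1)] al[OF r]
    by (cases q r rule: linorder_cases) auto
  have "\<not> (soft_exit x r)"
    using \<rho>_left_lim_ge[OF _ _ DL_paths[OF x] c(2)] c(1) by force
  thus ?thesis using q(3) unfolding qr by (simp only: if_False)
qed

text \<open>The old time change is conjugated with the two clocks up to the new time
  \<open>A x s\<close> and continued with slope one, where the last hypothesis compares the paths.
  The value at \<open>s\<close> itself belongs to that last part, since the paths need not be alive
  there.\<close>

lemma match_patch:
  assumes x: "x \<in> DL" and x': "x' \<in> DL" and l: "time_homeo l" and s: "0 \<le> s"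
    and c: "0 < c" "\<And>u. 0 \<le> u \<Longrightarrow> u < s \<Longrightarrow> c \<le> \<rho> (x u)" and c': "0 < c'" "\<And>v. 0 \<le> v \<Longrightarrow> v < l s \<Longrightarrow> c' \<le> \<rho> (x' v)"
    and near: "\<And>u. 0 \<le> u \<Longrightarrow> u \<le> s \<Longrightarrow> \<bar>A x' (l u) - A x u\<bar> \<le> d" "\<And>u. 0 \<le> u \<Longrightarrow> u < s \<Longrightarrow> dE (x u) (x' (l u)) \<le> d"
    and after: "\<And>t. A x s \<le> t \<Longrightarrow> t \<le> N \<Longrightarrow> dE (T x t) (T x' (A x' (l s) + (t - A x s))) \<le> d"
  shows "matched d N (T x) (T x')"
proof -
  note H = time_homeoD[OF l]
  have ls: "0 \<le> l s" by (rule H(1)[OF s])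
  have Ax: "v - u \<le> A x v - A x u" if "0 \<le> u" "u \<le> v" "v \<le> s" for u v
    by (rule A_increment(1)[OF x c(1)]) (use c(2) that in auto)
  have Ax': "v - u \<le> A x' v - A x' u" if "0 \<le> u" "u \<le> v" "v \<le> l s" for u v
    by (rule A_increment(1)[OF x' c'(1)]) (use c'(2) that in auto)
  define \<tau> where "\<tau> t = (SOME u. 0 \<le> u \<and> u \<le> s \<and> A x u = t)" for t
  have \<tau>: "0 \<le> \<tau> t" "\<tau> t \<le> s" "A x (\<tau> t) = t" if "0 \<le> t" "t \<le> A x s" for t
  proof -
    have "\<exists>u. 0 \<le> u \<and> u \<le> s \<and> A x u = t" using A_reaches[OF x order_refl s c, of t] that by simp
    hence "0 \<le> \<tau> t \<and> \<tau> t \<le> s \<and> A x (\<tau> t) = t" unfolding \<tau>_def by (rule someI_ex)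
    thus "0 \<le> \<tau> t" "\<tau> t \<le> s" "A x (\<tau> t) = t" by auto
  qed
  have \<tau>A: "\<tau> (A x u) = u" if u: "0 \<le> u" "u \<le> s" for u
  proof -
    have "0 \<le> A x u" "A x u \<le> A x s" using Ax[of 0 u] Ax[of u s] u by auto
    note t = \<tau>[OF this]
    show ?thesis using Ax[of "\<tau> (A x u)" u] Ax[of u "\<tau> (A x u)"] t u by (cases "\<tau> (A x u) \<le> u") auto
  qed
  define S where "S = A x s"
  have S: "0 \<le> S" using Ax[of 0 s] s by (simp add: S_def)
  define f where "f t = A x' (l (\<tau> t))" for t
  have fS: "f S = A x' (l s)" using \<tau>A[OF s order_refl] by (simp add: f_def S_def)
  have th: "time_homeo (\<lambda>t. if t \<le> S then f t else f S + (t - S))"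
  proof (rule piecewise_time_homeo[OF S])
    show "f 0 = 0" using \<tau>A[of 0] s H(2) by (simp add: f_def)
    show "f t < f t'" if t: "0 \<le> t" "t < t'" "t' \<le> S" for t t'
    proof -
      have a: "0 \<le> \<tau> t" "\<tau> t \<le> s" "A x (\<tau> t) = t" "0 \<le> \<tau> t'" "\<tau> t' \<le> s" "A x (\<tau> t') = t'"
        using \<tau>[of t] \<tau>[of t'] t by (auto simp: S_def)
      have "\<tau> t < \<tau> t'" using Ax[of "\<tau> t'" "\<tau> t"] a t(2) by force
      hence "l (\<tau> t) < l (\<tau> t')" "l (\<tau> t') \<le> l s" using H(3)[of "\<tau> t" "\<tau> t'"] H(4)[of "\<tau> t'" s] a s by auto
      thus ?thesis using Ax'[of "l (\<tau> t)" "l (\<tau> t')"] H(1)[OF a(1)] by (simp add: f_def)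
    qed
    fix y assume y: "0 \<le> y" "y \<le> f S"
    obtain v where v: "0 \<le> v" "v \<le> l s" "A x' v = y" using A_reaches[OF x' order_refl ls c', of y] y fS by auto
    obtain u where u: "0 \<le> u" "l u = v" using H(5)[OF v(1)] by blast
    hence us: "u \<le> s" using H(4)[of u s] v(2) s by simp
    hence "f (A x u) = y" using \<tau>A[OF u(1) us] u v by (simp add: f_def)
    thus "\<exists>t. 0 \<le> t \<and> t \<le> S \<and> f t = y" using Ax[of 0 u] Ax[of u s] u us by (intro exI[of _ "A x u"]) (auto simp: S_def)
  qed
  show ?thesis unfolding matched_def
  proof (intro exI[of _ "\<lambda>t. if t \<le> S then f t else f S + (t - S)"] conjI th allI impI)
    fix t assume t: "0 \<le> t \<and> t \<le> N"
    show "\<bar>(if t \<le> S then f t else f S + (t - S)) - t\<bar> \<le> d"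
    proof (cases "t \<le> S")
      case True
      thus ?thesis using near(1)[of "\<tau> t"] \<tau>[of t] t by (simp add: f_def S_def)
    next
      case False
      thus ?thesis using near(1)[OF s order_refl] fS by (simp add: S_def)
    qed
    show "dE (T x t) (T x' (if t \<le> S then f t else f S + (t - S))) \<le> d"
    proof (cases "t < S")
      case True
      hence u: "0 \<le> \<tau> t" "\<tau> t \<le> s" "A x (\<tau> t) = t" using \<tau>[of t] t by (auto simp: S_def)
      have us: "\<tau> t < s" using u True by (cases "\<tau> t = s") (auto simp: S_def)
      have al: "alive x (\<tau> t)" unfolding alive_def using c us by (intro exI[of _ c]) auto
      have "l (\<tau> t) < l s" using H(3)[OF u(1) s] us by simp
      hence al': "alive x' (l (\<tau> t))" unfolding alive_def using c' by (intro exI[of _ c']) auto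
      show ?thesis
        using T_alive[OF x u(1) al] T_alive[OF x' H(1)[OF u(1)] al'] near(2)[OF u(1) us] True u(3) by (simp add: f_def)
    next
      case False
      hence "(if t \<le> S then f t else f S + (t - S)) = A x' (l s) + (t - A x s)" using fS by (auto simp: S_def)
      thus ?thesis using after[of t] False t by (simp add: S_def)
    qed
  qed
qed

end

context lc_good begin

text \<open>If the clock of \<open>x\<close> runs beyond \<open>N\<close>, matching up to an alive
  time is enough. Otherwise \<open>x\<close>, being good, jumps out of \<open>U\<close> at some
  \<open>r\<close> and is frozen. The approximating path either jumps out as well or lands so close
  to the complement of \<open>U\<close> that, not being bad, it lingers there for more than
  \<open>N\<close> units of new time.\<close>

lemma T_matched:
  assumes x: "x \<in> DL" and xm: "x \<in> good m0" and xk: "\<And>k. xk k \<in> good m" and M: "Mconv xk x" and N: "0 \<le> N" and d: "0 < d"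
  shows "\<forall>\<^sub>F k in sequentially. matched d N (T x) (T (xk k))"
proof (cases "\<exists>s\<ge>0. alive x s \<and> N < A x s")
  case True
  then obtain s where s: "0 \<le> s" "alive x s" "N < A x s" by blast
  obtain c where c: "c > 0" "\<forall>u\<ge>0. u < s \<longrightarrow> c \<le> \<rho> (x u)"
    using s(2) unfolding alive_def by (meson less_imp_le)
  have xkD: "xk k \<in> DL" for k using xk[of k] by (simp add: good_def)
  show ?thesis using clock_convergence[OF x xkD M s(1) c d]
  proof eventually_elim
    case (elim k)
    then obtain l where l: "time_homeo l"
      and u: "\<And>u. 0 \<le> u \<Longrightarrow> u \<le> s \<Longrightarrow> dE (x u) (xk k (l u)) \<le> d" "\<And>u. 0 \<le> u \<Longrightarrow> u \<le> s \<Longrightarrow> \<bar>A (xk k) (l u) - A x u\<bar> \<le> d"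
      and v: "\<And>v. 0 \<le> v \<Longrightarrow> v < l s \<Longrightarrow> c / 2 \<le> \<rho> (xk k v)" by blast
    show ?case
      by (rule match_patch[OF x xkD l s(1) c(1) c(2)[rule_format] half_gt_zero[OF c(1)] v]) (use u s(3) in auto)
  qed
next
  case False
  hence bd: "A x s \<le> N" if "0 \<le> s" "alive x s" for s using that by force
  have xkD: "xk k \<in> DL" for k using xk[of k] by (simp add: good_def)
  obtain c where c: "c > 0" "\<And>s. 0 \<le> s \<Longrightarrow> alive x s \<Longrightarrow> c \<le> \<rho> (x s)" using good_explodes[OF xm bd] by blast
  have "late x (N + 1)" unfolding late_def using bd by force
  then obtain r where r: "0 \<le> r" "\<forall>s\<ge>0. alive x s \<longleftrightarrow> s < r" using T_late[OF x, of "N + 1"] N by auto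
  have cr: "c \<le> \<rho> (x u)" if "0 \<le> u" "u < r" for u using c(2)[OF that(1)] r(2) that by blast
  have xr: "\<rho> (x r) = 0"
  proof (rule ccontr)
    assume "\<rho> (x r) \<noteq> 0"
    hence "0 < \<rho> (x r)" using \<rho>_nonneg[of "x r"] by simp
    then obtain s' where "r < s'" "alive x s'" using alive_extend[OF x r(1) cr c(1)] by blast
    thus False using r by force
  qed
  obtain q1 :: nat where q1: "(1/2)^q1 < c / 4" using real_arch_pow_inv[of "c / 4" "1/2"] c(1) by auto
  obtain q2 :: nat where q2: "(1/2)^q2 < d / 2" using real_arch_pow_inv[of "d / 2" "1/2"] d by auto
  \<comment> \<open>\<open>m\<close> makes \<open>xk k\<close> not bad, \<open>r + N + 2\<close>
    puts the time \<open>l r\<close> below \<open>n\<close> and the gain \<open>n + 1\<close> above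
    \<open>N\<close>, and \<open>q1\<close>, \<open>q2\<close> make \<open>(1/2)^n\<close> small
    against \<open>c\<close> and \<open>d\<close>.\<close>
  define n0 where "n0 = max (max m (nat \<lceil>r + N + 2\<rceil>)) (max q1 q2)"
  have n0: "m \<le> n0" "r + N + 2 \<le> real n0" "q1 \<le> n0" "q2 \<le> n0" unfolding n0_def by linarith+
  define e where "e = min (d / 2) (min 1 ((1/2)^(n0+1)))"
  have e: "0 < e" "e \<le> d / 2" "e \<le> 1" "e < (1/2)^n0" using d by (auto simp: e_def min_def)
  have cr': "\<forall>u\<ge>0. u < r \<longrightarrow> c \<le> \<rho> (x u)" using cr by blast
  show ?thesis using clock_convergence[OF x xkD M r(1) c(1) cr' e(1)]
  proof eventually_elim
    case (elim k)
    then obtain l where l: "time_homeo l" and lr: "\<bar>l r - r\<bar> \<le> e"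
      and u: "\<And>u. 0 \<le> u \<Longrightarrow> u \<le> r \<Longrightarrow> dE (x u) (xk k (l u)) \<le> e" "\<And>u. 0 \<le> u \<Longrightarrow> u \<le> r \<Longrightarrow> \<bar>A (xk k) (l u) - A x u\<bar> \<le> e"
      and v: "\<And>v. 0 \<le> v \<Longrightarrow> v < l r \<Longrightarrow> c / 2 \<le> \<rho> (xk k v)" using r(1) by blast
    define z where "z = xk k (l r)"
    have lr0: "0 \<le> l r" by (rule time_homeoD(1)[OF l r(1)])
    have z\<Omega>: "z \<in> \<Omega>" "x r \<in> \<Omega>" using DL_paths[OF xkD lr0] DL_paths[OF x r(1)] by (auto simp: z_def)
    have xz: "dE (x r) z \<le> e" using u(1)[OF r(1) order_refl] by (simp add: z_def)
    have zd: "dE (T (xk k) (A (xk k) (l r) + t)) z \<le> d / 2" if t: "0 \<le> t" "t \<le> N" for t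
    proof (cases "\<rho> z = 0")
      case True
      have "T (xk k) (A (xk k) (l r) + t) = z" unfolding z_def
        by (rule T_jump[OF xkD lr0 half_gt_zero[OF c(1)] v]) (use True t in \<open>auto simp: z_def\<close>)
      thus ?thesis using z\<Omega> d by simp
    next
      case False
      hence z0: "0 < \<rho> z" using \<rho>_nonneg[of z] by simp
      have "\<rho> z < (1/2)^n0" using \<rho>_Lipschitz[OF z\<Omega>] xr xz e(4) E.commute[of z "x r"] by simp
      then obtain n where n: "n0 \<le> n" "(1/2)^(n+1) \<le> \<rho> z" "\<rho> z < (1/2)^n" using dyadic_level[OF z0] by blast
      have pw: "(1/2::real)^n \<le> (1/2)^q1" "(1/2::real)^n \<le> (1/2)^q2" using n(1) n0 by (auto intro!: power_decreasing)
      have pn: "(1/2::real)^(n+1) \<le> (1/2)^n" "(1/2::real)^(n+2) \<le> (1/2)^n" by (auto intro!: power_decreasing)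
      have nb: "xk k \<notin> bad n (\<epsilon> n)" using xk[of k] n(1) n0(1) by (simp add: good_def)
      have bef: "(1/2)^(n+1) \<le> \<rho> (xk k w)" if "0 \<le> w" "w < l r" for w
        using v[OF that] pw(1) pn(1) q1 c(1) by linarith
      have lrn: "l r \<le> real n" using lr e(3) n0(2) n(1) N by (auto simp: abs_le_iff)
      obtain a b where ab: "0 \<le> a" "a \<le> l r" "l r \<le> b" "a < b"
        "\<forall>w. a \<le> w \<and> w < b \<longrightarrow> dE (xk k w) z \<le> (1/2)^(n+2)"
        "\<forall>w. 0 \<le> w \<and> w < b \<longrightarrow> (1/2)^(n+2) \<le> \<rho> (xk k w)" "real n + 1 \<le> A (xk k) b - A (xk k) a"
        using not_bad_gain[OF xkD nb lr0 lrn _ _ bef] n(2,3) unfolding z_def by (metis less_imp_le)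
      \<comment> \<open>The slow stay cannot start before \<open>l r\<close>: until then
        \<open>\<rho>\<close> is at least \<open>c / 2\<close>, far above its values near
        \<open>z\<close>. Hence all the gain comes after \<open>l r\<close>.\<close>
      have "a = l r"
      proof (rule ccontr)
        assume "a \<noteq> l r"
        hence al: "a < l r" using ab(2) by simp
        have "\<rho> (xk k a) \<le> \<rho> z + dE (xk k a) z" by (rule \<rho>_Lipschitz[OF DL_paths[OF xkD ab(1)] z\<Omega>(1)])
        moreover have "dE (xk k a) z \<le> (1/2)^(n+2)" using ab(4,5) by blast
        ultimately show False using v[OF ab(1) al] n(3) pn(2) pw(1) q1 by linarith
      qed
      hence gain: "real n + 1 \<le> A (xk k) b - A (xk k) (l r)" using ab(7) by simp
      have h: "0 < (1/2::real)^(n+2)" by simp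
      have low: "\<And>w. 0 \<le> w \<Longrightarrow> w < b \<Longrightarrow> (1/2)^(n+2) \<le> \<rho> (xk k w)" using ab(6) by blast
      have tb: "A (xk k) (l r) + t < A (xk k) b" using gain t n0(2) n(1) r(1) by simp
      obtain w where w: "l r \<le> w" "w \<le> b" "A (xk k) w = A (xk k) (l r) + t"
        using A_reaches[OF xkD lr0 ab(3) h low, of "A (xk k) (l r) + t"] tb t(1) by auto
      have wb: "w < b" using w tb by (cases "w = b") auto
      have w0: "0 \<le> w" using w(1) lr0 by simp
      have "alive (xk k) w" unfolding alive_def using low wb h by (intro exI[of _ "(1/2)^(n+2)"]) auto
      hence "T (xk k) (A (xk k) (l r) + t) = xk k w" using T_alive[OF xkD w0] w(3) by metis
      moreover have "dE (xk k w) z \<le> (1/2)^(n+2)" using ab(2,5) w(1) wb by auto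
      ultimately show ?thesis using pn(2) pw(2) q2 by (simp only:)
    qed
    show ?case
    proof (rule match_patch[OF x xkD l r(1) c(1) cr half_gt_zero[OF c(1)] v])
      show "\<bar>A (xk k) (l w) - A x w\<bar> \<le> d" if "0 \<le> w" "w \<le> r" for w using u(2)[OF that] e(2) d by linarith
      show "dE (x w) (xk k (l w)) \<le> d" if "0 \<le> w" "w < r" for w using u(1)[of w] that e(2) d by simp
      fix t assume t: "A x r \<le> t" "t \<le> N"
      have T: "T x t = x r" by (rule T_jump[OF x r(1) c(1) cr xr t(1)])
      have "0 \<le> A x r" using A_increment(1)[OF x c(1) cr order_refl r(1)] r(1) by simp
      hence "dE (T (xk k) (A (xk k) (l r) + (t - A x r))) z \<le> d / 2" using t by (intro zd) auto
      moreover have "T (xk k) (A (xk k) (l r) + (t - A x r)) \<in> \<Omega>"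
      proof -
        have "0 \<le> A (xk k) (l r)" using A_increment(1)[OF xkD half_gt_zero[OF c(1)] v order_refl lr0] lr0 by simp
        thus ?thesis using T_in[OF xkD, of k] t(1) by auto
      qed
      ultimately show "dE (T x t) (T (xk k) (A (xk k) (l r) + (t - A x r))) \<le> d"
        using E.triangle[OF z\<Omega>(2,1), of "T (xk k) (A (xk k) (l r) + (t - A x r))"] xz e(2) T
          E.commute[of z "T (xk k) (A (xk k) (l r) + (t - A x r))"] by simp
    qed
  qed
qed

end

section \<open>Weak continuity\<close>

context lc_good begin

text \<open>A measurable replacement for \<open>good\<close>; its complement is a countable union of
  closures whose probabilities are made summable by the choice of \<open>\<epsilon>\<close>.\<close>

definition Gd :: "nat \<Rightarrow> 'a path set" where
  "Gd m = {x \<in> DL. \<forall>n\<ge>m. x \<notin> clbad n (\<epsilon> n)}"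

lemma Gd_good: "Gd m \<subseteq> good m"
  using bad_subset_clbad by (auto simp: Gd_def good_def)

lemma Gd_compl: "DL - Gd m = (\<Union>n. clbad (m + n) (\<epsilon> (m + n)))"
  by (auto simp: Gd_def clbad_def le_iff_add)

lemma Gd_measurable: "Gd m \<in> sets BL"
proof -
  have "DL - Gd m \<in> sets BL" unfolding Gd_compl using clbad_measurable by blast
  hence "DL - (DL - Gd m) \<in> sets BL" using sets.compl_sets[of "DL - Gd m" BL] by simp
  moreover have "DL - (DL - Gd m) = Gd m" by (auto simp: Gd_def)
  ultimately show ?thesis by simp
qed

lemma T_conv:
  assumes xk: "\<And>k. xk k \<in> Gd m" and x: "x \<in> Gd m" and conv: "(\<lambda>k. emb (xk k)) \<longlonglongrightarrow> emb x"
  shows "global_skorokhod_conv X (\<lambda>k. T (xk k)) (T x)"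
proof (rule matched_imp_global_conv)
  have D: "x \<in> DL" "\<And>k. xk k \<in> DL" using xk x by (auto simp: Gd_def)
  show "\<forall>\<^sub>F k in sequentially. matched d N (T x) (T (xk k))" if "0 \<le> N" "0 < d" for N d
    using T_matched[OF D(1) subsetD[OF Gd_good x] subsetD[OF Gd_good xk] emb_imp_Mconv[OF D conv] that] .
qed

lemma T_compose_seq_continuous:
  fixes f :: "'a path \<Rightarrow> real"
  assumes f: "continuous_map GU euclideanreal f"
    and xk: "\<And>k. xk k \<in> Gd m" and x: "x \<in> Gd m" and conv: "(\<lambda>k. emb (xk k)) \<longlonglongrightarrow> emb x"
  shows "(\<lambda>k. f (T (xk k))) \<longlonglongrightarrow> f (T x)"
proof -
  have LU: "T x \<in> LU" "\<And>k. T (xk k) \<in> LU" using T_good subsetD[OF Gd_good] x xk by blast+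
  have "limitin (global_skorokhod X) (\<lambda>k. T (xk k)) (T x) sequentially"
    unfolding global_skorokhod_def using LU LU_subset_DG T_conv[OF xk x conv]
    by (intro limitin_seq_topology) auto
  hence "limitin GU (\<lambda>k. T (xk k)) (T x) sequentially" unfolding limitin_subtopology using LU by simp
  from continuous_map_limit[OF f this] show ?thesis by (simp add: o_def)
qed

lemma g_continuous: "continuous_map X (top_of_set {0..}) g"
proof -
  have "continuous_map S.mtopology Met_TC.mtopology (\<lambda>y. \<rho> (Some y))"
    unfolding S.metric_continuous_map[OF Met_TC.Metric_space_axioms]
  proof (intro conjI ballI allI impI)
    fix a e :: real and y assume y: "y \<in> topspace X" and e: "0 < e"
    have "dist (\<rho> (Some y)) (\<rho> (Some z)) < e" if "z \<in> topspace X \<and> dS y z < e" for z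
      using that y \<rho>_Lipschitz[of "Some y" "Some z"] \<rho>_Lipschitz[of "Some z" "Some y"] E.commute[of "Some y" "Some z"]
      by (auto simp: dist_real_def dS_def abs_less_iff)
    thus "\<exists>d>0. \<forall>z. z \<in> topspace X \<and> dS y z < d \<longrightarrow> dist (\<rho> (Some y)) (\<rho> (Some z)) < e" using e by blast
  qed simp
  hence "continuous_map X euclideanreal (\<lambda>y. \<rho> (Some y))" by (simp add: mtopology_S)
  from continuous_map_compose[OF this, of euclideanreal \<gamma>] have "continuous_map X euclideanreal g"
    using \<gamma>_cont by (simp add: o_def g_def[abs_def])
  moreover have "0 \<le> g y" for y using \<gamma>_mono[of 0 "\<rho> (Some y)"] \<gamma>_zero[of 0] \<rho>_nonneg by (simp add: g_def)
  ultimately show ?thesis by (auto simp: continuous_map_in_subtopology)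
qed

context
  fixes Y :: "'b topology" and P :: "'b \<Rightarrow> 'a path measure"
  assumes P: "continuous_map Y (weak_topology (local_skorokhod X)) P"
    and small: "\<And>a. a \<in> topspace Y \<Longrightarrow> \<exists>V m0. openin Y V \<and> a \<in> V \<and> (\<forall>n\<ge>m0. \<forall>b\<in>V. measure (P b) (clbad n (\<epsilon> n)) \<le> (1/2)^n)"
begin

lemmas PM = weak_continuous_prob[OF P]

lemma Gd_tail:
  assumes a: "a \<in> topspace Y" and \<eta>: "0 < \<eta>"
  shows "\<exists>V m. openin Y V \<and> a \<in> V \<and> (\<forall>b\<in>V. measure (P b) (DL - Gd m) \<le> \<eta>)"
proof -
  obtain V m0 where V: "openin Y V" "a \<in> V" "\<And>n b. m0 \<le> n \<Longrightarrow> b \<in> V \<Longrightarrow> measure (P b) (clbad n (\<epsilon> n)) \<le> (1/2)^n"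
    using small[OF a] by blast
  obtain m1 where m1: "(1/2::real)^m1 < \<eta> / 2" using real_arch_pow_inv[of "\<eta> / 2" "1/2"] \<eta> by auto
  define m where "m = max m0 m1"
  have "(1/2::real)^m \<le> (1/2)^m1" by (intro power_decreasing) (auto simp: m_def)
  hence m: "2 * (1/2::real)^m \<le> \<eta>" using m1 by linarith
  have m0: "m0 \<le> m" by (simp add: m_def)
  have "measure (P b) (DL - Gd m) \<le> \<eta>" if b: "b \<in> V" for b
  proof -
    have bY: "b \<in> topspace Y" using V(1) b openin_subset by blast
    interpret prob_space "P b" by (rule prob_measuresD(1)[OF PM[OF bY]])
    have le: "measure (P b) (clbad (m + n) (\<epsilon> (m + n))) \<le> (1/2)^m * (1/2)^n" for n
      using V(3)[of "m + n" b] m0 b by (simp add: power_add)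
    have sm: "(\<lambda>n. (1/2::real)^m * (1/2)^n) sums ((1/2)^m * 2)"
      using sums_mult[OF geometric_sums[of "1/2::real"], of "(1/2)^m"] by simp
    have summ: "summable (\<lambda>n. measure (P b) (clbad (m + n) (\<epsilon> (m + n))))"
      by (rule summable_comparison_test'[OF sums_summable[OF sm], of 0]) (simp only: real_norm_def abs_of_nonneg[OF measure_nonneg] le)
    have "measure (P b) (DL - Gd m) \<le> (\<Sum>n. measure (P b) (clbad (m + n) (\<epsilon> (m + n))))"
      unfolding Gd_compl using clbad_measurable prob_measuresD(2)[OF PM[OF bY]]
      by (intro finite_measure_subadditive_countably summ) auto
    also have "\<dots> \<le> (\<Sum>n. (1/2)^m * (1/2)^n)" by (rule suminf_le[OF le summ sums_summable[OF sm]])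
    also have "\<dots> = (1/2)^m * 2" using sums_unique[OF sm] by simp
    finally show ?thesis using m by simp
  qed
  thus ?thesis using V(1,2) by blast
qed

abbreviation Q :: "'b \<Rightarrow> 'a path measure" where "Q a \<equiv> time_change_measure X g (P a)"

lemma T_measurable_P: "a \<in> topspace Y \<Longrightarrow> T \<in> measurable (P a) BL"
  using T_measurable measurable_cong_sets[OF prob_measuresD(2)[OF PM] refl] by blast

lemma sets_Q: "sets (Q a) = sets BL" by (simp add: time_change_measure_def)

text \<open>On each \<open>Gd m\<close> the time-changed path lies in \<open>LU\<close>, and the
  probability of the complement of \<open>Gd m\<close> can be made arbitrarily small.\<close>

lemma Q_LU:
  assumes a: "a \<in> topspace Y"
  shows "measure (Q a) LU = 1"
proof -
  interpret prob_space "P a" by (rule prob_measuresD(1)[OF PM[OF a]])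
  define N where "N = T -` LU \<inter> space (P a)"
  have sp: "space (P a) = DL" by (rule prob_measuresD(3)[OF PM[OF a]])
  have N: "N \<in> sets (P a)" unfolding N_def by (rule measurable_sets[OF T_measurable_P[OF a] LU_measurable])
  have small: "1 - measure (P a) N \<le> \<eta>" if \<eta>: "0 < \<eta>" for \<eta>
  proof -
    obtain V m where V: "a \<in> V" "\<forall>b\<in>V. measure (P b) (DL - Gd m) \<le> \<eta>" using Gd_tail[OF a \<eta>] by blast
    have "1 - measure (P a) N = measure (P a) (space (P a) - N)" by (rule prob_compl[OF N, symmetric])
    also have "\<dots> \<le> measure (P a) (DL - Gd m)"
    proof (rule finite_measure_mono)
      show "space (P a) - N \<subseteq> DL - Gd m" using T_good subsetD[OF Gd_good[of m]] by (auto simp: N_def sp)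
      show "DL - Gd m \<in> sets (P a)"
        using sets.compl_sets[OF Gd_measurable[of m]] prob_measuresD(2)[OF PM[OF a]] by simp
    qed
    finally show ?thesis using V by force
  qed
  have "1 - measure (P a) N \<le> 0"
  proof (rule field_le_epsilon)
    show "1 - measure (P a) N \<le> 0 + e" if "0 < e" for e using small[OF that] by simp
  qed
  hence "measure (P a) N = 1" using prob_le_1[of N] by linarith
  thus ?thesis using measure_distr[OF T_measurable_P[OF a] LU_measurable] by (simp add: time_change_measure_def N_def)
qed

lemma Q_prob_measures:
  assumes a: "a \<in> topspace Y"
  shows "restrict_space (Q a) LU \<in> prob_measures GU"
proof -
  interpret Pa: prob_space "P a" by (rule prob_measuresD(1)[OF PM[OF a]])
  interpret Qa: prob_space "Q a" unfolding time_change_measure_def by (rule Pa.prob_space_distr[OF T_measurable_P[OF a]])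
  have "prob_space (restrict_space (Q a) LU)"
    by (rule prob_space_restrict_space) (use Q_LU[OF a] LU_measurable in \<open>simp_all add: sets_Q Qa.emeasure_eq_measure\<close>)
  thus ?thesis using sets_restrict_LU[OF sets_Q] by (simp add: prob_measures_def)
qed

text \<open>A test function composed with \<open>T\<close> is known to be sequentially continuous on
  each \<open>Gd m\<close> only. The semicontinuity lemma allows for this, and applied to the
  composition and to its negative it gives both halves of continuity.\<close>

lemma Q_continuous: "continuous_map Y (weak_topology GU) (\<lambda>a. restrict_space (Q a) LU)"
  unfolding weak_topology_def
proof (rule continuous_on_generated_topo)
  have all: "prob_measures GU = topspace (weak_topology GU)" by (simp add: topspace_weak_topology)
  show "(\<lambda>a. restrict_space (Q a) LU) ` topspace Y \<subseteq> \<Union> {{M \<in> prob_measures GU. (\<integral>x. f x \<partial>M) \<in> V} |f V.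
        continuous_map GU euclideanreal f \<and> bounded (f ` topspace GU) \<and> open V}"
    using Q_prob_measures all unfolding weak_topology_def topology_generated_by_topspace by blast
  fix W assume "W \<in> {{M \<in> prob_measures GU. (\<integral>x. f x \<partial>M) \<in> V} |f V.
        continuous_map GU euclideanreal f \<and> bounded (f ` topspace GU) \<and> open V}"
  then obtain f V where W: "W = {M \<in> prob_measures GU. (\<integral>x. f x \<partial>M) \<in> V}" and f: "continuous_map GU euclideanreal f"
    "bounded (f ` topspace GU)" "open V" by blast
  obtain C where C: "\<And>y. y \<in> LU \<Longrightarrow> \<bar>f y\<bar> \<le> C" using f(2) unfolding bounded_iff topspace_GU by auto
  \<comment> \<open>Test functions live on \<open>LU\<close>; extension by zero makes them
    measurable on all of \<open>DL\<close>, and it is harmless because \<open>T\<close> maps each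
    \<open>Gd m\<close> into \<open>LU\<close>.\<close>
  define f' where "f' y = indicat_real LU y *\<^sub>R f y" for y
  define h where "h x = f' (T x)" for x
  have f'm: "f' \<in> borel_measurable BL"
  proof -
    have "f \<in> borel_measurable (borel_of GU)" by (rule continuous_map_measurable_borel_of[OF f(1)])
    hence "f \<in> borel_measurable (restrict_space BL LU)"
      using measurable_cong_sets[OF sets_restrict_LU[OF refl, symmetric] refl] by blast
    thus ?thesis unfolding f'_def
      by (subst (asm) borel_measurable_restrict_space_iff) (use LU_measurable sets.sets_into_space[OF LU_measurable] in \<open>auto simp: Int_absorb2\<close>)
  qed
  have hm: "h \<in> borel_measurable BL" unfolding h_def by (rule measurable_compose[OF T_measurable f'm])
  have hb: "\<bar>h x\<bar> \<le> max C 0" for x using C[of "T x"] by (auto simp: h_def f'_def indicator_def)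
  have I: "(\<integral>x. f x \<partial>restrict_space (Q a) LU) = (\<integral>x. h x \<partial>P a)" if a: "a \<in> topspace Y" for a
  proof -
    have "LU \<inter> space (Q a) \<in> sets (Q a)"
      using LU_measurable sets.sets_into_space[OF LU_measurable] by (simp add: sets_Q sets.Int)
    hence "(\<integral>x. f x \<partial>restrict_space (Q a) LU) = (\<integral>y. f' y \<partial>Q a)" unfolding f'_def by (rule integral_restrict_space)
    also have "\<dots> = (\<integral>x. h x \<partial>P a)" unfolding time_change_measure_def h_def
      by (rule integral_distr[OF T_measurable_P[OF a] f'm])
    finally show ?thesis .
  qed
  have hs: "(\<lambda>k. h (xk k)) \<longlonglongrightarrow> h x" if "\<And>k. xk k \<in> Gd m" "x \<in> Gd m" "(\<lambda>k. emb (xk k)) \<longlonglongrightarrow> emb x" for m xk x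
    using T_compose_seq_continuous[OF f(1) that] T_good[OF subsetD[OF Gd_good that(2)]] T_good[OF subsetD[OF Gd_good that(1)]]
    by (simp add: h_def f'_def)
  have up: "openin Y {a \<in> topspace Y. (\<integral>x. h x \<partial>P a) < t}" for t
    by (rule integral_upper_semicontinuous[OF P Gd_measurable Gd_tail hm hb order_tendstoD(2)[OF hs]])
  have lo: "openin Y {a \<in> topspace Y. (\<integral>x. - h x \<partial>P a) < t}" for t
    by (rule integral_upper_semicontinuous[OF P Gd_measurable Gd_tail _ _ order_tendstoD(2)[OF tendsto_minus[OF hs]]])
      (use hm hb in auto)
  have "continuous_map Y euclideanreal (\<lambda>a. \<integral>x. h x \<partial>P a)"
    unfolding continuous_map_upper_lower_semicontinuous_lt
  proof (intro conjI allI)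
    fix t
    have "{a \<in> topspace Y. t < (\<integral>x. h x \<partial>P a)} = {a \<in> topspace Y. (\<integral>x. - h x \<partial>P a) < - t}" by auto
    thus "openin Y {a \<in> topspace Y. t < (\<integral>x. h x \<partial>P a)}" using lo[of "- t"] by simp
  qed (rule up)
  from openin_continuous_map_preimage[OF this, of V] f(3)
  have "openin Y {a \<in> topspace Y. (\<integral>x. h x \<partial>P a) \<in> V}" by simp
  also have "{a \<in> topspace Y. (\<integral>x. h x \<partial>P a) \<in> V} = (\<lambda>a. restrict_space (Q a) LU) -` W \<inter> topspace Y"
    using I Q_prob_measures by (auto simp: W)
  finally show "openin Y ((\<lambda>a. restrict_space (Q a) LU) -` W \<inter> topspace Y)" .
qed

end

end

text \<open>By the Lindelof property countably many relatively compact open sets cover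
  \<open>Y\<close>, and \<open>C n\<close> collects compact supersets of the first
  \<open>n + 1\<close> of them. Each \<open>V i\<close> is then an open set contained in all
  \<open>C n\<close> with \<open>n \<ge> i\<close>, which makes bounds on \<open>C n\<close> locally
  uniform.\<close>

lemma compact_open_exhaustion:
  assumes "locally_compact_space Y" "second_countable Y"
  shows "\<exists>V C :: nat \<Rightarrow> 'b set. (\<forall>i. openin Y (V i)) \<and> (\<forall>n. compactin Y (C n)) \<and> (\<forall>i n. i \<le> n \<longrightarrow> V i \<subseteq> C n) \<and>
    topspace Y \<subseteq> (\<Union>i. V i)"
proof -
  define \<V> where "\<V> = {V. openin Y V \<and> (\<exists>K. compactin Y K \<and> V \<subseteq> K)}"
  have "\<Union>\<V> = topspace Y"
  proof
    show "\<Union>\<V> \<subseteq> topspace Y" using openin_subset by (auto simp: \<V>_def)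
    show "topspace Y \<subseteq> \<Union>\<V>" using assms(1) unfolding locally_compact_space_def \<V>_def by blast
  qed
  then obtain \<W> where \<W>: "countable \<W>" "\<W> \<subseteq> \<V>" "\<Union>\<W> = topspace Y"
    using second_countable_imp_Lindelof_space[OF assms(2)] unfolding Lindelof_space_def
    by (metis (no_types, lifting) \<V>_def mem_Collect_eq)
  \<comment> \<open>The empty set is inserted so that the enumeration stays within the family even
    if \<open>\<W>\<close> is empty.\<close>
  define V where "V = from_nat_into (insert {} \<W>)"
  have rV: "range V = insert {} \<W>" unfolding V_def using \<W>(1) by (intro range_from_nat_into) auto
  have "V i \<in> \<V>" for i
  proof -
    have "openin Y {}" "compactin Y {}" by simp_all
    hence "{} \<in> \<V>" unfolding \<V>_def by blast
    hence "range V \<subseteq> \<V>" unfolding rV using \<W>(2) by simp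
    thus ?thesis by (rule subsetD) simp
  qed
  hence "\<forall>i. \<exists>K. openin Y (V i) \<and> compactin Y K \<and> V i \<subseteq> K" unfolding \<V>_def by blast
  then obtain K where K: "\<And>i. openin Y (V i)" "\<And>i. compactin Y (K i)" "\<And>i. V i \<subseteq> K i" by metis
  define C where "C n = (\<Union>i\<le>n. K i)" for n
  have "compactin Y (C n)" for n unfolding C_def using K(2) by (intro compactin_Union) auto
  moreover have "V i \<subseteq> C n" if "i \<le> n" for i n using K(3)[of i] that by (auto simp: C_def)
  moreover have "topspace Y \<subseteq> (\<Union>i. V i)" using \<W>(3) rV by blast
  ultimately show ?thesis using K(1) by blast
qed

theorem proposition3p8:
  fixes X :: "'a topology" and Y :: "'b topology"
    and P :: "'b \<Rightarrow> 'a path measure" and U :: "'a set"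
  assumes "Hausdorff_space X" and "locally_compact_space X" and "second_countable X"
    and "Hausdorff_space Y" and "locally_compact_space Y" and "second_countable Y"
    and "continuous_map Y (weak_topology (local_skorokhod X)) P"
    and "openin X U"
  shows "\<exists>g. continuous_map X (top_of_set {0..}) g \<and>
    {y \<in> topspace X. g y \<noteq> 0} = U \<and>
    (\<forall>a\<in>topspace Y. measure (time_change_measure X g (P a)) (left_limit_in X U) = 1) \<and>
    continuous_map Y (weak_topology (subtopology (global_skorokhod X) (left_limit_in X U)))
      (\<lambda>a. restrict_space (time_change_measure X g (P a)) (left_limit_in X U))"
proof -
  interpret lc_open X U by unfold_locales (use assms in auto)
  obtain V C :: "nat \<Rightarrow> 'b set" where VC: "\<forall>i. openin Y (V i)" "\<forall>n. compactin Y (C n)" "\<forall>i n. i \<le> n \<longrightarrow> V i \<subseteq> C n"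
    "topspace Y \<subseteq> (\<Union>i. V i)" using compact_open_exhaustion[OF assms(5,6)] by blast
  note VC = VC(1-3)[rule_format] VC(4)
  \<comment> \<open>Level \<open>n\<close> is calibrated on \<open>C n\<close>, with the summable
    bound \<open>(1/2)^n\<close>.\<close>
  have "\<exists>e>0. \<forall>a\<in>C n. measure (P a) (clbad n e) \<le> (1/2)^n" for n
    by (rule clbad_uniformly_small[OF assms(7) VC(2)]) simp
  then obtain \<epsilon> where \<epsilon>: "\<And>n. 0 < \<epsilon> n" "\<And>n a. a \<in> C n \<Longrightarrow> measure (P a) (clbad n (\<epsilon> n)) \<le> (1/2)^n" by metis
  obtain \<gamma> where \<gamma>: "continuous_on UNIV \<gamma>" "\<forall>r\<le>(0::real). \<gamma> r = 0" "\<forall>r>0. 0 < \<gamma> r" "\<forall>r. \<gamma> r \<le> (1::real)"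
    "\<forall>r s. r \<le> s \<longrightarrow> \<gamma> r \<le> \<gamma> s" "\<forall>r n. r \<le> 2 * (1/2)^n \<longrightarrow> \<gamma> r \<le> \<epsilon> n / (real n + 1)"
    using rate_function[of \<epsilon>, OF \<epsilon>(1)] by blast
  interpret lc_good X U \<gamma> \<epsilon> by unfold_locales (use \<gamma> \<epsilon>(1) in auto)
  have small: "\<exists>W m0. openin Y W \<and> a \<in> W \<and> (\<forall>n\<ge>m0. \<forall>b\<in>W. measure (P b) (clbad n (\<epsilon> n)) \<le> (1/2)^n)"
    if "a \<in> topspace Y" for a
  proof -
    obtain i where "a \<in> V i" using VC(4) \<open>a \<in> topspace Y\<close> by blast
    thus ?thesis using VC(1)[of i] VC(3)[of i] \<epsilon>(2) by (intro exI[of _ "V i"] exI[of _ i]) blast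
  qed
  show ?thesis
    using g_continuous support_g Q_LU[OF assms(7) small] Q_continuous[OF assms(7) small]
    by (intro exI[of _ g] conjI ballI)
qed

end
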